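(* Let $0<\mu_0<1$. Given $N\in\mathbb N$, there exists an open neighborhood $\mathcal U_N\subset\mathbb R^2\times(\mathbb R\times\mathbb R/2\pi\mathbb Z)$ of the saddle-center singularities $S_\pm(\mu_0)$ corresponding to the first Lagrange point $l_1(\mu_0)$ such that, for all $(\mu,E)$ sufficiently close to $(\mu_0,L_1(\mu_0))$, any periodic orbit $P\subset\hat H_{\mu,E}^{-1}(0)$ of the regularized Hamiltonian flow which enters $\mathcal U_N$ and which is not a cover of the Lyapunov orbit has Conley-Zehnder index $\mu_{\mathrm{CZ}}(P)>N$.
   Context: For $0<\mu<1$ let $$H_\mu(p,q)=\tfrac12|p+iq|^2-\frac{\mu}{|q-(1-\mu)|}-\frac{1-\mu}{|q+\mu|}-\tfrac12|q|^2$$ on $\mathbb C\times(\mathbb C\setminus\{-\mu,1-\mu\})$. Its first Lagrange point $l_1(\mu)$ is the critical point whose $q$-projection $\hat l_1(\mu)$ lies on the real segment between $-\mu$ and $1-\mu$, and $L_1(\mu)=H_\mu(l_1(\mu))$ is the smallest critical value. Write $\hat l_1(\mu)=1-\mu-r_1(\mu)$. The regularized Hamiltonian at energy $E$ in elliptic-hyperbolic coordinates $(y,x)\in\mathbb R^2\times(\mathbb R\times\mathbb R/2\pi\mathbb Z)$, with symplectic form $\sum dy_i\wedge dx_i$, is $$\hat H_{\mu,E}(y,x)=\tfrac12\Big(y_1+\tfrac{\sin2x_2}{8}\Big)^2+\tfrac12\Big(y_2+\tfrac{\sinh2x_1}{8}\Big)^2+V_E(x)+(1-2\mu)\hat V_\mu(x),$$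 $$V_E=-\tfrac E4\cosh^2x_1-\tfrac12\cosh x_1-\tfrac1{128}\sinh^2(2x_1)+\tfrac E4\cos^2x_2-\tfrac1{128}\sin^2(2x_2),$$ $$\hat V_\mu=\tfrac12\cos x_2-\tfrac1{16}\big(\tfrac12-\mu+\cosh x_1\cos x_2\big)(\cosh^2x_1-\cos^2x_2).$$ It equals $\frac14(\cosh^2x_1-\cos^2x_2)(H_\mu-E)$ under $q_1=\frac12-\mu+\frac12\cosh x_1\cos x_2$, $q_2=\frac12\sinh x_1\sin x_2$ and the induced momenta; its zero level, modulo $(y,x)\sim-(y,x)$, is the regularized energy surface. $S_\pm(\mu)$ are the two saddle-center critical points of $\hat H_{\mu,L_1(\mu)}$ on its zero level that correspond to $l_1(\mu)$; they project to $x=(0,\pm\arccos(1-2r_1(\mu)))$. For $E$ slightly above $L_1(\mu)$, the Lyapunov orbit is the hyperbolic periodic orbit of index $2$ in $\hat H_{\mu,E}^{-1}(0)$ near $S_\pm(\mu)$ (one near each of $S_\pm$, exchanged by the antipodal map). Conley-Zehnder index: for a periodic orbit $P$ of period $T$ on the energy level, consider the linearized flow on the quotient of the tangent space of the level by the flow direction (isomorphic to the contact structure), in the global symplectic trivialization spanned by $(-\partial_{y_2}\hat H,\partial_{y_1}\hat H,\partial_{x_2}\hat H,-\partial_{x_1}\hat H)$ and $(\partial_{x_2}\hat H,-\partial_{x_1}\hat H,\partial_{y_2}\hat H,-\partial_{y_1}\hat H)$, suitably normalized; this gives a path $\Phi(t)\in\mathrm{Sp}(2)$, $t\in[0,T]$.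 With $\Delta(v)$ the total variation of the argument of $\Phi(t)v$ divided by $2\pi$ and $I=\{\Delta(v):v\ne0\}$, $\mu_{\mathrm{CZ}}(P)=2k$ if $k\in I-\epsilon$ for all small $\epsilon>0$, and $\mu_{\mathrm{CZ}}(P)=2k+1$ if $I-\epsilon\subset(k,k+1)$ for all small $\epsilon>0$. *)

theory Defs
  imports "HOL-Analysis.Analysis"
begin

definition H_mu :: "real \<Rightarrow> complex \<times> complex \<Rightarrow> real" where
  "H_mu \<mu> = (\<lambda>(p, q). (cmod (p + \<i> * q))\<^sup>2 / 2
     - \<mu> / cmod (q - of_real (1 - \<mu>)) - (1 - \<mu>) / cmod (q + of_real \<mu>)
     - (cmod q)\<^sup>2 / 2)"

definition l1 :: "real \<Rightarrow> complex \<times> complex" where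
  "l1 \<mu> = (THE z. snd z \<in> open_segment (of_real (- \<mu>)) (of_real (1 - \<mu>))
     \<and> GDERIV (H_mu \<mu>) z :> 0)"

definition L1 :: "real \<Rightarrow> real" where
  "L1 \<mu> = H_mu \<mu> (l1 \<mu>)"

definition r1 :: "real \<Rightarrow> real" where
  "r1 \<mu> = 1 - \<mu> - Re (snd (l1 \<mu>))"

text \<open>
  A phase point is a tuple \<open>(y1, y2, x1, x2)\<close>. We work on the universal cover of
  \<open>\<real>\<^sup>2 \<times> (\<real> \<times> \<real> / 2 \<pi> \<int>)\<close>: \<open>cyl_eq\<close> says that two points have the same projection, and
  an open subset of the cylinder is given by its preimage, an open \<open>cyl_eq\<close>-saturated set.
\<close>

type_synonym phase = "real \<times> real \<times> real \<times> real"

definition cyl_eq :: "phase \<Rightarrow> phase \<Rightarrow> bool" where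
  "cyl_eq z z' \<longleftrightarrow> (\<exists>k::int. z' = z + (0, 0, 0, 2 * pi * of_int k))"

definition cyl_open :: "phase set \<Rightarrow> bool" where
  "cyl_open U \<longleftrightarrow> open U \<and> (\<forall>z z'. z \<in> U \<and> cyl_eq z z' \<longrightarrow> z' \<in> U)"

definition V_E :: "real \<Rightarrow> real \<Rightarrow> real \<Rightarrow> real" where
  "V_E E x1 x2 = - (E / 4) * (cosh x1)\<^sup>2 - cosh x1 / 2 - (sinh (2 * x1))\<^sup>2 / 128
     + (E / 4) * (cos x2)\<^sup>2 - (sin (2 * x2))\<^sup>2 / 128"

definition V_hat :: "real \<Rightarrow> real \<Rightarrow> real \<Rightarrow> real" where
  "V_hat \<mu> x1 x2 = cos x2 / 2
     - (1 / 16) * (1 / 2 - \<mu> + cosh x1 * cos x2) * ((cosh x1)\<^sup>2 - (cos x2)\<^sup>2)"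

definition H_hat :: "real \<Rightarrow> real \<Rightarrow> phase \<Rightarrow> real" where
  "H_hat \<mu> E = (\<lambda>(y1, y2, x1, x2).
     (y1 + sin (2 * x2) / 8)\<^sup>2 / 2 + (y2 + sinh (2 * x1) / 8)\<^sup>2 / 2
     + V_E E x1 x2 + (1 - 2 * \<mu>) * V_hat \<mu> x1 x2)"

definition saddle_centers :: "real \<Rightarrow> phase set" where
  "saddle_centers \<mu> = {z. H_hat \<mu> (L1 \<mu>) z = 0 \<and> GDERIV (H_hat \<mu> (L1 \<mu>)) z :> 0 \<and>
     (\<exists>y1 y2. cyl_eq (y1, y2, 0, arccos (1 - 2 * r1 \<mu>)) z
            \<or> cyl_eq (y1, y2, 0, - arccos (1 - 2 * r1 \<mu>)) z)}"

definition grad :: "(phase \<Rightarrow> real) \<Rightarrow> phase \<Rightarrow> phase" where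
  "grad F z = (THE D. GDERIV F z :> D)"

definition ham_vf :: "(phase \<Rightarrow> real) \<Rightarrow> phase \<Rightarrow> phase" where
  "ham_vf F z = (case grad F z of (Fy1, Fy2, Fx1, Fx2) \<Rightarrow> (- Fx1, - Fx2, Fy1, Fy2))"

text \<open>A closed orbit comes with a period \<open>T\<close> which need not be minimal, so that multiple
  covers are included; equilibria are not periodic orbits.\<close>

definition periodic_orbit :: "(phase \<Rightarrow> real) \<Rightarrow> (real \<Rightarrow> phase) \<Rightarrow> real \<Rightarrow> bool" where
  "periodic_orbit F \<gamma> T \<longleftrightarrow> 0 < T
     \<and> (\<forall>t. (\<gamma> has_vector_derivative ham_vf F (\<gamma> t)) (at t))
     \<and> (\<forall>t. F (\<gamma> t) = 0)
     \<and> (\<forall>t. cyl_eq (\<gamma> t) (\<gamma> (t + T)))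
     \<and> (\<exists>t. \<gamma> t \<noteq> \<gamma> 0)"

definition simple_orbit :: "(phase \<Rightarrow> real) \<Rightarrow> (real \<Rightarrow> phase) \<Rightarrow> real \<Rightarrow> bool" where
  "simple_orbit F \<gamma> T \<longleftrightarrow> periodic_orbit F \<gamma> T
     \<and> (\<forall>T'. 0 < T' \<and> T' < T \<longrightarrow> \<not> (\<forall>t. cyl_eq (\<gamma> t) (\<gamma> (t + T'))))"

definition covers :: "(real \<Rightarrow> phase) \<Rightarrow> real \<Rightarrow> (real \<Rightarrow> phase) \<Rightarrow> real \<Rightarrow> bool" where
  "covers \<gamma> T \<delta> \<tau> \<longleftrightarrow>
     (\<exists>(k::nat) s. 1 \<le> k \<and> T = of_nat k * \<tau> \<and> (\<forall>t. cyl_eq (\<gamma> t) (\<delta> (t + s))))"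

text \<open>The linearized flow along \<open>\<gamma>\<close>, i.e. the solution of the variational equation.\<close>

definition lin_flow :: "(phase \<Rightarrow> real) \<Rightarrow> (real \<Rightarrow> phase) \<Rightarrow> phase \<Rightarrow> real \<Rightarrow> phase" where
  "lin_flow F \<gamma> v0 = (THE v. v 0 = v0 \<and>
     (\<forall>t. (v has_vector_derivative frechet_derivative (ham_vf F) (at (\<gamma> t)) (v t)) (at t)))"

text \<open>
  The frame of the tangent space of the level modulo the flow direction. With
  \<open>X = (-Fy2, Fy1, Fx2, -Fx1)\<close> and \<open>Y = (Fx2, -Fx1, Fy2, -Fy1)\<close> and
  \<open>\<omega> = dy1 \<and> dx1 + dy2 \<and> dx2\<close> one has \<open>\<omega>(Y, X) = |grad F|\<^sup>2\<close>, so the symplectic (that is,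
  positively oriented) ordering is \<open>Y\<close>, \<open>X\<close>, each divided by \<open>|grad F|\<close>. Moreover \<open>X\<close>, \<open>Y\<close>,
  \<open>grad F\<close>, \<open>ham_vf F\<close> are pairwise orthogonal, so for a vector tangent to the level the inner
  products with the frame are its coordinates modulo the flow direction.
\<close>

definition frame1 :: "(phase \<Rightarrow> real) \<Rightarrow> phase \<Rightarrow> phase" where
  "frame1 F z = (1 / norm (grad F z)) *\<^sub>R
     (case grad F z of (Fy1, Fy2, Fx1, Fx2) \<Rightarrow> (Fx2, - Fx1, Fy2, - Fy1))"

definition frame2 :: "(phase \<Rightarrow> real) \<Rightarrow> phase \<Rightarrow> phase" where
  "frame2 F z = (1 / norm (grad F z)) *\<^sub>R
     (case grad F z of (Fy1, Fy2, Fx1, Fx2) \<Rightarrow> (- Fy2, Fy1, Fx2, - Fx1))"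

definition transverse_flow ::
    "(phase \<Rightarrow> real) \<Rightarrow> (real \<Rightarrow> phase) \<Rightarrow> real \<Rightarrow> real^2^2" where
  "transverse_flow F \<gamma> t = matrix (\<lambda>w.
     let v = lin_flow F \<gamma> (w $ 1 *\<^sub>R frame1 F (\<gamma> 0) + w $ 2 *\<^sub>R frame2 F (\<gamma> 0)) t
     in vector [v \<bullet> frame1 F (\<gamma> t), v \<bullet> frame2 F (\<gamma> t)])"

definition arg_variation :: "(real \<Rightarrow> real^2^2) \<Rightarrow> real \<Rightarrow> real^2 \<Rightarrow> real" where
  "arg_variation \<Phi> T w = (THE d. \<exists>\<theta>. continuous_on {0..T} \<theta>
     \<and> (\<forall>t\<in>{0..T}. \<Phi> t *v w = norm (\<Phi> t *v w) *\<^sub>R vector [cos (\<theta> t), sin (\<theta> t)])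
     \<and> d = (\<theta> T - \<theta> 0) / (2 * pi))"

definition rotation_set :: "(real \<Rightarrow> real^2^2) \<Rightarrow> real \<Rightarrow> real set" where
  "rotation_set \<Phi> T = {arg_variation \<Phi> T w | w. w \<noteq> 0}"

definition cz_of_set :: "real set \<Rightarrow> int" where
  "cz_of_set I = (THE n.
     (\<exists>k. n = 2 * k \<and> (\<forall>\<^sub>F \<epsilon> in at_right 0. of_int k \<in> (\<lambda>x. x - \<epsilon>) ` I)) \<or>
     (\<exists>k. n = 2 * k + 1 \<and>
        (\<forall>\<^sub>F \<epsilon> in at_right 0. (\<lambda>x. x - \<epsilon>) ` I \<subseteq> {of_int k<..<of_int k + 1})))"

definition cz_index :: "(phase \<Rightarrow> real) \<Rightarrow> (real \<Rightarrow> phase) \<Rightarrow> real \<Rightarrow> int" where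
  "cz_index F \<gamma> T = cz_of_set (rotation_set (transverse_flow F \<gamma>) T)"

definition hyperbolic :: "(phase \<Rightarrow> real) \<Rightarrow> (real \<Rightarrow> phase) \<Rightarrow> real \<Rightarrow> bool" where
  "hyperbolic F \<gamma> T \<longleftrightarrow> (\<forall>ev::complex.
     det ((\<chi> i j. of_real (transverse_flow F \<gamma> T $ i $ j)) - mat ev :: complex^2^2) = 0
       \<longrightarrow> cmod ev \<noteq> 1)"

definition hyp_index2_in ::
    "phase set \<Rightarrow> real \<Rightarrow> real \<Rightarrow> (real \<Rightarrow> phase) \<Rightarrow> real \<Rightarrow> bool" where
  "hyp_index2_in W \<mu> E \<delta> \<tau> \<longleftrightarrow> simple_orbit (H_hat \<mu> E) \<delta> \<tau> \<and> range \<delta> \<subseteq> W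
     \<and> hyperbolic (H_hat \<mu> E) \<delta> \<tau> \<and> cz_index (H_hat \<mu> E) \<delta> \<tau> = 2"

text \<open>
  \<open>W\<close> makes precise which orbits count as near the saddle-centers. The Lyapunov orbit is
  \<^emph>\<open>the\<close> hyperbolic orbit of index 2 in \<open>W\<close>, uniquely determined up to time shift and the
  antipodal map (which exchanges the orbits near the two saddle-centers). If \<open>W\<close> contains
  another one, then no orbit satisfies this predicate.
\<close>

definition lyapunov_orbit ::
    "phase set \<Rightarrow> real \<Rightarrow> real \<Rightarrow> (real \<Rightarrow> phase) \<Rightarrow> real \<Rightarrow> bool" where
  "lyapunov_orbit W \<mu> E \<delta> \<tau> \<longleftrightarrow> L1 \<mu> < E \<and> hyp_index2_in W \<mu> E \<delta> \<tau>
     \<and> (\<forall>\<delta>' \<tau>'. hyp_index2_in W \<mu> E \<delta>' \<tau>' \<longrightarrow>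
          (\<exists>s. (\<forall>t. cyl_eq (\<delta>' t) (\<delta> (t + s))) \<or> (\<forall>t. cyl_eq (\<delta>' t) (- \<delta> (t + s)))))"

end

theory Submission
  imports Defs
begin

text \<open>
  Let \<open>(a, b)\<close> be the coordinates of a solution of the linearized flow in the quaternionic frame, and
  let \<open>f\<close> be the determinant of its position part and the velocity, so that \<open>f = 0\<close> means that
  the solution is vertical modulo the flow direction. For a Hamiltonian \<open>\<bar>p\<bar>\<^sup>2 / 2 + V\<close> with magnetic
  momenta one has \<open>f' = - b\<close>, and \<open>b' = 2 a\<close> at the vertical direction; hence the argument of \<open>(a, b)\<close> can pass the
  vertical direction only counterclockwise, and each zero of \<open>f\<close> gains half a turn. Near the
  saddle-centers the potential is convex in \<open>x1\<close>, and a Riccati inequality produces zeros of \<open>f\<close> in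
  all time intervals of a fixed length. By Gronwall's inequality, an orbit that comes very close to a
  saddle-center and leaves a fixed neighbourhood \<open>W\<close> spends a long time in \<open>W\<close>, so its index is large.

  An orbit that never leaves \<open>W\<close> is the Lyapunov orbit: the difference of two such orbits is bounded,
  hence lies in a thin cone around the center plane of the linearization, where the energy is strictly
  monotone along rays. So the orbit is closed and unique on its level, up to symmetry, which moreover
  lies above \<open>L1 \<mu>\<close>. Its linearized flow is close to the explicit one of the linear model, which
  rotates once and is hyperbolic.
\<close>

section \<open>Differential equations\<close>

text \<open>The Lyapunov orbit is never constructed. A given periodic orbit either leaves
  \<open>W\<close> or is itself checked against \<open>lyapunov_orbit\<close>, so index,
  hyperbolicity, uniqueness and L1 \<mu> < E are proved for the orbits that stay in
  \<open>W\<close>. The obstacle is the lack of a lower bound on their size: as (\<mu>, E)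
  approaches (\<mu>0, L1 \<mu>0) they may shrink to the equilibrium, which itself moves with (\<mu>,
  E) and need not lie on the zero level. Hence every comparison with the linear model is relative to
  the displacement from the equilibrium, with constants that depend only on the linearization at
  (\<mu>0, L1 \<mu>0). That linearization is parametrized by \<open>k1\<close> and \<open>k2\<close>
  in place of the second derivatives of the potential, since its invariant planes are then given by
  rational expressions. Convexity in x1 alone suffices, although the potential is concave in x2: f
  vanishes as soon as one slope of the solution plane blows up. \<open>W\<close> is fixed by the
  linear model before N is given; N only shrinks the inner neighbourhood.\<close>

lemma continuous_antiderivative:
  fixes g :: "real \<Rightarrow> 'a::banach"
  assumes "continuous_on UNIV g"
  obtains G where "G 0 = c" "\<And>t. (G has_vector_derivative g t) (at t)"
proof -
  \<comment> \<open>One of the two intervals is empty or a point, so the formula covers both signs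
    of t. On a bounded interval it differs from an integral starting at - n by a constant.\<close>
  define G where "G t = c + integral {0..t} g - integral {t..0} g" for t
  have cont: "continuous_on S g" for S using assms continuous_on_subset by blast
  have int: "g integrable_on {a..b}" for a b
    by (rule integrable_continuous_real[OF cont])
  have "(G has_vector_derivative g t) (at t)" for t
  proof -
    define n where "n = \<bar>t\<bar> + 1"
    have n: "- n < t" "t < n" "n > 0" by (auto simp: n_def abs_if)
    have "((\<lambda>u. integral {-n..u} g) has_vector_derivative g t) (at t within {-n..n})"
      using n by (intro integral_has_vector_derivative cont) auto
    hence "((\<lambda>u. integral {-n..u} g) has_vector_derivative g t) (at t within {-n<..<n})"
      by (rule has_vector_derivative_within_subset) auto
    hence "((\<lambda>u. integral {-n..u} g) has_vector_derivative g t) (at t)"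
      using n by (subst (asm) at_within_open) auto
    hence "((\<lambda>u. integral {-n..u} g + (c - integral {-n..0} g)) has_vector_derivative g t) (at t)"
      by (auto intro!: derivative_eq_intros)
    moreover have "integral {-n..u} g + (c - integral {-n..0} g) = G u" if "u \<in> {-n<..<n}" for u
    proof (cases "u \<ge> 0")
      case True
      have "integral {-n..0} g + integral {0..u} g = integral {-n..u} g"
        using that True n by (intro Henstock_Kurzweil_Integration.integral_combine int) auto
      moreover have "integral {u..0} g = 0" using True
        by (cases "u = 0") auto
      ultimately show ?thesis by (simp add: G_def algebra_simps)
    next
      case False
      have "integral {-n..u} g + integral {u..0} g = integral {-n..0} g"
        using that False n by (intro Henstock_Kurzweil_Integration.integral_combine int) auto
      then show ?thesis using False by (simp add: G_def algebra_simps)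
    qed
    ultimately show ?thesis
      using has_vector_derivative_transform_within_open[of _ "g t" t "{-n<..<n}" G] n by force
  qed
  thus ?thesis using that[of G] by (simp add: G_def)
qed

lemma has_vector_derivative_reflect:
  assumes "(f has_vector_derivative f') (at (c - t))"
  shows "((\<lambda>t. f (c - t)) has_vector_derivative - f') (at t)"
proof -
  have "((\<lambda>t. c - t) has_vector_derivative - 1) (at t)" by (auto intro!: derivative_eq_intros)
  from vector_diff_chain_at[OF this assms] show ?thesis by (simp add: o_def)
qed

lemma has_vector_derivative_shift:
  assumes "(f has_vector_derivative f') (at (t + c))"
  shows "((\<lambda>t. f (t + c)) has_vector_derivative f') (at t)"
proof -
  have "((\<lambda>t. t + c) has_vector_derivative 1) (at t)" by (auto intro!: derivative_eq_intros)
  from vector_diff_chain_at[OF this assms] show ?thesis by (simp add: o_def)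
qed

text \<open>Integration divides the weight exp (K |t|) by K; for large K this makes the Picard map
  of a bounded linear equation a contraction.\<close>

lemma vector_derivative_exp_bound:
  fixes G :: "real \<Rightarrow> 'a::real_normed_vector"
  assumes G: "\<And>t. (G has_vector_derivative g t) (at t)" and "G 0 = 0" "K > 0"
    and g: "\<And>t. norm (g t) \<le> C * exp (K * \<bar>t\<bar>)"
  shows "norm (G t) \<le> C / K * exp (K * \<bar>t\<bar>)"
proof -
  have C: "C \<ge> 0" using g[of 0] norm_ge_zero[of "g 0"] by (simp del: norm_ge_zero)
  have pos: "norm (F t) \<le> C / K * exp (K * t)"
    if F: "\<And>t. (F has_vector_derivative f t) (at t)" and "F 0 = 0" "t \<ge> 0"
      and f: "\<And>t. norm (f t) \<le> C * exp (K * \<bar>t\<bar>)" for F :: "real \<Rightarrow> 'a" and f t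
  proof (cases "t = 0")
    case True thus ?thesis using that C \<open>K > 0\<close> by simp
  next
    case False
    have "norm (F t - F 0) \<le> C / K * exp (K * t) - C / K * exp (K * 0)"
    proof (rule differentiable_bound_general[where f' = f and \<phi>' = "\<lambda>t. C * exp (K * t)"])
      show "continuous_on {0..t} F"
        using F by (auto intro!: continuous_at_imp_continuous_on dest: has_vector_derivative_continuous)
      show "((\<lambda>t. C / K * exp (K * t)) has_vector_derivative C * exp (K * x)) (at x)" for x
        unfolding has_real_derivative_iff_has_vector_derivative[symmetric]
        using \<open>K > 0\<close> by (auto intro!: derivative_eq_intros)
      show "norm (f x) \<le> C * exp (K * x)" if "0 < x" for x using f[of x] that by simp
      show "continuous_on {0..t} (\<lambda>t. C / K * exp (K * t))" by (intro continuous_intros)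
    qed (use that False F in auto)
    thus ?thesis using C \<open>K > 0\<close> \<open>F 0 = 0\<close> by (auto simp: field_simps)
  qed
  show ?thesis
  proof (cases "t \<ge> 0")
    case True thus ?thesis using pos[OF G, of t] assms by simp
  next
    case False
    have "((\<lambda>t. G (- t)) has_vector_derivative - g (- t)) (at t)" for t
      using has_vector_derivative_reflect[of G "g (- t)" 0 t] G[of "-t"] by simp
    from pos[OF this _ _, of "- t"] False g[of "- _"] show ?thesis using assms by simp
  qed
qed

text \<open>\<open>lin_flow\<close> is a definite description of a solution on the whole line, so it
  carries information only once global existence is known.\<close>

lemma linear_ode_exists:
  fixes A :: "real \<Rightarrow> 'a::banach \<Rightarrow> 'a"
  assumes lin: "\<And>t. linear (A t)" and bound: "\<And>t v. norm (A t v) \<le> L * norm v"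
    and cont: "\<And>u. continuous_on UNIV u \<Longrightarrow> continuous_on UNIV (\<lambda>t. A t (u t))"
  obtains v where "v 0 = v0" "\<And>t. (v has_vector_derivative A t (v t)) (at t)"
proof -
  \<comment> \<open>Picard iteration is a contraction for the norm weighted by \<open>exp (- K \<bar>t\<bar>)\<close>.\<close>
  define K where "K = 2 * max L 1"
  have K: "K > 0" "L / K \<le> 1 / 2" "K \<ge> 2 * L" unfolding K_def by (auto simp: divide_simps split: split_max) linarith?
  define W where "W t = exp (K * \<bar>t\<bar>)" for t
  have W: "W t > 0" "W t \<ge> 1" "W 0 = 1" for t using K by (auto simp: W_def)
  have Wc: "continuous_on UNIV W" unfolding W_def by (intro continuous_intros)
  define J where "J u = (SOME G. G 0 = v0 \<and> (\<forall>t. (G has_vector_derivative A t (u t)) (at t)))" for u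
  have J: "J u 0 = v0" "(J u has_vector_derivative A t (u t)) (at t)" if "continuous_on UNIV u" for u t
  proof -
    have "\<exists>G. G 0 = v0 \<and> (\<forall>t. (G has_vector_derivative A t (u t)) (at t))"
      using continuous_antiderivative[OF cont[OF that], of v0] by metis
    from someI_ex[OF this] show "J u 0 = v0" "(J u has_vector_derivative A t (u t)) (at t)"
      unfolding J_def by auto
  qed
  have Jc: "continuous_on UNIV (J u)" if "continuous_on UNIV u" for u
    using J(2)[OF that] by (auto intro!: continuous_at_imp_continuous_on dest: has_vector_derivative_continuous)
  have Jd: "norm (J u t - J u' t) \<le> M / 2 * W t"
    if u: "continuous_on UNIV u" "continuous_on UNIV u'" and M: "\<And>t. norm (u t - u' t) \<le> M * W t" for u u' M t
  proof -
    have M0: "M \<ge> 0" using M[of 0] norm_ge_zero[of "u 0 - u' 0"] W by (simp del: norm_ge_zero)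
    \<comment> \<open>A negative L is possible only on the zero space, where every bound is
      trivial.\<close>
    have L0: "(L \<ge> 0) \<or> (\<forall>v::'a. v = 0)"
    proof (rule ccontr)
      assume "\<not> ?thesis"
      then obtain v :: 'a where "L < 0" "v \<noteq> 0" by auto
      hence "L * norm v < 0" by (simp add: mult_neg_pos)
      thus False using bound[of 0 v] norm_ge_zero[of "A 0 v"] by linarith
    qed
    show ?thesis
    proof (cases "L \<ge> 0")
      case True
      have "norm (J u t - J u' t) \<le> (L * M) / K * exp (K * \<bar>t\<bar>)"
      proof (rule vector_derivative_exp_bound[where g = "\<lambda>t. A t (u t - u' t)"])
        show "((\<lambda>t. J u t - J u' t) has_vector_derivative A t (u t - u' t)) (at t)" for t
          using has_vector_derivative_diff[OF J(2)[OF u(1), of t] J(2)[OF u(2), of t]]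
          by (simp add: linear_diff[OF lin])
        show "norm (A t (u t - u' t)) \<le> L * M * exp (K * \<bar>t\<bar>)" for t
          using order_trans[OF bound mult_left_mono[OF M True]] by (simp add: W_def mult.assoc)
      qed (use J(1)[OF u(1)] J(1)[OF u(2)] K in auto)
      also have "\<dots> = M * (L / K) * W t" by (simp add: W_def)
      also have "\<dots> \<le> M * (1 / 2) * W t"
        using M0 W K by (intro mult_right_mono mult_left_mono) (auto intro: less_imp_le)
      finally show ?thesis by simp
    next
      case False
      with L0 have "J u t - J u' t = 0" by blast
      thus ?thesis using M0 W(1)[of t] by simp
    qed
  qed
  have inB: "(\<lambda>t. J u t /\<^sub>R W t) \<in> bcontfun" if u: "continuous_on UNIV u" and M: "\<And>t. norm (u t) \<le> M * W t" for u M
  proof (rule bcontfun_normI)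
    show "continuous_on UNIV (\<lambda>t. J u t /\<^sub>R W t)"
      using W(1) by (intro continuous_intros Jc u Wc) (metis less_irrefl)
    fix t
    \<comment> \<open>The Picard map sends 0 to the constant v0. Hence the estimate for differences
      also bounds the weighted image of a single function.\<close>
    have J0: "J (\<lambda>_. 0) t = v0" for t
    proof -
      have "\<exists>c. \<forall>x. J (\<lambda>_. 0) x = c"
      proof -
        have "(J (\<lambda>_. 0) has_vector_derivative 0) (at x within UNIV)" for x
          using J(2)[of "\<lambda>_. 0" x] by (simp add: linear_0[OF lin])
        from has_vector_derivative_zero_constant[OF convex_UNIV this] show ?thesis by auto
      qed
      thus ?thesis using J(1)[of "\<lambda>_. 0"] by (metis continuous_on_const)
    qed
    have "norm (J u t - J (\<lambda>_. 0) t) \<le> M / 2 * W t"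
      using u M by (intro Jd) auto
    hence "norm (J u t) \<le> norm v0 + M / 2 * W t"
      using norm_triangle_ineq2[of "J u t" v0] by (simp add: J0)
    hence "norm (J u t) / W t \<le> norm v0 / W t + M / 2"
      using W(1)[of t] by (simp add: field_simps)
    moreover have "norm v0 / W t \<le> norm v0" using W(2)[of t] mult_left_mono[of 1 "W t" "norm v0"] by (simp add: field_simps)
    moreover have "norm (J u t /\<^sub>R W t) = norm (J u t) / W t"
      using W(1)[of t] by (simp add: divide_inverse_commute)
    ultimately show "norm (J u t /\<^sub>R W t) \<le> norm v0 + M / 2" by linarith
  qed
  define \<Psi> where "\<Psi> g = Bcontfun (\<lambda>t. J (\<lambda>s. W s *\<^sub>R apply_bcontfun g s) t /\<^sub>R W t)" for g :: "real \<Rightarrow>\<^sub>C 'a"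
  have gc: "continuous_on UNIV (\<lambda>s. W s *\<^sub>R apply_bcontfun g s)" for g :: "real \<Rightarrow>\<^sub>C 'a"
    by (intro continuous_intros Wc) auto
  have \<Psi>: "apply_bcontfun (\<Psi> g) t = J (\<lambda>s. W s *\<^sub>R apply_bcontfun g s) t /\<^sub>R W t" for g t
  proof -
    have "norm (W t *\<^sub>R apply_bcontfun g t) \<le> norm g * W t" for t
      using norm_bounded[of g t] W(1)[of t] by (simp add: mult.commute mult_left_mono)
    from inB[OF gc this] show ?thesis
      unfolding \<Psi>_def by (subst Bcontfun_inverse) auto
  qed
  have "\<exists>!g. \<Psi> g = g"
  proof (rule banach_fix_type[of "1 / 2"], simp, simp, intro allI)
    fix g h :: "real \<Rightarrow>\<^sub>C 'a"
    show "dist (\<Psi> g) (\<Psi> h) \<le> 1 / 2 * dist g h"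
    proof (rule dist_bound)
      fix t
      have "norm (W t *\<^sub>R apply_bcontfun g t - W t *\<^sub>R apply_bcontfun h t) \<le> dist g h * W t" for t
      proof -
        have "W t * dist (apply_bcontfun g t) (apply_bcontfun h t) \<le> W t * dist g h"
          using W(1)[of t] by (intro mult_left_mono dist_bounded) auto
        thus ?thesis using W(1)[of t]
          by (simp add: dist_norm mult.commute flip: scaleR_diff_right)
      qed
      from Jd[OF gc gc this, of t]
      have "norm (J (\<lambda>s. W s *\<^sub>R apply_bcontfun g s) t - J (\<lambda>s. W s *\<^sub>R apply_bcontfun h s) t) / W t
          \<le> 1 / 2 * dist g h" using W(1)[of t] by (simp add: divide_le_eq)
      moreover have "dist (apply_bcontfun (\<Psi> g) t) (apply_bcontfun (\<Psi> h) t) =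
        norm (J (\<lambda>s. W s *\<^sub>R apply_bcontfun g s) t - J (\<lambda>s. W s *\<^sub>R apply_bcontfun h s) t) / W t"
        unfolding \<Psi> dist_norm scaleR_diff_right[symmetric] norm_scaleR
        using W(1)[of t] by (simp add: divide_inverse_commute)
      ultimately show "dist (apply_bcontfun (\<Psi> g) t) (apply_bcontfun (\<Psi> h) t) \<le> 1 / 2 * dist g h"
        by simp
    qed
  qed
  then obtain g where g: "\<Psi> g = g" by blast
  define v where "v t = W t *\<^sub>R apply_bcontfun g t" for t
  have vJ: "v t = J v t" for t
  proof -
    have "apply_bcontfun g t = J v t /\<^sub>R W t" using \<Psi>[of g t] by (simp add: g v_def[abs_def])
    thus ?thesis using W(1)[of t] by (simp add: v_def)
  qed
  hence "v = J v" by blast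
  moreover have "continuous_on UNIV v" using gc[of g] by (simp add: v_def[abs_def])
  ultimately show ?thesis using that[of v] J[of v] by metis
qed

section \<open>Gronwall inequalities and uniqueness\<close>

lemma gronwall_scalar:
  fixes s :: "real \<Rightarrow> real"
  assumes "0 \<le> T" and d: "\<And>t. 0 \<le> t \<Longrightarrow> t \<le> T \<Longrightarrow> (s has_real_derivative s' t) (at t)"
    and le: "\<And>t. 0 \<le> t \<Longrightarrow> t \<le> T \<Longrightarrow> s' t \<le> K * s t"
  shows "s T \<le> s 0 * exp (K * T)"
proof -
  have "s T * exp (- K * T) \<le> s 0 * exp (- K * 0)"
  proof (rule DERIV_nonpos_imp_nonincreasing[where f = "\<lambda>t. s t * exp (- K * t)"])
    fix t assume t: "0 \<le> t" "t \<le> T"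
    have "((\<lambda>t. s t * exp (- K * t)) has_real_derivative (s' t - K * s t) * exp (- K * t)) (at t)"
      by (auto intro!: derivative_eq_intros d t simp: algebra_simps)
    moreover have "(s' t - K * s t) * exp (- K * t) \<le> 0"
      using le[OF t] by (simp add: mult_nonpos_nonneg)
    ultimately show "\<exists>y. ((\<lambda>t. s t * exp (- K * t)) has_real_derivative y) (at t) \<and> y \<le> 0" by blast
  qed (use assms in auto)
  hence "s T * exp (- K * T) * exp (K * T) \<le> s 0 * exp (K * T)" by (simp add: mult_right_mono)
  thus ?thesis by (simp add: mult.assoc flip: exp_add)
qed

text \<open>The squared norm is differentiable also where the norm vanishes. The mixed term 2 |d| M
  is absorbed by |d|^2 + M^2, which is why M^2 is added on both sides and why the exponent contains
  the additional 1.\<close>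

lemma gronwall:
  fixes d :: "real \<Rightarrow> 'a::real_inner"
  assumes "0 \<le> T" "0 \<le> L" and d: "\<And>t. 0 \<le> t \<Longrightarrow> t \<le> T \<Longrightarrow> (d has_vector_derivative d' t) (at t)"
    and le: "\<And>t. 0 \<le> t \<Longrightarrow> t \<le> T \<Longrightarrow> norm (d' t) \<le> L * norm (d t) + M"
  shows "(norm (d T))\<^sup>2 + M\<^sup>2 \<le> ((norm (d 0))\<^sup>2 + M\<^sup>2) * exp ((2 * L + 1) * T)"
proof (rule gronwall_scalar[where s = "\<lambda>t. (norm (d t))\<^sup>2 + M\<^sup>2" and s' = "\<lambda>t. 2 * (d t \<bullet> d' t)"])
  fix t assume t: "0 \<le> t" "t \<le> T"
  have "((\<lambda>t. d t \<bullet> d t) has_vector_derivative (d t \<bullet> d' t + d' t \<bullet> d t)) (at t)"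
    by (rule bounded_bilinear.has_vector_derivative[OF bounded_bilinear_inner d[OF t] d[OF t]])
  thus "((\<lambda>t. (norm (d t))\<^sup>2 + M\<^sup>2) has_real_derivative 2 * (d t \<bullet> d' t)) (at t)"
    by (auto simp: power2_norm_eq_inner has_real_derivative_iff_has_vector_derivative inner_commute
        intro!: derivative_eq_intros)
  have "d t \<bullet> d' t \<le> norm (d t) * norm (d' t)" by (rule norm_cauchy_schwarz)
  also have "\<dots> \<le> norm (d t) * (L * norm (d t) + M)" by (intro mult_left_mono le t) auto
  finally have "2 * (d t \<bullet> d' t) \<le> 2 * L * (norm (d t))\<^sup>2 + 2 * (norm (d t) * M)"
    by (simp add: algebra_simps power2_eq_square)
  moreover have "2 * (norm (d t) * M) \<le> (norm (d t))\<^sup>2 + M\<^sup>2"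
    using sum_squares_bound[of "norm (d t)" M] by simp
  moreover have "0 \<le> L * M\<^sup>2" using assms by simp
  ultimately show "2 * (d t \<bullet> d' t) \<le> (2 * L + 1) * ((norm (d t))\<^sup>2 + M\<^sup>2)"
    by (simp add: algebra_simps)
qed fact

lemma gronwall_unique:
  fixes d :: "real \<Rightarrow> 'a::real_inner"
  assumes "0 \<le> L" and d: "\<And>t. (d has_vector_derivative d' t) (at t)"
    and le: "\<And>t. norm (d' t) \<le> L * norm (d t)" and "d t0 = 0"
  shows "d t = 0"
proof (cases "t \<ge> t0")
  case True
  have "(norm (d (t - t0 + t0)))\<^sup>2 + 0\<^sup>2 \<le> ((norm (d (0 + t0)))\<^sup>2 + 0\<^sup>2) * exp ((2 * L + 1) * (t - t0))"
    using True assms by (intro gronwall[where d' = "\<lambda>t. d' (t + t0)"] has_vector_derivative_shift) auto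
  thus ?thesis using assms by simp
next
  case False
  have "(norm (d (t0 - (t0 - t))))\<^sup>2 + 0\<^sup>2 \<le> ((norm (d (t0 - 0)))\<^sup>2 + 0\<^sup>2) * exp ((2 * L + 1) * (t0 - t))"
    using False assms by (intro gronwall[where d' = "\<lambda>t. - d' (t0 - t)"] has_vector_derivative_reflect) auto
  thus ?thesis using assms by simp
qed

section \<open>Rotation of planar paths\<close>

text \<open>The angle is defined as an antiderivative of the angular speed, so its derivative is
  known by construction. It remains to see that it is the argument: the component n of (a, b)
  orthogonal to (cos \<theta>, sin \<theta>) solves a linear equation and vanishes at 0, and the
  component m along this direction keeps its sign.\<close>

lemma polar_lift:
  fixes a b a' b' :: "real \<Rightarrow> real"
  assumes a: "\<And>t. (a has_real_derivative a' t) (at t)" and b: "\<And>t. (b has_real_derivative b' t) (at t)"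
    and cont: "continuous_on UNIV a'" "continuous_on UNIV b'"
    and nz: "\<And>t. (a t)\<^sup>2 + (b t)\<^sup>2 > 0"
  obtains \<theta> where
    "\<And>t. (\<theta> has_real_derivative (a t * b' t - b t * a' t) / ((a t)\<^sup>2 + (b t)\<^sup>2)) (at t)"
    "\<And>t. a t = sqrt ((a t)\<^sup>2 + (b t)\<^sup>2) * cos (\<theta> t)"
    "\<And>t. b t = sqrt ((a t)\<^sup>2 + (b t)\<^sup>2) * sin (\<theta> t)"
proof -
  define R where "R t = (a t)\<^sup>2 + (b t)\<^sup>2" for t
  define g where "g t = (a t * b' t - b t * a' t) / R t" for t
  have R: "R t > 0" "R t \<noteq> 0" for t using nz[of t] by (auto simp: R_def)
  have ac: "continuous_on UNIV a" "continuous_on UNIV b"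
    using a b by (auto intro!: continuous_at_imp_continuous_on DERIV_isCont)
  have "continuous_on UNIV g" using R(2) unfolding g_def R_def
    by (intro continuous_intros cont ac) auto
  moreover obtain \<theta>0 where \<theta>0: "a 0 = sqrt (R 0) * cos \<theta>0" "b 0 = sqrt (R 0) * sin \<theta>0"
  proof -
    have "(a 0 / sqrt (R 0))\<^sup>2 + (b 0 / sqrt (R 0))\<^sup>2 = 1"
      using R[of 0] by (simp add: power_divide add_divide_distrib[symmetric] R_def)
    from sincos_total_2pi[OF this] obtain t where "a 0 / sqrt (R 0) = cos t" "b 0 / sqrt (R 0) = sin t" by metis
    thus ?thesis using that[of t] R[of 0] by (simp add: field_simps)
  qed
  ultimately obtain \<theta> where \<theta>: "\<theta> 0 = \<theta>0" "\<And>t. (\<theta> has_vector_derivative g t) (at t)"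
    using continuous_antiderivative by metis
  have \<theta>': "(\<theta> has_real_derivative g t) (at t)" for t
    using \<theta>(2) by (simp add: has_real_derivative_iff_has_vector_derivative)
  define m where "m t = a t * cos (\<theta> t) + b t * sin (\<theta> t)" for t
  define n where "n t = b t * cos (\<theta> t) - a t * sin (\<theta> t)" for t
  define k where "k t = (a t * a' t + b t * b' t) / R t" for t
  have mn: "(m t)\<^sup>2 + (n t)\<^sup>2 = R t" for t
  proof -
    have "(m t)\<^sup>2 + (n t)\<^sup>2 = R t * ((cos (\<theta> t))\<^sup>2 + (sin (\<theta> t))\<^sup>2)"
      unfolding m_def n_def R_def by algebra
    thus ?thesis by simp
  qed
  have a'k: "a' t = k t * a t - g t * b t" and b'k: "b' t = k t * b t + g t * a t" for t
  proof -
    have *: "(a t * a' t + b t * b' t) * a t - (a t * b' t - b t * a' t) * b t = a' t * R t"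
      "(a t * a' t + b t * b' t) * b t + (a t * b' t - b t * a' t) * a t = b' t * R t"
      unfolding R_def by algebra+
    have "k t * a t - g t * b t = (a' t * R t) / R t" "k t * b t + g t * a t = (b' t * R t) / R t"
      unfolding *[symmetric] k_def g_def times_divide_eq_left
      by (rule diff_divide_distrib[symmetric], rule add_divide_distrib[symmetric])
    thus "a' t = k t * a t - g t * b t" "b' t = k t * b t + g t * a t" using R(2)[of t] by simp_all
  qed
  have dn: "(n has_real_derivative k t * n t) (at t)" for t
  proof -
    have "(n has_real_derivative (b' t * cos (\<theta> t) + b t * (- sin (\<theta> t) * g t) -
      (a' t * sin (\<theta> t) + a t * (cos (\<theta> t) * g t)))) (at t)"
      unfolding n_def[abs_def] by (auto intro!: derivative_eq_intros a b \<theta>')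
    thus ?thesis unfolding a'k b'k n_def by (simp add: algebra_simps)
  qed
  have dR: "(R has_real_derivative 2 * k t * R t) (at t)" for t
  proof -
    have "(R has_real_derivative 2 * (a t * a' t + b t * b' t)) (at t)"
      unfolding R_def[abs_def] by (auto intro!: derivative_eq_intros a b simp: algebra_simps)
    thus ?thesis using R(2)[of t] by (simp add: k_def)
  qed
  have "((\<lambda>t. (n t)\<^sup>2 / R t) has_real_derivative 0) (at t)" for t
    using R[of t] by (auto intro!: derivative_eq_intros dn dR simp: power2_eq_square)
  hence "(n t)\<^sup>2 / R t = (n 0)\<^sup>2 / R 0" for t
    using DERIV_isconst_all[of "\<lambda>t. (n t)\<^sup>2 / R t" t 0] by blast
  moreover have "n 0 = 0" using \<theta>0 by (simp add: n_def \<theta>(1))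
  ultimately have n0: "n t = 0" for t using R(2)[of t] by auto
  have m0: "m 0 > 0"
  proof -
    have "m 0 = sqrt (R 0) * ((cos \<theta>0)\<^sup>2 + (sin \<theta>0)\<^sup>2)"
      unfolding m_def \<theta>(1) \<theta>0 by algebra
    thus ?thesis using R[of 0] by simp
  qed
  have mnz: "m t \<noteq> 0" for t using mn[of t] n0[of t] R[of t] by auto
  have mc: "continuous_on S m" for S
  proof -
    have "continuous_on UNIV \<theta>" using \<theta>' by (auto intro!: continuous_at_imp_continuous_on DERIV_isCont)
    hence "continuous_on UNIV m" unfolding m_def by (intro continuous_intros ac)
    thus ?thesis using continuous_on_subset by blast
  qed
  have mpos: "m t > 0" for t
  proof (rule ccontr)
    assume "\<not> m t > 0"
    hence "m t \<le> 0" by simp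
    moreover have "connected (m ` UNIV)" using mc by (intro connected_continuous_image) auto
    ultimately have "0 \<in> m ` UNIV" using m0 connectedD_interval[of "m ` UNIV" "m t" "m 0" 0] by auto
    thus False using mnz by auto
  qed
  have mR: "m t = sqrt (R t)" for t using mn[of t] n0[of t] mpos[of t]
    by (metis add.right_neutral less_imp_le power_zero_numeral real_sqrt_unique)
  have sc: "(sin (\<theta> t))\<^sup>2 + (cos (\<theta> t))\<^sup>2 = 1" for t by simp
  have ab: "a t = m t * cos (\<theta> t) - n t * sin (\<theta> t)" "b t = m t * sin (\<theta> t) + n t * cos (\<theta> t)" for t
    unfolding m_def n_def using sc[of t] by algebra+
  have "a t = sqrt (R t) * cos (\<theta> t)" "b t = sqrt (R t) * sin (\<theta> t)" for t
    using ab[of t] unfolding n0 mR by (simp_all only: mult_zero_left diff_0_right add_0_right)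
  from that[OF _ this[unfolded R_def]] \<theta>' show ?thesis unfolding g_def R_def by blast
qed

section \<open>Angle lifts of planar curves\<close>

lemma stay_in_interval:
  fixes h :: "real \<Rightarrow> real"
  assumes "continuous_on {c..d} h" "t0 \<in> {c..d}" "a < h t0" "h t0 < b"
    and "\<And>t. t \<in> {c..d} \<Longrightarrow> h t \<noteq> a" "\<And>t. t \<in> {c..d} \<Longrightarrow> h t \<noteq> b" and "t \<in> {c..d}"
  shows "a < h t \<and> h t < b"
proof -
  have conn: "connected (h ` {c..d})" using assms by (intro connected_continuous_image) auto
  have "\<not> h t \<le> a"
    using connectedD_interval[OF conn, of "h t" "h t0" a] assms by force
  moreover have "\<not> h t \<ge> b"
    using connectedD_interval[OF conn, of "h t0" "h t" b] assms by force
  ultimately show ?thesis by auto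
qed

text \<open>This is the condition on \<theta> inside \<open>arg_variation\<close>, isolated so that
  lifts of different curves can be compared.\<close>

definition angle_lift :: "(real \<Rightarrow> real^2) \<Rightarrow> real \<Rightarrow> (real \<Rightarrow> real) \<Rightarrow> bool" where
  "angle_lift c T \<theta> \<longleftrightarrow> continuous_on {0..T} \<theta> \<and>
     (\<forall>t\<in>{0..T}. c t = norm (c t) *\<^sub>R vector [cos (\<theta> t), sin (\<theta> t)])"

definition cross2 :: "real^2 \<Rightarrow> real^2 \<Rightarrow> real" where
  "cross2 u v = u $ 1 * v $ 2 - u $ 2 * v $ 1"

definition ang2 :: "real^2 \<Rightarrow> real^2 \<Rightarrow> real" where
  "ang2 u v = arccos (u \<bullet> v / (norm u * norm v))"

lemma inner_2: "u \<bullet> v = u $ 1 * v $ 1 + u $ 2 * v $ 2" for u v :: "real^2"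
  by (simp add: inner_vec_def sum_2)

lemma norm_2: "(norm u)\<^sup>2 = (u $ 1)\<^sup>2 + (u $ 2)\<^sup>2" for u :: "real^2"
  unfolding power2_norm_eq_inner inner_2 by (simp add: power2_eq_square)

lemma cross2_commute: "cross2 v u = - cross2 u v"
  by (simp add: cross2_def)

lemma norm_cos_sin [simp]: "norm (vector [cos s, sin s] :: real^2) = 1"
  by (simp add: norm_eq_sqrt_inner inner_2 flip: power2_eq_square)

lemma polar_cross_inner:
  assumes "u = r *\<^sub>R vector [cos s, sin s]" "v = r' *\<^sub>R vector [cos s', sin s']"
  shows "cross2 u v = r * r' * sin (s' - s)" "u \<bullet> v = r * r' * cos (s' - s)"
  unfolding assms cross2_def inner_2 by (simp_all add: sin_diff cos_diff algebra_simps)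

lemma cross2_matrix: "cross2 (A *v u) (A *v v) = det A * cross2 u v"
  by (simp add: cross2_def matrix_vector_mult_def sum_2 det_2 algebra_simps)

text \<open>As the second vector stays strictly to the left of the first, the angle between them,
  reduced modulo 2 pi, never leaves (0, pi), where arccos of the normalized inner product recovers
  it. So the difference of the total rotations can be read off from the end points.\<close>

lemma lift_difference:
  assumes lift: "angle_lift c T \<theta>" "angle_lift c' T \<theta>'" and "T \<ge> 0"
    and cross: "\<And>t. t \<in> {0..T} \<Longrightarrow> cross2 (c t) (c' t) > 0"
  shows "(\<theta>' T - \<theta> T) - (\<theta>' 0 - \<theta> 0) = ang2 (c T) (c' T) - ang2 (c 0) (c' 0)"
    "0 < ang2 (c T) (c' T)" "ang2 (c T) (c' T) < pi" "0 < ang2 (c 0) (c' 0)" "ang2 (c 0) (c' 0) < pi"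
proof -
  define k where "k = \<lfloor>(\<theta>' 0 - \<theta> 0) / (2 * pi)\<rfloor>"
  define g where "g t = \<theta>' t - \<theta> t - 2 * pi * of_int k" for t
  have g_sin: "sin (g t) = sin (\<theta>' t - \<theta> t)" and g_cos: "cos (g t) = cos (\<theta>' t - \<theta> t)" for t
    unfolding g_def sin_diff[of _ "2 * pi * of_int k"] cos_diff[of _ "2 * pi * of_int k"] by simp_all
  have polar: "cross2 (c t) (c' t) = norm (c t) * norm (c' t) * sin (g t)"
    "c t \<bullet> c' t = norm (c t) * norm (c' t) * cos (g t)" if "t \<in> {0..T}" for t
    unfolding g_sin g_cos using lift that
    by (intro polar_cross_inner; simp only: angle_lift_def; blast)+
  have nn: "norm (c t) * norm (c' t) > 0" if "t \<in> {0..T}" for t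
    using cross[OF that] by (cases "c t = 0"; cases "c' t = 0") (auto simp: cross2_def)
  have pos: "sin (g t) > 0" if "t \<in> {0..T}" for t
    using zero_less_mult_pos[OF _ nn[OF that]] cross[OF that] polar(1)[OF that] by metis
  have "0 \<le> g 0" "g 0 < 2 * pi"
    unfolding g_def k_def using floor_divide_lower[of "2 * pi" "\<theta>' 0 - \<theta> 0"]
      floor_divide_upper[of "2 * pi" "\<theta>' 0 - \<theta> 0"] by (auto simp: algebra_simps)
  moreover have "sin (g 0) > 0" using pos \<open>T \<ge> 0\<close> by simp
  ultimately have g0: "0 < g 0" "g 0 < pi"
    using sin_le_zero[of "g 0"] by (auto simp: less_le) (metis linorder_not_le sin_le_zero order_le_less)
  have gc: "continuous_on {0..T} g" using lift unfolding g_def angle_lift_def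
    by (auto intro!: continuous_intros)
  have g: "0 < g t \<and> g t < pi" if "t \<in> {0..T}" for t
  proof (rule stay_in_interval[OF gc _ _ _ _ _ that])
    show "g t \<noteq> 0" "g t \<noteq> pi" if "t \<in> {0..T}" for t using pos[OF that] by auto
  qed (use g0 \<open>T \<ge> 0\<close> in auto)
  have ang: "ang2 (c t) (c' t) = g t" if "t \<in> {0..T}" for t
    unfolding ang2_def polar[OF that] using nn[OF that] g[OF that] by (auto simp: arccos_cos zero_less_mult_iff)
  have T0: "0 \<in> {0..T}" "T \<in> {0..T}" using \<open>T \<ge> 0\<close> by auto
  show "(\<theta>' T - \<theta> T) - (\<theta>' 0 - \<theta> 0) = ang2 (c T) (c' T) - ang2 (c 0) (c' 0)"
    unfolding ang[OF T0(1)] ang[OF T0(2)] by (simp add: g_def)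
  show "0 < ang2 (c T) (c' T)" "ang2 (c T) (c' T) < pi" "0 < ang2 (c 0) (c' 0)" "ang2 (c 0) (c' 0) < pi"
    unfolding ang[OF T0(1)] ang[OF T0(2)] using g[OF T0(1)] g[OF T0(2)] by blast+
qed

lemma angle_liftD: "angle_lift c T \<theta> \<Longrightarrow> t \<in> {0..T} \<Longrightarrow> c t = norm (c t) *\<^sub>R vector [cos (\<theta> t), sin (\<theta> t)]"
  and angle_lift_continuous: "angle_lift c T \<theta> \<Longrightarrow> continuous_on {0..T} \<theta>"
  unfolding angle_lift_def by blast+

text \<open>Both lifts are compared with the curve turned by a quarter circle, which lies strictly
  to the left of the given one; \<open>lift_difference\<close> gives the same value for
  both.\<close>

lemma lift_unique:
  assumes lift: "angle_lift c T \<theta>" "angle_lift c T \<theta>'" and "T \<ge> 0"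
    and nz: "\<And>t. t \<in> {0..T} \<Longrightarrow> c t \<noteq> 0"
  shows "\<theta>' T - \<theta>' 0 = \<theta> T - \<theta> 0"
proof -
  define c' :: "real \<Rightarrow> real^2" where "c' t = vector [- (c t $ 2), c t $ 1]" for t
  have nc: "norm (c' t) = norm (c t)" for t
    unfolding norm_eq_sqrt_inner inner_2 c'_def by (simp add: add.commute)
  have rot: "angle_lift c' T (\<lambda>t. \<eta> t + pi / 2)" if \<eta>: "angle_lift c T \<eta>" for \<eta>
  proof -
    have "c' t = norm (c' t) *\<^sub>R vector [cos (\<eta> t + pi / 2), sin (\<eta> t + pi / 2)]" if t: "t \<in> {0..T}" for t
    proof -
      have "c t = norm (c t) *\<^sub>R vector [cos (\<eta> t), sin (\<eta> t)]"
        by (rule angle_liftD[OF \<eta> t])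
      from arg_cong[OF this, of "\<lambda>v. v $ 1"] arg_cong[OF this, of "\<lambda>v. v $ 2"]
      have "c t $ 1 = norm (c t) * cos (\<eta> t)" "c t $ 2 = norm (c t) * sin (\<eta> t)"
        by (simp_all only: vector_scaleR_component vector_2 real_scaleR_def)
      hence "c' t = vector [- (norm (c t) * sin (\<eta> t)), norm (c t) * cos (\<eta> t)]"
        unfolding c'_def by (simp only:)
      also have "\<dots> = norm (c' t) *\<^sub>R vector [cos (\<eta> t + pi / 2), sin (\<eta> t + pi / 2)]"
        unfolding nc by (simp add: vec_eq_iff forall_2 cos_add sin_add)
      finally show ?thesis .
    qed
    moreover have "continuous_on {0..T} (\<lambda>t. \<eta> t + pi / 2)"
      by (intro continuous_intros angle_lift_continuous[OF \<eta>])
    ultimately show ?thesis unfolding angle_lift_def by blast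
  qed
  have cr: "cross2 (c t) (c' t) > 0" if "t \<in> {0..T}" for t
  proof -
    have "cross2 (c t) (c' t) = (norm (c t))\<^sup>2"
      unfolding norm_2 by (simp add: cross2_def c'_def power2_eq_square)
    thus ?thesis using nz[OF that] by simp
  qed
  show ?thesis
    using lift_difference(1)[OF lift(1) rot[OF lift(2)] \<open>T \<ge> 0\<close> cr]
      lift_difference(1)[OF lift(1) rot[OF lift(1)] \<open>T \<ge> 0\<close> cr] by simp
qed

section \<open>The rotation interval of a path of planar matrices\<close>

locale planar_path =
  fixes \<Phi> :: "real \<Rightarrow> real^2^2" and T :: real
  assumes T: "T > 0" and det_pos: "\<And>t. t \<in> {0..T} \<Longrightarrow> det (\<Phi> t) > 0" and \<Phi>0: "\<Phi> 0 = mat 1"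
    and lifts: "\<And>w. w \<noteq> 0 \<Longrightarrow> \<exists>\<theta>. angle_lift (\<lambda>t. \<Phi> t *v w) T \<theta>"
begin

lemma \<Phi>_nz: "\<Phi> t *v w \<noteq> 0" if "w \<noteq> 0" "t \<in> {0..T}"
  using det_pos[OF that(2)] that(1)
  by (metis invertible_det_nz less_irrefl matrix_left_invertible_ker invertible_left_inverse)

lemma arg_variation_eq:
  assumes "w \<noteq> 0" "angle_lift (\<lambda>t. \<Phi> t *v w) T \<theta>"
  shows "arg_variation \<Phi> T w = (\<theta> T - \<theta> 0) / (2 * pi)"
  unfolding arg_variation_def
proof (rule the_equality)
  show "\<exists>\<theta>'. continuous_on {0..T} \<theta>' \<and> (\<forall>t\<in>{0..T}. \<Phi> t *v w = norm (\<Phi> t *v w) *\<^sub>R vector [cos (\<theta>' t), sin (\<theta>' t)]) \<and>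
    (\<theta> T - \<theta> 0) / (2 * pi) = (\<theta>' T - \<theta>' 0) / (2 * pi)"
    using assms(2) unfolding angle_lift_def by blast
  fix d
  assume "\<exists>\<theta>'. continuous_on {0..T} \<theta>' \<and> (\<forall>t\<in>{0..T}. \<Phi> t *v w = norm (\<Phi> t *v w) *\<^sub>R vector [cos (\<theta>' t), sin (\<theta>' t)]) \<and>
    d = (\<theta>' T - \<theta>' 0) / (2 * pi)"
  then obtain \<theta>' where "angle_lift (\<lambda>t. \<Phi> t *v w) T \<theta>'" and d: "d = (\<theta>' T - \<theta>' 0) / (2 * pi)"
    unfolding angle_lift_def by blast
  from lift_unique[OF assms(2) this(1)] \<Phi>_nz[OF assms(1)] T
  show "d = (\<theta> T - \<theta> 0) / (2 * pi)" by (simp add: d)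
qed

abbreviation "\<Delta> \<equiv> arg_variation \<Phi> T"

lemma variation_scale:
  assumes "w \<noteq> 0" "c \<noteq> 0"
  shows "\<Delta> (c *\<^sub>R w) = \<Delta> w"
proof -
  obtain \<theta> where \<theta>: "angle_lift (\<lambda>t. \<Phi> t *v w) T \<theta>" using lifts[OF assms(1)] by auto
  define s where "s = (if c > 0 then 0 else pi)"
  have s: "c * cos x = \<bar>c\<bar> * cos (x + s)" "c * sin x = \<bar>c\<bar> * sin (x + s)" for x
    using assms(2) by (auto simp: s_def)
  have "angle_lift (\<lambda>t. \<Phi> t *v (c *\<^sub>R w)) T (\<lambda>t. \<theta> t + s)"
    unfolding angle_lift_def
  proof (intro conjI ballI)
    fix t assume "t \<in> {0..T}"
    from angle_liftD[OF \<theta> this] have "c *\<^sub>R (\<Phi> t *v w) = c *\<^sub>R (norm (\<Phi> t *v w) *\<^sub>R vector [cos (\<theta> t), sin (\<theta> t)])"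
      by (rule arg_cong)
    also have "\<dots> = norm (\<Phi> t *v w) *\<^sub>R vector [c * cos (\<theta> t), c * sin (\<theta> t)]"
      by (simp add: vec_eq_iff forall_2)
    also have "\<dots> = (\<bar>c\<bar> * norm (\<Phi> t *v w)) *\<^sub>R vector [cos (\<theta> t + s), sin (\<theta> t + s)]"
      unfolding s by (simp add: vec_eq_iff forall_2)
    finally have "c *\<^sub>R (\<Phi> t *v w) = (\<bar>c\<bar> * norm (\<Phi> t *v w)) *\<^sub>R vector [cos (\<theta> t + s), sin (\<theta> t + s)]" .
    thus "\<Phi> t *v (c *\<^sub>R w) = norm (\<Phi> t *v (c *\<^sub>R w)) *\<^sub>R vector [cos (\<theta> t + s), sin (\<theta> t + s)]"
      unfolding matrix_vector_mult_scaleR norm_scaleR .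
  qed (intro continuous_intros angle_lift_continuous[OF \<theta>])
  from arg_variation_eq[OF _ this] arg_variation_eq[OF assms(1) \<theta>] assms show ?thesis by simp
qed

text \<open>A path of matrices of positive determinant preserves the orientation of a pair of
  vectors, so the two images never overtake each other and their rotations differ by less than half
  a turn.\<close>

lemma variation_cross:
  assumes "cross2 w w' > 0"
  shows "2 * pi * (\<Delta> w' - \<Delta> w) = ang2 (\<Phi> T *v w) (\<Phi> T *v w') - ang2 w w'" "\<bar>\<Delta> w' - \<Delta> w\<bar> < 1 / 2"
proof -
  have nz: "w \<noteq> 0" "w' \<noteq> 0" using assms by (auto simp: cross2_def)
  obtain \<theta> \<theta>' where \<theta>: "angle_lift (\<lambda>t. \<Phi> t *v w) T \<theta>" "angle_lift (\<lambda>t. \<Phi> t *v w') T \<theta>'"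
    using lifts nz by metis
  have cr: "cross2 (\<Phi> t *v w) (\<Phi> t *v w') > 0" if "t \<in> {0..T}" for t
    using det_pos[OF that] assms by (simp add: cross2_matrix)
  have D: "2 * pi * (\<Delta> w' - \<Delta> w) = (\<theta>' T - \<theta> T) - (\<theta>' 0 - \<theta> 0)"
    unfolding arg_variation_eq[OF nz(1) \<theta>(1)] arg_variation_eq[OF nz(2) \<theta>(2)] by (simp add: field_simps)
  note ld = lift_difference[OF \<theta> less_imp_le[OF T] cr]
  show "2 * pi * (\<Delta> w' - \<Delta> w) = ang2 (\<Phi> T *v w) (\<Phi> T *v w') - ang2 w w'"
    using D ld by (simp add: \<Phi>0)
  hence "\<bar>2 * pi * (\<Delta> w' - \<Delta> w)\<bar> < 2 * pi * (1 / 2)" using D ld by (simp add: \<Phi>0)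
  thus "\<bar>\<Delta> w' - \<Delta> w\<bar> < 1 / 2" unfolding abs_mult using pi_gt_zero by (simp add: abs_less_iff)
qed

lemma cross2_zero_collinear:
  assumes "cross2 w w' = 0" "w \<noteq> 0" "w' \<noteq> 0"
  obtains c where "c \<noteq> 0" "w' = c *\<^sub>R w"
proof (cases "w $ 1 = 0")
  case True
  with assms have "w $ 2 \<noteq> 0" "w' $ 1 = 0" by (auto simp: cross2_def vec_eq_iff forall_2)
  with True assms show ?thesis
    by (intro that[of "w' $ 2 / w $ 2"]) (auto simp: vec_eq_iff forall_2)
next
  case False
  with assms have *: "w' $ 2 = w' $ 1 / w $ 1 * w $ 2" by (simp add: cross2_def field_simps)
  with assms have "w' $ 1 \<noteq> 0" by (auto simp: vec_eq_iff forall_2)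
  with * False show ?thesis
    by (intro that[of "w' $ 1 / w $ 1"]) (auto simp: vec_eq_iff forall_2)
qed

lemma variation_diff:
  assumes "w \<noteq> 0" "w' \<noteq> 0"
  shows "\<bar>\<Delta> w' - \<Delta> w\<bar> < 1 / 2"
proof (cases "cross2 w w' = 0")
  case True
  then obtain c where "c \<noteq> 0" "w' = c *\<^sub>R w" using cross2_zero_collinear assms by blast
  thus ?thesis using variation_scale assms by simp
next
  case False
  show ?thesis
  proof (cases "cross2 w w' > 0")
    case True thus ?thesis by (rule variation_cross)
  next
    case False
    with \<open>cross2 w w' \<noteq> 0\<close> have "cross2 w' w > 0" by (simp add: cross2_commute[of w'])
    from variation_cross(2)[OF this] show ?thesis by (simp add: abs_minus_commute)
  qed
qed

text \<open>Along the segment from w1 to w2 the rotation differs from that of w1 by an explicit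
  angle function G. Its continuity replaces a continuity proof for the rotation itself and allows
  the intermediate value theorem.\<close>

lemma rotation_set_interval: "is_interval (rotation_set \<Phi> T)"
proof -
  have key: "\<exists>w. w \<noteq> 0 \<and> \<Delta> w = y"
    if c: "cross2 w1 w2 > 0" and y: "min (\<Delta> w1) (\<Delta> w2) < y" "y < max (\<Delta> w1) (\<Delta> w2)" for w1 w2 y
  proof -
    define W where "W s = (1 - s) *\<^sub>R w1 + s *\<^sub>R w2" for s
    define G where "G s = ang2 (\<Phi> T *v w1) (\<Phi> T *v W s) - ang2 w1 (W s)" for s
    have crW: "cross2 w1 (W s) = s * cross2 w1 w2" for s
      by (simp add: cross2_def W_def algebra_simps)
    have w1: "w1 \<noteq> 0" using c by (auto simp: cross2_def)
    have Wnz: "W s \<noteq> 0" for s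
    proof (cases "s = 0")
      case True thus ?thesis using w1 by (simp add: W_def)
    next
      case False hence "cross2 w1 (W s) \<noteq> 0" using c by (simp add: crW)
      thus ?thesis by (auto simp: cross2_def)
    qed
    have Wc: "continuous_on {0..1} W" unfolding W_def by (intro continuous_intros)
    have PW: "continuous_on {0..1} (\<lambda>s. \<Phi> T *v W s)"
      by (rule continuous_on_compose2[OF linear_continuous_on[OF matrix_vector_mul_bounded_linear] Wc]) auto
    have angc: "continuous_on {0..1} (\<lambda>s. ang2 u (f s))"
      if "continuous_on {0..1} f" "u \<noteq> 0" "\<And>s. f s \<noteq> 0" for f and u :: "real^2"
      unfolding ang2_def
    proof (intro continuous_on_arccos continuous_intros that)
      show "\<forall>s\<in>{0..1}. -1 \<le> u \<bullet> f s / (norm u * norm (f s)) \<and> u \<bullet> f s / (norm u * norm (f s)) \<le> 1"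
      proof
        fix s
        have "\<bar>u \<bullet> f s\<bar> \<le> norm u * norm (f s)" by (rule Cauchy_Schwarz_ineq2)
        moreover have "norm u * norm (f s) > 0" using that by simp
        ultimately show "-1 \<le> u \<bullet> f s / (norm u * norm (f s)) \<and> u \<bullet> f s / (norm u * norm (f s)) \<le> 1"
          by (auto simp: le_divide_eq divide_le_eq abs_le_iff)
      qed
    qed (use that in auto)
    have ang0: "ang2 u u = 0" if "u \<noteq> 0" for u
      using that by (simp add: ang2_def flip: power2_norm_eq_inner power2_eq_square)
    have Tin: "T \<in> {0..T}" using T by simp
    have Gc: "continuous_on {0..1} G" unfolding G_def
      by (intro continuous_intros angc Wc PW w1 Wnz \<Phi>_nz Tin)
    \<comment> \<open>\<open>variation_cross\<close> covers only s > 0; at s = 0 both angles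
      degenerate to arccos 1.\<close>
    have G0: "G 0 = 0" using ang0 w1 \<Phi>_nz[OF w1 Tin] by (simp add: G_def W_def)
    have G: "G s = 2 * pi * (\<Delta> (W s) - \<Delta> w1)" if "s > 0" for s
      using variation_cross(1)[of w1 "W s"] c that by (simp add: crW G_def)
    have G1: "G 1 = 2 * pi * (\<Delta> w2 - \<Delta> w1)" using G[of 1] by (simp add: W_def)
    have mono: "2 * pi * x \<le> 2 * pi * x'" if "x \<le> x'" for x x' :: real
      using that pi_gt_zero by simp
    have "\<exists>s\<ge>0. s \<le> 1 \<and> G s = 2 * pi * (y - \<Delta> w1)"
    proof (cases "\<Delta> w1 \<le> \<Delta> w2")
      case True
      show ?thesis
        by (rule IVT'[OF _ _ _ Gc]) (use True y in \<open>auto simp: G0 G1\<close>)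
    next
      case False
      show ?thesis
        by (rule IVT2'[OF _ _ _ Gc]) (use False y in \<open>auto simp: G0 G1 mult_le_0_iff\<close>)
    qed
    then obtain s where s: "s \<ge> 0" "G s = 2 * pi * (y - \<Delta> w1)" by auto
    show ?thesis
    proof (cases "s = 0")
      case True
      hence "y = \<Delta> w1" using s G0 by simp
      thus ?thesis using w1 by blast
    next
      case False
      hence "\<Delta> (W s) = y" using G[of s] s by simp
      thus ?thesis using Wnz by blast
    qed
  qed
  have "\<exists>w. w \<noteq> 0 \<and> \<Delta> w = y" if w: "w1 \<noteq> 0" "w2 \<noteq> 0" and y: "\<Delta> w1 < y" "y < \<Delta> w2" for w1 w2 y
  proof (cases "cross2 w1 w2 > 0")
    case True from key[OF this] y show ?thesis by auto
  next
    case False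
    have "cross2 w1 w2 \<noteq> 0"
    proof
      assume "cross2 w1 w2 = 0"
      then obtain c where "c \<noteq> 0" "w2 = c *\<^sub>R w1" using cross2_zero_collinear w by blast
      thus False using variation_scale w y by simp
    qed
    hence "cross2 w2 w1 > 0" using False by (simp add: cross2_commute[of w2])
    from key[OF this] y show ?thesis by auto
  qed
  hence "\<forall>a\<in>rotation_set \<Phi> T. \<forall>b\<in>rotation_set \<Phi> T. \<forall>y. a \<le> y \<and> y \<le> b \<longrightarrow> y \<in> rotation_set \<Phi> T"
    unfolding rotation_set_def by (smt (verit) mem_Collect_eq)
  thus ?thesis unfolding is_interval_1 by blast
qed

lemma rotation_set_diam: "x \<in> rotation_set \<Phi> T \<Longrightarrow> y \<in> rotation_set \<Phi> T \<Longrightarrow> \<bar>x - y\<bar> < 1 / 2"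
  using variation_diff unfolding rotation_set_def by auto

end

section \<open>The Conley-Zehnder index of an interval\<close>

lemma no_int_between:
  assumes "of_int k < (of_int l :: real)" "of_int l < (of_int k :: real) + 1"
  shows False
proof -
  have "k < l" "l < k + 1"
    using assms of_int_less_iff[of l "k + 1", where 'a = real] by simp_all
  thus False by linarith
qed

text \<open>This justifies the definite description in \<open>cz_of_set\<close>: an interval of
  length at most 1/2 fits exactly one of the two alternatives, and with a single k.\<close>

lemma cz_of_set_props:
  fixes I :: "real set"
  assumes I: "is_interval I" "I \<noteq> {}" and diam: "\<And>x y. x \<in> I \<Longrightarrow> y \<in> I \<Longrightarrow> \<bar>x - y\<bar> < 1 / 2"
  obtains k :: int where "cz_of_set I = 2 * k" "\<forall>\<^sub>F \<epsilon> in at_right 0. of_int k + \<epsilon> \<in> I"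
  | k :: int where "cz_of_set I = 2 * k + 1" "\<forall>\<^sub>F \<epsilon> in at_right 0. \<forall>x\<in>I. of_int k < x - \<epsilon> \<and> x - \<epsilon> < of_int k + 1"
proof -
  define E where "E k \<longleftrightarrow> (\<forall>\<^sub>F \<epsilon> in at_right 0. of_int k + \<epsilon> \<in> I)" for k :: int
  define O' where "O' k \<longleftrightarrow> (\<forall>\<^sub>F \<epsilon> in at_right 0. \<forall>x\<in>I. of_int k < x - \<epsilon> \<and> x - \<epsilon> < of_int k + 1)" for k :: int
  have E_iff: "E k \<longleftrightarrow> (\<forall>\<^sub>F \<epsilon> in at_right 0. of_int k \<in> (\<lambda>x. x - \<epsilon>) ` I)" for k
  proof -
    have "of_int k + \<epsilon> \<in> I \<longleftrightarrow> of_int k \<in> (\<lambda>x. x - \<epsilon>) ` I" for \<epsilon>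
      by (auto simp: image_iff) (metis add_diff_cancel)
    thus ?thesis unfolding E_def by simp
  qed
  have O_iff: "O' k \<longleftrightarrow> (\<forall>\<^sub>F \<epsilon> in at_right 0. (\<lambda>x. x - \<epsilon>) ` I \<subseteq> {of_int k<..<of_int k + 1})" for k
  proof -
    have "(\<forall>x\<in>I. of_int k < x - \<epsilon> \<and> x - \<epsilon> < of_int k + 1) \<longleftrightarrow>
      (\<lambda>x. x - \<epsilon>) ` I \<subseteq> {of_int k<..<of_int k + 1}" for \<epsilon> by auto
    thus ?thesis unfolding O'_def by simp
  qed
  have mem: "y \<in> I" if "a \<in> I" "b \<in> I" "a \<le> y" "y \<le> b" for a b y
    using I(1) that unfolding is_interval_1 by blast
  have ex: "\<exists>\<epsilon>. P \<epsilon>" if "\<forall>\<^sub>F \<epsilon> in at_right (0::real). P \<epsilon>" for P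
    using eventually_happens[OF that] by (auto simp: trivial_limit_at_right_real)
  have EE: "k = k'" if "E k" "E k'" for k k'
  proof -
    from ex[OF eventually_conj[OF that[unfolded E_def]]] obtain \<epsilon>
      where "of_int k + \<epsilon> \<in> I" "of_int k' + \<epsilon> \<in> I" by auto
    from diam[OF this] have "real_of_int \<bar>k - k'\<bar> < 1" by simp
    hence "\<bar>k - k'\<bar> < 1" by linarith
    thus ?thesis by linarith
  qed
  have EO: False if "E k" "O' k'" for k k'
  proof -
    from ex[OF eventually_conj[OF that[unfolded E_def O'_def]]] obtain \<epsilon>
      where "of_int k + \<epsilon> \<in> I" "\<forall>x\<in>I. of_int k' < x - \<epsilon> \<and> x - \<epsilon> < of_int k' + 1" by auto
    hence "of_int k' < (of_int k :: real)" "of_int k < (of_int k' + 1 :: real)" by force+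
    thus False by (rule no_int_between)
  qed
  have OO: "k = k'" if "O' k" "O' k'" for k k'
  proof -
    obtain x where x: "x \<in> I" using I(2) by auto
    from ex[OF eventually_conj[OF that[unfolded O'_def]]] obtain \<epsilon>
      where "of_int k < x - \<epsilon> \<and> x - \<epsilon> < of_int k + 1" "of_int k' < x - \<epsilon> \<and> x - \<epsilon> < of_int k' + 1"
      using x by blast
    hence "of_int k < (of_int k' :: real) + 1" "of_int k' < (of_int k :: real) + 1" by linarith+
    hence "k < k' + 1" "k' < k + 1"
      using of_int_less_iff[of k "k' + 1", where 'a = real] of_int_less_iff[of k' "k + 1", where 'a = real] by simp_all
    thus ?thesis by linarith
  qed
  have EorO: "(\<exists>k. E k) \<or> (\<exists>k. O' k)"
  \<comment> \<open>If an integer has a point of I at or below it and another point of I above it,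
    its right neighbours lie in I: the even alternative.\<close>
  proof (cases "\<exists>k::int. \<exists>x\<in>I. \<exists>y\<in>I. x \<le> of_int k \<and> of_int k < y")
    case True
    then obtain k :: int and x y where xy: "x \<in> I" "y \<in> I" "x \<le> of_int k" "of_int k < y" by auto
    have "\<forall>\<^sub>F \<epsilon> in at_right 0. \<epsilon> < y - of_int k"
      by (rule eventually_at_rightI[of 0 "y - of_int k"]) (use xy in auto)
    moreover have "\<forall>\<^sub>F \<epsilon> in at_right (0::real). \<epsilon> > 0" by (simp add: eventually_at_right_less)
    ultimately have "\<forall>\<^sub>F \<epsilon> in at_right 0. of_int k + \<epsilon> \<in> I"
      by eventually_elim (rule mem[OF xy(1,2)], use xy in auto)
    thus ?thesis unfolding E_def by blast
  next
    case no: False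
    obtain x0 where x0: "x0 \<in> I" using I(2) by auto
    \<comment> \<open>Otherwise I lies in (k, k + 1]. The right end is included because the shift by
      \<epsilon> moves an integer end point inside. If I comes arbitrarily close to k the index is
      even, and if it keeps a distance the index is odd.\<close>
    define k where "k = \<lceil>x0\<rceil> - 1"
    have k: "of_int k < x0" "x0 \<le> of_int k + 1" unfolding k_def by linarith+
    have no': "\<not> (x \<le> of_int j \<and> of_int j < y)" if "x \<in> I" "y \<in> I" for x y and j :: int
      using no that by blast
    have rng: "of_int k < y" "y \<le> of_int k + 1" if "y \<in> I" for y
      using no'[OF that x0, of k] no'[OF x0 that, of "k + 1"] k by auto
    show ?thesis
    proof (cases "\<exists>\<delta>>0. \<forall>y\<in>I. of_int k + \<delta> \<le> y")
      case True
      then obtain \<delta> where \<delta>: "\<delta> > 0" "\<And>y. y \<in> I \<Longrightarrow> of_int k + \<delta> \<le> y" by auto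
      have "\<forall>\<^sub>F \<epsilon> in at_right 0. \<epsilon> < \<delta>"
        by (rule eventually_at_rightI[of 0 \<delta>]) (use \<delta> in auto)
      moreover have "\<forall>\<^sub>F \<epsilon> in at_right (0::real). \<epsilon> > 0" by (simp add: eventually_at_right_less)
      ultimately have "O' k" unfolding O'_def
        by eventually_elim (use \<delta>(2) rng(2) in \<open>force\<close>)
      thus ?thesis by blast
    next
      case False
      have "\<forall>\<^sub>F \<epsilon> in at_right 0. \<epsilon> < x0 - of_int k"
        by (rule eventually_at_rightI[of 0 "x0 - of_int k"]) (use k in auto)
      moreover have "\<forall>\<^sub>F \<epsilon> in at_right (0::real). \<epsilon> > 0" by (simp add: eventually_at_right_less)
      ultimately have "E k" unfolding E_def
      proof eventually_elim
        case (elim \<epsilon>)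
        with False obtain y where "y \<in> I" "y < of_int k + \<epsilon>" by force
        thus ?case using mem[of y x0 "of_int k + \<epsilon>"] x0 elim by simp
      qed
      thus ?thesis by blast
    qed
  qed
  have cz: "cz_of_set I = (THE n. (\<exists>k. n = 2 * k \<and> E k) \<or> (\<exists>k. n = 2 * k + 1 \<and> O' k))"
    unfolding cz_of_set_def E_iff O_iff ..
  from EorO show thesis
  proof (elim disjE exE)
    fix k assume k: "E k"
    hence "cz_of_set I = 2 * k" unfolding cz using EE EO by (intro the_equality) blast+
    thus thesis using k that(1) unfolding E_def by blast
  next
    fix k assume k: "O' k"
    hence "cz_of_set I = 2 * k + 1" unfolding cz using OO EO by (intro the_equality) blast+
    thus thesis using k that(2) unfolding O'_def by blast
  qed
qed

text \<open>The shift by \<epsilon> < 1 may cost one integer, so that in the odd case only k \<ge> N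
  is certain; 2 * k + 1 still exceeds N.\<close>

lemma cz_of_set_gt:
  fixes I :: "real set"
  assumes I: "is_interval I" "I \<noteq> {}" and diam: "\<And>x y. x \<in> I \<Longrightarrow> y \<in> I \<Longrightarrow> \<bar>x - y\<bar> < 1 / 2"
    and gt: "\<And>x. x \<in> I \<Longrightarrow> x > real N + 1"
  shows "cz_of_set I > int N"
proof -
  have ex: "\<exists>\<epsilon>. 0 < \<epsilon> \<and> \<epsilon> < 1 \<and> P \<epsilon>" if "\<forall>\<^sub>F \<epsilon> in at_right (0::real). P \<epsilon>" for P
  proof -
    have "\<forall>\<^sub>F \<epsilon> in at_right (0::real). 0 < \<epsilon> \<and> \<epsilon> < 1 \<and> P \<epsilon>"
      by (intro eventually_conj that eventually_at_right_less eventually_at_rightI[of 0 1]) auto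
    from eventually_happens[OF this] show ?thesis by (auto simp: trivial_limit_at_right_real)
  qed
  show ?thesis
  proof (rule cz_of_set_props[OF I])
    show "\<bar>x - y\<bar> < 1 / 2" if "x \<in> I" "y \<in> I" for x y using that by (rule diam)
  next
    fix k :: int
    assume 1: "cz_of_set I = 2 * k" "\<forall>\<^sub>F \<epsilon> in at_right 0. of_int k + \<epsilon> \<in> I"
    from ex[OF 1(2)] gt obtain \<epsilon> where "\<epsilon> < 1" "of_int k + \<epsilon> > real N + 1" by blast
    hence "k > int N" by linarith
    thus ?thesis using 1 by simp
  next
    fix k :: int
    assume 2: "cz_of_set I = 2 * k + 1"
      "\<forall>\<^sub>F \<epsilon> in at_right 0. \<forall>x\<in>I. of_int k < x - \<epsilon> \<and> x - \<epsilon> < of_int k + 1"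
    obtain x where x: "x \<in> I" using I(2) by auto
    from ex[OF 2(2)] x obtain \<epsilon> where "\<epsilon> < 1" "x - \<epsilon> < of_int k + 1" by blast
    hence "k \<ge> int N" using gt[OF x] by linarith
    thus ?thesis using 2 by simp
  qed
qed

lemma cz_of_set_eq_2:
  fixes I :: "real set"
  assumes I: "is_interval I" and diam: "\<And>x y. x \<in> I \<Longrightarrow> y \<in> I \<Longrightarrow> \<bar>x - y\<bar> < 1 / 2"
    and xy: "x \<in> I" "y \<in> I" "x < 1" "1 < y"
  shows "cz_of_set I = 2"
proof -
  have ne: "I \<noteq> {}" using xy by auto
  have small: "\<forall>\<^sub>F \<epsilon> in at_right (0::real). 0 < \<epsilon> \<and> \<epsilon> < y - 1 \<and> \<epsilon> < 1 / 2"
    using xy by (intro eventually_conj eventually_at_right_less eventually_at_rightI[of 0 "y - 1"]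
        eventually_at_rightI[of 0 "1 / 2"]) auto
  have ex: "\<exists>\<epsilon>. 0 < \<epsilon> \<and> \<epsilon> < y - 1 \<and> \<epsilon> < 1 / 2 \<and> P \<epsilon>" if "\<forall>\<^sub>F \<epsilon> in at_right (0::real). P \<epsilon>" for P
    using eventually_happens[OF eventually_conj[OF small that]] by (auto simp: trivial_limit_at_right_real)
  have mem: "1 + \<epsilon> \<in> I" if "0 < \<epsilon>" "\<epsilon> < y - 1" for \<epsilon>
  proof -
    have "x \<le> 1 + \<epsilon>" "1 + \<epsilon> \<le> y" using xy that by auto
    thus ?thesis using I xy(1,2) unfolding is_interval_1 by blast
  qed
  show ?thesis
  proof (rule cz_of_set_props[OF I ne])
    show "\<bar>x - y\<bar> < 1 / 2" if "x \<in> I" "y \<in> I" for x y using that by (rule diam)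
  next
    fix k :: int
    assume 1: "cz_of_set I = 2 * k" "\<forall>\<^sub>F \<epsilon> in at_right 0. of_int k + \<epsilon> \<in> I"
    from ex[OF 1(2)] obtain \<epsilon> where \<epsilon>: "0 < \<epsilon>" "\<epsilon> < y - 1" "of_int k + \<epsilon> \<in> I" by blast
    from diam[OF \<epsilon>(3) mem[OF \<epsilon>(1,2)]] have "real_of_int \<bar>k - 1\<bar> < 1" by simp
    hence "\<bar>k - 1\<bar> < 1" by linarith
    hence "k = 1" by linarith
    thus ?thesis using 1 by simp
  next
    fix k :: int
    assume 2: "cz_of_set I = 2 * k + 1"
      "\<forall>\<^sub>F \<epsilon> in at_right 0. \<forall>x\<in>I. of_int k < x - \<epsilon> \<and> x - \<epsilon> < of_int k + 1"
    from ex[OF 2(2)] obtain \<epsilon> where \<epsilon>: "0 < \<epsilon>" "\<epsilon> < y - 1"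
      "\<forall>x\<in>I. of_int k < x - \<epsilon> \<and> x - \<epsilon> < of_int k + 1" by blast
    from bspec[OF \<epsilon>(3) mem[OF \<epsilon>(1,2)]] have "of_int k < (1::real)" "(1::real) < of_int k + 1" by auto
    hence False using no_int_between[of k 1] by simp
    thus ?thesis ..
  qed
qed

section \<open>Hyperbolicity from a sign change of a quadratic form\<close>

lemma sign_change_discriminant:
  fixes p q r :: real
  assumes "p * x1\<^sup>2 + q * x1 * x2 + r * x2\<^sup>2 > 0" "p * y1\<^sup>2 + q * y1 * y2 + r * y2\<^sup>2 < 0"
  shows "q\<^sup>2 - 4 * p * r > 0"
proof (rule ccontr)
  assume "\<not> ?thesis"
  hence D: "q\<^sup>2 - 4 * p * r \<le> 0" by simp
  have sq: "4 * p * (p * x1\<^sup>2 + q * x1 * x2 + r * x2\<^sup>2) = (2 * p * x1 + q * x2)\<^sup>2 - (q\<^sup>2 - 4 * p * r) * x2\<^sup>2" for x1 x2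
    by (simp add: power2_eq_square algebra_simps)
  have nn: "p * (p * x1\<^sup>2 + q * x1 * x2 + r * x2\<^sup>2) \<ge> 0" for x1 x2
  proof -
    have "(q\<^sup>2 - 4 * p * r) * x2\<^sup>2 \<le> 0" using D by (simp add: mult_nonpos_nonneg)
    hence "4 * (p * (p * x1\<^sup>2 + q * x1 * x2 + r * x2\<^sup>2)) \<ge> 0"
      unfolding mult.assoc[symmetric] sq using zero_le_power2[of "2 * p * x1 + q * x2"] by linarith
    thus ?thesis by simp
  qed
  have "p \<ge> 0" using nn[of x1 x2] assms(1) by (simp add: zero_le_mult_iff)
  moreover have "p \<le> 0" using nn[of y1 y2] assms(2) by (auto simp: zero_le_mult_iff)
  ultimately have "p = 0" by simp
  hence "q = 0" using D by simp
  thus False using assms \<open>p = 0\<close> by (simp add: zero_less_mult_iff mult_less_0_iff)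
qed

text \<open>The cross product of w and M w is a quadratic form in w with discriminant tr(M)^2 - 4
  det(M). If it takes both signs, then |tr M| > 2, whereas an eigenvalue on the unit circle would
  give tr M = 2 Re ev.\<close>

lemma sign_change_eigenvalue:
  fixes M :: "real^2^2"
  assumes det: "det M = 1" and "cross2 w (M *v w) > 0" "cross2 w' (M *v w') < 0"
    and ev: "det ((\<chi> i j. of_real (M $ i $ j)) - mat ev :: complex^2^2) = 0"
  shows "cmod ev \<noteq> 1"
proof
  assume 1: "cmod ev = 1"
  have cr: "cross2 w (M *v w) = M$2$1 * (w$1)\<^sup>2 + (M$2$2 - M$1$1) * w$1 * w$2 + (- M$1$2) * (w$2)\<^sup>2" for w
    by (simp add: cross2_def matrix_vector_mult_def sum_2 algebra_simps power2_eq_square)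
  have D: "(M$2$2 - M$1$1)\<^sup>2 - 4 * M$2$1 * (- M$1$2) > 0"
    using assms(2,3) unfolding cr by (rule sign_change_discriminant)
  define tr where "tr = M$1$1 + M$2$2"
  have dM: "M$1$1 * M$2$2 - M$1$2 * M$2$1 = 1" using det by (simp add: det_2)
  have tr: "tr\<^sup>2 > 4"
  proof -
    have "tr\<^sup>2 - 4 * (M$1$1 * M$2$2 - M$1$2 * M$2$1) = (M$2$2 - M$1$1)\<^sup>2 - 4 * M$2$1 * (- M$1$2)"
      unfolding tr_def by (simp add: power2_eq_square algebra_simps)
    thus ?thesis using D dM by simp
  qed
  have "(of_real (M$1$1) - ev) * (of_real (M$2$2) - ev) - of_real (M$1$2) * of_real (M$2$1) = 0"
    using ev by (simp add: det_2 mat_def)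
  hence "ev\<^sup>2 - of_real tr * ev + of_real (M$1$1 * M$2$2 - M$1$2 * M$2$1) = 0"
    unfolding tr_def by (simp add: power2_eq_square algebra_simps)
  hence q: "ev * ev - of_real tr * ev + 1 = 0" by (simp add: dM power2_eq_square)
  have c: "ev * cnj ev = 1" using 1 by (simp add: complex_mult_cnj cmod_def flip: of_real_add)
  have "ev * (ev + cnj ev - of_real tr) = 0" using q c by (simp add: algebra_simps)
  hence "ev + cnj ev = of_real tr" using 1 by auto
  hence "2 * Re ev = tr" by (metis complex_add_cnj of_real_eq_iff)
  hence "\<bar>tr\<bar> \<le> 2" using abs_Re_le_cmod[of ev] 1 by simp
  hence "tr\<^sup>2 \<le> 2\<^sup>2" using abs_le_square_iff[of tr 2] by simp
  thus False using tr by simp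
qed

section \<open>Magnetic Hamiltonians with two degrees of freedom\<close>

definition cy1 :: "phase \<Rightarrow> real" where "cy1 z = fst z"
definition cy2 :: "phase \<Rightarrow> real" where "cy2 z = fst (snd z)"
definition cx1 :: "phase \<Rightarrow> real" where "cx1 z = fst (snd (snd z))"
definition cx2 :: "phase \<Rightarrow> real" where "cx2 z = snd (snd (snd z))"

lemmas comp_defs = cy1_def cy2_def cx1_def cx2_def

lemma comp_simps [simp]:
  "cy1 (a, b, c, d) = a" "cy2 (a, b, c, d) = b" "cx1 (a, b, c, d) = c" "cx2 (a, b, c, d) = d"
  by (simp_all add: comp_defs)

lemma phase_eqI: "cy1 z = cy1 w \<Longrightarrow> cy2 z = cy2 w \<Longrightarrow> cx1 z = cx1 w \<Longrightarrow> cx2 z = cx2 w \<Longrightarrow> z = w"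
  by (simp add: comp_defs prod_eq_iff)

lemma comp_linear [simp]:
  "cy1 (z + w) = cy1 z + cy1 w" "cy2 (z + w) = cy2 z + cy2 w" "cx1 (z + w) = cx1 z + cx1 w" "cx2 (z + w) = cx2 z + cx2 w"
  "cy1 (z - w) = cy1 z - cy1 w" "cy2 (z - w) = cy2 z - cy2 w" "cx1 (z - w) = cx1 z - cx1 w" "cx2 (z - w) = cx2 z - cx2 w"
  "cy1 (c *\<^sub>R z) = c * cy1 z" "cy2 (c *\<^sub>R z) = c * cy2 z" "cx1 (c *\<^sub>R z) = c * cx1 z" "cx2 (c *\<^sub>R z) = c * cx2 z"
  "cy1 (- z) = - cy1 z" "cy2 (- z) = - cy2 z" "cx1 (- z) = - cx1 z" "cx2 (- z) = - cx2 z"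
  "cy1 0 = 0" "cy2 0 = 0" "cx1 0 = 0" "cx2 0 = 0"
  by (simp_all add: comp_defs)

lemma inner_phase: "z \<bullet> w = cy1 z * cy1 w + cy2 z * cy2 w + cx1 z * cx1 w + cx2 z * cx2 w"
  by (simp add: comp_defs inner_prod_def)

lemma norm_phase: "(norm z)\<^sup>2 = (cy1 z)\<^sup>2 + (cy2 z)\<^sup>2 + (cx1 z)\<^sup>2 + (cx2 z)\<^sup>2" for z :: phase
  unfolding power2_norm_eq_inner inner_phase by (simp add: power2_eq_square)

lemma bounded_linear_comp:
  "bounded_linear cy1" "bounded_linear cy2" "bounded_linear cx1" "bounded_linear cx2"
  unfolding comp_defs[abs_def]
  by (intro bounded_linear_intros)+

lemmas comp_has_derivative [derivative_intros] = bounded_linear_comp[THEN bounded_linear.has_derivative]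
lemmas comp_continuous_on [continuous_intros] = bounded_linear_comp[THEN bounded_linear.continuous_on]
lemmas comp_has_vector_derivative = bounded_linear_comp[THEN bounded_linear.has_vector_derivative]

lemma comp_DERIV:
  assumes "(z has_vector_derivative z') (at t)"
  shows "((\<lambda>t. cy1 (z t)) has_real_derivative cy1 z') (at t)"
    "((\<lambda>t. cy2 (z t)) has_real_derivative cy2 z') (at t)"
    "((\<lambda>t. cx1 (z t)) has_real_derivative cx1 z') (at t)"
    "((\<lambda>t. cx2 (z t)) has_real_derivative cx2 z') (at t)"
  unfolding has_real_derivative_iff_has_vector_derivative by (intro comp_has_vector_derivative assms)+

lemma norm_comp_le: "\<bar>cy1 z\<bar> \<le> norm z" "\<bar>cy2 z\<bar> \<le> norm z" "\<bar>cx1 z\<bar> \<le> norm z" "\<bar>cx2 z\<bar> \<le> norm z"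
proof -
  have "(cy1 z)\<^sup>2 \<le> (norm z)\<^sup>2" "(cy2 z)\<^sup>2 \<le> (norm z)\<^sup>2" "(cx1 z)\<^sup>2 \<le> (norm z)\<^sup>2" "(cx2 z)\<^sup>2 \<le> (norm z)\<^sup>2"
    unfolding norm_phase by simp_all
  thus "\<bar>cy1 z\<bar> \<le> norm z" "\<bar>cy2 z\<bar> \<le> norm z" "\<bar>cx1 z\<bar> \<le> norm z" "\<bar>cx2 z\<bar> \<le> norm z"
    by (metis abs_le_square_iff abs_norm_cancel)+
qed

lemma norm_le_comp: "norm z \<le> \<bar>cy1 z\<bar> + \<bar>cy2 z\<bar> + \<bar>cx1 z\<bar> + \<bar>cx2 z\<bar>"
proof -
  have "(norm z)\<^sup>2 \<le> (\<bar>cy1 z\<bar> + \<bar>cy2 z\<bar> + \<bar>cx1 z\<bar> + \<bar>cx2 z\<bar>)\<^sup>2"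
  proof -
    have "0 \<le> 2 * (\<bar>cy1 z\<bar> * \<bar>cy2 z\<bar>) + 2 * (\<bar>cy1 z\<bar> * \<bar>cx1 z\<bar>) + 2 * (\<bar>cy1 z\<bar> * \<bar>cx2 z\<bar>) +
      2 * (\<bar>cy2 z\<bar> * \<bar>cx1 z\<bar>) + 2 * (\<bar>cy2 z\<bar> * \<bar>cx2 z\<bar>) + 2 * (\<bar>cx1 z\<bar> * \<bar>cx2 z\<bar>)"
      by (intro add_nonneg_nonneg) auto
    also have "\<dots> = (\<bar>cy1 z\<bar> + \<bar>cy2 z\<bar> + \<bar>cx1 z\<bar> + \<bar>cx2 z\<bar>)\<^sup>2 -
        (\<bar>cy1 z\<bar>\<^sup>2 + \<bar>cy2 z\<bar>\<^sup>2 + \<bar>cx1 z\<bar>\<^sup>2 + \<bar>cx2 z\<bar>\<^sup>2)"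
      by algebra
    finally show ?thesis unfolding norm_phase by simp
  qed
  thus ?thesis by (rule power2_le_imp_le) auto
qed

text \<open>The symplectic form dy1 \<and> dx1 + dy2 \<and> dx2.\<close>

definition om :: "phase \<Rightarrow> phase \<Rightarrow> real" where
  "om v w = cy1 v * cx1 w - cx1 v * cy1 w + cy2 v * cx2 w - cx2 v * cy2 w"

text \<open>The Hamiltonian is |P|^2 / 2 + V with kinetic momenta P1 = y1 + A1 (x2) and P2 = y2 + A2
  (x1), which is the shape of \<open>H_hat\<close>. The locale keeps the linear algebra of the
  linearized flow apart from the concrete potential.\<close>

locale magnetic =
  fixes A1 A1' A1'' A2 A2' A2'' :: "real \<Rightarrow> real"
    and V V1 V2 V11 V12 V22 :: "real \<times> real \<Rightarrow> real"
  assumes A1: "\<And>s. (A1 has_real_derivative A1' s) (at s)" "\<And>s. (A1' has_real_derivative A1'' s) (at s)"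
    and A2: "\<And>s. (A2 has_real_derivative A2' s) (at s)" "\<And>s. (A2' has_real_derivative A2'' s) (at s)"
    and Ac: "continuous_on UNIV A1''" "continuous_on UNIV A2''"
    and V: "\<And>x. (V has_derivative (\<lambda>h. V1 x * fst h + V2 x * snd h)) (at x)"
    and V1: "\<And>x. (V1 has_derivative (\<lambda>h. V11 x * fst h + V12 x * snd h)) (at x)"
    and V2: "\<And>x. (V2 has_derivative (\<lambda>h. V12 x * fst h + V22 x * snd h)) (at x)"
    and Vc: "continuous_on UNIV V11" "continuous_on UNIV V12" "continuous_on UNIV V22"
begin

definition P1 where "P1 z = cy1 z + A1 (cx2 z)"
definition P2 where "P2 z = cy2 z + A2 (cx1 z)"
definition G1 where "G1 z = P2 z * A2' (cx1 z) + V1 (cx1 z, cx2 z)"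
definition G2 where "G2 z = P1 z * A1' (cx2 z) + V2 (cx1 z, cx2 z)"
definition H11 where "H11 z = (A2' (cx1 z))\<^sup>2 + P2 z * A2'' (cx1 z) + V11 (cx1 z, cx2 z)"
definition H22 where "H22 z = (A1' (cx2 z))\<^sup>2 + P1 z * A1'' (cx2 z) + V22 (cx1 z, cx2 z)"
definition H12 where "H12 z = V12 (cx1 z, cx2 z)"
definition F :: "phase \<Rightarrow> real" where "F z = (P1 z)\<^sup>2 / 2 + (P2 z)\<^sup>2 / 2 + V (cx1 z, cx2 z)"
definition gradF :: "phase \<Rightarrow> phase" where "gradF z = (P1 z, P2 z, G1 z, G2 z)"
definition XF :: "phase \<Rightarrow> phase" where "XF z = (- G1 z, - G2 z, P1 z, P2 z)"
definition DX :: "phase \<Rightarrow> phase \<Rightarrow> phase" where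
  "DX z v = (- (H11 z * cx1 v + H12 z * cx2 v + A2' (cx1 z) * cy2 v),
    - (H12 z * cx1 v + H22 z * cx2 v + A1' (cx2 z) * cy1 v),
    cy1 v + A1' (cx2 z) * cx2 v, cy2 v + A2' (cx1 z) * cx1 v)"

lemma A_chain [derivative_intros]:
  assumes "(g has_derivative g') (at z)"
  shows "((\<lambda>z. A1 (g z)) has_derivative (\<lambda>h. A1' (g z) * g' h)) (at z)"
    "((\<lambda>z. A2 (g z)) has_derivative (\<lambda>h. A2' (g z) * g' h)) (at z)"
    "((\<lambda>z. A1' (g z)) has_derivative (\<lambda>h. A1'' (g z) * g' h)) (at z)"
    "((\<lambda>z. A2' (g z)) has_derivative (\<lambda>h. A2'' (g z) * g' h)) (at z)"
  using A1 A2 assms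
  by (auto intro!: has_derivative_compose[of g g' z UNIV, simplified] simp: has_field_derivative_def)

lemma V_chain [derivative_intros]:
  assumes "(g has_derivative g') (at z)" "(k has_derivative k') (at z)"
  shows "((\<lambda>z. V (g z, k z)) has_derivative (\<lambda>h. V1 (g z, k z) * g' h + V2 (g z, k z) * k' h)) (at z)"
    "((\<lambda>z. V1 (g z, k z)) has_derivative (\<lambda>h. V11 (g z, k z) * g' h + V12 (g z, k z) * k' h)) (at z)"
    "((\<lambda>z. V2 (g z, k z)) has_derivative (\<lambda>h. V12 (g z, k z) * g' h + V22 (g z, k z) * k' h)) (at z)"
  using has_derivative_compose[OF has_derivative_Pair[OF assms] V]
    has_derivative_compose[OF has_derivative_Pair[OF assms] V1]
    has_derivative_compose[OF has_derivative_Pair[OF assms] V2] by simp_all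

lemma F_has_derivative: "(F has_derivative (\<lambda>h. h \<bullet> gradF z)) (at z)"
  unfolding F_def[abs_def] P1_def P2_def
  by (rule derivative_eq_intros has_derivative_ident refl | simp)+
    (auto simp: inner_phase gradF_def G1_def G2_def P1_def P2_def field_simps)

lemma gderiv_F: "GDERIV F z :> gradF z"
  unfolding gderiv_def by (rule F_has_derivative)

lemma grad_F: "grad F z = gradF z"
  unfolding grad_def
proof (rule the_equality)
  fix D assume "GDERIV F z :> D"
  from has_derivative_unique[OF this[unfolded gderiv_def] F_has_derivative]
  have "h \<bullet> D = h \<bullet> gradF z" for h by metis
  thus "D = gradF z" by (metis vector_eq_ldot)
qed (rule gderiv_F)

lemma ham_vf_F: "ham_vf F = XF"
  by (rule ext) (simp add: ham_vf_def grad_F gradF_def XF_def)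

lemma XF_has_derivative: "(XF has_derivative DX z) (at z)"
  unfolding XF_def[abs_def] G1_def G2_def P1_def P2_def
  by (rule derivative_eq_intros has_derivative_ident refl | simp)+
    (auto simp: DX_def H11_def H22_def H12_def P1_def P2_def algebra_simps power2_eq_square fun_eq_iff)

lemma frechet_XF: "frechet_derivative (ham_vf F) (at z) = DX z"
  unfolding ham_vf_F by (rule frechet_derivative_at[OF XF_has_derivative, symmetric])

end

section \<open>Monotonicity of the rotation at the vertical direction\<close>

lemma sin_pos_near:
  fixes x :: real
  assumes "sin x > 0" "-pi < x" "x < pi"
  shows "x > 0"
proof (rule ccontr)
  assume "\<not> x > 0"
  hence "sin (- x) \<ge> 0" using assms by (intro sin_ge_zero) auto
  thus False using assms by simp
qed

text \<open>
  In the application \<open>\<theta>\<close> is the argument of \<open>(a, b)\<close>, the coordinates of a solution of the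
  linearized flow in the quaternionic frame, and \<open>f\<close> vanishes when the solution is vertical modulo
  the flow direction. The predicates \<open>level0\<close> and \<open>level1\<close> say that \<open>\<theta>\<close> has passed the vertical
  direction at least zero times and once. They persist, and \<open>level0\<close> turns into \<open>level1\<close> at a zero of \<open>f\<close>.
\<close>

locale vertical_crossing =
  fixes a b f \<theta> \<rho> :: "real \<Rightarrow> real"
  assumes a: "\<And>t. a t = \<rho> t * cos (\<theta> t)" and b: "\<And>t. b t = \<rho> t * sin (\<theta> t)" and \<rho>: "\<And>t. \<rho> t > 0"
    and \<theta>: "\<And>t. isCont \<theta> t" and f': "\<And>t. (f has_real_derivative - b t) (at t)"
    and fa: "\<And>t. b t = 0 \<Longrightarrow> f t * a t \<ge> 0"
    and b': "\<And>t. b t = 0 \<Longrightarrow> f t = 0 \<Longrightarrow> (b has_real_derivative 2 * a t) (at t)"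
begin

definition level0 :: "real \<Rightarrow> bool" where "level0 t \<longleftrightarrow> \<theta> t \<ge> 0 \<or> (\<theta> t > - pi \<and> f t \<ge> 0)"
definition level1 :: "real \<Rightarrow> bool" where "level1 t \<longleftrightarrow> \<theta> t \<ge> pi \<or> (\<theta> t > 0 \<and> f t \<le> 0)"

lemma near:
  fixes g :: "real \<Rightarrow> real"
  assumes "isCont g s" "l < g s" "g s < (u::real)"
  shows "\<exists>\<epsilon>>0. \<forall>t. \<bar>t - s\<bar> < \<epsilon> \<longrightarrow> l < g t \<and> g t < u"
proof -
  have "\<forall>\<^sub>F t in at s. l < g t \<and> g t < u"
    using assms by (intro eventually_conj order_tendstoD[where f = g and y = "g s"]) (auto simp: isCont_def)
  then obtain \<epsilon> where "\<epsilon> > 0" "\<forall>t. t \<noteq> s \<and> dist t s < \<epsilon> \<longrightarrow> l < g t \<and> g t < u"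
    by (auto simp: eventually_at)
  with assms show ?thesis by (intro exI[of _ \<epsilon>]) (metis dist_real_def)
qed

lemma fcont: "isCont f s" using f' DERIV_isCont by blast

lemma f_zero_at_pi:
  assumes "\<theta> s = - pi" "f s \<ge> 0"
  shows "f s = 0" "b s = 0" "a s < 0"
proof -
  show bs: "b s = 0" and as: "a s < 0" using assms \<rho>[of s] by (simp_all add: a b)
  from fa[OF bs] as assms(2) show "f s = 0" by (simp add: zero_le_mult_iff)
qed

text \<open>The critical case is \<theta> = 0 with f = 0: there b' = 2 a > 0, so b becomes positive
  and \<theta> passes 0. For - pi < \<theta> < 0 the derivative - b of f is positive, so f cannot
  become negative.\<close>

lemma right_near:
  assumes "level0 s"
  shows "\<exists>\<epsilon>>0. \<forall>t. s < t \<and> t < s + \<epsilon> \<longrightarrow> level0 t"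
proof -
  consider "\<theta> s > 0" | "\<theta> s = 0" | "- pi < \<theta> s" "\<theta> s < 0" "f s \<ge> 0"
    using assms by (cases "\<theta> s" "0::real" rule: linorder_cases) (auto simp: level0_def)
  thus ?thesis
  proof cases
    case 1
    from near[OF \<theta> this, of "\<theta> s + 1"] obtain \<epsilon> where "\<epsilon> > 0" "\<forall>t. \<bar>t - s\<bar> < \<epsilon> \<longrightarrow> 0 < \<theta> t" by auto
    thus ?thesis by (intro exI[of _ \<epsilon>]) (auto simp: level0_def intro: less_imp_le)
  next
    case 2
    have bs: "b s = 0" and as: "a s > 0" using 2 \<rho>[of s] by (simp_all add: a b)
    have fs: "f s \<ge> 0" using fa[OF bs] as by (simp add: zero_le_mult_iff)
    from near[OF \<theta>, of "- pi" s pi] 2 obtain \<epsilon> where \<epsilon>: "\<epsilon> > 0" "\<forall>t. \<bar>t - s\<bar> < \<epsilon> \<longrightarrow> - pi < \<theta> t \<and> \<theta> t < pi" by auto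
    show ?thesis
    proof (cases "f s > 0")
      case True
      from near[OF fcont True, of "f s + 1"] obtain \<delta> where "\<delta> > 0" "\<forall>t. \<bar>t - s\<bar> < \<delta> \<longrightarrow> 0 < f t" by auto
      with \<epsilon> show ?thesis by (intro exI[of _ "min \<epsilon> \<delta>"]) (auto simp: level0_def intro: less_imp_le)
    next
      case False
      with fs have "(b has_real_derivative 2 * a s) (at s)" by (intro b' bs) simp
      from DERIV_pos_inc_right[OF this] as obtain \<delta> where \<delta>: "\<delta> > 0" "\<forall>h>0. h < \<delta> \<longrightarrow> b s < b (s + h)" by auto
      have "level0 t" if t: "s < t" "t < s + min \<epsilon> \<delta>" for t
      proof -
        have "b t > 0" using \<delta>(2)[rule_format, of "t - s"] t bs by simp
        hence sn: "sin (\<theta> t) > 0" using \<rho>[of t] by (simp add: b zero_less_mult_iff)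
        have "\<theta> t > 0" by (rule sin_pos_near[OF sn]) (use \<epsilon>(2)[rule_format, of t] t in auto)
        thus ?thesis by (simp add: level0_def)
      qed
      thus ?thesis using \<epsilon>(1) \<delta>(1) by (intro exI[of _ "min \<epsilon> \<delta>"]) auto
    qed
  next
    case 3
    from near[OF \<theta> 3(1,2)] obtain \<epsilon> where \<epsilon>: "\<epsilon> > 0" "\<forall>t. \<bar>t - s\<bar> < \<epsilon> \<longrightarrow> - pi < \<theta> t \<and> \<theta> t < 0" by auto
    obtain \<delta> where \<delta>: "\<delta> > 0" "\<forall>t. s < t \<and> t < s + \<delta> \<longrightarrow> f t > 0"
    proof (cases "f s > 0")
      case True
      from near[OF fcont True, of "f s + 1"] obtain \<delta> where "\<delta> > 0" "\<forall>t. \<bar>t - s\<bar> < \<delta> \<longrightarrow> 0 < f t" by auto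
      thus ?thesis by (intro that[of \<delta>]) auto
    next
      case False
      have "sin (- \<theta> s) > 0" using 3 by (intro sin_gt_zero) auto
      hence "- b s > 0" using \<rho>[of s] by (simp add: b mult_less_0_iff)
      from DERIV_pos_inc_right[OF f' this] obtain \<delta> where \<delta>: "\<delta> > 0" "\<forall>h>0. h < \<delta> \<longrightarrow> f s < f (s + h)" by auto
      show ?thesis
      proof (rule that[OF \<delta>(1)], intro allI impI)
        fix t assume "s < t \<and> t < s + \<delta>"
        thus "f t > 0" using \<delta>(2)[rule_format, of "t - s"] 3 by simp
      qed
    qed
    with \<epsilon> show ?thesis by (intro exI[of _ "min \<epsilon> \<delta>"]) (auto simp: level0_def intro: less_imp_le)
  qed
qed

text \<open>The boundary case is \<theta> = - pi with f \<ge> 0: there a < 0 and \<open>fa\<close>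
  force f = 0, and then b' = 2 a < 0 shows that \<theta> was below - pi just before.\<close>

lemma left_near:
  assumes "\<not> level0 s"
  shows "\<exists>\<epsilon>>0. \<forall>t. s - \<epsilon> < t \<and> t < s \<longrightarrow> \<not> level0 t"
proof -
  consider "\<theta> s < 0" "f s < 0" | "\<theta> s < - pi" | "\<theta> s = - pi" "f s \<ge> 0"
    using assms by (force simp: level0_def)
  thus ?thesis
  proof cases
    case 1
    from near[OF \<theta> _ 1(1), of "\<theta> s - 1"] obtain \<epsilon> where \<epsilon>: "\<epsilon> > 0" "\<forall>t. \<bar>t - s\<bar> < \<epsilon> \<longrightarrow> \<theta> t < 0" by auto
    from near[OF fcont _ 1(2), of "f s - 1"] obtain \<delta> where "\<delta> > 0" "\<forall>t. \<bar>t - s\<bar> < \<delta> \<longrightarrow> f t < 0" by auto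
    with \<epsilon> show ?thesis by (intro exI[of _ "min \<epsilon> \<delta>"]) (auto simp: level0_def not_le)
  next
    case 2
    from near[OF \<theta> _ 2, of "\<theta> s - 1"] obtain \<epsilon> where \<epsilon>: "\<epsilon> > 0" "\<forall>t. \<bar>t - s\<bar> < \<epsilon> \<longrightarrow> \<theta> t < - pi" by auto
    have "\<not> level0 t" if "\<bar>t - s\<bar> < \<epsilon>" for t
      using \<epsilon>(2)[rule_format, OF that] pi_gt_zero unfolding level0_def by linarith
    with \<epsilon> show ?thesis by (intro exI[of _ \<epsilon>]) auto
  next
    case 3
    note fs = f_zero_at_pi[OF 3]
    have "2 * a s < 0" using fs by simp
    from DERIV_neg_dec_left[OF b'[OF fs(2,1)] this] obtain \<delta> where \<delta>: "\<delta> > 0" "\<forall>h>0. h < \<delta> \<longrightarrow> b s < b (s - h)" by auto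
    from near[OF \<theta>, of "- 2 * pi" s 0] 3 pi_gt_zero obtain \<epsilon> where
      \<epsilon>: "\<epsilon> > 0" "\<forall>t. \<bar>t - s\<bar> < \<epsilon> \<longrightarrow> - 2 * pi < \<theta> t \<and> \<theta> t < 0" by auto
    have "\<not> level0 t" if "s - min \<epsilon> \<delta> < t" "t < s" for t
    proof -
      have t: "s - \<epsilon> < t" "s - \<delta> < t" "t < s" using that by auto
      have "b t > 0" using \<delta>(2)[rule_format, of "s - t"] t fs by simp
      hence "sin (\<theta> t) > 0" using \<rho>[of t] by (simp add: b zero_less_mult_iff)
      hence sn: "sin (- pi - \<theta> t) > 0" by (simp add: sin_diff)
      have "- pi - \<theta> t > 0" by (rule sin_pos_near[OF sn]) (use \<epsilon>(2)[rule_format, of t] t in auto)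
      thus ?thesis using pi_gt_zero unfolding level0_def by linarith
    qed
    thus ?thesis using \<epsilon>(1) \<delta>(1) by (intro exI[of _ "min \<epsilon> \<delta>"]) auto
  qed
qed

text \<open>\<open>level0\<close> persists for a short time to the right and its failure for a short
  time to the left. So the supremum of the times with \<open>level0\<close> can neither have the
  property before t1 nor lack it.\<close>

lemma level0_forward:
  assumes "level0 t0" "t0 \<le> t1"
  shows "level0 t1"
proof (rule ccontr)
  assume n: "\<not> level0 t1"
  define S where "S = {t. t0 \<le> t \<and> t \<le> t1 \<and> level0 t}"
  define s where "s = Sup S"
  have S: "S \<noteq> {}" "bdd_above S" "t0 \<in> S" using assms by (auto simp: S_def)
  have s: "t0 \<le> s" "s \<le> t1" unfolding s_def
    by (rule cSup_upper[OF S(3,2)], rule cSup_least[OF S(1)], simp add: S_def)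
  have up: "t \<le> s" if "t \<in> S" for t unfolding s_def by (rule cSup_upper[OF that S(2)])
  show False
  proof (cases "level0 s")
    case True
    hence "s < t1" using n s by (cases "s = t1") auto
    from right_near[OF True] obtain \<epsilon> where \<epsilon>: "\<epsilon> > 0" "\<forall>t. s < t \<and> t < s + \<epsilon> \<longrightarrow> level0 t" by auto
    define t where "t = min t1 (s + \<epsilon> / 2)"
    have t: "s < t" "t < s + \<epsilon>" "t \<le> t1" using \<open>s < t1\<close> \<epsilon>(1) by (auto simp: t_def min_def)
    hence "t \<in> S" using \<epsilon>(2) s by (auto simp: S_def)
    thus False using up t by force
  next
    case False
    from left_near[OF this] obtain \<epsilon> where \<epsilon>: "\<epsilon> > 0" "\<forall>t. s - \<epsilon> < t \<and> t < s \<longrightarrow> \<not> level0 t" by auto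
    obtain t where "t \<in> S" "s - \<epsilon> < t" using less_cSupD[OF S(1), of "s - \<epsilon>"] \<epsilon>(1) by (auto simp: s_def)
    moreover have "t \<noteq> s" using calculation False by (auto simp: S_def)
    ultimately show False using \<epsilon>(2) up[of t] by (auto simp: S_def)
  qed
qed

text \<open>Passing to the negative solution lowers the argument by half a turn and turns
  \<open>level1\<close> into \<open>level0\<close>, so crossings can be counted by
  induction.\<close>

lemma shift: "vertical_crossing (\<lambda>t. - a t) (\<lambda>t. - b t) (\<lambda>t. - f t) (\<lambda>t. \<theta> t - pi) \<rho>"
proof
  fix t
  show "- a t = \<rho> t * cos (\<theta> t - pi)" "- b t = \<rho> t * sin (\<theta> t - pi)"
    by (simp_all add: a b cos_diff sin_diff)
  show "\<rho> t > 0" by (rule \<rho>)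
  show "isCont (\<lambda>t. \<theta> t - pi) t" by (intro continuous_intros \<theta>)
  show "((\<lambda>t. - f t) has_real_derivative - (- b t)) (at t)" by (rule DERIV_minus[OF f'])
  show "- b t = 0 \<Longrightarrow> 0 \<le> - f t * - a t" using fa[of t] by simp
  show "- b t = 0 \<Longrightarrow> - f t = 0 \<Longrightarrow> ((\<lambda>t. - b t) has_real_derivative 2 * - a t) (at t)"
    using DERIV_minus[OF b'[of t]] by simp
qed

lemma level1_shift: "vertical_crossing.level0 (\<lambda>t. - f t) (\<lambda>t. \<theta> t - pi) t \<longleftrightarrow> level1 t"
  unfolding vertical_crossing.level0_def[OF shift] level1_def by simp

lemma level1_forward: "level1 t0 \<Longrightarrow> t0 \<le> t1 \<Longrightarrow> level1 t1"
  using vertical_crossing.level0_forward[OF shift] unfolding level1_shift .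

text \<open>If \<theta> s < 0 at the zero s, then f is increasing there and was negative just
  before, contrary to \<open>level0\<close>; hence the strict inequality t0 < s. If \<theta> s = 0,
  then b > 0 and f < 0 just after s, which is \<open>level1\<close>.\<close>

lemma level_zero:
  assumes "level0 t0" "t0 < s" "s < t1" "f s = 0"
  shows "level1 t1"
proof -
  have l: "level0 t" if "t0 \<le> t" for t using level0_forward[OF assms(1) that] .
  have "level0 s" using l assms by simp
  then consider "\<theta> s > 0" | "\<theta> s = 0" | "- pi < \<theta> s" "\<theta> s < 0"
    by (cases "\<theta> s" "0::real" rule: linorder_cases) (auto simp: level0_def)
  thus ?thesis
  proof cases
    case 1
    hence "level1 s" using assms by (simp add: level1_def)
    thus ?thesis using level1_forward assms by simp
  next
    case 2
    have bs: "b s = 0" and as: "a s > 0" using 2 \<rho>[of s] by (simp_all add: a b)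
    from DERIV_pos_inc_right[OF b'[OF bs assms(4)]] as
    obtain \<delta> where \<delta>: "\<delta> > 0" "\<forall>h>0. h < \<delta> \<longrightarrow> b s < b (s + h)" by auto
    from near[OF \<theta>, of "- pi" s pi] 2 obtain \<epsilon> where \<epsilon>: "\<epsilon> > 0" "\<forall>t. \<bar>t - s\<bar> < \<epsilon> \<longrightarrow> - pi < \<theta> t \<and> \<theta> t < pi" by auto
    define t where "t = s + min (min \<epsilon> \<delta>) (t1 - s) / 2"
    have "min (min \<epsilon> \<delta>) (t1 - s) > 0" "min (min \<epsilon> \<delta>) (t1 - s) \<le> \<epsilon>" "min (min \<epsilon> \<delta>) (t1 - s) \<le> \<delta>"
      "min (min \<epsilon> \<delta>) (t1 - s) \<le> t1 - s" using \<epsilon>(1) \<delta>(1) assms by auto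
    hence t: "s < t" "t < s + \<epsilon>" "t < s + \<delta>" "t < t1" unfolding t_def by linarith+
    have bt: "b r > 0" if "s < r" "r \<le> t" for r using \<delta>(2)[rule_format, of "r - s"] that t bs by simp
    have sn: "sin (\<theta> t) > 0" using \<rho>[of t] bt[of t] t by (simp add: b zero_less_mult_iff)
    have "\<theta> t > 0" by (rule sin_pos_near[OF sn]) (use \<epsilon>(2)[rule_format, of t] t in auto)
    moreover have "f t < f s"
    proof (rule DERIV_neg_imp_decreasing_open[OF t(1)])
      show "\<exists>y. (f has_real_derivative y) (at x) \<and> y < 0" if "s < x" "x < t" for x
        using f'[of x] bt[of x] that by (intro exI[of _ "- b x"]) auto
      show "continuous_on {s..t} f" using fcont by (simp add: continuous_at_imp_continuous_on)
    qed
    ultimately have "level1 t" using assms by (simp add: level1_def)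
    thus ?thesis using level1_forward t by simp
  next
    case 3
    have "sin (- \<theta> s) > 0" using 3 by (intro sin_gt_zero) auto
    hence "- b s > 0" using \<rho>[of s] by (simp add: b mult_less_0_iff)
    from DERIV_pos_inc_left[OF f' this] obtain \<delta> where \<delta>: "\<delta> > 0" "\<forall>h>0. h < \<delta> \<longrightarrow> f (s - h) < f s" by auto
    from near[OF \<theta> _ 3(2), of "\<theta> s - 1"] obtain \<epsilon> where \<epsilon>: "\<epsilon> > 0" "\<forall>t. \<bar>t - s\<bar> < \<epsilon> \<longrightarrow> \<theta> t < 0" by auto
    define h where "h = min (min \<epsilon> \<delta>) (s - t0) / 2"
    have "min (min \<epsilon> \<delta>) (s - t0) > 0" "min (min \<epsilon> \<delta>) (s - t0) \<le> \<epsilon>" "min (min \<epsilon> \<delta>) (s - t0) \<le> \<delta>"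
      "min (min \<epsilon> \<delta>) (s - t0) \<le> s - t0" using \<epsilon>(1) \<delta>(1) assms by auto
    hence h: "h > 0" "h < \<epsilon>" "h < \<delta>" "h < s - t0" unfolding h_def by linarith+
    hence "f (s - h) < 0" "\<theta> (s - h) < 0" using \<delta>(2) \<epsilon>(2) assms by auto
    thus ?thesis using l[of "s - h"] h by (auto simp: level0_def)
  qed
qed

end

lemma crossing_count_level:
  assumes "d > 0"
  shows "vertical_crossing a b f \<theta> \<rho> \<Longrightarrow> vertical_crossing.level0 f \<theta> t0 \<Longrightarrow> t0 + 3 * d * real m \<le> t1 \<Longrightarrow>
    (\<And>t. t0 \<le> t \<Longrightarrow> t + d \<le> t0 + 3 * d * real m \<Longrightarrow> \<exists>s. t \<le> s \<and> s \<le> t + d \<and> f s = 0) \<Longrightarrow>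
    \<theta> t1 > (real m - 1) * pi"
proof (induction m arbitrary: a b f \<theta> t0)
  case 0
  interpret vertical_crossing a b f \<theta> \<rho> by fact
  have "level0 t1" using 0 by (auto intro: level0_forward[of t0 t1])
  hence "\<theta> t1 > - pi" using pi_gt_zero unfolding level0_def by linarith
  thus ?case by simp
next
  case (Suc m)
  interpret vertical_crossing a b f \<theta> \<rho> by fact
  have e: "3 * d * real (Suc m) = 3 * d + 3 * d * real m" by (simp add: algebra_simps)
  have nn: "3 * d * real m \<ge> 0" using \<open>d > 0\<close> by simp
  \<comment> \<open>The zero is taken from the middle third of a block of length 3 * d, so that it
    lies strictly inside the block as \<open>level_zero\<close> requires.\<close>
  obtain s where s: "t0 + d \<le> s" "s \<le> t0 + d + d" "f s = 0"
    using Suc.prems(4)[of "t0 + d"] nn \<open>d > 0\<close> unfolding e by auto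
  have "level1 (t0 + 3 * d)" using s \<open>d > 0\<close> Suc.prems by (intro level_zero[of t0 s]) auto
  hence l: "vertical_crossing.level0 (\<lambda>t. - f t) (\<lambda>t. \<theta> t - pi) (t0 + 3 * d)"
    unfolding level1_shift .
  have "(real m - 1) * pi < \<theta> t1 - pi"
  proof (rule Suc.IH[OF shift l])
    show "t0 + 3 * d + 3 * d * real m \<le> t1" using Suc.prems(3) unfolding e by simp
    fix t assume "t0 + 3 * d \<le> t" "t + d \<le> t0 + 3 * d + 3 * d * real m"
    thus "\<exists>s\<ge>t. s \<le> t + d \<and> - f s = 0" using Suc.prems(4)[of t] \<open>d > 0\<close> unfolding e by auto
  qed
  thus ?case by (simp add: algebra_simps)
qed

text \<open>Subtracting a multiple of 2 pi brings \<theta> t0 into [0, 2 pi), where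
  \<open>level0\<close> holds. This costs at most two half turns, hence m - 3 in place of m -
  1.\<close>

lemma crossing_count:
  assumes vc: "vertical_crossing a b f \<theta> \<rho>" and "d > 0"
    and zero: "\<And>t. t0 \<le> t \<Longrightarrow> t + d \<le> t0 + 3 * d * real m \<Longrightarrow> \<exists>s. t \<le> s \<and> s \<le> t + d \<and> f s = 0"
    and "t0 + 3 * d * real m \<le> t1"
  shows "\<theta> t1 - \<theta> t0 > (real m - 3) * pi"
proof -
  interpret vertical_crossing a b f \<theta> \<rho> by fact
  define k where "k = \<lfloor>\<theta> t0 / (2 * pi)\<rfloor>"
  have k: "0 \<le> \<theta> t0 - 2 * pi * of_int k" "\<theta> t0 - 2 * pi * of_int k < 2 * pi"
    unfolding k_def using floor_divide_lower[of "2 * pi" "\<theta> t0"] floor_divide_upper[of "2 * pi" "\<theta> t0"]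
    by (auto simp: algebra_simps)
  have vc': "vertical_crossing a b f (\<lambda>t. \<theta> t - 2 * pi * of_int k) \<rho>"
  proof
    fix t
    show "a t = \<rho> t * cos (\<theta> t - 2 * pi * of_int k)" "b t = \<rho> t * sin (\<theta> t - 2 * pi * of_int k)"
      unfolding sin_diff[of _ "2 * pi * of_int k"] cos_diff[of _ "2 * pi * of_int k"] by (simp_all add: a b)
    show "isCont (\<lambda>t. \<theta> t - 2 * pi * of_int k) t" by (intro continuous_intros \<theta>)
  qed (fact \<rho> f' fa b')+
  have "vertical_crossing.level0 f (\<lambda>t. \<theta> t - 2 * pi * of_int k) t0"
    using k unfolding vertical_crossing.level0_def[OF vc'] by simp
  from crossing_count_level[OF \<open>d > 0\<close> vc' this assms(4) zero] k show ?thesis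
    by (simp add: algebra_simps)
qed

section \<open>The linearized flow in the quaternionic frame\<close>

text \<open>If w is the velocity, \<open>fa2\<close> and \<open>fb2\<close> are the inner products
  with the two frame vectors times the norm of w, see \<open>frame_F\<close>. They are bilinear,
  which makes their derivatives polynomial. \<open>ff2\<close> is the determinant f.\<close>

definition fa2 :: "phase \<Rightarrow> phase \<Rightarrow> real" where
  "fa2 v w = cx1 v * cx2 w - cx2 v * cx1 w - (cy1 v * cy2 w - cy2 v * cy1 w)"
definition fb2 :: "phase \<Rightarrow> phase \<Rightarrow> real" where
  "fb2 v w = cy2 v * cx1 w - cx1 v * cy2 w - (cy1 v * cx2 w - cx2 v * cy1 w)"
definition ff2 :: "phase \<Rightarrow> phase \<Rightarrow> real" where
  "ff2 v w = cx1 v * cx2 w - cx2 v * cx1 w"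

text \<open>After normalization this says that the frame is symplectic on the tangent space of the
  level modulo the flow.\<close>

lemma frame_det:
  assumes "om v w = 0" "om v' w = 0"
  shows "fa2 v w * fb2 v' w - fb2 v w * fa2 v' w = (norm w)\<^sup>2 * om v v'"
  using assms unfolding norm_phase om_def fa2_def fb2_def by algebra

text \<open>So f is a linear form in (a, b) whose coefficient at a is never negative. At b = 0 this
  is the sign condition \<open>fa\<close> of \<open>vertical_crossing\<close>.\<close>

lemma frame_ff2:
  assumes "om v w = 0"
  shows "(norm w)\<^sup>2 * ff2 v w = ((cx1 w)\<^sup>2 + (cx2 w)\<^sup>2) * fa2 v w - (cy1 w * cx1 w + cy2 w * cx2 w) * fb2 v w"
  using assms unfolding norm_phase om_def fa2_def fb2_def ff2_def by algebra

context magnetic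
begin

lemma A_continuous [continuous_intros]:
  assumes "continuous_on S g"
  shows "continuous_on S (\<lambda>x. A1 (g x))" "continuous_on S (\<lambda>x. A1' (g x))" "continuous_on S (\<lambda>x. A1'' (g x))"
    "continuous_on S (\<lambda>x. A2 (g x))" "continuous_on S (\<lambda>x. A2' (g x))" "continuous_on S (\<lambda>x. A2'' (g x))"
proof -
  have "continuous_on UNIV A1" "continuous_on UNIV A1'" "continuous_on UNIV A2" "continuous_on UNIV A2'"
    using A1 A2 by (auto intro!: continuous_at_imp_continuous_on DERIV_isCont)
  thus "continuous_on S (\<lambda>x. A1 (g x))" "continuous_on S (\<lambda>x. A1' (g x))" "continuous_on S (\<lambda>x. A1'' (g x))"
    "continuous_on S (\<lambda>x. A2 (g x))" "continuous_on S (\<lambda>x. A2' (g x))" "continuous_on S (\<lambda>x. A2'' (g x))"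
    using continuous_on_compose2[OF _ assms subset_UNIV] Ac by blast+
qed

lemma V_continuous [continuous_intros]:
  assumes "continuous_on S g" "continuous_on S k"
  shows "continuous_on S (\<lambda>x. V11 (g x, k x))" "continuous_on S (\<lambda>x. V12 (g x, k x))" "continuous_on S (\<lambda>x. V22 (g x, k x))"
  using continuous_on_compose2[OF _ continuous_on_Pair[OF assms] subset_UNIV] Vc by blast+

lemma H_continuous [continuous_intros]:
  assumes "continuous_on S g"
  shows "continuous_on S (\<lambda>x. H11 (g x))" "continuous_on S (\<lambda>x. H12 (g x))" "continuous_on S (\<lambda>x. H22 (g x))"
  unfolding H11_def H12_def H22_def P1_def P2_def by (intro continuous_intros assms)+

lemma DX_continuous [continuous_intros]:
  assumes "continuous_on S g" "continuous_on S k"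
  shows "continuous_on S (\<lambda>x. DX (g x) (k x))"
  unfolding DX_def by (intro continuous_intros assms)

lemma DX_linear: "linear (DX z)"
  by (rule linearI) (auto intro!: phase_eqI simp: DX_def algebra_simps)

lemma om_DX: "om (DX z v) w + om v (DX z w) = 0"
  by (simp add: om_def DX_def algebra_simps)

lemma om_XF: "om v (XF z) = v \<bullet> gradF z"
  by (simp add: om_def XF_def gradF_def inner_phase algebra_simps)

lemma norm_XF: "norm (XF z) = norm (gradF z)"
  by (rule power2_eq_imp_eq) (simp_all add: norm_phase XF_def gradF_def)

lemma frame_F:
  "v \<bullet> frame1 F z = fa2 v (XF z) / norm (XF z)" "v \<bullet> frame2 F z = fb2 v (XF z) / norm (XF z)"
  unfolding frame1_def frame2_def grad_F norm_XF[symmetric]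
  by (simp_all add: gradF_def inner_phase fa2_def fb2_def XF_def algebra_simps add_divide_distrib diff_divide_distrib)

end

text \<open>The bound on \<open>DX\<close> comes from compactness for periodic orbits and from
  closeness to the linear model near a saddle-center. It makes the variational equation solvable for
  all times.\<close>

locale magnetic_orbit = magnetic +
  fixes \<gamma> :: "real \<Rightarrow> phase"
  assumes \<gamma>: "\<And>t. (\<gamma> has_vector_derivative XF (\<gamma> t)) (at t)"
    and nonconst: "\<exists>t. \<gamma> t \<noteq> \<gamma> 0"
    and bounded_DX: "\<exists>L\<ge>0. \<forall>t v. norm (DX (\<gamma> t) v) \<le> L * norm v"
begin

definition sol :: "(real \<Rightarrow> phase) \<Rightarrow> bool" where
  "sol v \<longleftrightarrow> (\<forall>t. (v has_vector_derivative DX (\<gamma> t) (v t)) (at t))"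

definition w where "w t = XF (\<gamma> t)"

lemma \<gamma>_continuous [continuous_intros]: "continuous_on S \<gamma>"
  using \<gamma> by (auto intro!: continuous_at_imp_continuous_on dest: has_vector_derivative_continuous)

lemma sol_continuous: "sol v \<Longrightarrow> continuous_on S v"
  unfolding sol_def by (auto intro!: continuous_at_imp_continuous_on dest: has_vector_derivative_continuous)

section \<open>Solutions of the variational equation\<close>

lemma sol_exists: "\<exists>v. v 0 = v0 \<and> sol v"
proof -
  obtain L where L: "\<And>t v. norm (DX (\<gamma> t) v) \<le> L * norm v" using bounded_DX by auto
  have "continuous_on UNIV (\<lambda>t. DX (\<gamma> t) (u t))" if "continuous_on UNIV u" for u
    by (intro continuous_intros that)
  from linear_ode_exists[OF DX_linear L this, of v0] show ?thesis unfolding sol_def by blast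
qed

lemma sol_linear: "sol u \<Longrightarrow> sol v \<Longrightarrow> sol (\<lambda>t. c *\<^sub>R u t + d *\<^sub>R v t)"
  unfolding sol_def
  by (auto intro!: derivative_eq_intros simp: linear_add[OF DX_linear] linear_cmul[OF DX_linear])

lemma sol_unique:
  assumes "sol u" "sol v" "u s = v s"
  shows "u = v"
proof
  fix t
  obtain L where L: "L \<ge> 0" "\<And>t v. norm (DX (\<gamma> t) v) \<le> L * norm v" using bounded_DX by auto
  have "sol (\<lambda>t. u t - v t)" using sol_linear[OF assms(1,2), of 1 "-1"] by simp
  from gronwall_unique[OF L(1) this[unfolded sol_def, rule_format] L(2), of s t] assms(3)
  show "u t = v t" by simp
qed

lemma lin_flow_eq:
  assumes "sol v" "v 0 = v0"
  shows "lin_flow F \<gamma> v0 = v"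
  unfolding lin_flow_def frechet_XF sol_def[symmetric]
proof (rule the_equality)
  show "v 0 = v0 \<and> sol v" using assms by blast
  fix u assume "u 0 = v0 \<and> sol u"
  with assms show "u = v" by (intro sol_unique[of u v 0]) simp_all
qed

lemma sol_w: "sol w"
  unfolding sol_def w_def[abs_def]
proof
  fix t
  show "((\<lambda>t. XF (\<gamma> t)) has_vector_derivative DX (\<gamma> t) (XF (\<gamma> t))) (at t)"
    using has_derivative_compose[OF \<gamma>[unfolded has_vector_derivative_def] XF_has_derivative]
    by (simp add: has_vector_derivative_def linear_cmul[OF DX_linear])
qed

lemma w_nz: "w t \<noteq> 0"
proof
  assume "w t = 0"
  have "sol (\<lambda>_. 0)" unfolding sol_def by (auto simp: linear_0[OF DX_linear])
  from sol_unique[OF sol_w this, of t] \<open>w t = 0\<close> have "w = (\<lambda>_. 0)" by simp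
  hence "(\<gamma> has_vector_derivative 0) (at s within UNIV)" for s using \<gamma>[of s] unfolding w_def by (metis)
  from has_vector_derivative_zero_constant[OF convex_UNIV this] nonconst show False by (metis UNIV_I)
qed

lemma om_const:
  assumes "sol u" "sol v"
  shows "om (u t) (v t) = om (u 0) (v 0)"
proof -
  have "((\<lambda>t. om (u t) (v t)) has_real_derivative 0) (at t)" for t
  proof -
    have u: "(u has_vector_derivative DX (\<gamma> t) (u t)) (at t)" and v: "(v has_vector_derivative DX (\<gamma> t) (v t)) (at t)"
      using assms by (auto simp: sol_def)
    have "((\<lambda>t. om (u t) (v t)) has_real_derivative om (DX (\<gamma> t) (u t)) (v t) + om (u t) (DX (\<gamma> t) (v t))) (at t)"
      unfolding om_def
      by (rule derivative_eq_intros comp_DERIV[OF u] comp_DERIV[OF v] refl)+ (simp add: algebra_simps)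
    thus ?thesis unfolding om_DX .
  qed
  thus ?thesis using DERIV_isconst_all[of "\<lambda>t. om (u t) (v t)" t 0] by blast
qed

section \<open>The projected flow as a path of planar matrices\<close>

abbreviation "\<Phi> \<equiv> transverse_flow F \<gamma>"

definition proj :: "(real \<Rightarrow> phase) \<Rightarrow> real \<Rightarrow> real^2" where
  "proj v t = vector [fa2 (v t) (w t) / norm (w t), fb2 (v t) (w t) / norm (w t)]"

lemma proj_lin: "proj (\<lambda>t. c *\<^sub>R u t + d *\<^sub>R v t) t = c *\<^sub>R proj u t + d *\<^sub>R proj v t"
  unfolding proj_def fa2_def fb2_def
  by (simp add: vec_eq_iff forall_2 algebra_simps add_divide_distrib diff_divide_distrib)

lemma proj_w: "proj w t = 0"
  by (simp add: proj_def fa2_def fb2_def vec_eq_iff forall_2)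

lemma cross2_proj:
  assumes "om (u t) (w t) = 0" "om (v t) (w t) = 0"
  shows "cross2 (proj u t) (proj v t) = om (u t) (v t)"
proof -
  have "cross2 (proj u t) (proj v t) =
    (fa2 (u t) (w t) * fb2 (v t) (w t) - fb2 (u t) (w t) * fa2 (v t) (w t)) / (norm (w t))\<^sup>2"
    unfolding proj_def cross2_def vector_2 using w_nz[of t] by (simp add: field_simps power2_eq_square)
  thus ?thesis unfolding frame_det[OF assms] using w_nz[of t] by simp
qed

definition frame_vec :: "real^2 \<Rightarrow> phase" where
  "frame_vec x = x $ 1 *\<^sub>R frame1 F (\<gamma> 0) + x $ 2 *\<^sub>R frame2 F (\<gamma> 0)"

lemma transverse_flow_proj:
  assumes v: "sol v" "v 0 = frame_vec x"
  shows "\<Phi> t *v x = proj v t"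
proof -
  have eq: "(\<lambda>x. let v = lin_flow F \<gamma> (x $ 1 *\<^sub>R frame1 F (\<gamma> 0) + x $ 2 *\<^sub>R frame2 F (\<gamma> 0)) t
     in vector [v \<bullet> frame1 F (\<gamma> t), v \<bullet> frame2 F (\<gamma> t)]) x = proj v t"
    if "sol v" "v 0 = frame_vec x" for v x
    using lin_flow_eq[OF that] by (simp add: frame_vec_def frame_F proj_def w_def Let_def)
  have "linear (\<lambda>x::real^2. let v = lin_flow F \<gamma> (x $ 1 *\<^sub>R frame1 F (\<gamma> 0) + x $ 2 *\<^sub>R frame2 F (\<gamma> 0)) t
     in vector [v \<bullet> frame1 F (\<gamma> t), v \<bullet> frame2 F (\<gamma> t)] :: real^2)" (is "linear ?f")
  proof (rule linearI)
    fix x y c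
    obtain u v where u: "sol u" "u 0 = frame_vec x" and v: "sol v" "v 0 = frame_vec y" using sol_exists by metis
    have "frame_vec (x + y) = frame_vec x + frame_vec y" "frame_vec (c *\<^sub>R x) = c *\<^sub>R frame_vec x"
      by (simp_all add: frame_vec_def algebra_simps)
    hence "(\<lambda>t. 1 *\<^sub>R u t + 1 *\<^sub>R v t) 0 = frame_vec (x + y)" "(\<lambda>t. c *\<^sub>R u t + 0 *\<^sub>R v t) 0 = frame_vec (c *\<^sub>R x)"
      using u v by simp_all
    from eq[OF sol_linear[OF u(1) v(1)] this(1)] eq[OF sol_linear[OF u(1) v(1)] this(2)]
    show "?f (x + y) = ?f x + ?f y" "?f (c *\<^sub>R x) = c *\<^sub>R ?f x"
      unfolding eq[OF u] eq[OF v] proj_lin by simp_all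
  qed
  from matrix_works[OF this[folded linear_matrix_vector_mul_eq], of x] eq[OF v] show ?thesis unfolding transverse_flow_def by simp
qed

lemma frame_tangent: "om (frame_vec x) (w 0) = 0"
  and frame_proj: "(\<And>v. v 0 = frame_vec x \<Longrightarrow> proj v 0 = x)"
proof -
  define W where "W = XF (\<gamma> 0)"
  have nz: "norm W \<noteq> 0" using w_nz[of 0] by (simp add: w_def W_def)
  have fr: "frame1 F (\<gamma> 0) = (1 / norm W) *\<^sub>R (- cy2 W, cy1 W, cx2 W, - cx1 W)"
    "frame2 F (\<gamma> 0) = (1 / norm W) *\<^sub>R (- cx2 W, cx1 W, - cy2 W, cy1 W)"
    unfolding frame1_def frame2_def grad_F norm_XF[symmetric] W_def
    by (simp_all add: gradF_def XF_def)
  show "om (frame_vec x) (w 0) = 0"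
    unfolding frame_vec_def fr w_def W_def[symmetric] by (simp add: om_def algebra_simps)
  have n2: "norm W * norm W = (cy1 W)\<^sup>2 + (cy2 W)\<^sup>2 + (cx1 W)\<^sup>2 + (cx2 W)\<^sup>2"
    using norm_phase[of W] by (simp add: power2_eq_square)
  show "proj v 0 = x" if "v 0 = frame_vec x" for v
  proof -
    have "fa2 (frame_vec x) W = norm W * norm W / norm W * x $ 1" "fb2 (frame_vec x) W = norm W * norm W / norm W * x $ 2"
      unfolding n2 unfolding frame_vec_def fr fa2_def fb2_def using nz
      by (simp_all add: field_simps power2_eq_square)
    thus ?thesis using nz unfolding proj_def that w_def W_def[symmetric] by (simp add: vec_eq_iff forall_2)
  qed
qed

text \<open>A tangent vector and the combination of the frame vectors with the same coordinates
  differ by a multiple of the velocity, and the linearized solution of the velocity projects to 0.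
  So test solutions may start at any tangent vector, not only in the span of the frame.\<close>

lemma transverse_flow_tangent:
  assumes "sol v" "om (v 0) (w 0) = 0"
  shows "\<Phi> t *v proj v 0 = proj v t"
proof -
  define x where "x = proj v 0"
  obtain u where u: "sol u" "u 0 = frame_vec x" using sol_exists by metis
  define d where "d t = v t - u t" for t
  have d: "sol d" using sol_linear[OF assms(1) u(1), of 1 "-1"] by (simp add: d_def[abs_def])
  have pd: "proj d t = proj v t - proj u t" for t
    using proj_lin[of 1 v "-1" u t] by (simp add: d_def[abs_def])
  have "proj d 0 = 0" unfolding pd frame_proj[of u x, OF u(2)] x_def by simp
  hence ab: "fa2 (d 0) (w 0) = 0" "fb2 (d 0) (w 0) = 0"
    using w_nz[of 0] by (auto simp: proj_def vec_eq_iff forall_2)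
  have om: "om (d 0) (w 0) = 0"
    using assms(2) frame_tangent[of x] u(2) by (simp add: d_def om_def algebra_simps)
  define c where "c = (d 0 \<bullet> w 0) / (norm (w 0))\<^sup>2"
  \<comment> \<open>The vector d 0 is orthogonal to both frame vectors and to the gradient, hence
    parallel to w 0.\<close>
  have "(norm (w 0))\<^sup>2 *\<^sub>R d 0 = (d 0 \<bullet> w 0) *\<^sub>R w 0"
    using ab om unfolding norm_phase inner_phase fa2_def fb2_def om_def
    by (intro phase_eqI; simp only: comp_linear; algebra)
  from arg_cong[OF this, of "\<lambda>z. (1 / (norm (w 0))\<^sup>2) *\<^sub>R z"] have d0: "d 0 = c *\<^sub>R w 0"
    using w_nz[of 0] unfolding c_def by simp
  have "d = (\<lambda>t. c *\<^sub>R w t + 0 *\<^sub>R w t)" by (rule sol_unique[OF d sol_linear[OF sol_w sol_w], of 0]) (simp add: d0)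
  hence "proj d t = 0" using proj_lin[of c w 0 w t] by (simp add: proj_w)
  thus ?thesis using transverse_flow_proj[OF u] by (simp add: pd x_def)
qed

lemma DERIV_form:
  assumes "sol v"
  shows
    "((\<lambda>t. fa2 (v t) (w t)) has_real_derivative
      fa2 (DX (\<gamma> t) (v t)) (w t) + fa2 (v t) (DX (\<gamma> t) (w t))) (at t)"
    "((\<lambda>t. fb2 (v t) (w t)) has_real_derivative
      fb2 (DX (\<gamma> t) (v t)) (w t) + fb2 (v t) (DX (\<gamma> t) (w t))) (at t)"
    "((\<lambda>t. ff2 (v t) (w t)) has_real_derivative - fb2 (v t) (w t)) (at t)"
proof -
  have v: "(v has_vector_derivative DX (\<gamma> t) (v t)) (at t)" and w: "(w has_vector_derivative DX (\<gamma> t) (w t)) (at t)"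
    using assms sol_w by (auto simp: sol_def)
  show "((\<lambda>t. fa2 (v t) (w t)) has_real_derivative
      fa2 (DX (\<gamma> t) (v t)) (w t) + fa2 (v t) (DX (\<gamma> t) (w t))) (at t)"
    "((\<lambda>t. fb2 (v t) (w t)) has_real_derivative
      fb2 (DX (\<gamma> t) (v t)) (w t) + fb2 (v t) (DX (\<gamma> t) (w t))) (at t)"
    unfolding fa2_def fb2_def
    by (rule derivative_eq_intros comp_DERIV[OF v] comp_DERIV[OF w] refl | simp add: algebra_simps)+
  have "((\<lambda>t. ff2 (v t) (w t)) has_real_derivative
      ff2 (DX (\<gamma> t) (v t)) (w t) + ff2 (v t) (DX (\<gamma> t) (w t))) (at t)"
    unfolding ff2_def
    by (rule derivative_eq_intros comp_DERIV[OF v] comp_DERIV[OF w] refl | simp add: algebra_simps)+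
  moreover have "ff2 (DX (\<gamma> t) (v t)) (w t) + ff2 (v t) (DX (\<gamma> t) (w t)) = - fb2 (v t) (w t)"
    by (simp add: ff2_def fb2_def DX_def algebra_simps)
  ultimately show "((\<lambda>t. ff2 (v t) (w t)) has_real_derivative - fb2 (v t) (w t)) (at t)" by simp
qed

lemma tangent_const: "sol v \<Longrightarrow> om (v 0) (w 0) = 0 \<Longrightarrow> om (v t) (w t) = 0"
  using om_const[OF _ sol_w] by metis

lemma \<Phi>_0: "\<Phi> 0 = mat 1"
proof -
  have "\<Phi> 0 *v x = mat 1 *v x" for x
  proof -
    obtain v where v: "sol v" "v 0 = frame_vec x" using sol_exists by metis
    show ?thesis using transverse_flow_proj[OF v, of 0] frame_proj[of v x, OF v(2)] by simp
  qed
  thus ?thesis by (simp add: matrix_eq)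
qed

lemma det_\<Phi>: "det (\<Phi> t) = 1"
proof -
  define e :: "real^2" and e' :: "real^2" where "e = vector [1, 0]" and "e' = vector [0, 1]"
  obtain u v where u: "sol u" "u 0 = frame_vec e" and v: "sol v" "v 0 = frame_vec e'" using sol_exists by metis
  have tan: "om (u s) (w s) = 0" "om (v s) (w s) = 0" for s
    using tangent_const[OF u(1)] tangent_const[OF v(1)] frame_tangent u(2) v(2) by auto
  have "det (\<Phi> t) * cross2 e e' = cross2 (proj u t) (proj v t)"
    using cross2_matrix[of "\<Phi> t" e e'] unfolding transverse_flow_proj[OF u] transverse_flow_proj[OF v] by simp
  also have "\<dots> = cross2 (proj u 0) (proj v 0)"
    unfolding cross2_proj[OF tan] by (rule om_const[OF u(1) v(1)])
  also have "\<dots> = cross2 e e'" by (simp add: frame_proj u(2) v(2))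
  finally show ?thesis by (simp add: e_def e'_def cross2_def)
qed

lemma \<Phi>_nz: "x \<noteq> 0 \<Longrightarrow> \<Phi> t *v x \<noteq> 0"
  using det_\<Phi>[of t] by (metis invertible_det_nz zero_neq_one matrix_left_invertible_ker invertible_left_inverse)

lemma solution_lift:
  assumes v: "sol v" "om (v 0) (w 0) = 0" "proj v 0 \<noteq> 0"
  obtains \<theta> \<rho> where "\<And>t. isCont \<theta> t" "\<And>t. \<rho> t > 0"
    "\<And>t. fa2 (v t) (w t) = \<rho> t * cos (\<theta> t)" "\<And>t. fb2 (v t) (w t) = \<rho> t * sin (\<theta> t)"
    "\<And>T. angle_lift (\<lambda>t. \<Phi> t *v proj v 0) T \<theta>"
proof -
  let ?a = "\<lambda>t. fa2 (v t) (w t)" and ?b = "\<lambda>t. fb2 (v t) (w t)"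
  have c: "continuous_on UNIV v" "continuous_on UNIV w" using sol_continuous v sol_w by auto
  have pos: "(?a t)\<^sup>2 + (?b t)\<^sup>2 > 0" for t
  proof (rule ccontr)
    assume "\<not> ?thesis"
    hence "?a t = 0 \<and> ?b t = 0" by (meson sum_power2_gt_zero_iff)
    hence "proj v t = 0" by (simp add: proj_def vec_eq_iff forall_2)
    thus False using \<Phi>_nz[OF v(3), of t] transverse_flow_tangent[OF v(1,2), of t] by simp
  qed
  obtain \<theta> where \<theta>: "\<And>t. (\<theta> has_real_derivative (?a t *
       (fb2 (DX (\<gamma> t) (v t)) (w t) + fb2 (v t) (DX (\<gamma> t) (w t))) -
       ?b t * (fa2 (DX (\<gamma> t) (v t)) (w t) + fa2 (v t) (DX (\<gamma> t) (w t)))) /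
      ((?a t)\<^sup>2 + (?b t)\<^sup>2)) (at t)"
    "\<And>t. ?a t = sqrt ((?a t)\<^sup>2 + (?b t)\<^sup>2) * cos (\<theta> t)"
    "\<And>t. ?b t = sqrt ((?a t)\<^sup>2 + (?b t)\<^sup>2) * sin (\<theta> t)"
  proof (rule polar_lift[OF DERIV_form(1)[OF v(1)] DERIV_form(2)[OF v(1)] _ _ pos])
    show "continuous_on UNIV (\<lambda>t. fa2 (DX (\<gamma> t) (v t)) (w t) + fa2 (v t) (DX (\<gamma> t) (w t)))"
      "continuous_on UNIV (\<lambda>t. fb2 (DX (\<gamma> t) (v t)) (w t) + fb2 (v t) (DX (\<gamma> t) (w t)))"
      unfolding fa2_def fb2_def by (intro continuous_intros c)+
  qed blast
  define \<rho> where "\<rho> t = sqrt ((?a t)\<^sup>2 + (?b t)\<^sup>2)" for t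
  have \<rho>: "\<rho> t > 0" for t using pos by (simp add: \<rho>_def)
  have ab: "?a t = \<rho> t * cos (\<theta> t)" "?b t = \<rho> t * sin (\<theta> t)" for t
    unfolding \<rho>_def by (rule \<theta>(2), rule \<theta>(3))
  have cont: "isCont \<theta> t" for t using \<theta>(1) by (rule DERIV_isCont)
  have eq: "\<Phi> t *v proj v 0 = (\<rho> t / norm (w t)) *\<^sub>R vector [cos (\<theta> t), sin (\<theta> t)]" for t
    unfolding transverse_flow_tangent[OF v(1,2)] unfolding proj_def ab by (simp add: vec_eq_iff forall_2)
  have nrm: "norm (\<Phi> t *v proj v 0) = \<rho> t / norm (w t)" for t
    unfolding eq norm_scaleR norm_cos_sin using \<rho>[of t] by simp
  have "angle_lift (\<lambda>t. \<Phi> t *v proj v 0) T \<theta>" for T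
    unfolding angle_lift_def nrm
  proof (intro conjI ballI eq)
    show "continuous_on {0..T} \<theta>" using cont by (blast intro: continuous_at_imp_continuous_on)
  qed
  from that[OF cont \<rho> ab this] show ?thesis .
qed

lemma planar: "T > 0 \<Longrightarrow> planar_path \<Phi> T"
proof
  show "det (\<Phi> t) > 0" for t by (simp add: det_\<Phi>)
  show "\<Phi> 0 = mat 1" by (rule \<Phi>_0)
  show "\<exists>\<theta>. angle_lift (\<lambda>t. \<Phi> t *v x) T \<theta>" if "x \<noteq> 0" for x
  proof -
    obtain v where v: "sol v" "v 0 = frame_vec x" using sol_exists by metis
    from solution_lift[OF v(1)] frame_tangent[of x] frame_proj[of v x, OF v(2)] that v(2)
    show ?thesis by metis
  qed
qed

lemma vertical_crossing:
  assumes v: "sol v" "om (v 0) (w 0) = 0" and \<theta>: "\<And>t. isCont \<theta> t" "\<And>t. \<rho> t > 0"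
    "\<And>t. fa2 (v t) (w t) = \<rho> t * cos (\<theta> t)" "\<And>t. fb2 (v t) (w t) = \<rho> t * sin (\<theta> t)"
  shows "vertical_crossing (\<lambda>t. fa2 (v t) (w t)) (\<lambda>t. fb2 (v t) (w t)) (\<lambda>t. ff2 (v t) (w t)) \<theta> \<rho>"
proof
  fix t
  have om: "om (v t) (w t) = 0" by (rule tangent_const[OF v])
  have nw: "(norm (w t))\<^sup>2 > 0" using w_nz[of t] by simp
  show "fb2 (v t) (w t) = 0 \<Longrightarrow> 0 \<le> ff2 (v t) (w t) * fa2 (v t) (w t)"
  proof -
    assume b: "fb2 (v t) (w t) = 0"
    have "(norm (w t))\<^sup>2 * (ff2 (v t) (w t) * fa2 (v t) (w t)) =
      ((cx1 (w t))\<^sup>2 + (cx2 (w t))\<^sup>2) * (fa2 (v t) (w t))\<^sup>2"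
      using frame_ff2[OF om] b by (simp add: power2_eq_square)
    also have "\<dots> \<ge> 0" by simp
    finally show ?thesis using nw by (simp add: zero_le_mult_iff)
  qed
  assume b: "fb2 (v t) (w t) = 0" and f: "ff2 (v t) (w t) = 0"
  have a: "fa2 (v t) (w t) \<noteq> 0"
  proof
    assume "fa2 (v t) (w t) = 0"
    hence "cos (\<theta> t) = 0" "sin (\<theta> t) = 0" using b \<theta>(2)[of t] by (auto simp: \<theta>(3,4))
    thus False using sin_cos_squared_add[of "\<theta> t"] by simp
  qed
  \<comment> \<open>As a is nonzero, \<open>frame_ff2\<close> leaves only a vanishing x-part of the
    velocity; tangency and b = 0 then annihilate the x-part of v as well. With both x-parts gone the
    derivative of b is 2 a.\<close>
  have "(cx1 (w t))\<^sup>2 + (cx2 (w t))\<^sup>2 = 0" using frame_ff2[OF om] a b f by simp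
  hence p: "cx1 (w t) = 0" "cx2 (w t) = 0" by (simp_all add: sum_power2_eq_zero_iff)
  have n: "(norm (w t))\<^sup>2 = (cy1 (w t))\<^sup>2 + (cy2 (w t))\<^sup>2" unfolding norm_phase using p by simp
  have "(norm (w t))\<^sup>2 * cx1 (v t) = 0" "(norm (w t))\<^sup>2 * cx2 (v t) = 0"
    using om b p unfolding n om_def fb2_def by algebra+
  hence x: "cx1 (v t) = 0" "cx2 (v t) = 0" using nw by auto
  have "fb2 (DX (\<gamma> t) (v t)) (w t) + fb2 (v t) (DX (\<gamma> t) (w t)) = 2 * fa2 (v t) (w t)"
    using p x by (simp add: fb2_def fa2_def DX_def algebra_simps)
  thus "((\<lambda>t. fb2 (v t) (w t)) has_real_derivative 2 * fa2 (v t) (w t)) (at t)"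
    using DERIV_form(2)[OF v(1), of t] by simp
qed (fact \<theta> DERIV_form(3)[OF v(1)])+

text \<open>\<open>H11\<close> without the square of A2': this square goes into the term h^2 of the
  Riccati identity, and what is left has to be positive.\<close>

definition K where "K t = P2 (\<gamma> t) * A2'' (cx1 (\<gamma> t)) + V11 (cx1 (\<gamma> t), cx2 (\<gamma> t))"

text \<open>The slope of the solution plane over the \<open>x1\<close>-axis satisfies a Riccati inequality, so it
  blows up, and the plane becomes vertical, within time \<open>pi / sqrt k\<close>.\<close>

lemma riccati_zero:
  assumes v: "sol v" "om (v 0) (w 0) = 0" and "k > 0"
    and K: "\<And>t. s \<le> t \<Longrightarrow> t \<le> s + pi / sqrt k \<Longrightarrow> K t \<ge> k"
  shows "\<exists>t. s \<le> t \<and> t \<le> s + pi / sqrt k \<and> ff2 (v t) (w t) = 0"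
proof (rule ccontr)
  assume contr: "\<not> ?thesis"
  \<comment> \<open>The vector cx2 (w t) v t - cx2 (v t) w t lies in the solution plane and has no
    x2-component. Its x1- and y1-components are f and g, so g / f is the slope, and h is its
    y2-component completed by the magnetic term.\<close>
  define f where "f t = ff2 (v t) (w t)" for t
  define g where "g t = cy1 (v t) * cx2 (w t) - cx2 (v t) * cy1 (w t)" for t
  define h where "h t = cy2 (v t) * cx2 (w t) - cx2 (v t) * cy2 (w t) + A2' (cx1 (\<gamma> t)) * f t" for t
  define Q where "Q t = arctan (g t / f t / sqrt k)" for t
  have fnz: "f t \<noteq> 0" if "s \<le> t" "t \<le> s + pi / sqrt k" for t using contr that by (auto simp: f_def)
  define g' where "g' t = cy1 (DX (\<gamma> t) (v t)) * cx2 (w t) + cy1 (v t) * cx2 (DX (\<gamma> t) (w t))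
      - (cx2 (DX (\<gamma> t) (v t)) * cy1 (w t) + cx2 (v t) * cy1 (DX (\<gamma> t) (w t)))" for t
  have g': "(g has_real_derivative g' t) (at t)" for t
  proof -
    have v': "(v has_vector_derivative DX (\<gamma> t) (v t)) (at t)" and w': "(w has_vector_derivative DX (\<gamma> t) (w t)) (at t)"
      using v sol_w by (auto simp: sol_def)
    show ?thesis unfolding g_def[abs_def] g'_def
      by (rule derivative_eq_intros comp_DERIV[OF v'] comp_DERIV[OF w'] refl | simp add: algebra_simps)+
  qed
  have key: "g' t * f t - g t * (- fb2 (v t) (w t)) = - ((g t)\<^sup>2 + (h t)\<^sup>2 + K t * (f t)\<^sup>2)" for t
    using tangent_const[OF v, of t]
    unfolding om_def f_def g_def g'_def h_def fb2_def ff2_def K_def DX_def H11_def comp_simps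
    by algebra
  have Q': "\<exists>y. (Q has_real_derivative y) (at t) \<and> y \<le> - sqrt k" if t: "s \<le> t" "t \<le> s + pi / sqrt k" for t
  proof -
    define y where "y = ((g' t * f t - g t * (- fb2 (v t) (w t))) / (f t * f t)) / sqrt k / (1 + (g t / f t / sqrt k)\<^sup>2)"
    have "(Q has_real_derivative y) (at t)"
      unfolding Q_def[abs_def] y_def
      using DERIV_chain2[OF DERIV_arctan DERIV_cdivide[OF DERIV_divide[OF g' DERIV_form(3)[OF v(1), of t, folded f_def] fnz[OF t]], of "sqrt k"]]
      by (simp only: divide_inverse mult.commute)
    moreover have "y \<le> - sqrt k"
    proof -
      define D where "D = 1 + (g t / f t / sqrt k)\<^sup>2"
      have f2: "(f t)\<^sup>2 > 0" using fnz[OF t] by simp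
      have D: "D > 0" unfolding D_def by (rule add_pos_nonneg) auto
      have kD: "k * D * (f t)\<^sup>2 = k * (f t)\<^sup>2 + (g t)\<^sup>2"
        unfolding D_def using fnz[OF t] \<open>k > 0\<close> by (simp add: power_divide field_simps)
      have "(g t)\<^sup>2 + (h t)\<^sup>2 + K t * (f t)\<^sup>2 \<ge> k * D * (f t)\<^sup>2"
        unfolding kD using mult_right_mono[OF K[OF t] zero_le_power2[of "f t"]] zero_le_power2[of "h t"] by linarith
      hence "((g t)\<^sup>2 + (h t)\<^sup>2 + K t * (f t)\<^sup>2) / (f t)\<^sup>2 \<ge> k * D" using f2 by (simp add: le_divide_eq)
      hence "((g t)\<^sup>2 + (h t)\<^sup>2 + K t * (f t)\<^sup>2) / (f t)\<^sup>2 / (sqrt k * D) \<ge> k * D / (sqrt k * D)"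
        using D \<open>k > 0\<close> by (intro divide_right_mono) auto
      moreover have "k * D / (sqrt k * D) = sqrt k" using D \<open>k > 0\<close> by (simp add: real_div_sqrt)
      moreover have "y = - (((g t)\<^sup>2 + (h t)\<^sup>2 + K t * (f t)\<^sup>2) / (f t)\<^sup>2 / (sqrt k * D))"
        unfolding y_def key D_def[symmetric]
        by (simp only: minus_divide_left[symmetric] power2_eq_square divide_divide_eq_left mult.assoc)
      ultimately show ?thesis by simp
    qed
    ultimately show ?thesis by blast
  qed
  define e where "e = s + pi / sqrt k"
  have se: "s < e" unfolding e_def using \<open>k > 0\<close> by simp
  \<comment> \<open>Over the time pi / sqrt k the arctan of the scaled slope would have to drop by
    at least pi, more than its range allows.\<close>
  have "Q e + sqrt k * e \<le> Q s + sqrt k * s"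
  proof (rule DERIV_nonpos_imp_nonincreasing[where f = "\<lambda>t. Q t + sqrt k * t"])
    fix t assume "s \<le> t" "t \<le> e"
    then obtain y where "(Q has_real_derivative y) (at t)" "y \<le> - sqrt k" using Q'[of t] by (auto simp: e_def)
    thus "\<exists>y. ((\<lambda>t. Q t + sqrt k * t) has_real_derivative y) (at t) \<and> y \<le> 0"
      by (intro exI[of _ "y + sqrt k"]) (auto intro!: derivative_eq_intros)
  qed (use se in simp)
  moreover have "sqrt k * e = sqrt k * s + pi" unfolding e_def using \<open>k > 0\<close> by (simp add: distrib_left)
  ultimately show False using arctan_lbound[of "g e / f e / sqrt k"] arctan_ubound[of "g s / f s / sqrt k"]
    unfolding Q_def by simp
qed

text \<open>The 2 N + 8 blocks gain more than 2 N + 5 half turns from t0 on, and the time before t0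
  loses less than 3. So every vector turns by more than N + 1 full turns.\<close>

lemma cz_index_large:
  assumes "k > 0" "0 \<le> t0" "t0 + 3 * (pi / sqrt k) * (2 * real N + 8) \<le> T"
    and K: "\<And>t. t0 \<le> t \<Longrightarrow> t \<le> t0 + 3 * (pi / sqrt k) * (2 * real N + 8) \<Longrightarrow> K t \<ge> k"
  shows "cz_index F \<gamma> T > int N"
proof -
  define d where "d = pi / sqrt k"
  have d: "d > 0" using \<open>k > 0\<close> by (simp add: d_def)
  have "T > 0"
  proof -
    have "0 < 3 * d * (2 * real N + 8)" using d by simp
    thus ?thesis using assms(2,3) unfolding d_def by linarith
  qed
  interpret pp: planar_path \<Phi> T by (rule planar) fact
  have gt: "x > real N + 1" if x: "x \<in> rotation_set \<Phi> T" for x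
  proof -
    obtain y where y: "y \<noteq> 0" "x = arg_variation \<Phi> T y" using x by (auto simp: rotation_set_def)
    obtain v where v: "sol v" "v 0 = frame_vec y" using sol_exists by metis
    have tan: "om (v 0) (w 0) = 0" using frame_tangent v(2) by simp
    have py: "proj v 0 = y" by (rule frame_proj[of v y, OF v(2)])
    obtain \<theta> \<rho> where \<theta>: "\<And>t. isCont \<theta> t" "\<And>t. \<rho> t > 0"
      "\<And>t. fa2 (v t) (w t) = \<rho> t * cos (\<theta> t)" "\<And>t. fb2 (v t) (w t) = \<rho> t * sin (\<theta> t)"
      and lift: "\<And>T. angle_lift (\<lambda>t. \<Phi> t *v y) T \<theta>"
      using solution_lift[OF v(1) tan, unfolded py, OF y(1)] by blast
    note vc = vertical_crossing[OF v(1) tan \<theta>]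
    have "\<theta> T - \<theta> t0 > (real (2 * N + 8) - 3) * pi"
    proof (rule crossing_count[OF vc d])
      fix t assume t: "t0 \<le> t" "t + d \<le> t0 + 3 * d * real (2 * N + 8)"
      show "\<exists>s\<ge>t. s \<le> t + d \<and> ff2 (v s) (w s) = 0"
        unfolding d_def using t by (intro riccati_zero[OF v(1) tan \<open>k > 0\<close>] K) (auto simp: d_def)
    qed (use assms in \<open>simp add: d_def\<close>)
    moreover have "\<theta> t0 - \<theta> 0 > (real 0 - 3) * pi"
      by (rule crossing_count[OF vc d]) (use d assms in auto)
    ultimately have "\<theta> T - \<theta> 0 > (2 * real N + 2) * pi" by (simp add: algebra_simps)
    hence "(\<theta> T - \<theta> 0) / (2 * pi) > real N + 1" by (simp add: field_simps)
    thus ?thesis using pp.arg_variation_eq[OF y(1) lift] y(2) by simp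
  qed
  have "(vector [1, 0] :: real^2) \<noteq> 0" by (simp add: vec_eq_iff forall_2)
  hence "rotation_set \<Phi> T \<noteq> {}" unfolding rotation_set_def by blast
  from cz_of_set_gt[OF pp.rotation_set_interval this pp.rotation_set_diam gt]
  show ?thesis unfolding cz_index_def by blast
qed

text \<open>The angle \<psi> makes exactly one turn and (a, b) stays in the open half plane around
  it, so the solution makes one turn up to an angle \<delta> with |\<delta>| < pi. The sign of
  \<delta> is that of the symplectic product of the initial and the final vector, because the
  velocity is the same at both ends.\<close>

lemma variation_near_one:
  assumes v: "sol v" "om (v 0) (w 0) = 0" and "\<tau> > 0" "\<gamma> \<tau> = \<gamma> 0"
    and \<psi>: "continuous_on {0..\<tau>} \<psi>" "\<psi> \<tau> = \<psi> 0 + 2 * pi"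
    and pos: "\<And>t. 0 \<le> t \<Longrightarrow> t \<le> \<tau> \<Longrightarrow> fa2 (v t) (w t) * cos (\<psi> t) + fb2 (v t) (w t) * sin (\<psi> t) > 0"
  shows "\<exists>x\<in>rotation_set \<Phi> \<tau>. (om (v 0) (v \<tau>) > 0 \<longrightarrow> x > 1) \<and> (om (v 0) (v \<tau>) < 0 \<longrightarrow> x < 1)"
    and "cross2 (proj v 0) (\<Phi> \<tau> *v proj v 0) = om (v 0) (v \<tau>)"
proof -
  interpret pp: planar_path \<Phi> \<tau> by (rule planar) fact
  have p0: "proj v 0 \<noteq> 0"
  proof
    assume "proj v 0 = 0"
    hence "fa2 (v 0) (w 0) = 0" "fb2 (v 0) (w 0) = 0" using w_nz[of 0] by (auto simp: proj_def vec_eq_iff forall_2)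
    thus False using pos[of 0] \<open>\<tau> > 0\<close> by simp
  qed
  obtain \<theta> \<rho> where \<theta>: "\<And>t. isCont \<theta> t" "\<And>t. \<rho> t > 0"
      "\<And>t. fa2 (v t) (w t) = \<rho> t * cos (\<theta> t)" "\<And>t. fb2 (v t) (w t) = \<rho> t * sin (\<theta> t)"
      and lift: "\<And>T. angle_lift (\<lambda>t. \<Phi> t *v proj v 0) T \<theta>"
    using solution_lift[OF v p0] by blast
  define g where "g t = \<theta> t - \<psi> t" for t
  have gc: "continuous_on {0..\<tau>} g" unfolding g_def
    using \<theta>(1) by (intro continuous_intros \<psi>) (simp add: continuous_at_imp_continuous_on)
  have cosg: "cos (g t) > 0" if "0 \<le> t" "t \<le> \<tau>" for t
  proof -
    have "\<rho> t * cos (g t) > 0" using pos[OF that] unfolding \<theta>(3,4) g_def cos_diff by (simp add: algebra_simps)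
    thus ?thesis using \<theta>(2)[of t] by (simp add: zero_less_mult_iff)
  qed
  define k where "k = \<lfloor>(g 0 + pi) / (2 * pi)\<rfloor>"
  have k: "- pi \<le> g 0 - 2 * pi * of_int k" "g 0 - 2 * pi * of_int k < pi"
    unfolding k_def using floor_divide_lower[of "2 * pi" "g 0 + pi"] floor_divide_upper[of "2 * pi" "g 0 + pi"]
    by (auto simp: algebra_simps)
  define h where "h t = g t - 2 * pi * of_int k" for t
  have cosh: "cos (h t) > 0" if "0 \<le> t" "t \<le> \<tau>" for t
    using cosg[OF that] unfolding h_def cos_diff[of _ "2 * pi * of_int k"] by simp
  have h0: "- (pi / 2) < h 0" "h 0 < pi / 2"
  proof -
    have c: "cos (h 0) > 0" using cosh[of 0] \<open>\<tau> > 0\<close> by simp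
    have "\<not> (pi / 2 \<le> \<bar>h 0\<bar>)"
    proof
      assume "pi / 2 \<le> \<bar>h 0\<bar>"
      moreover have "\<bar>h 0\<bar> \<le> pi" using k by (auto simp: h_def)
      ultimately have "cos \<bar>h 0\<bar> \<le> cos (pi / 2)" by (intro cos_monotone_0_pi_le) auto
      thus False using c by simp
    qed
    thus "- (pi / 2) < h 0" "h 0 < pi / 2" by auto
  qed
  have hc: "continuous_on {0..\<tau>} h" unfolding h_def by (intro continuous_intros gc)
  have h\<tau>: "- (pi / 2) < h \<tau> \<and> h \<tau> < pi / 2"
  proof (rule stay_in_interval[OF hc, of 0])
    fix t assume t: "t \<in> {0..\<tau>}"
    have "cos (h t) > 0" using cosh[of t] t by simp
    thus "h t \<noteq> - (pi / 2)" "h t \<noteq> pi / 2" by (metis cos_minus cos_pi_half less_irrefl)+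
  qed (use h0 \<open>\<tau> > 0\<close> in auto)
  define \<delta> where "\<delta> = h \<tau> - h 0"
  have \<delta>: "- pi < \<delta>" "\<delta> < pi" using h0 h\<tau> by (auto simp: \<delta>_def)
  have rot: "\<theta> \<tau> - \<theta> 0 = \<delta> + 2 * pi" using \<psi>(2) by (simp add: \<delta>_def h_def g_def)
  define x where "x = arg_variation \<Phi> \<tau> (proj v 0)"
  have x: "x = \<delta> / (2 * pi) + 1" unfolding x_def pp.arg_variation_eq[OF p0 lift] rot
    by (simp add: add_divide_distrib)
  have w\<tau>: "w \<tau> = w 0" unfolding w_def \<open>\<gamma> \<tau> = \<gamma> 0\<close> ..
  have om: "cross2 (proj v 0) (proj v \<tau>) = om (v 0) (v \<tau>)"
  proof -
    have "proj v \<tau> = proj (\<lambda>_. v \<tau>) 0" by (simp add: proj_def w\<tau>)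
    moreover have "om (v \<tau>) (w 0) = 0" using tangent_const[OF v, of \<tau>] w\<tau> by simp
    ultimately show ?thesis using cross2_proj[of v 0 "\<lambda>_. v \<tau>"] v(2) by simp
  qed
  thus "cross2 (proj v 0) (\<Phi> \<tau> *v proj v 0) = om (v 0) (v \<tau>)"
    by (simp add: transverse_flow_tangent[OF v])
  have polar: "proj v t = (\<rho> t / norm (w t)) *\<^sub>R vector [cos (\<theta> t), sin (\<theta> t)]" for t
    unfolding proj_def \<theta>(3,4) by (simp add: vec_eq_iff forall_2)
  have "om (v 0) (v \<tau>) = (\<rho> 0 / norm (w 0)) * (\<rho> \<tau> / norm (w \<tau>)) * sin (\<theta> \<tau> - \<theta> 0)"
    unfolding om[symmetric] by (rule polar_cross_inner(1)[OF polar polar])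
  also have "sin (\<theta> \<tau> - \<theta> 0) = sin \<delta>" unfolding rot by simp
  finally have om\<delta>: "om (v 0) (v \<tau>) = (\<rho> 0 / norm (w 0)) * (\<rho> \<tau> / norm (w \<tau>)) * sin \<delta>" .
  have c: "(\<rho> 0 / norm (w 0)) * (\<rho> \<tau> / norm (w \<tau>)) > 0" using \<theta>(2) w_nz by simp
  have "x \<in> rotation_set \<Phi> \<tau>" unfolding x_def rotation_set_def using p0 by blast
  moreover have "x > 1" if "om (v 0) (v \<tau>) > 0"
  proof -
    have "sin \<delta> > 0" using that unfolding om\<delta> by (rule zero_less_mult_pos[OF _ c])
    hence "\<delta> > 0" by (rule sin_pos_near[OF _ \<delta>])
    thus ?thesis by (simp add: x)
  qed
  moreover have "x < 1" if "om (v 0) (v \<tau>) < 0"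
  proof -
    have "(\<rho> 0 / norm (w 0)) * (\<rho> \<tau> / norm (w \<tau>)) * sin (- \<delta>) > 0"
      using that unfolding om\<delta> sin_minus mult_minus_right by linarith
    hence "sin (- \<delta>) > 0" by (rule zero_less_mult_pos[OF _ c])
    hence "- \<delta> > 0" by (rule sin_pos_near) (use \<delta> in auto)
    thus ?thesis by (simp add: x divide_neg_pos)
  qed
  ultimately show "\<exists>x\<in>rotation_set \<Phi> \<tau>. (om (v 0) (v \<tau>) > 0 \<longrightarrow> x > 1) \<and> (om (v 0) (v \<tau>) < 0 \<longrightarrow> x < 1)"
    by blast
qed

text \<open>One solution ahead of a full turn and one behind it put 1 strictly inside the rotation
  interval. The same two vectors give the sign change of
  \<open>sign_change_eigenvalue\<close>.\<close>

lemma index_two_hyperbolic: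
  assumes u: "sol u" "om (u 0) (w 0) = 0" and v: "sol v" "om (v 0) (w 0) = 0"
    and \<tau>: "\<tau> > 0" "\<gamma> \<tau> = \<gamma> 0"
    and \<psi>: "continuous_on {0..\<tau>} \<psi>" "\<psi> \<tau> = \<psi> 0 + 2 * pi"
    and posu: "\<And>t. 0 \<le> t \<Longrightarrow> t \<le> \<tau> \<Longrightarrow> fa2 (u t) (w t) * cos (\<psi> t) + fb2 (u t) (w t) * sin (\<psi> t) > 0"
    and posv: "\<And>t. 0 \<le> t \<Longrightarrow> t \<le> \<tau> \<Longrightarrow> fa2 (v t) (w t) * cos (\<psi> t) + fb2 (v t) (w t) * sin (\<psi> t) > 0"
    and sign: "om (u 0) (u \<tau>) > 0" "om (v 0) (v \<tau>) < 0"
  shows "cz_index F \<gamma> \<tau> = 2" "hyperbolic F \<gamma> \<tau>"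
proof -
  interpret pp: planar_path \<Phi> \<tau> by (rule planar) fact
  note U = variation_near_one[OF u \<tau> \<psi> posu] and V = variation_near_one[OF v \<tau> \<psi> posv]
  obtain x y where "x \<in> rotation_set \<Phi> \<tau>" "y \<in> rotation_set \<Phi> \<tau>" "x < 1" "1 < y"
    using U(1) V(1) sign by blast
  from cz_of_set_eq_2[OF pp.rotation_set_interval pp.rotation_set_diam this]
  show "cz_index F \<gamma> \<tau> = 2" unfolding cz_index_def by blast
  have "cross2 (proj u 0) (\<Phi> \<tau> *v proj u 0) > 0" "cross2 (proj v 0) (\<Phi> \<tau> *v proj v 0) < 0"
    using U(2) V(2) sign by auto
  from sign_change_eigenvalue[OF det_\<Phi> this] show "hyperbolic F \<gamma> \<tau>" unfolding hyperbolic_def by blast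
qed

end

section \<open>Cones at a saddle-center\<close>

text \<open>Once positive, \<phi> stays above \<phi> t0 and therefore grows at least linearly, which
  a bound excludes.\<close>

lemma growth_unbounded:
  fixes \<phi> :: "real \<Rightarrow> real"
  assumes d: "\<And>t. (\<phi> has_real_derivative \<phi>' t) (at t)" and "c > 0"
    and grow: "\<And>t. \<phi> t > 0 \<Longrightarrow> \<phi>' t \<ge> c * \<phi> t" and le: "\<And>t. \<phi> t \<le> M"
  shows "\<phi> t0 \<le> 0"
proof (rule ccontr)
  assume "\<not> \<phi> t0 \<le> 0"
  hence p0: "\<phi> t0 > 0" by simp
  have cont: "continuous_on A \<phi>" for A using d by (auto intro!: continuous_at_imp_continuous_on DERIV_isCont)
  have ge: "\<phi> t \<ge> \<phi> t0" if "t \<ge> t0" for t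
  proof (rule ccontr)
    assume contr: "\<not> \<phi> t \<ge> \<phi> t0"
    define S where "S = {s \<in> {t0..t}. \<phi> s \<ge> \<phi> t0}"
    have "S = {t0..t} \<inter> {s. \<phi> t0 \<le> \<phi> s}" by (auto simp: S_def)
    hence "closed S" by (simp add: closed_Int closed_Collect_le[OF continuous_on_const cont])
    moreover have "t0 \<in> S" "bdd_above S" using that by (auto simp: S_def)
    ultimately have s: "Sup S \<in> S" by (intro closed_contains_Sup) auto
    define s where "s = Sup S"
    have s: "t0 \<le> s" "s \<le> t" "\<phi> s \<ge> \<phi> t0" using s by (auto simp: S_def s_def)
    hence "s < t" using contr by (cases "s = t") auto
    have "\<phi>' s > 0" using grow[of s] s p0 \<open>c > 0\<close> by (smt (verit) mult_pos_pos)
    from DERIV_pos_inc_right[OF d this] obtain \<delta> where \<delta>: "\<delta> > 0" "\<forall>h>0. h < \<delta> \<longrightarrow> \<phi> s < \<phi> (s + h)" by auto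
    define h where "h = min (\<delta> / 2) (t - s)"
    have h: "0 < h" "h < \<delta>" "h \<le> t - s" using \<delta> \<open>s < t\<close> by (auto simp: h_def)
    hence "s + h \<in> S" using \<delta>(2) s by (force simp: S_def)
    hence "s + h \<le> s" unfolding s_def by (intro cSup_upper \<open>bdd_above S\<close>)
    thus False using h by simp
  qed
  have lin: "\<phi> t \<ge> \<phi> t0 + c * \<phi> t0 * (t - t0)" if "t \<ge> t0" for t
  proof -
    have "\<phi> t0 - c * \<phi> t0 * t0 \<le> \<phi> t - c * \<phi> t0 * t"
    proof (rule DERIV_nonneg_imp_nondecreasing[where f = "\<lambda>t. \<phi> t - c * \<phi> t0 * t", OF that])
      fix s assume "t0 \<le> s"
      hence "\<phi> s \<ge> \<phi> t0" by (rule ge)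
      hence "\<phi>' s \<ge> c * \<phi> t0" using grow[of s] p0 \<open>c > 0\<close> mult_left_mono[of "\<phi> t0" "\<phi> s" c] by linarith
      thus "\<exists>y. ((\<lambda>t. \<phi> t - c * \<phi> t0 * t) has_real_derivative y) (at s) \<and> y \<ge> 0"
        by (intro exI[of _ "\<phi>' s - c * \<phi> t0"]) (auto intro!: derivative_eq_intros d)
    qed
    thus ?thesis by (simp add: algebra_simps)
  qed
  define t where "t = t0 + \<bar>M\<bar> / (c * \<phi> t0)"
  have "\<phi> t \<ge> \<phi> t0 + c * \<phi> t0 * (t - t0)" using p0 \<open>c > 0\<close> by (intro lin) (simp add: t_def)
  also have "c * \<phi> t0 * (t - t0) = \<bar>M\<bar>" using p0 \<open>c > 0\<close> by (simp add: t_def)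
  finally show False using le[of t] p0 by linarith
qed

text \<open>Here c1 and c2 are the derivatives of the magnetic potentials, and b = c2 - c1 is the
  field strength. In terms of k1 and k2 the characteristic polynomial factors: the exponents are
  \<plusminus> sqrt ((k1 - b) (b - k2)) and \<plusminus> i sqrt (k1 k2).\<close>

locale saddle_center =
  fixes c1 c2 k1 k2 :: real
  assumes k2_pos: "0 < k2" and k2_b: "k2 < c2 - c1" and b_k1: "c2 - c1 < k1"
begin

definition b where "b = c2 - c1"
definition P where "P = k1 - b"
definition Q where "Q = b - k2"
definition m where "m = k1 + k2 - b"
definition lam where "lam = sqrt P * sqrt Q"

lemma pos: "P > 0" "Q > 0" "k1 > 0" "k2 > 0" "m > 0" "lam > 0" "k2 < k1" "b > 0"
  using k2_pos k2_b b_k1 by (auto simp: P_def Q_def m_def b_def lam_def)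

text \<open>\<open>A0\<close> is the linearized vector field at the saddle-center when \<open>k2 * P\<close> and \<open>- (k1 * Q)\<close> are the second
  derivatives of the potential in \<open>x1\<close> and \<open>x2\<close>. The center plane is \<open>h1 = h2 = 0\<close>, while \<open>U\<close> and \<open>S\<close> are
  the coordinates along the unstable and the stable direction.\<close>

definition A0 :: "phase \<Rightarrow> phase" where
  "A0 v = (- ((c2\<^sup>2 + k2 * P) * cx1 v + c2 * cy2 v), - ((c1\<^sup>2 - k1 * Q) * cx2 v + c1 * cy1 v),
     cy1 v + c1 * cx2 v, cy2 v + c2 * cx1 v)"
definition h1 where "h1 v = cy1 v + c1 * cx2 v + k1 * cx2 v"
definition h2 where "h2 v = cy2 v + c2 * cx1 v - k2 * cx1 v"
definition XX :: "phase \<Rightarrow> real \<times> real" where "XX v = (cx1 v, cx2 v)"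
definition HH :: "phase \<Rightarrow> real \<times> real" where "HH v = (h1 v, h2 v)"
definition U where "U v = sqrt Q * h1 v + sqrt P * h2 v"
definition S where "S v = sqrt Q * h1 v - sqrt P * h2 v"
text \<open>A form preserved by the linear flow on the center plane; elsewhere it changes at the
  rate 2 (k2 x1 h1 + k1 x2 h2).\<close>

definition N where "N v = k2 * (cx1 v)\<^sup>2 + k1 * (cx2 v)\<^sup>2"

lemma sq: "sqrt P * sqrt P = P" "sqrt Q * sqrt Q = Q" "sqrt P > 0" "sqrt Q > 0"
  using pos by auto

lemma A0_coords:
  "h1 (A0 v) = P * h2 v" "h2 (A0 v) = Q * h1 v"
  "cx1 (A0 v) = h1 v - k1 * cx2 v" "cx2 (A0 v) = h2 v + k2 * cx1 v"
  by (simp_all add: A0_def h1_def h2_def P_def Q_def b_def algebra_simps power2_eq_square)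

lemma US_A0: "U (A0 v) = lam * U v" "S (A0 v) = - lam * S v"
proof -
  have "U (A0 v) = sqrt Q * (sqrt P * sqrt P) * h2 v + sqrt P * (sqrt Q * sqrt Q) * h1 v"
    "S (A0 v) = sqrt Q * (sqrt P * sqrt P) * h2 v - sqrt P * (sqrt Q * sqrt Q) * h1 v"
    unfolding U_def S_def A0_coords sq by simp_all
  thus "U (A0 v) = lam * U v" "S (A0 v) = - lam * S v"
    by (simp_all add: U_def S_def lam_def algebra_simps)
qed

lemma linear_coords:
  "linear A0" "linear h1" "linear h2" "linear U" "linear S" "linear XX" "linear HH"
  by (auto intro!: linearI phase_eqI simp: A0_def h1_def h2_def U_def S_def XX_def HH_def algebra_simps)

lemma bounded_linear_coords:
  "bounded_linear A0" "bounded_linear h1" "bounded_linear h2" "bounded_linear U" "bounded_linear S"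
  "bounded_linear XX" "bounded_linear HH"
  using linear_coords by (simp_all add: linear_conv_bounded_linear)

lemma norm_XX: "(norm (XX v))\<^sup>2 = (cx1 v)\<^sup>2 + (cx2 v)\<^sup>2"
  and norm_HH: "(norm (HH v))\<^sup>2 = (h1 v)\<^sup>2 + (h2 v)\<^sup>2"
  unfolding power2_norm_eq_inner by (simp_all add: XX_def HH_def power2_eq_square)

lemma abs_le_XX: "\<bar>cx1 v\<bar> \<le> norm (XX v)" "\<bar>cx2 v\<bar> \<le> norm (XX v)"
  and abs_le_HH: "\<bar>h1 v\<bar> \<le> norm (HH v)" "\<bar>h2 v\<bar> \<le> norm (HH v)"
proof -
  have "(cx1 v)\<^sup>2 \<le> (norm (XX v))\<^sup>2" "(cx2 v)\<^sup>2 \<le> (norm (XX v))\<^sup>2"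
    "(h1 v)\<^sup>2 \<le> (norm (HH v))\<^sup>2" "(h2 v)\<^sup>2 \<le> (norm (HH v))\<^sup>2"
    unfolding norm_XX norm_HH by simp_all
  thus "\<bar>cx1 v\<bar> \<le> norm (XX v)" "\<bar>cx2 v\<bar> \<le> norm (XX v)" "\<bar>h1 v\<bar> \<le> norm (HH v)" "\<bar>h2 v\<bar> \<le> norm (HH v)"
    by (metis abs_le_square_iff abs_norm_cancel)+
qed

lemma N_bounds: "k2 * (norm (XX v))\<^sup>2 \<le> N v" "N v \<le> k1 * (norm (XX v))\<^sup>2"
proof -
  have "k2 * (cx2 v)\<^sup>2 \<le> k1 * (cx2 v)\<^sup>2" "k2 * (cx1 v)\<^sup>2 \<le> k1 * (cx1 v)\<^sup>2"
    using pos by (intro mult_right_mono; simp)+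
  thus "k2 * (norm (XX v))\<^sup>2 \<le> N v" "N v \<le> k1 * (norm (XX v))\<^sup>2"
    unfolding norm_XX N_def by (simp_all add: distrib_left)
qed

definition good_const :: "real \<Rightarrow> bool" where
  "good_const C \<longleftrightarrow> C \<ge> 1 \<and> (\<forall>v. norm (A0 v) \<le> C * norm v \<and> \<bar>h1 v\<bar> \<le> C * norm v \<and> \<bar>h2 v\<bar> \<le> C * norm v \<and>
     \<bar>U v\<bar> \<le> C * norm v \<and> \<bar>S v\<bar> \<le> C * norm v \<and> norm (XX v) \<le> C * norm v \<and> norm (HH v) \<le> C * norm v \<and>
     norm v \<le> C * (norm (XX v) + norm (HH v)))"

lemma good_const_exists: "\<exists>C. good_const C"
proof -
  have bl: "\<exists>K. \<forall>v. norm (f v) \<le> K * norm v" if "bounded_linear f" for f :: "phase \<Rightarrow> 'b::real_normed_vector"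
    using bounded_linear.bounded[OF that] by (metis mult.commute)
  obtain K1 where K1: "\<forall>v. norm (A0 v) \<le> K1 * norm v" using bl[OF bounded_linear_coords(1)] by auto
  obtain K2 where K2: "\<forall>v. norm (h1 v) \<le> K2 * norm v" using bl[OF bounded_linear_coords(2)] by auto
  obtain K3 where K3: "\<forall>v. norm (h2 v) \<le> K3 * norm v" using bl[OF bounded_linear_coords(3)] by auto
  obtain K4 where K4: "\<forall>v. norm (U v) \<le> K4 * norm v" using bl[OF bounded_linear_coords(4)] by auto
  obtain K5 where K5: "\<forall>v. norm (S v) \<le> K5 * norm v" using bl[OF bounded_linear_coords(5)] by auto
  obtain K6 where K6: "\<forall>v. norm (XX v) \<le> K6 * norm v" using bl[OF bounded_linear_coords(6)] by auto
  obtain K7 where K7: "\<forall>v. norm (HH v) \<le> K7 * norm v" using bl[OF bounded_linear_coords(7)] by auto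
  define K8 where "K8 = 4 + \<bar>c1 + k1\<bar> + \<bar>c2 - k2\<bar>"
  have K8: "norm v \<le> K8 * (norm (XX v) + norm (HH v))" for v
  proof -
    have tri: "\<bar>x - a * y\<bar> \<le> \<bar>x\<bar> + \<bar>a\<bar> * \<bar>y\<bar>" for x a y :: real
      unfolding abs_mult[symmetric] by (rule abs_triangle_ineq4)
    have y: "\<bar>cy1 v\<bar> \<le> \<bar>h1 v\<bar> + \<bar>c1 + k1\<bar> * \<bar>cx2 v\<bar>" "\<bar>cy2 v\<bar> \<le> \<bar>h2 v\<bar> + \<bar>c2 - k2\<bar> * \<bar>cx1 v\<bar>"
    proof -
      have "cy1 v = h1 v - (c1 + k1) * cx2 v" "cy2 v = h2 v - (c2 - k2) * cx1 v"
        by (simp_all add: h1_def h2_def algebra_simps)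
      thus "\<bar>cy1 v\<bar> \<le> \<bar>h1 v\<bar> + \<bar>c1 + k1\<bar> * \<bar>cx2 v\<bar>" "\<bar>cy2 v\<bar> \<le> \<bar>h2 v\<bar> + \<bar>c2 - k2\<bar> * \<bar>cx1 v\<bar>"
        using tri by metis+
    qed
    have mn: "\<bar>c1 + k1\<bar> * \<bar>cx2 v\<bar> \<le> \<bar>c1 + k1\<bar> * norm (XX v)" "\<bar>c2 - k2\<bar> * \<bar>cx1 v\<bar> \<le> \<bar>c2 - k2\<bar> * norm (XX v)"
      using abs_le_XX[of v] by (intro mult_left_mono; simp)+
    have eq: "K8 * (norm (XX v) + norm (HH v)) = 4 * norm (XX v) + \<bar>c1 + k1\<bar> * norm (XX v) + \<bar>c2 - k2\<bar> * norm (XX v)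
      + 4 * norm (HH v) + (\<bar>c1 + k1\<bar> + \<bar>c2 - k2\<bar>) * norm (HH v)" by (simp add: K8_def algebra_simps)
    have aux: "n \<le> 4 * X + A * X + B * X + 4 * H + R"
      if "n \<le> y1 + y2 + x1 + x2" "x1 \<le> X" "x2 \<le> X" "q1 \<le> H" "q2 \<le> H" "y1 \<le> q1 + A * x2" "y2 \<le> q2 + B * x1"
        "A * x2 \<le> A * X" "B * x1 \<le> B * X" "0 \<le> R" "0 \<le> X" "0 \<le> H"
      for n X A B H R y1 y2 x1 x2 q1 q2 :: real using that by linarith
    show ?thesis unfolding eq
      by (rule aux[OF norm_le_comp abs_le_XX abs_le_HH y mn]) simp_all
  qed
  define C where "C = Max {1, K1, K2, K3, K4, K5, K6, K7, K8}"
  have le: "x \<le> C * n" if "x \<le> K * n" "K \<le> C" "n \<ge> 0" for x K n :: real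
    using that mult_right_mono[of K C n] by linarith
  have Ks: "K1 \<le> C" "K2 \<le> C" "K3 \<le> C" "K4 \<le> C" "K5 \<le> C" "K6 \<le> C" "K7 \<le> C" "K8 \<le> C" "C \<ge> 1"
    unfolding C_def by (rule Max_ge; simp)+
  have "good_const C" unfolding good_const_def
    using le[OF K1[rule_format] Ks(1)] le[OF K2[rule_format] Ks(2)] le[OF K3[rule_format] Ks(3)] le[OF K4[rule_format] Ks(4)]
      le[OF K5[rule_format] Ks(5)] le[OF K6[rule_format] Ks(6)] le[OF K7[rule_format] Ks(7)] le[OF K8 Ks(8)] Ks(9)
    by simp
  thus ?thesis by blast
qed

text \<open>One constant serves for all changes of coordinates. As it depends on c1, c2, k1, k2
  only, it can occur in the smallness assumptions of later locales.\<close>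

definition C where "C = (SOME C. good_const C)"

lemma C: "C \<ge> 1" "norm (A0 v) \<le> C * norm v" "\<bar>h1 v\<bar> \<le> C * norm v" "\<bar>h2 v\<bar> \<le> C * norm v"
  "\<bar>U v\<bar> \<le> C * norm v" "\<bar>S v\<bar> \<le> C * norm v" "norm (XX v) \<le> C * norm v" "norm (HH v) \<le> C * norm v"
  "norm v \<le> C * (norm (XX v) + norm (HH v))"
  using someI_ex[OF good_const_exists, folded C_def] unfolding good_const_def by blast+

definition C1 where "C1 = 1 / (2 * P) + 1 / (2 * Q)"

lemma HH_US: "(norm (HH v))\<^sup>2 \<le> C1 * ((U v)\<^sup>2 + (S v)\<^sup>2)"
proof -
  have "(U v)\<^sup>2 + (S v)\<^sup>2 = 2 * ((sqrt Q * sqrt Q) * (h1 v)\<^sup>2 + (sqrt P * sqrt P) * (h2 v)\<^sup>2)"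
    unfolding U_def S_def by (simp add: power2_eq_square algebra_simps)
  hence us: "(U v)\<^sup>2 + (S v)\<^sup>2 = 2 * (Q * (h1 v)\<^sup>2 + P * (h2 v)\<^sup>2)" unfolding sq .
  have "C1 * ((U v)\<^sup>2 + (S v)\<^sup>2) = (h1 v)\<^sup>2 + (h2 v)\<^sup>2 + (Q / P * (h1 v)\<^sup>2 + P / Q * (h2 v)\<^sup>2)"
    unfolding us C1_def using pos by (simp add: field_simps)
  moreover have "Q / P * (h1 v)\<^sup>2 + P / Q * (h2 v)\<^sup>2 \<ge> 0" using pos by simp
  ultimately show ?thesis unfolding norm_HH by linarith
qed

text \<open>Here \<open>Y\<close> and \<open>Z\<close> are \<open>U v\<close> and \<open>S v\<close>, in this order for the expanding and in the other
  order for the contracting direction.\<close>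

lemma cone_estimate:
  fixes \<kappa> \<epsilon> :: real
  defines "D \<equiv> (k1 + k2) * \<kappa> * (1 / k2 + 3 * C1) + 8 * (1 + k1 + k2) * C ^ 4 * \<epsilon> * (1 / (k2 * \<kappa>\<^sup>2) + 3 * C1)"
  assumes \<kappa>: "0 < \<kappa>" "\<kappa> \<le> 1" and "\<epsilon> \<ge> 0" and D: "D \<le> lam"
    and YZ: "{Y, Z} = {U v, S v}" "{Ye, Ze} = {U e, S e}"
    and e: "norm e \<le> \<epsilon> * norm v" and pos_form: "Y\<^sup>2 - Z\<^sup>2 / 2 - \<kappa>\<^sup>2 * N v > 0"
  shows "2 * lam * Y\<^sup>2 + lam * Z\<^sup>2 - \<bar>2 * \<kappa>\<^sup>2 * (k2 * cx1 v * h1 v + k1 * cx2 v * h2 v)\<bar>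
      - \<bar>2 * Y * Ye - Z * Ze - 2 * \<kappa>\<^sup>2 * (k2 * cx1 v * cx1 e + k1 * cx2 v * cx2 e)\<bar> \<ge> lam * (Y\<^sup>2 - Z\<^sup>2 / 2 - \<kappa>\<^sup>2 * N v)"
proof -
  define n where "n = norm (XX v)"
  define hh where "hh = norm (HH v)"
  have n0: "n \<ge> 0" "hh \<ge> 0" by (simp_all add: n_def hh_def)
  have C1: "C1 > 0" unfolding C1_def using pos by (simp add: add_pos_pos)
  have N0: "N v \<ge> 0" using pos by (simp add: N_def)
  \<comment> \<open>Positivity of the form means that Y dominates Z and the position part, hence by
    \<open>HH_US\<close> also the hyperbolic part. All terms below are therefore measured against
    Y^2.\<close>
  have kN: "0 \<le> \<kappa>\<^sup>2 * N v" using N0 by simp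
  hence Z2: "Z\<^sup>2 \<le> 2 * Y\<^sup>2" using pos_form by linarith
  have kn: "k2 * (\<kappa>\<^sup>2 * n\<^sup>2) \<le> Y\<^sup>2"
  proof -
    have "\<kappa>\<^sup>2 * (k2 * n\<^sup>2) \<le> \<kappa>\<^sup>2 * N v" unfolding n_def by (intro mult_left_mono N_bounds) auto
    also have "\<dots> \<le> Y\<^sup>2" using pos_form zero_le_power2[of Z] by linarith
    finally show ?thesis by (simp add: mult.left_commute)
  qed
  have kn': "\<kappa>\<^sup>2 * n\<^sup>2 \<le> Y\<^sup>2 / k2" "n\<^sup>2 \<le> Y\<^sup>2 / (k2 * \<kappa>\<^sup>2)"
    using kn pos \<kappa> by (simp_all add: field_simps)
  have hY: "hh\<^sup>2 \<le> 3 * C1 * Y\<^sup>2"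
  proof -
    have "(U v)\<^sup>2 + (S v)\<^sup>2 = Y\<^sup>2 + Z\<^sup>2" using YZ(1) by (auto simp: doubleton_eq_iff)
    hence "hh\<^sup>2 \<le> C1 * (Y\<^sup>2 + Z\<^sup>2)" using HH_US[of v] by (simp add: hh_def)
    also have "\<dots> \<le> C1 * (3 * Y\<^sup>2)" using Z2 C1 by (intro mult_left_mono) auto
    finally show ?thesis by simp
  qed
  have xy: "\<bar>k2 * cx1 v * a + k1 * cx2 v * a'\<bar> \<le> (k1 + k2) * n * A" if "\<bar>a\<bar> \<le> A" "\<bar>a'\<bar> \<le> A" for a a' A
  proof -
    have "\<bar>k2 * cx1 v * a\<bar> \<le> k2 * n * A" "\<bar>k1 * cx2 v * a'\<bar> \<le> k1 * n * A"
      unfolding abs_mult using pos that abs_le_XX[of v] n0 by (auto simp: n_def intro!: mult_mono)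
    thus ?thesis by (simp add: algebra_simps abs_le_iff)
  qed
  \<comment> \<open>The position part is bounded only by a multiple of Y / \<kappa>. This uses up
    one of the two factors \<kappa>; the other one makes the term small.\<close>
  have t1: "\<bar>2 * \<kappa>\<^sup>2 * (k2 * cx1 v * h1 v + k1 * cx2 v * h2 v)\<bar> \<le> (k1 + k2) * \<kappa> * (1 / k2 + 3 * C1) * Y\<^sup>2"
  proof -
    have "\<bar>2 * \<kappa>\<^sup>2 * (k2 * cx1 v * h1 v + k1 * cx2 v * h2 v)\<bar> \<le> 2 * \<kappa>\<^sup>2 * ((k1 + k2) * n * hh)"
      unfolding abs_mult[of "2 * \<kappa>\<^sup>2"] using xy[OF abs_le_HH[of v], folded hh_def] by (simp add: mult_left_mono)
    also have "\<dots> = (k1 + k2) * \<kappa> * (2 * (\<kappa> * n) * hh)" by (simp add: power2_eq_square)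
    also have "\<dots> \<le> (k1 + k2) * \<kappa> * ((\<kappa> * n)\<^sup>2 + hh\<^sup>2)"
      using pos \<kappa> by (intro mult_left_mono sum_squares_bound) auto
    also have "\<dots> \<le> (k1 + k2) * \<kappa> * (Y\<^sup>2 / k2 + 3 * C1 * Y\<^sup>2)"
      using pos \<kappa> kn' hY by (intro mult_left_mono add_mono) (auto simp: power_mult_distrib)
    also have "Y\<^sup>2 / k2 + 3 * C1 * Y\<^sup>2 = (1 / k2 + 3 * C1) * Y\<^sup>2" by (simp add: distrib_right)
    finally have "\<bar>2 * \<kappa>\<^sup>2 * (k2 * cx1 v * h1 v + k1 * cx2 v * h2 v)\<bar> \<le> (k1 + k2) * \<kappa> * ((1 / k2 + 3 * C1) * Y\<^sup>2)" .
    also have "\<dots> = (k1 + k2) * \<kappa> * (1 / k2 + 3 * C1) * Y\<^sup>2" by (simp only: mult.assoc)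
    finally show ?thesis .
  qed
  have nv: "(norm v)\<^sup>2 \<le> 2 * C\<^sup>2 * ((1 / (k2 * \<kappa>\<^sup>2) + 3 * C1) * Y\<^sup>2)"
  proof -
    have "(norm v)\<^sup>2 \<le> (C * (n + hh))\<^sup>2" using C(9)[of v] by (intro power_mono) (auto simp: n_def hh_def)
    also have "\<dots> = C\<^sup>2 * (n\<^sup>2 + hh\<^sup>2 + 2 * n * hh)" by (simp add: power2_eq_square algebra_simps)
    also have "\<dots> \<le> C\<^sup>2 * (n\<^sup>2 + hh\<^sup>2 + (n\<^sup>2 + hh\<^sup>2))" by (intro mult_left_mono add_left_mono sum_squares_bound) auto
    also have "\<dots> \<le> C\<^sup>2 * (2 * (Y\<^sup>2 / (k2 * \<kappa>\<^sup>2) + 3 * C1 * Y\<^sup>2))"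
      using kn' hY by (intro mult_left_mono) auto
    also have "Y\<^sup>2 / (k2 * \<kappa>\<^sup>2) + 3 * C1 * Y\<^sup>2 = (1 / (k2 * \<kappa>\<^sup>2) + 3 * C1) * Y\<^sup>2" by (simp add: distrib_right)
    finally show ?thesis by (simp only: mult.assoc mult.left_commute)
  qed
  \<comment> \<open>The error costs a factor 1 / \<kappa>^2, so \<epsilon> has to be chosen after
    \<kappa>.\<close>
  have t2: "\<bar>2 * Y * Ye - Z * Ze - 2 * \<kappa>\<^sup>2 * (k2 * cx1 v * cx1 e + k1 * cx2 v * cx2 e)\<bar>
    \<le> 8 * (1 + k1 + k2) * C ^ 4 * \<epsilon> * (1 / (k2 * \<kappa>\<^sup>2) + 3 * C1) * Y\<^sup>2"
  proof -
    have Cn: "\<bar>Y\<bar> \<le> C * norm v" "\<bar>Z\<bar> \<le> C * norm v" using YZ(1) C(5,6)[of v] by (auto simp: doubleton_eq_iff)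
    have Ce: "\<bar>Ye\<bar> \<le> C * (\<epsilon> * norm v)" "\<bar>Ze\<bar> \<le> C * (\<epsilon> * norm v)"
    proof -
      have "C * norm e \<le> C * (\<epsilon> * norm v)" using C(1) e by (intro mult_left_mono) auto
      thus "\<bar>Ye\<bar> \<le> C * (\<epsilon> * norm v)" "\<bar>Ze\<bar> \<le> C * (\<epsilon> * norm v)"
        using YZ(2) C(5,6)[of e] by (auto simp: doubleton_eq_iff)
    qed
    have "\<bar>Y * Ye\<bar> \<le> C * norm v * (C * (\<epsilon> * norm v))" "\<bar>Z * Ze\<bar> \<le> C * norm v * (C * (\<epsilon> * norm v))"
      unfolding abs_mult using Cn Ce C(1) by (auto intro!: mult_mono)
    moreover have "\<bar>k2 * cx1 v * cx1 e + k1 * cx2 v * cx2 e\<bar> \<le> (k1 + k2) * n * (\<epsilon> * norm v)"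
      using norm_comp_le[of e] e by (intro xy) auto
    moreover have "(k1 + k2) * n * (\<epsilon> * norm v) \<le> (k1 + k2) * (C * norm v) * (\<epsilon> * norm v)"
      using C(7)[of v] pos \<open>\<epsilon> \<ge> 0\<close> by (intro mult_right_mono mult_left_mono) (auto simp: n_def)
    moreover have "\<bar>2 * \<kappa>\<^sup>2 * (k2 * cx1 v * cx1 e + k1 * cx2 v * cx2 e)\<bar> \<le> 2 * \<bar>k2 * cx1 v * cx1 e + k1 * cx2 v * cx2 e\<bar>"
      using mult_right_mono[of "\<kappa>\<^sup>2" 1 "\<bar>k2 * cx1 v * cx1 e + k1 * cx2 v * cx2 e\<bar>"] \<kappa>
      by (simp add: abs_mult power_le_one)
    ultimately have "\<bar>2 * Y * Ye - Z * Ze - 2 * \<kappa>\<^sup>2 * (k2 * cx1 v * cx1 e + k1 * cx2 v * cx2 e)\<bar>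
      \<le> 3 * (C * norm v * (C * (\<epsilon> * norm v))) + 2 * ((k1 + k2) * (C * norm v) * (\<epsilon> * norm v))"
    proof -
      assume a: "\<bar>Y * Ye\<bar> \<le> C * norm v * (C * (\<epsilon> * norm v))" "\<bar>Z * Ze\<bar> \<le> C * norm v * (C * (\<epsilon> * norm v))"
        "\<bar>k2 * cx1 v * cx1 e + k1 * cx2 v * cx2 e\<bar> \<le> (k1 + k2) * n * (\<epsilon> * norm v)"
        "(k1 + k2) * n * (\<epsilon> * norm v) \<le> (k1 + k2) * (C * norm v) * (\<epsilon> * norm v)"
        "\<bar>2 * \<kappa>\<^sup>2 * (k2 * cx1 v * cx1 e + k1 * cx2 v * cx2 e)\<bar> \<le> 2 * \<bar>k2 * cx1 v * cx1 e + k1 * cx2 v * cx2 e\<bar>"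
      have aux: "\<bar>2 * p * p' - q - r\<bar> \<le> 2 * \<bar>p * p'\<bar> + \<bar>q\<bar> + \<bar>r\<bar>" for p p' q r :: real
        unfolding mult.assoc by linarith
      have aux2: "T \<le> 3 * A + 2 * B" if "T \<le> 2 * p + q + r" "p \<le> A" "q \<le> A" "r \<le> 2 * s" "s \<le> s'" "s' \<le> B" for T p q r s s' A B :: real
        using that by linarith
      show ?thesis by (rule aux2[OF aux a(1,2,5,3,4)])
    qed
    also have "\<dots> = (3 * C + 2 * (k1 + k2)) * (C * (\<epsilon> * (norm v)\<^sup>2))"
      by (simp add: power2_eq_square algebra_simps)
    also have "\<dots> \<le> (4 * (1 + k1 + k2) * C) * (C * (\<epsilon> * (norm v)\<^sup>2))"
    proof (intro mult_right_mono)
      have "(k1 + k2) * 1 \<le> (k1 + k2) * C" using pos C(1) by (intro mult_left_mono) auto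
      moreover have "4 * (1 + k1 + k2) * C = 4 * C + 4 * ((k1 + k2) * C)" by (simp add: algebra_simps)
      moreover have "0 \<le> (k1 + k2) * C" using pos C(1) by simp
      ultimately show "3 * C + 2 * (k1 + k2) \<le> 4 * (1 + k1 + k2) * C" using C(1) by linarith
    qed (use C(1) \<open>\<epsilon> \<ge> 0\<close> in auto)
    also have "\<dots> = 4 * (1 + k1 + k2) * C\<^sup>2 * \<epsilon> * (norm v)\<^sup>2" by (simp add: power2_eq_square)
    also have "\<dots> \<le> 4 * (1 + k1 + k2) * C\<^sup>2 * \<epsilon> * (2 * C\<^sup>2 * ((1 / (k2 * \<kappa>\<^sup>2) + 3 * C1) * Y\<^sup>2))"
      using pos \<open>\<epsilon> \<ge> 0\<close> by (intro mult_left_mono nv) auto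
    also have "\<dots> = 8 * (1 + k1 + k2) * C ^ 4 * \<epsilon> * (1 / (k2 * \<kappa>\<^sup>2) + 3 * C1) * Y\<^sup>2"
      by (simp add: power2_eq_square power4_eq_xxxx)
    finally show ?thesis .
  qed
  have "D * Y\<^sup>2 \<le> lam * Y\<^sup>2" using D by (intro mult_right_mono) auto
  hence "(k1 + k2) * \<kappa> * (1 / k2 + 3 * C1) * Y\<^sup>2 + 8 * (1 + k1 + k2) * C ^ 4 * \<epsilon> * (1 / (k2 * \<kappa>\<^sup>2) + 3 * C1) * Y\<^sup>2 \<le> lam * Y\<^sup>2"
    unfolding D_def by (simp add: distrib_right)
  moreover have "lam * (Y\<^sup>2 - Z\<^sup>2 / 2 - \<kappa>\<^sup>2 * N v) \<le> lam * Y\<^sup>2 + lam * Z\<^sup>2"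
  proof -
    have "Y\<^sup>2 - Z\<^sup>2 / 2 - \<kappa>\<^sup>2 * N v \<le> Y\<^sup>2" using kN zero_le_power2[of Z] by linarith
    hence "lam * (Y\<^sup>2 - Z\<^sup>2 / 2 - \<kappa>\<^sup>2 * N v) \<le> lam * Y\<^sup>2" using pos by (intro mult_left_mono) auto
    moreover have "0 \<le> lam * Z\<^sup>2" using pos by simp
    ultimately show ?thesis by linarith
  qed
  ultimately show ?thesis using t1 t2 by linarith
qed

end

section \<open>Bounded solutions of perturbations of the linear model\<close>

lemma om_bound: "\<bar>om v w\<bar> \<le> norm v * norm w"
proof -
  have "om v w = v \<bullet> (cx1 w, cx2 w, - cy1 w, - cy2 w)" by (simp add: om_def inner_phase)
  moreover have "norm (cx1 w, cx2 w, - cy1 w, - cy2 w) = norm w"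
    by (rule power2_eq_imp_eq) (simp_all add: norm_phase)
  ultimately show ?thesis using Cauchy_Schwarz_ineq2[of v "(cx1 w, cx2 w, - cy1 w, - cy2 w)"] by simp
qed

context saddle_center
begin

definition in_cone :: "real \<Rightarrow> phase \<Rightarrow> bool" where
  "in_cone \<eta> v \<longleftrightarrow> norm (HH v) \<le> \<eta> * norm (XX v)"

text \<open>The curves z are later differences of two orbits. Boundedness in both time directions is
  what excludes a dominating unstable or stable part.\<close>

definition cone_prop :: "real \<Rightarrow> real \<Rightarrow> bool" where
  "cone_prop \<epsilon> \<eta> \<longleftrightarrow> (\<forall>z z'. (\<forall>t. (z has_vector_derivative z' t) (at t) \<and> norm (z' t - A0 (z t)) \<le> \<epsilon> * norm (z t)) \<and>
     bounded (range z) \<longrightarrow> (\<forall>t. in_cone \<eta> (z t)))"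

text \<open>If U^2 - S^2 / 2 - \<kappa>^2 N were ever positive, it would grow exponentially; with U
  and S exchanged the same holds backward in time. So both forms are at most 0, and adding them
  bounds U^2 + S^2 by 4 \<kappa>^2 N. The weight 1/2 prevents U and S from cancelling in the
  sum.\<close>

lemma cone_prop_exists:
  assumes "\<eta> > 0"
  shows "\<exists>\<epsilon>0>0. \<forall>\<epsilon>. 0 \<le> \<epsilon> \<and> \<epsilon> \<le> \<epsilon>0 \<longrightarrow> cone_prop \<epsilon> \<eta>"
proof -
  have C1: "C1 > 0" unfolding C1_def using pos by (simp add: add_pos_pos)
  define L where "L = (k1 + k2) * (1 / k2 + 3 * C1)"
  have L: "L > 0" unfolding L_def using pos C1 by (simp add: add_pos_pos)
  \<comment> \<open>The bound with \<eta> gives 4 C1 k1 \<kappa>^2 \<le> \<eta>^2 at the end. The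
    bound with \<open>lam\<close> makes the first part of the loss D at most lam / 2, and \<epsilon>
    \<le> lam / (2 M) does so for the second part.\<close>
  define \<kappa> where "\<kappa> = min 1 (min (\<eta> / (1 + 4 * C1 * k1)) (lam / (2 * L)))"
  have k14: "0 < 4 * C1 * k1" using pos C1 by simp
  have \<kappa>: "0 < \<kappa>" "\<kappa> \<le> 1" "\<kappa> \<le> \<eta> / (1 + 4 * C1 * k1)" "\<kappa> \<le> lam / (2 * L)"
  proof -
    have "1 + 4 * C1 * k1 > 0" using k14 by linarith
    hence "\<eta> / (1 + 4 * C1 * k1) > 0" using assms by (intro divide_pos_pos)
    thus "0 < \<kappa>" "\<kappa> \<le> 1" "\<kappa> \<le> \<eta> / (1 + 4 * C1 * k1)" "\<kappa> \<le> lam / (2 * L)"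
      unfolding \<kappa>_def using pos L by auto
  qed
  have L\<kappa>: "(k1 + k2) * \<kappa> * (1 / k2 + 3 * C1) \<le> lam / 2"
  proof -
    have "L * \<kappa> \<le> L * (lam / (2 * L))" using \<kappa>(4) L by (intro mult_left_mono) auto
    also have "\<dots> = lam / 2" using L by simp
    also have "L * \<kappa> = (k1 + k2) * \<kappa> * (1 / k2 + 3 * C1)" by (simp add: L_def)
    finally show ?thesis .
  qed
  define M where "M = 8 * (1 + k1 + k2) * C ^ 4 * (1 / (k2 * \<kappa>\<^sup>2) + 3 * C1)"
  have M: "M > 0" unfolding M_def using pos C1 C(1) \<kappa>(1) by (intro mult_pos_pos add_pos_pos) auto
  have main: "cone_prop \<epsilon> \<eta>" if \<epsilon>: "0 \<le> \<epsilon>" "\<epsilon> \<le> lam / (2 * M)" for \<epsilon>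
    unfolding cone_prop_def
  proof (intro allI impI, elim conjE)
    fix z z' :: "real \<Rightarrow> phase" and t0
    assume z: "\<forall>t. (z has_vector_derivative z' t) (at t) \<and> norm (z' t - A0 (z t)) \<le> \<epsilon> * norm (z t)"
      and bz: "bounded (range z)"
    obtain Bz where Bz: "\<And>t. norm (z t) \<le> Bz" using bz unfolding bounded_iff by auto
    define e where "e t = z' t - A0 (z t)" for t
    have e: "norm (e t) \<le> \<epsilon> * norm (z t)" for t using z by (simp add: e_def)
    have z'e: "z' t = A0 (z t) + e t" for t by (simp add: e_def)
    have zd: "(z has_vector_derivative z' t) (at t)" for t using z by blast
    have D: "(k1 + k2) * \<kappa> * (1 / k2 + 3 * C1) + 8 * (1 + k1 + k2) * C ^ 4 * \<epsilon> * (1 / (k2 * \<kappa>\<^sup>2) + 3 * C1) \<le> lam"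
    proof -
      have "M * \<epsilon> \<le> M * (lam / (2 * M))" using \<epsilon> M by (intro mult_left_mono) auto
      also have "\<dots> = lam / 2" using M by simp
      also have "M * \<epsilon> = 8 * (1 + k1 + k2) * C ^ 4 * \<epsilon> * (1 / (k2 * \<kappa>\<^sup>2) + 3 * C1)" by (simp add: M_def)
      finally show ?thesis using L\<kappa> by linarith
    qed
    note est = cone_estimate[OF \<kappa>(1,2) \<epsilon>(1) D _ _ e]
    have Uz: "U (z' t) = lam * U (z t) + U (e t)" "S (z' t) = - lam * S (z t) + S (e t)"
      "cx1 (z' t) = h1 (z t) - k1 * cx2 (z t) + cx1 (e t)" "cx2 (z' t) = h2 (z t) + k2 * cx1 (z t) + cx2 (e t)" for t
      unfolding z'e linear_add[OF linear_coords(4)] linear_add[OF linear_coords(5)] US_A0 comp_linear A0_coords by simp_all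
    have dU: "((\<lambda>t. U (z t)) has_real_derivative U (z' t)) (at t)" "((\<lambda>t. S (z t)) has_real_derivative S (z' t)) (at t)" for t
      unfolding has_real_derivative_iff_has_vector_derivative
      by (rule bounded_linear.has_vector_derivative[OF bounded_linear_coords(4) zd],
          rule bounded_linear.has_vector_derivative[OF bounded_linear_coords(5) zd])
    define W where "W t = 2 * \<kappa>\<^sup>2 * (k2 * cx1 (z t) * h1 (z t) + k1 * cx2 (z t) * h2 (z t))" for t
    define E where "E t = 2 * \<kappa>\<^sup>2 * (k2 * cx1 (z t) * cx1 (e t) + k1 * cx2 (z t) * cx2 (e t))" for t
    have dN: "((\<lambda>t. \<kappa>\<^sup>2 * N (z t)) has_real_derivative W t + E t) (at t)" for t
    proof -
      have "((\<lambda>t. \<kappa>\<^sup>2 * N (z t)) has_real_derivative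
        \<kappa>\<^sup>2 * (k2 * (2 * cx1 (z t) * cx1 (z' t)) + k1 * (2 * cx2 (z t) * cx2 (z' t)))) (at t)"
        unfolding N_def by (rule derivative_eq_intros comp_DERIV[OF zd] refl | simp)+
      moreover have "\<kappa>\<^sup>2 * (k2 * (2 * cx1 (z t) * cx1 (z' t)) + k1 * (2 * cx2 (z t) * cx2 (z' t))) = W t + E t"
        unfolding Uz W_def E_def by (simp add: algebra_simps)
      ultimately show ?thesis by simp
    qed
    have NN: "\<kappa>\<^sup>2 * N v \<ge> 0" for v using pos by (simp add: N_def)
    have sqle: "x\<^sup>2 \<le> (C * Bz)\<^sup>2" if "\<bar>x\<bar> \<le> C * norm (z t)" for x t
    proof -
      have "\<bar>x\<bar> \<le> C * Bz" using that mult_left_mono[OF Bz[of t], of C] C(1) by linarith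
      thus ?thesis using power_mono[of "\<bar>x\<bar>" "C * Bz" 2] by simp
    qed
    have a: "(U (z t0))\<^sup>2 - (S (z t0))\<^sup>2 / 2 - \<kappa>\<^sup>2 * N (z t0) \<le> 0"
    proof (rule growth_unbounded[where c = lam and M = "(C * Bz)\<^sup>2" and
        \<phi> = "\<lambda>t. (U (z t))\<^sup>2 - (S (z t))\<^sup>2 / 2 - \<kappa>\<^sup>2 * N (z t)" and
        \<phi>' = "\<lambda>t. 2 * U (z t) * U (z' t) - S (z t) * S (z' t) - (W t + E t)"])
      fix t
      show "((\<lambda>t. (U (z t))\<^sup>2 - (S (z t))\<^sup>2 / 2 - \<kappa>\<^sup>2 * N (z t)) has_real_derivative
          2 * U (z t) * U (z' t) - S (z t) * S (z' t) - (W t + E t)) (at t)"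
        by (rule derivative_eq_intros dU dN refl | simp)+
      show "(U (z t))\<^sup>2 - (S (z t))\<^sup>2 / 2 - \<kappa>\<^sup>2 * N (z t) \<le> (C * Bz)\<^sup>2"
        using sqle[OF C(5)[of "z t"]] NN[of "z t"] zero_le_power2[of "S (z t)"] by linarith
      assume "0 < (U (z t))\<^sup>2 - (S (z t))\<^sup>2 / 2 - \<kappa>\<^sup>2 * N (z t)"
      from est[OF refl refl this]
      have "lam * ((U (z t))\<^sup>2 - (S (z t))\<^sup>2 / 2 - \<kappa>\<^sup>2 * N (z t)) \<le> 2 * lam * (U (z t))\<^sup>2 + lam * (S (z t))\<^sup>2 - \<bar>W t\<bar>
        - \<bar>2 * U (z t) * U (e t) - S (z t) * S (e t) - E t\<bar>" unfolding W_def E_def .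
      also have "\<dots> \<le> 2 * lam * (U (z t))\<^sup>2 + lam * (S (z t))\<^sup>2 - W t + (2 * U (z t) * U (e t) - S (z t) * S (e t) - E t)"
        by linarith
      also have "\<dots> = 2 * U (z t) * U (z' t) - S (z t) * S (z' t) - (W t + E t)"
        unfolding Uz by (simp add: power2_eq_square algebra_simps)
      finally show "lam * ((U (z t))\<^sup>2 - (S (z t))\<^sup>2 / 2 - \<kappa>\<^sup>2 * N (z t)) \<le>
        2 * U (z t) * U (z' t) - S (z t) * S (z' t) - (W t + E t)" .
    qed (use pos in simp)
    have "(\<lambda>t. (S (z (- t)))\<^sup>2 - (U (z (- t)))\<^sup>2 / 2 - \<kappa>\<^sup>2 * N (z (- t))) (- t0) \<le> 0"
    proof (rule growth_unbounded[where c = lam and M = "(C * Bz)\<^sup>2" and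
        \<phi> = "\<lambda>t. (S (z (- t)))\<^sup>2 - (U (z (- t)))\<^sup>2 / 2 - \<kappa>\<^sup>2 * N (z (- t))" and
        \<phi>' = "\<lambda>t. - (2 * S (z (- t)) * S (z' (- t)) - U (z (- t)) * U (z' (- t)) - (W (- t) + E (- t)))"])
      fix t
      have dG: "((\<lambda>t. (S (z t))\<^sup>2 - (U (z t))\<^sup>2 / 2 - \<kappa>\<^sup>2 * N (z t)) has_real_derivative
          2 * S (z t) * S (z' t) - U (z t) * U (z' t) - (W t + E t)) (at t)" for t
        by (rule derivative_eq_intros dU dN refl | simp)+
      show "((\<lambda>t. (S (z (- t)))\<^sup>2 - (U (z (- t)))\<^sup>2 / 2 - \<kappa>\<^sup>2 * N (z (- t))) has_real_derivative
          - (2 * S (z (- t)) * S (z' (- t)) - U (z (- t)) * U (z' (- t)) - (W (- t) + E (- t)))) (at t)"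
        using dG[of "- t"] DERIV_mirror[of "\<lambda>t. (S (z t))\<^sup>2 - (U (z t))\<^sup>2 / 2 - \<kappa>\<^sup>2 * N (z t)"] by blast
      show "(S (z (- t)))\<^sup>2 - (U (z (- t)))\<^sup>2 / 2 - \<kappa>\<^sup>2 * N (z (- t)) \<le> (C * Bz)\<^sup>2"
        using sqle[OF C(6)[of "z (- t)"]] NN[of "z (- t)"] zero_le_power2[of "U (z (- t))"] by linarith
      define s where "s = - t"
      assume "0 < (S (z (- t)))\<^sup>2 - (U (z (- t)))\<^sup>2 / 2 - \<kappa>\<^sup>2 * N (z (- t))"
      hence "0 < (S (z s))\<^sup>2 - (U (z s))\<^sup>2 / 2 - \<kappa>\<^sup>2 * N (z s)" unfolding s_def .
      from est[OF insert_commute insert_commute this]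
      have "lam * ((S (z s))\<^sup>2 - (U (z s))\<^sup>2 / 2 - \<kappa>\<^sup>2 * N (z s)) \<le> 2 * lam * (S (z s))\<^sup>2 + lam * (U (z s))\<^sup>2 - \<bar>W s\<bar>
        - \<bar>2 * S (z s) * S (e s) - U (z s) * U (e s) - E s\<bar>" unfolding W_def E_def .
      also have "\<dots> \<le> 2 * lam * (S (z s))\<^sup>2 + lam * (U (z s))\<^sup>2 + W s - (2 * S (z s) * S (e s) - U (z s) * U (e s) - E s)"
        by linarith
      also have "\<dots> = - (2 * S (z s) * S (z' s) - U (z s) * U (z' s) - (W s + E s))"
        unfolding Uz by (simp add: power2_eq_square algebra_simps)
      finally show "lam * ((S (z (- t)))\<^sup>2 - (U (z (- t)))\<^sup>2 / 2 - \<kappa>\<^sup>2 * N (z (- t))) \<le>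
        - (2 * S (z (- t)) * S (z' (- t)) - U (z (- t)) * U (z' (- t)) - (W (- t) + E (- t)))" unfolding s_def .
    qed (use pos in simp)
    hence b: "(S (z t0))\<^sup>2 - (U (z t0))\<^sup>2 / 2 - \<kappa>\<^sup>2 * N (z t0) \<le> 0" by simp
    have "(norm (HH (z t0)))\<^sup>2 \<le> C1 * ((U (z t0))\<^sup>2 + (S (z t0))\<^sup>2)" by (rule HH_US)
    also have "\<dots> \<le> C1 * (4 * (\<kappa>\<^sup>2 * N (z t0)))" using a b C1 by (intro mult_left_mono) auto
    also have "\<dots> \<le> C1 * (4 * (\<kappa>\<^sup>2 * (k1 * (norm (XX (z t0)))\<^sup>2)))"
      using C1 by (intro mult_left_mono N_bounds) auto
    also have "\<dots> = (4 * C1 * k1) * \<kappa>\<^sup>2 * (norm (XX (z t0)))\<^sup>2" by simp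
    also have "\<dots> \<le> \<eta>\<^sup>2 * (norm (XX (z t0)))\<^sup>2"
    proof (intro mult_right_mono)
      have "\<kappa> * (1 + 4 * C1 * k1) \<le> \<eta>" using \<kappa>(3) k14 pos_le_divide_eq[of "1 + 4 * C1 * k1" \<kappa> \<eta>] by linarith
      hence "(\<kappa> * (1 + 4 * C1 * k1))\<^sup>2 \<le> \<eta>\<^sup>2" using \<kappa>(1) k14 by (intro power_mono) auto
      moreover have "(4 * C1 * k1) * \<kappa>\<^sup>2 \<le> (1 + 4 * C1 * k1)\<^sup>2 * \<kappa>\<^sup>2"
      proof (intro mult_right_mono)
        show "4 * C1 * k1 \<le> (1 + 4 * C1 * k1)\<^sup>2"
          using k14 zero_le_power2[of "4 * C1 * k1"] unfolding power2_sum by simp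
      qed simp
      ultimately show "(4 * C1 * k1) * \<kappa>\<^sup>2 \<le> \<eta>\<^sup>2" by (simp add: power_mult_distrib mult.commute)
    qed simp
    finally have "(norm (HH (z t0)))\<^sup>2 \<le> (\<eta> * norm (XX (z t0)))\<^sup>2" by (simp add: power_mult_distrib)
    thus "in_cone \<eta> (z t0)" unfolding in_cone_def
      by (rule power2_le_imp_le) (use assms in simp)
  qed
  show ?thesis
    by (rule exI[of _ "lam / (2 * M)"]) (use main pos M in auto)
qed

end

section \<open>Orbits that stay near a saddle-center\<close>

context saddle_center
begin

text \<open>For \<open>v\<close> in the hyperbolic plane, the coordinates \<open>(a, b)\<close> along an orbit in the center plane pair
  with \<open>(rho1 * x2, - rho2 * x1)\<close> to \<open>h1 v\<close> times a positive quantity. So the orbit is measured by the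
  angle of \<open>(rho2 * x1, rho1 * x2)\<close>; \<open>om1\<close> and \<open>om2\<close> bound its speed.\<close>

definition Aa where "Aa = k1 + c1"
definition Bb where "Bb = c2 - k2"
definition rho1 where "rho1 = k1 * m"
definition rho2 where "rho2 = k2 * (1 + Aa\<^sup>2)"
definition om1 where "om1 = rho1 * rho2 * (k2 / 2) / (rho1 + rho2)\<^sup>2"
definition om2 where "om2 = rho1 * rho2 * (2 * k1) / (min rho1 rho2)\<^sup>2"

lemma rho_pos: "rho1 > 0" "rho2 > 0" "om1 > 0" "om2 > 0"
proof -
  show r: "rho1 > 0" "rho2 > 0" using pos by (auto simp: rho1_def rho2_def intro!: mult_pos_pos add_pos_nonneg)
  show "om1 > 0" "om2 > 0" using r pos by (auto simp: om1_def om2_def intro!: divide_pos_pos mult_pos_pos)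
qed

text \<open>The Hessian of the energy at the saddle-center in adapted coordinates. On the center
  plane only the first term survives, m times the polar form of \<open>N\<close>, which is positive
  definite.\<close>

lemma om_A0: "om d (A0 z) = m * (k2 * (cx1 z * cx1 d) + k1 * (cx2 z * cx2 d)) + (h1 z * h1 d + h2 z * h2 d)
   - k1 * (h1 z * cx2 d + cx2 z * h1 d) + k2 * (h2 z * cx1 d + cx1 z * h2 d)"
  unfolding om_def A0_def h1_def h2_def P_def Q_def m_def b_def comp_simps by algebra

end

text \<open>On the convex set B the vector field is \<epsilon>-close to the linear model, and Se is
  the equilibrium for the current parameters. \<open>small1\<close> makes the energy monotone along
  rays inside the cone, \<open>small2\<close> gives orbits a positive angular speed.\<close>

locale local_magnetic = saddle_center c1 c2 k1 k2 + magnetic A1 A1' A1'' A2 A2' A2'' V V1 V2 V11 V12 V22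
  for c1 c2 k1 k2 A1 A1' A1'' A2 A2' A2'' V V1 V2 V11 V12 V22 +
  fixes B :: "phase set" and Se :: phase and \<epsilon> \<eta> :: real
  assumes B: "convex B" "bounded B" and Se: "Se \<in> B" "XF Se = 0"
    and \<epsilon>: "\<epsilon> \<ge> 0" and near: "\<And>z v. z \<in> B \<Longrightarrow> norm (DX z v - A0 v) \<le> \<epsilon> * norm v"
    and cone: "cone_prop \<epsilon> \<eta>" and \<eta>: "0 \<le> \<eta>" "\<eta> \<le> 1"
    and small1: "(1 + 2 * k1 + 2 * k2) * \<eta> + 4 * C\<^sup>2 * \<epsilon> < m * k2"
    and small2: "2 * \<eta> + 4 * C * \<epsilon> \<le> k2 / 2"
begin

text \<open>By the mean value inequality the difference of any two orbits in B solves the linear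
  equation up to the relative error \<epsilon>. This is the form that \<open>cone_prop\<close> takes
  as input, and it needs no equilibrium.\<close>

lemma XF_diff:
  assumes "z \<in> B" "z' \<in> B"
  shows "norm (XF z' - XF z - A0 (z' - z)) \<le> \<epsilon> * norm (z' - z)"
proof -
  have "norm ((\<lambda>z. XF z - A0 z) z' - (\<lambda>z. XF z - A0 z) z) \<le> \<epsilon> * norm (z' - z)"
  proof (rule differentiable_bound[where f' = "\<lambda>z v. DX z v - A0 v" and S = B])
    fix z assume "z \<in> B"
    show "((\<lambda>z. XF z - A0 z) has_derivative (\<lambda>v. DX z v - A0 v)) (at z within B)"
      by (intro has_derivative_diff has_derivative_at_withinI[OF XF_has_derivative]
          bounded_linear_imp_has_derivative bounded_linear_coords)
    show "onorm (\<lambda>v. DX z v - A0 v) \<le> \<epsilon>"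
      by (rule onorm_bound[OF \<epsilon>]) (rule near[OF \<open>z \<in> B\<close>])
  qed (use assms B in auto)
  thus ?thesis by (simp add: linear_diff[OF linear_coords(1)] algebra_simps)
qed

lemma XF_Se: "z \<in> B \<Longrightarrow> norm (XF z - A0 (z - Se)) \<le> \<epsilon> * norm (z - Se)"
  using XF_diff[OF Se(1)] Se(2) by simp

lemma XF_lipschitz:
  assumes "z \<in> B" "z' \<in> B"
  shows "norm (XF z' - XF z) \<le> (C + \<epsilon>) * norm (z' - z)"
  using XF_diff[OF assms] C(2)[of "z' - z"] norm_triangle_ineq2[of "XF z' - XF z" "A0 (z' - z)"]
  by (simp add: distrib_right)

section \<open>Orbits that stay in the ball: cone condition and energy along rays\<close>

definition flows :: "(real \<Rightarrow> phase) \<Rightarrow> bool" where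
  "flows \<gamma> \<longleftrightarrow> (\<forall>t. (\<gamma> has_vector_derivative XF (\<gamma> t)) (at t)) \<and> (\<forall>t. \<gamma> t \<in> B)"

lemma flows_Se: "flows (\<lambda>_. Se)"
  using Se by (simp add: flows_def)

lemma flows_shift: "flows \<gamma> \<Longrightarrow> flows (\<lambda>t. \<gamma> (t + s))"
  by (auto simp: flows_def intro!: has_vector_derivative_shift)

lemma flows_cone:
  assumes "flows \<gamma>" "flows \<gamma>'"
  shows "in_cone \<eta> (\<gamma>' t - \<gamma> t)"
proof -
  have "\<forall>t. ((\<lambda>t. \<gamma>' t - \<gamma> t) has_vector_derivative XF (\<gamma>' t) - XF (\<gamma> t)) (at t) \<and>
     norm (XF (\<gamma>' t) - XF (\<gamma> t) - A0 (\<gamma>' t - \<gamma> t)) \<le> \<epsilon> * norm (\<gamma>' t - \<gamma> t)"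
    using assms XF_diff by (auto simp: flows_def intro!: has_vector_derivative_diff)
  moreover have "bounded (range (\<lambda>t. \<gamma>' t - \<gamma> t))"
  proof -
    obtain K where K: "\<And>z. z \<in> B \<Longrightarrow> norm z \<le> K" using B(2) by (auto simp: bounded_iff)
    have "norm (\<gamma>' t - \<gamma> t) \<le> K + K" for t
      using norm_triangle_ineq4[of "\<gamma>' t" "\<gamma> t"] K[of "\<gamma> t"] K[of "\<gamma>' t"] assms by (force simp: flows_def)
    thus ?thesis unfolding bounded_iff by auto
  qed
  ultimately have "(\<forall>t. ((\<lambda>t. \<gamma>' t - \<gamma> t) has_vector_derivative XF (\<gamma>' t) - XF (\<gamma> t)) (at t) \<and>
     norm (XF (\<gamma>' t) - XF (\<gamma> t) - A0 (\<gamma>' t - \<gamma> t)) \<le> \<epsilon> * norm (\<gamma>' t - \<gamma> t)) \<and> bounded (range (\<lambda>t. \<gamma>' t - \<gamma> t))"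
    by blast
  from cone[unfolded cone_prop_def, THEN spec, THEN spec, THEN mp, OF this] show ?thesis by blast
qed

lemma flows_cone_Se: "flows \<gamma> \<Longrightarrow> in_cone \<eta> (\<gamma> t - Se)"
  using flows_cone[OF flows_Se] .

lemma flows_unique:
  assumes "flows \<gamma>" "flows \<gamma>'" "\<gamma> s = \<gamma>' s"
  shows "\<gamma> t = \<gamma>' t"
proof -
  have "((\<lambda>t. \<gamma>' t - \<gamma> t) has_vector_derivative XF (\<gamma>' t) - XF (\<gamma> t)) (at t)"
    "norm (XF (\<gamma>' t) - XF (\<gamma> t)) \<le> (C + \<epsilon>) * norm (\<gamma>' t - \<gamma> t)" for t
    using assms by (auto simp: flows_def intro!: has_vector_derivative_diff XF_lipschitz)
  from gronwall_unique[OF _ this, of s t] C(1) \<epsilon> assms(3) show ?thesis by simp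
qed

lemma cone_norm: "in_cone \<eta> v \<Longrightarrow> norm v \<le> 2 * C * norm (XX v)"
proof -
  assume "in_cone \<eta> v"
  hence "norm (HH v) \<le> 1 * norm (XX v)" unfolding in_cone_def using \<eta> mult_right_mono[of \<eta> 1 "norm (XX v)"] by simp
  hence "C * (norm (XX v) + norm (HH v)) \<le> C * (2 * norm (XX v))" using C(1) by (intro mult_left_mono) auto
  thus ?thesis using C(9)[of v] by simp
qed

text \<open>On a common ray the main term of \<open>om_A0\<close> is at least m k2 times the product
  of the position norms. In the cone the terms with h1 and h2 are of order \<eta>, the nonlinear
  part is of order \<epsilon>, and \<open>small1\<close> compares the sum of these losses with m
  k2.\<close>

lemma hess_positive:
  assumes z: "Se + z \<in> B" and cone: "in_cone \<eta> z" "in_cone \<eta> d" and ray: "XX z = s *\<^sub>R XX d" "s > 0" "XX d \<noteq> 0"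
  shows "d \<bullet> gradF (Se + z) > 0"
proof -
  define n where "n = norm (XX z)"
  define n' where "n' = norm (XX d)"
  have n': "n' > 0" using ray by (simp add: n'_def)
  have n: "n = s * n'" using ray by (simp add: n_def n'_def)
  hence n0: "n > 0" using n' ray by simp
  have hz: "\<bar>h1 z\<bar> \<le> \<eta> * n" "\<bar>h2 z\<bar> \<le> \<eta> * n" "\<bar>h1 d\<bar> \<le> \<eta> * n'" "\<bar>h2 d\<bar> \<le> \<eta> * n'"
    using abs_le_HH[of z] abs_le_HH[of d] cone by (auto simp: in_cone_def n_def n'_def)
  have xz: "\<bar>cx1 z\<bar> \<le> n" "\<bar>cx2 z\<bar> \<le> n" "\<bar>cx1 d\<bar> \<le> n'" "\<bar>cx2 d\<bar> \<le> n'"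
    using abs_le_XX[of z] abs_le_XX[of d] by (auto simp: n_def n'_def)
  define e where "e = XF (Se + z) - A0 z"
  have e: "norm e \<le> \<epsilon> * norm z" using XF_Se[OF z] by (simp add: e_def)
  have "d \<bullet> gradF (Se + z) = om d (A0 z + e)" by (simp add: om_XF e_def)
  also have "\<dots> = om d (A0 z) + om d e" by (simp add: om_def algebra_simps)
  finally have eq: "d \<bullet> gradF (Se + z) = om d (A0 z) + om d e" .
  have main: "k2 * (cx1 z * cx1 d) + k1 * (cx2 z * cx2 d) \<ge> k2 * (n * n')"
  proof -
    have "cx1 z = s * cx1 d" "cx2 z = s * cx2 d" using ray(1) by (auto simp: XX_def)
    hence "k2 * (cx1 z * cx1 d) + k1 * (cx2 z * cx2 d) = s * N d" by (simp add: N_def power2_eq_square algebra_simps)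
    also have "\<dots> \<ge> s * (k2 * n'\<^sup>2)" using N_bounds(1)[of d] ray by (intro mult_left_mono) (auto simp: n'_def)
    finally show ?thesis by (simp add: n power2_eq_square algebra_simps)
  qed
  have p: "\<bar>x * y\<bar> \<le> X * Y" if "\<bar>x\<bar> \<le> X" "\<bar>y\<bar> \<le> Y" for x y X Y :: real
    unfolding abs_mult using that by (intro mult_mono) auto
  have r1: "\<bar>h1 z * h1 d + h2 z * h2 d\<bar> \<le> \<eta> * (n * n')"
  proof -
    have "h1 z * h1 d + h2 z * h2 d = HH z \<bullet> HH d" by (simp add: HH_def)
    hence "\<bar>h1 z * h1 d + h2 z * h2 d\<bar> \<le> norm (HH z) * norm (HH d)" using Cauchy_Schwarz_ineq2 by metis
    also have "\<dots> \<le> (\<eta> * n) * (\<eta> * n')" using cone by (intro mult_mono) (auto simp: in_cone_def n_def n'_def \<eta>)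
    also have "\<dots> = \<eta> * (\<eta> * (n * n'))" by simp
    also have "\<dots> \<le> \<eta> * (1 * (n * n'))" using \<eta> n0 n' by (intro mult_left_mono mult_right_mono) auto
    finally show ?thesis by simp
  qed
  have r2: "\<bar>k1 * (h1 z * cx2 d + cx2 z * h1 d)\<bar> \<le> k1 * (2 * (\<eta> * (n * n')))"
  proof -
    have "\<bar>h1 z * cx2 d\<bar> \<le> \<eta> * (n * n')" using p[OF hz(1) xz(4)] by (simp add: mult.assoc)
    moreover have "\<bar>cx2 z * h1 d\<bar> \<le> \<eta> * (n * n')" using p[OF xz(2) hz(3)] by (simp add: mult.left_commute)
    ultimately have "\<bar>h1 z * cx2 d + cx2 z * h1 d\<bar> \<le> 2 * (\<eta> * (n * n'))"
      using abs_triangle_ineq[of "h1 z * cx2 d" "cx2 z * h1 d"] by linarith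
    thus ?thesis unfolding abs_mult[of k1] using pos by (simp add: mult_left_mono)
  qed
  have r3: "\<bar>k2 * (h2 z * cx1 d + cx1 z * h2 d)\<bar> \<le> k2 * (2 * (\<eta> * (n * n')))"
  proof -
    have "\<bar>h2 z * cx1 d\<bar> \<le> \<eta> * (n * n')" using p[OF hz(2) xz(3)] by (simp add: mult.assoc)
    moreover have "\<bar>cx1 z * h2 d\<bar> \<le> \<eta> * (n * n')" using p[OF xz(1) hz(4)] by (simp add: mult.left_commute)
    ultimately have "\<bar>h2 z * cx1 d + cx1 z * h2 d\<bar> \<le> 2 * (\<eta> * (n * n'))"
      using abs_triangle_ineq[of "h2 z * cx1 d" "cx1 z * h2 d"] by linarith
    thus ?thesis unfolding abs_mult[of k2] using pos by (simp add: mult_left_mono)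
  qed
  have r4: "\<bar>om d e\<bar> \<le> 4 * C\<^sup>2 * \<epsilon> * (n * n')"
  proof -
    have "\<bar>om d e\<bar> \<le> norm d * norm e" by (rule om_bound)
    also have "\<dots> \<le> (2 * C * n') * (\<epsilon> * (2 * C * n))"
      using cone_norm[OF cone(2)] order_trans[OF e mult_left_mono[OF cone_norm[OF cone(1)] \<epsilon>]]
      C(1) n' by (intro mult_mono) (auto simp: n_def n'_def)
    finally show ?thesis by (simp add: power2_eq_square mult.assoc mult.left_commute mult.commute)
  qed
  have "m * (k2 * (n * n')) - ((1 + 2 * k1 + 2 * k2) * \<eta> + 4 * C\<^sup>2 * \<epsilon>) * (n * n') \<le> om d (A0 z) + om d e"
  proof -
    have "m * (k2 * (n * n')) \<le> m * (k2 * (cx1 z * cx1 d) + k1 * (cx2 z * cx2 d))"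
      using main pos by (intro mult_left_mono) auto
    moreover have "((1 + 2 * k1 + 2 * k2) * \<eta> + 4 * C\<^sup>2 * \<epsilon>) * (n * n') =
      \<eta> * (n * n') + k1 * (2 * (\<eta> * (n * n'))) + k2 * (2 * (\<eta> * (n * n'))) + 4 * C\<^sup>2 * \<epsilon> * (n * n')"
      by (simp add: algebra_simps)
    ultimately show ?thesis unfolding om_A0 using r1 r2 r3 r4 by linarith
  qed
  moreover have "((1 + 2 * k1 + 2 * k2) * \<eta> + 4 * C\<^sup>2 * \<epsilon>) * (n * n') < m * k2 * (n * n')"
    using small1 n0 n' by (intro mult_strict_right_mono) auto
  ultimately show ?thesis unfolding eq by (simp add: mult.assoc)
qed

text \<open>The cone is not convex in general. It contains the segment because the position parts
  are parallel with nonnegative factors, so that their norms add; hence \<open>hess_positive\<close>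
  applies along the whole segment.\<close>

lemma energy_increase:
  assumes z: "z \<in> B" "z' \<in> B" and cone: "in_cone \<eta> (z - Se)" "in_cone \<eta> (z' - z)"
    and ray: "XX (z - Se) = s *\<^sub>R XX (z' - z)" "s \<ge> 0" "XX (z' - z) \<noteq> 0"
  shows "F z < F z'"
proof -
  define d where "d = z' - z"
  have "(\<lambda>\<theta>. F (z + \<theta> *\<^sub>R d)) 0 < (\<lambda>\<theta>. F (z + \<theta> *\<^sub>R d)) 1"
  proof (rule DERIV_pos_imp_increasing_open[where f = "\<lambda>\<theta>. F (z + \<theta> *\<^sub>R d)"])
    have DER: "((\<lambda>\<theta>. F (z + \<theta> *\<^sub>R d)) has_real_derivative d \<bullet> gradF (z + \<theta> *\<^sub>R d)) (at \<theta>)" for \<theta>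
    proof -
      have "((\<lambda>\<theta>. z + \<theta> *\<^sub>R d) has_derivative (\<lambda>h. h *\<^sub>R d)) (at \<theta>)" by (auto intro!: derivative_eq_intros)
      from has_derivative_compose[OF this F_has_derivative] show ?thesis
        by (simp add: has_field_derivative_def mult_commute_abs)
    qed
    show "continuous_on {0..1} (\<lambda>\<theta>. F (z + \<theta> *\<^sub>R d))"
      using DER by (auto intro!: continuous_at_imp_continuous_on DERIV_isCont)
    fix \<theta> :: real assume \<theta>: "0 < \<theta>" "\<theta> < 1"
    define \<zeta> where "\<zeta> = z - Se + \<theta> *\<^sub>R d"
    have lin: "XX \<zeta> = XX (z - Se) + \<theta> *\<^sub>R XX d" "HH \<zeta> = HH (z - Se) + \<theta> *\<^sub>R HH d"
      unfolding \<zeta>_def using linear_coords(6,7) by (simp_all add: linear_add linear_cmul)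
    have "d \<bullet> gradF (Se + \<zeta>) > 0"
    proof (rule hess_positive)
      have "Se + \<zeta> = (1 - \<theta>) *\<^sub>R z + \<theta> *\<^sub>R z'" by (simp add: \<zeta>_def d_def algebra_simps)
      thus "Se + \<zeta> \<in> B" using B(1) z \<theta> by (simp add: convex_alt)
      show X: "XX \<zeta> = (s + \<theta>) *\<^sub>R XX d" using lin ray by (simp add: d_def scaleR_left_distrib)
      have "norm (HH \<zeta>) \<le> norm (HH (z - Se)) + \<theta> * norm (HH d)"
        unfolding lin using norm_triangle_ineq[of "HH (z - Se)" "\<theta> *\<^sub>R HH d"] \<theta> by simp
      also have "\<dots> \<le> \<eta> * (s * norm (XX d)) + \<theta> * (\<eta> * norm (XX d))"
        using cone ray \<theta> by (intro add_mono mult_left_mono) (auto simp: in_cone_def d_def)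
      also have "\<dots> = \<eta> * norm (XX \<zeta>)" unfolding X norm_scaleR using ray(2) \<theta> by (simp add: distrib_left distrib_right)
      finally show "in_cone \<eta> \<zeta>" by (simp add: in_cone_def)
      show "in_cone \<eta> d" using cone by (simp add: d_def)
    qed (use \<theta> ray in \<open>auto simp: d_def\<close>)
    moreover have "Se + \<zeta> = z + \<theta> *\<^sub>R d" by (simp add: \<zeta>_def)
    ultimately show "\<exists>y. ((\<lambda>\<theta>. F (z + \<theta> *\<^sub>R d)) has_real_derivative y) (at \<theta>) \<and> y > 0"
      using DER by auto
  qed simp
  thus ?thesis by (simp add: d_def)
qed

lemma XX_zero: "in_cone \<eta> v \<Longrightarrow> XX v = 0 \<Longrightarrow> v = 0"
  using cone_norm[of v] by simp

text \<open>If the positions differ, the farther point has the larger energy. If they agree, the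
  difference lies in the cone with vanishing position part and is 0.\<close>

lemma ray_unique:
  assumes \<gamma>: "flows \<gamma>" "flows \<gamma>'" and F: "F (\<gamma> 0) = F (\<gamma>' 0)"
    and ray: "XX (\<gamma>' 0 - Se) = s *\<^sub>R XX (\<gamma> 0 - Se)" "s > 0" "XX (\<gamma> 0 - Se) \<noteq> 0"
  shows "\<gamma> 0 = \<gamma>' 0"
proof -
  have key: "\<gamma> 0 = \<gamma>' 0" if \<gamma>: "flows \<gamma>" "flows \<gamma>'" and F: "F (\<gamma> 0) = F (\<gamma>' 0)"
    and ray: "XX (\<gamma>' 0 - Se) = s *\<^sub>R XX (\<gamma> 0 - Se)" "s \<ge> 1" "XX (\<gamma> 0 - Se) \<noteq> 0" for \<gamma> \<gamma>' s
  proof -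
    have d: "XX (\<gamma>' 0 - \<gamma> 0) = (s - 1) *\<^sub>R XX (\<gamma> 0 - Se)"
    proof -
      have "XX (\<gamma>' 0 - \<gamma> 0) = XX ((\<gamma>' 0 - Se) - (\<gamma> 0 - Se))" by simp
      also have "\<dots> = XX (\<gamma>' 0 - Se) - XX (\<gamma> 0 - Se)" by (rule linear_diff[OF linear_coords(6)])
      finally show ?thesis using ray by (simp add: scaleR_left_diff_distrib)
    qed
    show ?thesis
    proof (cases "s = 1")
      case True
      hence "XX (\<gamma>' 0 - \<gamma> 0) = 0" using d by simp
      from XX_zero[OF flows_cone[OF \<gamma>] this] show ?thesis by simp
    next
      case False
      have "F (\<gamma> 0) < F (\<gamma>' 0)"
      proof (rule energy_increase)
        show "XX (\<gamma> 0 - Se) = (1 / (s - 1)) *\<^sub>R XX (\<gamma>' 0 - \<gamma> 0)" using d False by simp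
        show "XX (\<gamma>' 0 - \<gamma> 0) \<noteq> 0" using d False ray by simp
      qed (use \<gamma> flows_cone flows_cone_Se ray in \<open>auto simp: flows_def\<close>)
      thus ?thesis using F by simp
    qed
  qed
  show ?thesis
  proof (cases "s \<ge> 1")
    case True
    from key[OF \<gamma> F ray(1) True ray(3)] show ?thesis .
  next
    case False
    have "XX (\<gamma> 0 - Se) = (1 / s) *\<^sub>R XX (\<gamma>' 0 - Se)" "1 / s \<ge> 1" "XX (\<gamma>' 0 - Se) \<noteq> 0"
      using ray False by auto
    from key[OF \<gamma>(2,1) F[symmetric] this] show ?thesis by simp
  qed
qed

text \<open>The degenerate ray that starts at the equilibrium itself. This is later the reason why
  orbits near the saddle-center occur only above L1 \<mu>.\<close>

lemma equilibrium_energy: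
  assumes "flows \<gamma>" "\<gamma> 0 \<noteq> Se"
  shows "F Se < F (\<gamma> 0)"
proof (rule energy_increase[where s = 0])
  show "in_cone \<eta> (Se - Se)" by (simp add: in_cone_def XX_def HH_def h1_def h2_def)
  show "XX (\<gamma> 0 - Se) \<noteq> 0" using XX_zero[OF flows_cone_Se[OF assms(1)]] assms(2) by auto
  show "XX (Se - Se) = 0 *\<^sub>R XX (\<gamma> 0 - Se)" by (simp add: XX_def zero_prod_def)
qed (use assms Se flows_cone_Se in \<open>auto simp: flows_def\<close>)

lemma flows_magnetic_orbit:
  assumes "flows \<gamma>" "\<exists>t. \<gamma> t \<noteq> \<gamma> 0"
  shows "magnetic_orbit A1 A1' A1'' A2 A2' A2'' V V1 V2 V11 V12 V22 \<gamma>"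
proof
  show "(\<gamma> has_vector_derivative XF (\<gamma> t)) (at t)" for t using assms by (simp add: flows_def)
  have "norm (DX (\<gamma> t) v) \<le> (C + \<epsilon>) * norm v" for t v
    using near[of "\<gamma> t" v] C(2)[of v] norm_triangle_ineq2[of "DX (\<gamma> t) v" "A0 v"] assms(1)
    by (auto simp: flows_def distrib_right)
  thus "\<exists>L\<ge>0. \<forall>t v. norm (DX (\<gamma> t) v) \<le> L * norm v" using C(1) \<epsilon> by (intro exI[of _ "C + \<epsilon>"]) auto
qed fact

section \<open>The angle along an orbit and its period\<close>

lemma flows_ne_Se: "flows \<gamma> \<Longrightarrow> \<exists>t. \<gamma> t \<noteq> \<gamma> 0 \<Longrightarrow> \<gamma> t \<noteq> Se"
  using flows_unique[OF _ flows_Se] by metis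

text \<open>The same weighted angle serves twice: to find the period, and as the comparison angle in
  the index computation, for which its weights are chosen.\<close>

definition angular :: "(real \<Rightarrow> phase) \<Rightarrow> (real \<Rightarrow> real) \<Rightarrow> bool" where
  "angular \<gamma> \<phi> \<longleftrightarrow> (\<forall>t. \<exists>d. (\<phi> has_real_derivative d) (at t) \<and> om1 \<le> d \<and> d \<le> om2) \<and>
    (\<forall>t. \<exists>R>0. rho2 * cx1 (\<gamma> t - Se) = R * cos (\<phi> t) \<and> rho1 * cx2 (\<gamma> t - Se) = R * sin (\<phi> t))"

text \<open>The cross product of position and velocity is \<open>N\<close>, between k2 n^2 and k1
  n^2, up to an error that \<open>small2\<close> bounds by k2 n^2 / 2. This is the origin of k2 / 2
  and 2 * k1 in \<open>om1\<close> and \<open>om2\<close>.\<close>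

lemma angular_exists:
  assumes \<gamma>: "flows \<gamma>" "\<exists>t. \<gamma> t \<noteq> \<gamma> 0"
  shows "\<exists>\<phi>. angular \<gamma> \<phi>"
proof -
  define z where "z t = \<gamma> t - Se" for t
  define z' where "z' t = XF (\<gamma> t)" for t
  have zd: "(z has_vector_derivative z' t) (at t)" for t
    using \<gamma>(1) unfolding z_def z'_def flows_def by (auto intro!: derivative_eq_intros)
  have cz: "in_cone \<eta> (z t)" for t unfolding z_def by (rule flows_cone_Se[OF \<gamma>(1)])
  have znz: "z t \<noteq> 0" for t using flows_ne_Se[OF \<gamma>] by (simp add: z_def)
  have xnz: "norm (XX (z t)) > 0" for t using XX_zero[OF cz] znz by force
  define a where "a t = rho2 * cx1 (z t)" for t
  define b where "b t = rho1 * cx2 (z t)" for t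
  define a' where "a' t = rho2 * cx1 (z' t)" for t
  define b' where "b' t = rho1 * cx2 (z' t)" for t
  have da: "(a has_real_derivative a' t) (at t)" "(b has_real_derivative b' t) (at t)" for t
    unfolding a_def[abs_def] b_def[abs_def] a'_def b'_def by (intro DERIV_cmult comp_DERIV zd)+
  have z'c: "continuous_on UNIV z'"
  proof -
    have gc: "continuous_on UNIV \<gamma>" using \<gamma>(1) unfolding flows_def
      by (auto intro!: continuous_at_imp_continuous_on dest: has_vector_derivative_continuous)
    have "continuous_on UNIV XF"
      by (intro continuous_at_imp_continuous_on ballI has_derivative_continuous[OF XF_has_derivative])
    from continuous_on_compose2[OF this gc] show ?thesis unfolding z'_def by simp
  qed
  have rmin: "min rho1 rho2 > 0" using rho_pos by simp
  have R: "(a t)\<^sup>2 + (b t)\<^sup>2 \<ge> (min rho1 rho2)\<^sup>2 * (norm (XX (z t)))\<^sup>2"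
    "(a t)\<^sup>2 + (b t)\<^sup>2 \<le> (rho1 + rho2)\<^sup>2 * (norm (XX (z t)))\<^sup>2" for t
  proof -
    have "(min rho1 rho2)\<^sup>2 * x\<^sup>2 \<le> rho1\<^sup>2 * x\<^sup>2" "(min rho1 rho2)\<^sup>2 * x\<^sup>2 \<le> rho2\<^sup>2 * x\<^sup>2"
      "rho1\<^sup>2 * x\<^sup>2 \<le> (rho1 + rho2)\<^sup>2 * x\<^sup>2" "rho2\<^sup>2 * x\<^sup>2 \<le> (rho1 + rho2)\<^sup>2 * x\<^sup>2" for x
      using rho_pos rmin by (intro mult_right_mono power_mono; simp)+
    from this[of "cx1 (z t)"] this[of "cx2 (z t)"]
    show "(a t)\<^sup>2 + (b t)\<^sup>2 \<ge> (min rho1 rho2)\<^sup>2 * (norm (XX (z t)))\<^sup>2"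
      "(a t)\<^sup>2 + (b t)\<^sup>2 \<le> (rho1 + rho2)\<^sup>2 * (norm (XX (z t)))\<^sup>2"
      unfolding norm_XX a_def b_def power_mult_distrib distrib_left by linarith+
  qed
  have pos2: "(a t)\<^sup>2 + (b t)\<^sup>2 > 0" for t
    using R(1)[of t] mult_pos_pos[OF zero_less_power[OF rmin] zero_less_power[OF xnz], of 2 t 2] by linarith
  obtain \<phi> where \<phi>: "\<And>t. (\<phi> has_real_derivative (a t * b' t - b t * a' t) / ((a t)\<^sup>2 + (b t)\<^sup>2)) (at t)"
      "\<And>t. a t = sqrt ((a t)\<^sup>2 + (b t)\<^sup>2) * cos (\<phi> t)" "\<And>t. b t = sqrt ((a t)\<^sup>2 + (b t)\<^sup>2) * sin (\<phi> t)"
  proof (rule polar_lift[OF da _ _ pos2])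
    show "continuous_on UNIV a'" "continuous_on UNIV b'"
      unfolding a'_def b'_def by (intro continuous_intros z'c)+
  qed blast
  have bound: "om1 \<le> (a t * b' t - b t * a' t) / ((a t)\<^sup>2 + (b t)\<^sup>2)"
    "(a t * b' t - b t * a' t) / ((a t)\<^sup>2 + (b t)\<^sup>2) \<le> om2" for t
  proof -
    define n where "n = norm (XX (z t))"
    define e where "e = z' t - A0 (z t)"
    have n: "n > 0" using xnz by (simp add: n_def)
    have e: "norm e \<le> \<epsilon> * (2 * C * n)"
    proof -
      have "norm e \<le> \<epsilon> * norm (z t)" using XF_Se \<gamma>(1) by (simp add: e_def z'_def z_def flows_def)
      also have "\<dots> \<le> \<epsilon> * (2 * C * n)" using cone_norm[OF cz] \<epsilon> by (intro mult_left_mono) (auto simp: n_def)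
      finally show ?thesis .
    qed
    have "z' t = A0 (z t) + e" by (simp add: e_def)
    hence x': "cx1 (z' t) = h1 (z t) - k1 * cx2 (z t) + cx1 e" "cx2 (z' t) = h2 (z t) + k2 * cx1 (z t) + cx2 e"
      by (simp_all add: A0_coords)
    define q where "q = cx1 (z t) * cx2 (z' t) - cx2 (z t) * cx1 (z' t)"
    have q: "q = N (z t) + (cx1 (z t) * h2 (z t) - cx2 (z t) * h1 (z t)) + (cx1 (z t) * cx2 e - cx2 (z t) * cx1 e)"
      unfolding q_def x' N_def by (simp add: power2_eq_square algebra_simps)
    have p: "\<bar>x * y\<bar> \<le> X * Y" if "\<bar>x\<bar> \<le> X" "\<bar>y\<bar> \<le> Y" for x y X Y :: real
      unfolding abs_mult using that by (intro mult_mono) auto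
    have x: "\<bar>cx1 (z t)\<bar> \<le> n" "\<bar>cx2 (z t)\<bar> \<le> n" using abs_le_XX by (auto simp: n_def)
    have hh: "\<bar>h1 (z t)\<bar> \<le> \<eta> * n" "\<bar>h2 (z t)\<bar> \<le> \<eta> * n"
      using abs_le_HH[of "z t"] cz[of t] by (auto simp: in_cone_def n_def)
    have ee: "\<bar>cx1 e\<bar> \<le> \<epsilon> * (2 * C * n)" "\<bar>cx2 e\<bar> \<le> \<epsilon> * (2 * C * n)" using norm_comp_le[of e] e by auto
    have rest: "\<bar>q - N (z t)\<bar> \<le> (2 * \<eta> + 4 * C * \<epsilon>) * n\<^sup>2"
    proof -
      have "\<bar>q - N (z t)\<bar> \<le> \<bar>cx1 (z t) * h2 (z t)\<bar> + \<bar>cx2 (z t) * h1 (z t)\<bar> + \<bar>cx1 (z t) * cx2 e\<bar> + \<bar>cx2 (z t) * cx1 e\<bar>"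
        unfolding q by linarith
      also have "\<dots> \<le> n * (\<eta> * n) + n * (\<eta> * n) + n * (\<epsilon> * (2 * C * n)) + n * (\<epsilon> * (2 * C * n))"
        by (intro add_mono p x hh ee)
      also have "\<dots> = (2 * \<eta> + 4 * C * \<epsilon>) * n\<^sup>2" by (simp add: power2_eq_square algebra_simps)
      finally show ?thesis .
    qed
    have "(2 * \<eta> + 4 * C * \<epsilon>) * n\<^sup>2 \<le> k2 / 2 * n\<^sup>2" using small2 by (intro mult_right_mono) auto
    hence r2: "\<bar>q - N (z t)\<bar> \<le> k2 / 2 * n\<^sup>2" using rest by linarith
    have "k2 * n\<^sup>2 \<le> k1 * n\<^sup>2" using pos by (intro mult_right_mono) auto
    moreover have "k2 * n\<^sup>2 = 2 * (k2 / 2 * n\<^sup>2)" "(2 * k1) * n\<^sup>2 = 2 * (k1 * n\<^sup>2)" by simp_all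
    moreover have "0 \<le> k2 / 2 * n\<^sup>2" using pos by simp
    ultimately have qb: "k2 / 2 * n\<^sup>2 \<le> q" "q \<le> (2 * k1) * n\<^sup>2"
      using N_bounds[of "z t", folded n_def] r2 by linarith+
    have num: "a t * b' t - b t * a' t = rho1 * rho2 * q"
      unfolding a_def b_def a'_def b'_def q_def by (simp add: algebra_simps)
    have rr: "rho1 * rho2 > 0" using rho_pos by simp
    have "om1 * ((rho1 + rho2)\<^sup>2 * n\<^sup>2) = rho1 * rho2 * (k2 / 2 * n\<^sup>2)"
      using rho_pos by (simp add: om1_def)
    moreover have "om1 * ((a t)\<^sup>2 + (b t)\<^sup>2) \<le> om1 * ((rho1 + rho2)\<^sup>2 * n\<^sup>2)"
      using R(2)[of t] rho_pos by (intro mult_left_mono) (auto simp: n_def)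
    moreover have "rho1 * rho2 * (k2 / 2 * n\<^sup>2) \<le> rho1 * rho2 * q" using qb rr by (intro mult_left_mono) auto
    ultimately show "om1 \<le> (a t * b' t - b t * a' t) / ((a t)\<^sup>2 + (b t)\<^sup>2)"
      unfolding num pos_le_divide_eq[OF pos2] by linarith
    have "om2 * ((min rho1 rho2)\<^sup>2 * n\<^sup>2) = rho1 * rho2 * (2 * k1 * n\<^sup>2)"
    proof -
      have "(min rho1 rho2)\<^sup>2 \<noteq> 0" using rmin by (metis less_irrefl power_not_zero)
      thus ?thesis unfolding om2_def by (simp only: times_divide_eq_left nonzero_mult_div_cancel_right) (simp add: field_simps)
    qed
    moreover have "om2 * ((a t)\<^sup>2 + (b t)\<^sup>2) \<ge> om2 * ((min rho1 rho2)\<^sup>2 * n\<^sup>2)"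
      using R(1)[of t] rho_pos by (intro mult_left_mono) (auto simp: n_def)
    moreover have "rho1 * rho2 * (2 * k1 * n\<^sup>2) \<ge> rho1 * rho2 * q" using qb rr by (intro mult_left_mono) auto
    ultimately show "(a t * b' t - b t * a' t) / ((a t)\<^sup>2 + (b t)\<^sup>2) \<le> om2"
      unfolding num pos_divide_le_eq[OF pos2] by linarith
  qed
  have "angular \<gamma> \<phi>" unfolding angular_def
  proof (intro conjI allI)
    fix t
    show "\<exists>d. (\<phi> has_real_derivative d) (at t) \<and> om1 \<le> d \<and> d \<le> om2" using \<phi>(1) bound by blast
    have "sqrt ((a t)\<^sup>2 + (b t)\<^sup>2) > 0" using pos2 by simp
    with \<phi>(2,3)[of t] show "\<exists>R>0. rho2 * cx1 (\<gamma> t - Se) = R * cos (\<phi> t) \<and> rho1 * cx2 (\<gamma> t - Se) = R * sin (\<phi> t)"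
      unfolding a_def b_def z_def by blast
  qed
  thus ?thesis by blast
qed

lemma angular_cont: "angular \<gamma> \<phi> \<Longrightarrow> continuous_on A \<phi>"
  unfolding angular_def by (meson DERIV_isCont continuous_at_imp_continuous_on)

lemma angular_speed:
  assumes "angular \<gamma> \<phi>" "s \<le> t"
  shows "om1 * (t - s) \<le> \<phi> t - \<phi> s" "\<phi> t - \<phi> s \<le> om2 * (t - s)"
proof -
  have "\<phi> s - om1 * s \<le> \<phi> t - om1 * t"
  proof (rule DERIV_nonneg_imp_nondecreasing[where f = "\<lambda>t. \<phi> t - om1 * t", OF assms(2)])
    fix x
    obtain d where "(\<phi> has_real_derivative d) (at x)" "om1 \<le> d" using assms(1) unfolding angular_def by blast
    thus "\<exists>y. ((\<lambda>t. \<phi> t - om1 * t) has_real_derivative y) (at x) \<and> y \<ge> 0"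
      by (intro exI[of _ "d - om1"]) (auto intro!: derivative_eq_intros)
  qed
  thus "om1 * (t - s) \<le> \<phi> t - \<phi> s" by (simp add: algebra_simps)
  have "\<phi> s - om2 * s \<ge> \<phi> t - om2 * t"
  proof (rule DERIV_nonpos_imp_nonincreasing[where f = "\<lambda>t. \<phi> t - om2 * t", OF assms(2)])
    fix x
    obtain d where "(\<phi> has_real_derivative d) (at x)" "d \<le> om2" using assms(1) unfolding angular_def by blast
    thus "\<exists>y. ((\<lambda>t. \<phi> t - om2 * t) has_real_derivative y) (at x) \<and> y \<le> 0"
      by (intro exI[of _ "d - om2"]) (auto intro!: derivative_eq_intros)
  qed
  thus "\<phi> t - \<phi> s \<le> om2 * (t - s)" by (simp add: algebra_simps)
qed

lemma angular_strict: "angular \<gamma> \<phi> \<Longrightarrow> s < t \<Longrightarrow> \<phi> s < \<phi> t"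
  using angular_speed(1)[of \<gamma> \<phi> s t] mult_pos_pos[OF rho_pos(3), of "t - s"] by linarith

lemma angular_surj:
  assumes "angular \<gamma> \<phi>"
  shows "\<exists>t. \<phi> t = y"
proof -
  define d where "d = \<bar>y - \<phi> 0\<bar> / om1"
  have d: "d \<ge> 0" "om1 * d = \<bar>y - \<phi> 0\<bar>" using rho_pos by (auto simp: d_def)
  have "\<phi> d \<ge> y" "\<phi> (- d) \<le> y"
    using angular_speed(1)[OF assms, of 0 d] angular_speed(1)[OF assms, of "- d" 0] d by auto
  from IVT'[OF this(2,1) _ angular_cont[OF assms]] d show ?thesis by auto
qed

text \<open>Equal angles put the two positions on one ray from the equilibrium; on equal energy
  levels \<open>ray_unique\<close> identifies the points.\<close>

lemma angular_meet:
  assumes \<gamma>: "flows \<gamma>" "flows \<gamma>'" and ang: "angular \<gamma> \<phi>" "angular \<gamma>' \<phi>'"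
    and F: "F (\<gamma> s) = F (\<gamma>' t)" and eq: "\<phi>' t = \<phi> s + 2 * pi * of_int k"
  shows "\<gamma> s = \<gamma>' t"
proof -
  obtain R where R: "R > 0" "rho2 * cx1 (\<gamma> s - Se) = R * cos (\<phi> s)" "rho1 * cx2 (\<gamma> s - Se) = R * sin (\<phi> s)"
    using ang(1) unfolding angular_def by blast
  obtain R' where R': "R' > 0" "rho2 * cx1 (\<gamma>' t - Se) = R' * cos (\<phi>' t)" "rho1 * cx2 (\<gamma>' t - Se) = R' * sin (\<phi>' t)"
    using ang(2) unfolding angular_def by blast
  have sc: "cos (\<phi>' t) = cos (\<phi> s)" "sin (\<phi>' t) = sin (\<phi> s)"
    unfolding eq sin_add[of _ "2 * pi * of_int k"] cos_add[of _ "2 * pi * of_int k"] by simp_all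
  have "rho2 * cx1 (\<gamma>' t - Se) = rho2 * (R' / R * cx1 (\<gamma> s - Se))" "rho1 * cx2 (\<gamma>' t - Se) = rho1 * (R' / R * cx2 (\<gamma> s - Se))"
    using R R' sc by (simp_all add: mult.left_commute[of rho2] mult.left_commute[of rho1] del: comp_linear)
  hence "cx1 (\<gamma>' t - Se) = R' / R * cx1 (\<gamma> s - Se)" "cx2 (\<gamma>' t - Se) = R' / R * cx2 (\<gamma> s - Se)"
    using rho_pos by (simp_all only: mult_cancel_left) auto
  hence ray: "XX (\<gamma>' t - Se) = (R' / R) *\<^sub>R XX (\<gamma> s - Se)" unfolding XX_def by simp
  have nz: "XX (\<gamma> s - Se) \<noteq> 0"
  proof
    assume "XX (\<gamma> s - Se) = 0"
    hence "R * cos (\<phi> s) = 0" "R * sin (\<phi> s) = 0" using R by (auto simp: XX_def zero_prod_def simp del: comp_linear)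
    hence "cos (\<phi> s) = 0" "sin (\<phi> s) = 0" using R by auto
    thus False using sin_cos_squared_add[of "\<phi> s"] by simp
  qed
  have "(\<lambda>u. \<gamma> (u + s)) 0 = (\<lambda>u. \<gamma>' (u + t)) 0"
    by (rule ray_unique[OF flows_shift[OF \<gamma>(1)] flows_shift[OF \<gamma>(2)], where s = "R' / R"])
      (use F ray nz R R' in \<open>auto simp del: comp_linear\<close>)
  thus ?thesis by simp
qed

lemma angular_return:
  assumes ang: "angular \<gamma> \<phi>" and eq: "\<gamma> s = \<gamma> t"
  shows "\<exists>k::int. \<phi> t = \<phi> s + 2 * pi * of_int k"
proof -
  obtain R where R: "R > 0" "rho2 * cx1 (\<gamma> s - Se) = R * cos (\<phi> s)" "rho1 * cx2 (\<gamma> s - Se) = R * sin (\<phi> s)"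
    using ang(1) unfolding angular_def by blast
  obtain R' where R': "R' > 0" "rho2 * cx1 (\<gamma> t - Se) = R' * cos (\<phi> t)" "rho1 * cx2 (\<gamma> t - Se) = R' * sin (\<phi> t)"
    using ang(1) unfolding angular_def by blast
  have e: "R * cos (\<phi> s) = R' * cos (\<phi> t)" "R * sin (\<phi> s) = R' * sin (\<phi> t)" using R R' eq by metis+
  have "R\<^sup>2 = (R * cos (\<phi> s))\<^sup>2 + (R * sin (\<phi> s))\<^sup>2" by (simp add: power_mult_distrib flip: distrib_left)
  also have "\<dots> = R'\<^sup>2" unfolding e by (simp add: power_mult_distrib flip: distrib_left)
  finally have "R = R'" using R R' by (simp add: power2_eq_iff_nonneg)
  with e R have "sin (\<phi> t) = sin (\<phi> s) \<and> cos (\<phi> t) = cos (\<phi> s)" by auto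
  thus ?thesis unfolding sin_cos_eq_iff by (simp add: mult.commute mult.left_commute)
qed

text \<open>The angles take all values, so some time of one orbit has the angle of the other at time
  0.\<close>

lemma flows_same_orbit:
  assumes "flows \<gamma>" "\<exists>t. \<gamma> t \<noteq> \<gamma> 0" "\<And>t. F (\<gamma> t) = 0" "flows \<gamma>'" "\<exists>t. \<gamma>' t \<noteq> \<gamma>' 0" "\<And>t. F (\<gamma>' t) = 0"
  shows "\<exists>s. \<forall>t. \<gamma>' t = \<gamma> (t + s)"
proof -
  obtain \<phi> \<phi>' where ang: "angular \<gamma> \<phi>" "angular \<gamma>' \<phi>'" using angular_exists assms by metis
  obtain s where s: "\<phi> s = \<phi>' 0" using angular_surj[OF ang(1)] by blast
  have "\<gamma> s = \<gamma>' 0" by (rule angular_meet[OF assms(1,4) ang, where k = 0]) (use s assms in auto)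
  hence "(\<lambda>t. \<gamma> (t + s)) 0 = \<gamma>' 0" by simp
  from flows_unique[OF flows_shift[OF assms(1)] assms(4) this] show ?thesis by (intro exI[of _ s]) simp
qed

text \<open>When the angle has advanced by 2 pi, the orbit is back on the same ray of the same level
  and closes up. Conversely a return advances the angle by a multiple of 2 pi, so all periods are
  multiples of \<tau>.\<close>

lemma period:
  assumes \<gamma>: "flows \<gamma>" "\<And>t. F (\<gamma> t) = 0" and ang: "angular \<gamma> \<phi>"
  obtains \<tau> where "\<tau> > 0" "\<phi> \<tau> = \<phi> 0 + 2 * pi" "\<And>t. \<gamma> (t + \<tau>) = \<gamma> t"
    "om1 * \<tau> \<le> 2 * pi" "2 * pi \<le> om2 * \<tau>"
    "\<And>T. T > 0 \<Longrightarrow> \<gamma> T = \<gamma> 0 \<Longrightarrow> \<exists>k::nat. k \<ge> 1 \<and> T = of_nat k * \<tau>"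
proof -
  obtain \<tau> where \<tau>: "\<phi> \<tau> = \<phi> 0 + 2 * pi" using angular_surj[OF ang] by blast
  have pos\<tau>: "\<tau> > 0"
  proof (rule ccontr)
    assume "\<not> \<tau> > 0"
    hence "\<phi> \<tau> \<le> \<phi> 0" using angular_strict[OF ang, of \<tau> 0] by (cases "\<tau> = 0") auto
    thus False using \<tau> pi_gt_zero by linarith
  qed
  have "\<gamma> 0 = \<gamma> \<tau>" by (rule angular_meet[OF \<gamma>(1,1) ang ang, where k = 1]) (use \<tau> \<gamma> in auto)
  hence per: "\<gamma> (t + \<tau>) = \<gamma> t" for t
    using flows_unique[OF flows_shift[OF \<gamma>(1), of \<tau>] \<gamma>(1), of 0 t] by simp
  have perk: "\<gamma> (real k * \<tau>) = \<gamma> 0" for k :: nat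
  proof (induction k)
    case (Suc k)
    have "real (Suc k) * \<tau> = real k * \<tau> + \<tau>" by (simp add: algebra_simps)
    thus ?case using per[of "real k * \<tau>"] Suc by simp
  qed simp
  have phk: "\<phi> (real k * \<tau>) = \<phi> 0 + 2 * pi * real k" for k :: nat
  proof -
    have inc: "\<exists>j::int. \<phi> (t + \<tau>) = \<phi> t + 2 * pi * of_int j" for t
      using angular_return[OF ang, of t "t + \<tau>"] per by simp
    \<comment> \<open>The advance during \<tau> in units of 2 pi is continuous and integer-valued,
      hence equal to its value 1 at time 0.\<close>
    have cont: "continuous_on UNIV (\<lambda>t. (\<phi> (t + \<tau>) - \<phi> t) / (2 * pi))"
      by (intro continuous_intros continuous_on_compose2[OF angular_cont[OF ang, of UNIV]] angular_cont[OF ang]) auto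
    have "(\<lambda>t. (\<phi> (t + \<tau>) - \<phi> t) / (2 * pi)) constant_on UNIV"
    proof (rule continuous_discrete_range_constant[OF connected_UNIV cont])
      fix x
      show "\<exists>e>0. \<forall>y. y \<in> UNIV \<and> (\<phi> (y + \<tau>) - \<phi> y) / (2 * pi) \<noteq> (\<phi> (x + \<tau>) - \<phi> x) / (2 * pi) \<longrightarrow>
        e \<le> norm ((\<phi> (y + \<tau>) - \<phi> y) / (2 * pi) - (\<phi> (x + \<tau>) - \<phi> x) / (2 * pi))"
      proof (intro exI[of _ 1] conjI allI impI)
        fix y
        assume ne: "y \<in> UNIV \<and> (\<phi> (y + \<tau>) - \<phi> y) / (2 * pi) \<noteq> (\<phi> (x + \<tau>) - \<phi> x) / (2 * pi)"
        obtain i j :: int where ij: "\<phi> (x + \<tau>) = \<phi> x + 2 * pi * of_int i" "\<phi> (y + \<tau>) = \<phi> y + 2 * pi * of_int j"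
          using inc by metis
        have v: "(\<phi> (y + \<tau>) - \<phi> y) / (2 * pi) = of_int j" "(\<phi> (x + \<tau>) - \<phi> x) / (2 * pi) = of_int i"
          unfolding ij by simp_all
        have "i \<noteq> j" using ne unfolding v by auto
        hence "1 \<le> \<bar>j - i\<bar>" by linarith
        hence "(1::real) \<le> \<bar>of_int j - of_int i\<bar>" by linarith
        thus "1 \<le> norm ((\<phi> (y + \<tau>) - \<phi> y) / (2 * pi) - (\<phi> (x + \<tau>) - \<phi> x) / (2 * pi))" unfolding v by simp
      qed simp
    qed
    then obtain c where c: "(\<phi> (t + \<tau>) - \<phi> t) / (2 * pi) = c" for t unfolding constant_on_def by auto
    have "c = 1" using c[of 0] \<tau> by simp
    hence add: "\<phi> (t + \<tau>) = \<phi> t + 2 * pi" for t using c[of t] by (simp add: field_simps)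
    show ?thesis
    proof (induction k)
      case (Suc k)
      have "real (Suc k) * \<tau> = real k * \<tau> + \<tau>" by (simp add: algebra_simps)
      thus ?case using add[of "real k * \<tau>"] Suc by (simp add: algebra_simps)
    qed simp
  qed
  show ?thesis
  proof (rule that[OF pos\<tau> \<tau> per])
    show "om1 * \<tau> \<le> 2 * pi" "2 * pi \<le> om2 * \<tau>" using angular_speed[OF ang, of 0 \<tau>] pos\<tau> \<tau> by auto
    fix T assume T: "T > 0" "\<gamma> T = \<gamma> 0"
    obtain j :: int where j: "\<phi> T = \<phi> 0 + 2 * pi * of_int j" using angular_return[OF ang, of 0 T] T by auto
    have "0 < 2 * pi * of_int j" using angular_strict[OF ang T(1)] j by simp
    hence j0: "j > 0" by (simp add: zero_less_mult_iff)
    define k where "k = nat j"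
    have k: "of_int j = real k" "k \<ge> 1" using j0 by (auto simp: k_def)
    have "\<phi> T = \<phi> (real k * \<tau>)" unfolding phk j k(1) ..
    hence "T = real k * \<tau>" using angular_strict[OF ang, of T "real k * \<tau>"] angular_strict[OF ang, of "real k * \<tau>" T]
      by (cases T "real k * \<tau>" rule: linorder_cases) auto
    thus "\<exists>k::nat. k \<ge> 1 \<and> T = of_nat k * \<tau>" using k(2) by blast
  qed
qed

end

section \<open>The index of the Lyapunov orbit\<close>

lemma fa2_bound: "\<bar>fa2 v w\<bar> \<le> norm v * norm w" and fb2_bound: "\<bar>fb2 v w\<bar> \<le> norm v * norm w"
proof -
  have "fa2 v w = v \<bullet> (- cy2 w, cy1 w, cx2 w, - cx1 w)" "fb2 v w = v \<bullet> (- cx2 w, cx1 w, - cy2 w, cy1 w)"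
    by (simp_all add: fa2_def fb2_def inner_phase)
  moreover have "norm (- cy2 w, cy1 w, cx2 w, - cx1 w) = norm w" "norm (- cx2 w, cx1 w, - cy2 w, cy1 w) = norm w"
    by (rule power2_eq_imp_eq, simp_all add: norm_phase)+
  ultimately show "\<bar>fa2 v w\<bar> \<le> norm v * norm w" "\<bar>fb2 v w\<bar> \<le> norm v * norm w"
    using Cauchy_Schwarz_ineq2 by metis+
qed

lemma bilinear_diff:
  "fa2 v w - fa2 v' w' = fa2 (v - v') w + fa2 v' (w - w')"
  "fb2 v w - fb2 v' w' = fb2 (v - v') w + fb2 v' (w - w')"
  "om v w - om v' w' = om (v - v') w + om v' (w - w')"
  by (simp_all add: fa2_def fb2_def om_def algebra_simps)

context saddle_center
begin

text \<open>\<open>hyp H1 H2\<close> and \<open>centre x\<close> parametrize the hyperbolic and the center plane of \<open>A0\<close>.\<close>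

definition hyp :: "real \<Rightarrow> real \<Rightarrow> phase" where
  "hyp H1 H2 = (- (Bb * H1 / m), Aa * H2 / m, - (H2 / m), H1 / m)"
definition centre :: "phase \<Rightarrow> phase" where
  "centre z = (- (Aa * cx2 z), - (Bb * cx1 z), cx1 z, cx2 z)"

lemma m_eq: "m = Aa - Bb" by (simp add: m_def Aa_def Bb_def b_def)

lemma A0_hyp: "A0 (hyp H1 H2) = hyp (P * H2) (Q * H1)"
proof (rule phase_eqI)
  have e: "(c2\<^sup>2 + k2 * P) - c2 * Aa = - (Bb * P)" "(c1\<^sup>2 - k1 * Q) - c1 * Bb = - (Aa * Q)" "Aa - c2 = P" "Bb - c1 = Q"
    by (simp_all add: P_def Q_def b_def Aa_def Bb_def power2_eq_square algebra_simps)
  have "cy1 (A0 (hyp H1 H2)) = ((c2\<^sup>2 + k2 * P) - c2 * Aa) * (H2 / m)"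
    "cy2 (A0 (hyp H1 H2)) = - ((c1\<^sup>2 - k1 * Q) - c1 * Bb) * (H1 / m)"
    "cx1 (A0 (hyp H1 H2)) = - (Bb - c1) * (H1 / m)" "cx2 (A0 (hyp H1 H2)) = (Aa - c2) * (H2 / m)"
    by (simp_all add: A0_def hyp_def left_diff_distrib diff_divide_distrib)
  thus "cy1 (A0 (hyp H1 H2)) = cy1 (hyp (P * H2) (Q * H1))" "cy2 (A0 (hyp H1 H2)) = cy2 (hyp (P * H2) (Q * H1))"
    "cx1 (A0 (hyp H1 H2)) = cx1 (hyp (P * H2) (Q * H1))" "cx2 (A0 (hyp H1 H2)) = cx2 (hyp (P * H2) (Q * H1))"
    unfolding e by (simp_all add: hyp_def)
qed

lemma A0_centre: "A0 (centre z) = (- (k2 * Aa * cx1 z), k1 * Bb * cx2 z, - (k1 * cx2 z), k2 * cx1 z)"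
  unfolding A0_def centre_def comp_simps P_def Q_def b_def Aa_def Bb_def
  by (simp add: algebra_simps power2_eq_square)

lemma om_hyp: "om (hyp H1 H2) (hyp K1 K2) = - (H1 * K2 - H2 * K1) / m"
proof -
  have "om (hyp H1 H2) (hyp K1 K2) = (Bb - Aa) * (H1 * K2 - H2 * K1) / (m * m)"
    unfolding om_def hyp_def comp_simps by (simp add: algebra_simps diff_divide_distrib add_divide_distrib)
  also have "Bb - Aa = - m" by (simp add: m_eq)
  also have "- m * (H1 * K2 - H2 * K1) / (m * m) = - (H1 * K2 - H2 * K1) / m" using pos by (simp add: field_simps)
  finally show ?thesis .
qed

lemma om_hyp_centre: "om (hyp H1 H2) (A0 (centre z)) = 0"
  unfolding A0_centre om_def hyp_def comp_simps using pos by (simp add: field_simps)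

text \<open>This identity is the origin of \<open>rho1\<close> and \<open>rho2\<close>: they are
  weights for which the terms with H2 cancel, so that the pairing has the sign of H1 whatever H2
  is.\<close>

lemma frame_hyp_centre:
  "fa2 (hyp H1 H2) (A0 (centre z)) * (rho1 * cx2 z) - fb2 (hyp H1 H2) (A0 (centre z)) * (rho2 * cx1 z)
   = H1 * (k1\<^sup>2 * (1 + Bb\<^sup>2) * (cx2 z)\<^sup>2 + k2\<^sup>2 * (1 + Aa\<^sup>2) * (cx1 z)\<^sup>2)"
proof -
  have a: "m * fa2 (hyp H1 H2) (A0 (centre z)) = k1 * (1 + Bb\<^sup>2) * H1 * cx2 z - k2 * (1 + Aa\<^sup>2) * H2 * cx1 z"
    unfolding A0_centre fa2_def hyp_def comp_simps using pos by (simp add: field_simps power2_eq_square)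
  have "m * fb2 (hyp H1 H2) (A0 (centre z)) = - (Aa - Bb) * (k2 * cx1 z * H1 + k1 * cx2 z * H2)"
    unfolding A0_centre fb2_def hyp_def comp_simps using pos by (simp add: field_simps)
  hence "m * fb2 (hyp H1 H2) (A0 (centre z)) = m * (- (k2 * cx1 z * H1 + k1 * cx2 z * H2))"
    unfolding m_eq[symmetric] by (simp only: mult_minus_left mult_minus_right)
  hence b: "fb2 (hyp H1 H2) (A0 (centre z)) = - (k2 * cx1 z * H1 + k1 * cx2 z * H2)"
    by (simp only: mult_left_cancel[OF less_imp_neq[OF pos(5), symmetric]])
  have "fa2 (hyp H1 H2) (A0 (centre z)) * (rho1 * cx2 z) =
    (m * fa2 (hyp H1 H2) (A0 (centre z))) * (k1 * cx2 z)" by (simp add: rho1_def)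
  thus ?thesis unfolding a b rho2_def by (simp add: power2_eq_square algebra_simps)
qed

lemma centre_bounds: "norm (A0 (centre z)) \<le> C\<^sup>2 * norm (XX z)" "k2 * norm (XX z) \<le> norm (A0 (centre z))"
  "norm (A0 (z - centre z)) \<le> C\<^sup>2 * norm (HH z)"
proof -
  have c: "XX (centre z) = XX z" "HH (centre z) = 0" "XX (z - centre z) = 0" "HH (z - centre z) = HH z"
    by (simp_all add: XX_def HH_def centre_def h1_def h2_def Aa_def Bb_def zero_prod_def algebra_simps)
  have C0: "0 \<le> C" using C(1) by simp
  have n: "norm (centre z) \<le> C * norm (XX z)" "norm (z - centre z) \<le> C * norm (HH z)"
    using C(9)[of "centre z"] C(9)[of "z - centre z"] c by simp_all
  have "norm (A0 (centre z)) \<le> C * (C * norm (XX z))"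
    by (rule order_trans[OF C(2) mult_left_mono[OF n(1) C0]])
  thus "norm (A0 (centre z)) \<le> C\<^sup>2 * norm (XX z)" by (simp add: power2_eq_square)
  have "norm (A0 (z - centre z)) \<le> C * (C * norm (HH z))"
    by (rule order_trans[OF C(2) mult_left_mono[OF n(2) C0]])
  thus "norm (A0 (z - centre z)) \<le> C\<^sup>2 * norm (HH z)" by (simp add: power2_eq_square)
  have "k2\<^sup>2 * (cx2 z)\<^sup>2 \<le> k1\<^sup>2 * (cx2 z)\<^sup>2" using pos by (intro mult_right_mono power_mono) auto
  hence "k2\<^sup>2 * (norm (XX z))\<^sup>2 \<le> (k1 * cx2 z)\<^sup>2 + (k2 * cx1 z)\<^sup>2"
    unfolding norm_XX by (simp add: power_mult_distrib distrib_left)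
  also have "\<dots> \<le> (norm (A0 (centre z)))\<^sup>2" unfolding norm_phase A0_centre by simp
  finally have "(k2 * norm (XX z))\<^sup>2 \<le> (norm (A0 (centre z)))\<^sup>2" by (simp add: power_mult_distrib)
  thus "k2 * norm (XX z) \<le> norm (A0 (centre z))" by (rule power2_le_imp_le) simp
qed

text \<open>\<open>Vs k\<close> is the solution of the linear model with initial value \<open>hyp 1 k\<close>.\<close>

definition Hs1 where "Hs1 k t = cosh (lam * t) + P / lam * k * sinh (lam * t)"
definition Hs2 where "Hs2 k t = k * cosh (lam * t) + Q / lam * sinh (lam * t)"
definition Vs where "Vs k t = hyp (Hs1 k t) (Hs2 k t)"

lemma lam2: "lam * lam = P * Q"
  unfolding lam_def using sq by (metis mult.assoc mult.left_commute)

lemma Vs_deriv: "(Vs k has_vector_derivative A0 (Vs k t)) (at t)"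
proof -
  have l: "P / lam * Q = lam" "Q / lam * P = lam" using lam2 pos by (simp_all add: field_simps)
  have d1: "(Hs1 k has_real_derivative P * Hs2 k t) (at t)"
  proof -
    have "(Hs1 k has_real_derivative lam * sinh (lam * t) + P / lam * k * (lam * cosh (lam * t))) (at t)"
      unfolding Hs1_def[abs_def] by (auto intro!: derivative_eq_intros)
    moreover have "lam * sinh (lam * t) + P / lam * k * (lam * cosh (lam * t)) = P * Hs2 k t"
      unfolding Hs2_def using pos l(1)[symmetric] by (simp add: field_simps)
    ultimately show ?thesis by simp
  qed
  have d2: "(Hs2 k has_real_derivative Q * Hs1 k t) (at t)"
  proof -
    have "(Hs2 k has_real_derivative k * (lam * sinh (lam * t)) + Q / lam * (lam * cosh (lam * t))) (at t)"
      unfolding Hs2_def[abs_def] by (auto intro!: derivative_eq_intros)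
    moreover have "k * (lam * sinh (lam * t)) + Q / lam * (lam * cosh (lam * t)) = Q * Hs1 k t"
      unfolding Hs1_def using pos l(1) by (simp add: field_simps)
    ultimately show ?thesis by simp
  qed
  have eq: "A0 (Vs k t) = hyp (P * Hs2 k t) (Q * Hs1 k t)" unfolding Vs_def A0_hyp ..
  have "((\<lambda>t. - (Bb * Hs1 k t / m)) has_real_derivative - (Bb * (P * Hs2 k t) / m)) (at t)"
    "((\<lambda>t. Aa * Hs2 k t / m) has_real_derivative Aa * (Q * Hs1 k t) / m) (at t)"
    "((\<lambda>t. - (Hs2 k t / m)) has_real_derivative - (Q * Hs1 k t / m)) (at t)"
    "((\<lambda>t. Hs1 k t / m) has_real_derivative P * Hs2 k t / m) (at t)"
    by (intro DERIV_minus DERIV_cdivide DERIV_cmult d1 d2)+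
  thus ?thesis unfolding eq unfolding Vs_def[abs_def] hyp_def has_real_derivative_iff_has_vector_derivative
    by (intro has_vector_derivative_Pair)
qed

text \<open>The solutions with \<open>k = 0\<close> and \<open>k = kk\<close> rotate by less and by more than a full turn, which
  gives an index interval around \<open>1\<close>; \<open>tau1\<close> and \<open>tau2\<close> bound the period.\<close>

definition tau1 where "tau1 = 2 * pi / om2"
definition tau2 where "tau2 = 2 * pi / om1"
definition kk where "kk = 1 + Q / P"

lemma kk: "kk \<ge> 0" "P * kk\<^sup>2 - Q \<ge> P"
proof -
  show "kk \<ge> 0" using pos by (simp add: kk_def)
  have "P * kk\<^sup>2 - Q = P + Q + Q * Q / P" unfolding kk_def using pos by (simp add: field_simps power2_eq_square)
  thus "P * kk\<^sup>2 - Q \<ge> P" using pos by simp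
qed

lemma Hs1_ge: "k \<ge> 0 \<Longrightarrow> t \<ge> 0 \<Longrightarrow> Hs1 k t \<ge> 1"
  unfolding Hs1_def using pos cosh_real_ge_1[of "lam * t"] by (simp add: add_increasing2)

lemma om_Vs: "om (Vs k 0) (Vs k t) = (P * k\<^sup>2 - Q) / (lam * m) * sinh (lam * t)"
  unfolding Vs_def om_hyp Hs1_def Hs2_def using pos by (simp add: field_simps power2_eq_square)

text \<open>A lower bound for the absolute values of both symplectic products, taken at the shortest
  possible period. It is the room left for the perturbation.\<close>

definition com where "com = min P Q / (lam * m) * sinh (lam * tau1)"

lemma tau_pos: "tau1 > 0" "tau2 > 0" using rho_pos by (auto simp: tau1_def tau2_def)

lemma com_pos: "com > 0" unfolding com_def using pos tau_pos by (auto intro!: mult_pos_pos divide_pos_pos)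

lemma om_Vs_bounds:
  assumes "t \<ge> tau1"
  shows "om (Vs 0 0) (Vs 0 t) \<le> - com" "om (Vs kk 0) (Vs kk t) \<ge> com"
proof -
  have s: "0 \<le> sinh (lam * tau1)" "sinh (lam * tau1) \<le> sinh (lam * t)" using pos tau_pos assms by auto
  have lm: "lam * m > 0" using pos by simp
  have "com \<le> Q / (lam * m) * sinh (lam * t)" "com \<le> (P * kk\<^sup>2 - Q) / (lam * m) * sinh (lam * t)"
    unfolding com_def using pos s kk lm by (intro mult_mono divide_right_mono; simp)+
  thus "om (Vs 0 0) (Vs 0 t) \<le> - com" "om (Vs kk 0) (Vs kk t) \<ge> com" unfolding om_Vs by simp_all
qed

lemma Vs_bounded: "\<exists>K\<ge>1. \<forall>k\<in>{0, kk}. \<forall>t\<in>{0..tau2}. norm (Vs k t) \<le> K"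
proof -
  have "\<exists>K. \<forall>t\<in>{0..tau2}. norm (Vs k t) \<le> K" for k
  proof -
    have "continuous_on {0..tau2} (Vs k)"
      using Vs_deriv by (auto intro!: continuous_at_imp_continuous_on dest: has_vector_derivative_continuous)
    hence "bounded (Vs k ` {0..tau2})" by (intro compact_imp_bounded compact_continuous_image) auto
    thus ?thesis by (auto simp: bounded_iff)
  qed
  then obtain K0 K1 where "\<forall>t\<in>{0..tau2}. norm (Vs 0 t) \<le> K0" "\<forall>t\<in>{0..tau2}. norm (Vs kk t) \<le> K1" by metis
  thus ?thesis by (intro exI[of _ "max 1 (max K0 K1)"]) (auto simp: le_max_iff_disj)
qed

section \<open>Constants of the perturbation argument\<close>

definition KV where "KV = (SOME K. K \<ge> 1 \<and> (\<forall>k\<in>{0, kk}. \<forall>t\<in>{0..tau2}. norm (Vs k t) \<le> K))"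

lemma KV: "KV \<ge> 1" "k \<in> {0, kk} \<Longrightarrow> 0 \<le> t \<Longrightarrow> t \<le> tau2 \<Longrightarrow> norm (Vs k t) \<le> KV"
  using someI_ex[of "\<lambda>K. K \<ge> 1 \<and> (\<forall>k\<in>{0, kk}. \<forall>t\<in>{0..tau2}. norm (Vs k t) \<le> K)", folded KV_def] Vs_bounded
  by (auto simp: Bex_def)

text \<open>\<open>GG\<close> is a Gronwall factor over the longest period. \<open>C6\<close> and
  \<open>C7\<close> bound, per unit of \<delta>, the relative error of the velocity and the error of
  the solutions.\<close>

definition GG where "GG = exp ((2 * (C + 1) + 1) * tau2)"
definition C6 where "C6 = C\<^sup>2 + 2 * C"
definition C7 where "C7 = KV * (2 * C6 / k2 + 1) * GG"

text \<open>Beyond 0 < \<delta> \<le> 1 the conditions say that the velocity keeps at least half of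
  its linear lower bound, that the pairing of \<open>frame_hyp_centre\<close> stays positive, that
  solutions stay within distance 1 of the model, and that the symplectic products keep their
  signs.\<close>

definition index_small :: "real \<Rightarrow> bool" where
  "index_small \<delta> \<longleftrightarrow> 0 < \<delta> \<and> \<delta> \<le> 1 \<and> C6 * \<delta> \<le> k2 / 2 \<and>
    (rho1 + rho2) * (C7 * \<delta> * (C\<^sup>2 + k2) + KV * (C6 * \<delta>)) < k2\<^sup>2 \<and> C7 * \<delta> \<le> 1 \<and> C7 * \<delta> * (2 * KV + 1) < com"

lemma const_pos: "GG \<ge> 1" "C6 > 0" "C7 > 0"
proof -
  have "(2 * (C + 1) + 1) * tau2 \<ge> 0" using C(1) tau_pos by simp
  thus g: "GG \<ge> 1" unfolding GG_def by simp
  have "C\<^sup>2 \<ge> 0" by simp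
  thus c6: "C6 > 0" unfolding C6_def using C(1) by linarith
  have "2 * C6 / k2 + 1 > 0" using c6 pos by (intro add_pos_pos) auto
  thus "C7 > 0" unfolding C7_def using g KV(1) by (intro mult_pos_pos) auto
qed

lemma index_small_exists: "\<exists>\<delta>0>0. \<forall>\<delta>. 0 < \<delta> \<and> \<delta> \<le> \<delta>0 \<longrightarrow> index_small \<delta>"
proof -
  define X where "X = (rho1 + rho2) * (C7 * (C\<^sup>2 + k2) + KV * C6)"
  have X: "X > 0" unfolding X_def using rho_pos const_pos KV(1) pos C(1)
    by (intro mult_pos_pos add_pos_pos) (auto intro!: add_nonneg_pos)
  define Y where "Y = C7 * (2 * KV + 1)"
  have Y: "Y > 0" unfolding Y_def using const_pos KV(1) by simp
  define \<delta>0 where "\<delta>0 = min 1 (min (k2 / 2 / C6) (min (k2\<^sup>2 / (2 * X)) (min (1 / C7) (com / (2 * Y)))))"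
  have \<delta>0: "\<delta>0 > 0" unfolding \<delta>0_def using pos const_pos X Y com_pos by simp
  have "index_small \<delta>" if \<delta>: "0 < \<delta>" "\<delta> \<le> \<delta>0" for \<delta>
  proof -
    have d: "\<delta> \<le> 1" "\<delta> \<le> k2 / 2 / C6" "\<delta> \<le> k2\<^sup>2 / (2 * X)" "\<delta> \<le> 1 / C7" "\<delta> \<le> com / (2 * Y)"
      using \<delta> by (auto simp: \<delta>0_def)
    have "C6 * \<delta> \<le> k2 / 2" "C7 * \<delta> \<le> 1"
      using d(2,4) const_pos by (simp_all add: pos_le_divide_eq mult.commute)
    moreover have "X * \<delta> \<le> k2\<^sup>2 / 2" "Y * \<delta> \<le> com / 2"
      using d(3,5) X Y by (simp_all add: pos_le_divide_eq mult.commute mult.left_commute)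
    hence "X * \<delta> < k2\<^sup>2" "Y * \<delta> < com" using pos com_pos zero_less_power[of k2 2] by linarith+
    moreover have "X * \<delta> = (rho1 + rho2) * (C7 * \<delta> * (C\<^sup>2 + k2) + KV * (C6 * \<delta>))" "Y * \<delta> = C7 * \<delta> * (2 * KV + 1)"
      unfolding X_def Y_def by (simp_all add: algebra_simps)
    ultimately show ?thesis unfolding index_small_def using \<delta> d(1) by auto
  qed
  thus ?thesis using \<delta>0 by blast
qed

end

context local_magnetic
begin

text \<open>Two model solutions are tilted into the tangent space of the level and followed along
  the orbit for one period. The velocity has the size n of the displacement, which has no lower
  bound. It is compared with A0 (centre z) up to C6 \<delta> n, so that n^2 factors out of the
  positivity of the pairing.\<close>

lemma local_index_two:
  assumes small: "index_small \<delta>" "\<epsilon> \<le> \<delta>" "\<eta> \<le> \<delta>"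
    and \<gamma>: "flows \<gamma>" "\<exists>t. \<gamma> t \<noteq> \<gamma> 0"
    and ang: "angular \<gamma> \<phi>" and \<tau>: "\<tau> > 0" "\<phi> \<tau> = \<phi> 0 + 2 * pi" "\<gamma> \<tau> = \<gamma> 0"
      "om1 * \<tau> \<le> 2 * pi" "2 * pi \<le> om2 * \<tau>"
  shows "cz_index F \<gamma> \<tau> = 2" "hyperbolic F \<gamma> \<tau>"
proof -
  interpret mo: magnetic_orbit A1 A1' A1'' A2 A2' A2'' V V1 V2 V11 V12 V22 \<gamma>
    by (rule flows_magnetic_orbit[OF \<gamma>])
  have \<delta>: "0 < \<delta>" "\<delta> \<le> 1" "C6 * \<delta> \<le> k2 / 2" "C7 * \<delta> \<le> 1" "C7 * \<delta> * (2 * KV + 1) < com"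
    "(rho1 + rho2) * (C7 * \<delta> * (C\<^sup>2 + k2) + KV * (C6 * \<delta>)) < k2\<^sup>2"
    using small(1) by (auto simp: index_small_def)
  have \<tau>12: "tau1 \<le> \<tau>" "\<tau> \<le> tau2"
    using \<tau>(4,5) rho_pos by (simp_all add: tau1_def tau2_def pos_divide_le_eq pos_le_divide_eq mult.commute)
  define z where "z t = \<gamma> t - Se" for t
  define n where "n t = norm (XX (z t))" for t
  have cz: "in_cone \<eta> (z t)" for t unfolding z_def by (rule flows_cone_Se[OF \<gamma>(1)])
  have n: "n t > 0" for t
    using XX_zero[OF cz] flows_ne_Se[OF \<gamma>, of t] unfolding n_def z_def by force
  have w: "mo.w t = XF (\<gamma> t)" for t by (simp add: mo.w_def)
  have C0: "C \<ge> 0" using C(1) by simp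
  have r: "norm (mo.w t - A0 (centre (z t))) \<le> C6 * \<delta> * n t" for t
  proof -
    have "mo.w t - A0 (centre (z t)) = (XF (\<gamma> t) - A0 (z t)) + A0 (z t - centre (z t))"
      by (simp add: w linear_diff[OF linear_coords(1)])
    hence "norm (mo.w t - A0 (centre (z t))) \<le> norm (XF (\<gamma> t) - A0 (z t)) + norm (A0 (z t - centre (z t)))"
      by (simp add: norm_triangle_ineq)
    also have "norm (XF (\<gamma> t) - A0 (z t)) \<le> \<delta> * (2 * C * n t)"
    proof -
      have "norm (XF (\<gamma> t) - A0 (z t)) \<le> \<epsilon> * norm (z t)" using XF_Se \<gamma>(1) by (simp add: z_def flows_def)
      also have "\<dots> \<le> \<delta> * (2 * C * n t)" unfolding n_def using small(2) \<delta>(1) by (intro mult_mono cone_norm cz) auto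
      finally show ?thesis .
    qed
    also have "norm (A0 (z t - centre (z t))) \<le> C\<^sup>2 * (\<delta> * n t)"
    proof -
      have "norm (HH (z t)) \<le> \<delta> * n t"
        using cz[of t] mult_right_mono[OF small(3), of "n t"] n[of t] unfolding in_cone_def n_def by linarith
      hence "C\<^sup>2 * norm (HH (z t)) \<le> C\<^sup>2 * (\<delta> * n t)" by (intro mult_left_mono) auto
      thus ?thesis using centre_bounds(3)[of "z t"] by linarith
    qed
    finally show ?thesis by (simp add: C6_def algebra_simps)
  qed
  have r': "norm (mo.w t - A0 (centre (z t))) \<le> k2 / 2 * n t" for t
    using r[of t] mult_right_mono[OF \<delta>(3) less_imp_le[OF n]] by (rule order_trans)
  have wb: "norm (mo.w t) \<le> (C\<^sup>2 + k2) * n t" "norm (mo.w t) \<ge> k2 / 2 * n t" for t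
  proof -
    have "norm (mo.w t) \<le> norm (A0 (centre (z t))) + norm (mo.w t - A0 (centre (z t)))"
      using norm_triangle_sub by blast
    moreover have "k2 / 2 * n t \<le> k2 * n t" using pos n[of t] by simp
    ultimately show "norm (mo.w t) \<le> (C\<^sup>2 + k2) * n t"
      using centre_bounds(1)[of "z t"] r'[of t] unfolding n_def[symmetric] by (simp add: distrib_right)
    have "norm (A0 (centre (z t))) \<le> norm (mo.w t) + norm (mo.w t - A0 (centre (z t)))"
      by (metis norm_minus_commute norm_triangle_sub)
    moreover have "k2 * n t = k2 / 2 * n t + k2 / 2 * n t" by simp
    ultimately show "norm (mo.w t) \<ge> k2 / 2 * n t"
      using centre_bounds(2)[of "z t"] r'[of t] unfolding n_def[symmetric] by linarith
  qed
  \<comment> \<open>The quarter turn converts the pairing with (rho1 x2, - rho2 x1) into the inner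
    product with (cos \<psi>, sin \<psi>) up to a positive factor.\<close>
  define \<psi> where "\<psi> t = \<phi> t - pi / 2" for t
  have \<psi>: "continuous_on {0..\<tau>} \<psi>" "\<psi> \<tau> = \<psi> 0 + 2 * pi"
    unfolding \<psi>_def using \<tau>(2) by (auto intro!: continuous_intros angular_cont[OF ang])
  have key: "\<exists>v. mo.sol v \<and> om (v 0) (mo.w 0) = 0 \<and>
      (\<forall>t. 0 \<le> t \<and> t \<le> \<tau> \<longrightarrow> fa2 (v t) (mo.w t) * cos (\<psi> t) + fb2 (v t) (mo.w t) * sin (\<psi> t) > 0) \<and>
      \<bar>om (v 0) (v \<tau>) - om (Vs k 0) (Vs k \<tau>)\<bar> < com" if k: "k \<in> {0, kk}" for k
  proof -
    have k0: "k \<ge> 0" using k kk(1) by auto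
    have VB: "norm (Vs k t) \<le> KV" if "0 \<le> t" "t \<le> \<tau>" for t using KV(2)[OF k] that \<tau>12 by simp
    define g where "g = gradF (\<gamma> 0)"
    have ng: "norm g = norm (mo.w 0)" by (simp add: g_def w norm_XF)
    have gpos: "norm g > 0" unfolding ng using mo.w_nz by simp
    \<comment> \<open>The orthogonal projection to the tangent space of the level. The correction is
      of order \<delta>, because the hyperbolic plane is symplectically orthogonal to the velocity
      of the center model (\<open>om_hyp_centre\<close>).\<close>
    define v0 where "v0 = Vs k 0 - ((Vs k 0 \<bullet> g) / (norm g)\<^sup>2) *\<^sub>R g"
    have tan: "om v0 (mo.w 0) = 0"
      unfolding w om_XF g_def[symmetric] v0_def using gpos by (simp add: inner_diff_left power2_norm_eq_inner)
    have d0: "norm (v0 - Vs k 0) \<le> KV * (2 * (C6 * \<delta>) / k2)"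
    proof -
      have "Vs k 0 \<bullet> g = om (Vs k 0) (mo.w 0)" by (simp add: w om_XF g_def)
      also have "\<dots> = om (Vs k 0) (mo.w 0 - A0 (centre (z 0)))"
        using om_hyp_centre[of "Hs1 k 0" "Hs2 k 0" "z 0"] unfolding Vs_def by (simp add: om_def algebra_simps)
      finally have "\<bar>Vs k 0 \<bullet> g\<bar> \<le> norm (Vs k 0) * norm (mo.w 0 - A0 (centre (z 0)))" using om_bound by metis
      also have "\<dots> \<le> KV * (C6 * \<delta> * n 0)" using VB[of 0] \<tau>(1) KV(1) r[of 0] by (intro mult_mono) auto
      finally have a: "\<bar>Vs k 0 \<bullet> g\<bar> \<le> KV * (C6 * \<delta> * n 0)" .
      have "norm (v0 - Vs k 0) = \<bar>Vs k 0 \<bullet> g\<bar> / norm g"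
        unfolding v0_def using gpos by (simp add: power2_eq_square)
      also have "\<dots> \<le> KV * (C6 * \<delta> * n 0) / (k2 / 2 * n 0)"
        using a wb(2)[of 0, folded ng] pos n[of 0] by (intro frac_le) auto
      also have "\<dots> = KV * (2 * (C6 * \<delta>) / k2)" using n[of 0] pos by (simp add: field_simps)
      finally show ?thesis .
    qed
    obtain v where v: "v 0 = v0" "mo.sol v" using mo.sol_exists by blast
    define d where "d t = v t - Vs k t" for t
    have db: "norm (d t) \<le> C7 * \<delta>" if t: "0 \<le> t" "t \<le> \<tau>" for t
    proof -
      have "(norm (d t))\<^sup>2 + (\<delta> * KV)\<^sup>2 \<le> ((norm (d 0))\<^sup>2 + (\<delta> * KV)\<^sup>2) * exp ((2 * (C + 1) + 1) * t)"
      proof (rule gronwall[where d' = "\<lambda>t. DX (\<gamma> t) (v t) - A0 (Vs k t)"])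
        fix s assume s: "0 \<le> s" "s \<le> t"
        show "(d has_vector_derivative DX (\<gamma> s) (v s) - A0 (Vs k s)) (at s)"
          unfolding d_def[abs_def] using v(2) Vs_deriv by (auto simp: mo.sol_def intro!: derivative_intros)
        have eq: "DX (\<gamma> s) (v s) - A0 (Vs k s) = (DX (\<gamma> s) (v s) - A0 (v s)) + A0 (d s)"
          by (simp add: d_def linear_diff[OF linear_coords(1)])
        have "norm (DX (\<gamma> s) (v s) - A0 (Vs k s)) \<le> norm (DX (\<gamma> s) (v s) - A0 (v s)) + norm (A0 (d s))"
          unfolding eq by (rule norm_triangle_ineq)
        also have "norm (DX (\<gamma> s) (v s) - A0 (v s)) \<le> \<delta> * (norm (d s) + KV)"
        proof -
          have "norm (DX (\<gamma> s) (v s) - A0 (v s)) \<le> \<epsilon> * norm (v s)" using near \<gamma>(1) by (simp add: flows_def)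
          also have "\<dots> \<le> \<delta> * (norm (d s) + KV)"
          proof (intro mult_mono)
            show "norm (v s) \<le> norm (d s) + KV"
              using VB[of s] s t norm_triangle_ineq[of "d s" "Vs k s"] by (simp add: d_def)
          qed (use small \<delta>(1) in auto)
          finally show ?thesis .
        qed
        also have "norm (A0 (d s)) \<le> C * norm (d s)" by (rule C(2))
        also have "\<delta> * (norm (d s) + KV) + C * norm (d s) \<le> (C + 1) * norm (d s) + \<delta> * KV"
          using mult_right_mono[OF \<delta>(2) norm_ge_zero[of "d s"]] by (simp add: algebra_simps)
        finally show "norm (DX (\<gamma> s) (v s) - A0 (Vs k s)) \<le> (C + 1) * norm (d s) + \<delta> * KV" by simp
      qed (use t C(1) in auto)
      also have "\<dots> \<le> ((norm (d 0))\<^sup>2 + (\<delta> * KV)\<^sup>2) * GG"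
        unfolding GG_def using t \<tau>12 C(1) by (intro mult_left_mono) auto
      \<comment> \<open>As GG \<ge> 1, it may be squared, which allows taking the root.\<close>
      also have "\<dots> \<le> ((norm (d 0))\<^sup>2 + (\<delta> * KV)\<^sup>2) * (GG * GG)"
        using const_pos(1) by (intro mult_left_mono) auto
      also have "\<dots> \<le> ((norm (d 0) + \<delta> * KV) * GG)\<^sup>2"
      proof -
        have "0 \<le> 2 * norm (d 0) * (\<delta> * KV)" using \<delta>(1) KV(1) by simp
        hence "(norm (d 0))\<^sup>2 + (\<delta> * KV)\<^sup>2 \<le> (norm (d 0) + \<delta> * KV)\<^sup>2" unfolding power2_sum by linarith
        from mult_right_mono[OF this, of "GG * GG"] show ?thesis
          using const_pos(1) by (simp add: power_mult_distrib power2_eq_square)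
      qed
      finally have "(norm (d t))\<^sup>2 \<le> ((norm (d 0) + \<delta> * KV) * GG)\<^sup>2" using zero_le_power2[of "\<delta> * KV"] by linarith
      hence "norm (d t) \<le> (norm (d 0) + \<delta> * KV) * GG"
        by (rule power2_le_imp_le) (use \<delta>(1) KV(1) const_pos(1) in auto)
      also have "\<dots> \<le> (KV * (2 * (C6 * \<delta>) / k2) + \<delta> * KV) * GG"
        using d0 const_pos(1) by (intro mult_right_mono add_right_mono) (auto simp: d_def v(1))
      also have "\<dots> = C7 * \<delta>" by (simp add: C7_def field_simps)
      finally show ?thesis .
    qed
    have pos': "fa2 (v t) (mo.w t) * cos (\<psi> t) + fb2 (v t) (mo.w t) * sin (\<psi> t) > 0" if t: "0 \<le> t" "t \<le> \<tau>" for t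
    proof -
      define c where "c = A0 (centre (z t))"
      obtain R where R: "R > 0" "rho2 * cx1 (z t) = R * cos (\<phi> t)" "rho1 * cx2 (z t) = R * sin (\<phi> t)"
        using ang unfolding angular_def z_def by blast
      define e where "e = norm (d t) * norm (mo.w t) + norm (Vs k t) * norm (mo.w t - c)"
      have e: "e \<le> (C7 * \<delta> * (C\<^sup>2 + k2) + KV * (C6 * \<delta>)) * n t"
      proof -
        have "e \<le> (C7 * \<delta>) * ((C\<^sup>2 + k2) * n t) + KV * (C6 * \<delta> * n t)"
          unfolding e_def c_def using db[OF t] wb(1) VB[OF t] r KV(1) const_pos \<delta>(1)
          by (intro add_mono mult_mono) auto
        thus ?thesis by (simp add: algebra_simps)
      qed
      have fd: "\<bar>fa2 (v t) (mo.w t) - fa2 (Vs k t) c\<bar> \<le> e" "\<bar>fb2 (v t) (mo.w t) - fb2 (Vs k t) c\<bar> \<le> e"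
        unfolding bilinear_diff e_def d_def
        using fa2_bound[of "v t - Vs k t" "mo.w t"] fa2_bound[of "Vs k t" "mo.w t - c"]
          fb2_bound[of "v t - Vs k t" "mo.w t"] fb2_bound[of "Vs k t" "mo.w t - c"] by linarith+
      have xz: "\<bar>cx1 (z t)\<bar> \<le> n t" "\<bar>cx2 (z t)\<bar> \<le> n t" using abs_le_XX by (auto simp: n_def)
      have e0: "e \<ge> 0" by (simp add: e_def)
      have err: "\<bar>(fa2 (v t) (mo.w t) - fa2 (Vs k t) c) * (rho1 * cx2 (z t))\<bar> \<le> e * (rho1 * n t)"
        "\<bar>(fb2 (v t) (mo.w t) - fb2 (Vs k t) c) * (rho2 * cx1 (z t))\<bar> \<le> e * (rho2 * n t)"
        unfolding abs_mult using fd xz rho_pos e0 by (auto intro!: mult_mono)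
      have main: "fa2 (Vs k t) c * (rho1 * cx2 (z t)) - fb2 (Vs k t) c * (rho2 * cx1 (z t)) \<ge> k2\<^sup>2 * (n t)\<^sup>2"
      proof -
        have kb: "k2\<^sup>2 * 1 \<le> k1\<^sup>2 * (1 + Bb\<^sup>2)" "k2\<^sup>2 * 1 \<le> k2\<^sup>2 * (1 + Aa\<^sup>2)"
          using pos by (intro mult_mono power_mono; simp)+
        have "k2\<^sup>2 * (n t)\<^sup>2 = k2\<^sup>2 * (cx2 (z t))\<^sup>2 + k2\<^sup>2 * (cx1 (z t))\<^sup>2"
          unfolding n_def norm_XX by (simp add: algebra_simps)
        also have "\<dots> \<le> k1\<^sup>2 * (1 + Bb\<^sup>2) * (cx2 (z t))\<^sup>2 + k2\<^sup>2 * (1 + Aa\<^sup>2) * (cx1 (z t))\<^sup>2"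
          using kb by (intro add_mono mult_right_mono) auto
        also have "\<dots> \<le> Hs1 k t * (k1\<^sup>2 * (1 + Bb\<^sup>2) * (cx2 (z t))\<^sup>2 + k2\<^sup>2 * (1 + Aa\<^sup>2) * (cx1 (z t))\<^sup>2)"
          using mult_right_mono[OF Hs1_ge[OF k0 t(1)], of "k1\<^sup>2 * (1 + Bb\<^sup>2) * (cx2 (z t))\<^sup>2 + k2\<^sup>2 * (1 + Aa\<^sup>2) * (cx1 (z t))\<^sup>2"]
          by simp
        finally show ?thesis unfolding Vs_def c_def frame_hyp_centre .
      qed
      have "fa2 (v t) (mo.w t) * (rho1 * cx2 (z t)) - fb2 (v t) (mo.w t) * (rho2 * cx1 (z t)) =
        (fa2 (Vs k t) c * (rho1 * cx2 (z t)) - fb2 (Vs k t) c * (rho2 * cx1 (z t)))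
        + (fa2 (v t) (mo.w t) - fa2 (Vs k t) c) * (rho1 * cx2 (z t)) - (fb2 (v t) (mo.w t) - fb2 (Vs k t) c) * (rho2 * cx1 (z t))"
        by (simp add: algebra_simps)
      hence "fa2 (v t) (mo.w t) * (rho1 * cx2 (z t)) - fb2 (v t) (mo.w t) * (rho2 * cx1 (z t))
        \<ge> k2\<^sup>2 * (n t)\<^sup>2 - e * (rho1 * n t) - e * (rho2 * n t)"
        using main err by linarith
      moreover have "e * (rho1 * n t) + e * (rho2 * n t) < k2\<^sup>2 * (n t)\<^sup>2"
      proof -
        have "e * (rho1 * n t) + e * (rho2 * n t) = e * ((rho1 + rho2) * n t)" by (simp add: algebra_simps)
        also have "\<dots> \<le> ((C7 * \<delta> * (C\<^sup>2 + k2) + KV * (C6 * \<delta>)) * n t) * ((rho1 + rho2) * n t)"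
          using e rho_pos n[of t] by (intro mult_right_mono) auto
        also have "\<dots> = ((rho1 + rho2) * (C7 * \<delta> * (C\<^sup>2 + k2) + KV * (C6 * \<delta>))) * (n t)\<^sup>2"
          by (simp add: power2_eq_square)
        also have "\<dots> < k2\<^sup>2 * (n t)\<^sup>2" using \<delta>(6) n[of t] by (intro mult_strict_right_mono) auto
        finally show ?thesis .
      qed
      ultimately have "fa2 (v t) (mo.w t) * (rho1 * cx2 (z t)) - fb2 (v t) (mo.w t) * (rho2 * cx1 (z t)) > 0" by linarith
      moreover have "fa2 (v t) (mo.w t) * (rho1 * cx2 (z t)) - fb2 (v t) (mo.w t) * (rho2 * cx1 (z t)) =
        R * (fa2 (v t) (mo.w t) * cos (\<psi> t) + fb2 (v t) (mo.w t) * sin (\<psi> t))"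
        unfolding R(2,3) \<psi>_def cos_diff sin_diff by (simp add: algebra_simps)
      ultimately show ?thesis using R(1) by (simp add: zero_less_mult_iff)
    qed
    have "\<bar>om (v 0) (v \<tau>) - om (Vs k 0) (Vs k \<tau>)\<bar> < com"
    proof -
      have t: "norm (d 0) \<le> C7 * \<delta>" "norm (d \<tau>) \<le> C7 * \<delta>" "norm (Vs k 0) \<le> KV" "norm (Vs k \<tau>) \<le> KV"
        using db VB \<tau>(1) by auto
      have v\<tau>: "norm (v \<tau>) \<le> 1 + KV"
        using norm_triangle_ineq[of "d \<tau>" "Vs k \<tau>"] t \<delta>(4) by (simp add: d_def)
      have "\<bar>om (v 0) (v \<tau>) - om (Vs k 0) (Vs k \<tau>)\<bar> \<le> norm (d 0) * norm (v \<tau>) + norm (Vs k 0) * norm (d \<tau>)"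
        unfolding bilinear_diff d_def
        using om_bound[of "v 0 - Vs k 0" "v \<tau>"] om_bound[of "Vs k 0" "v \<tau> - Vs k \<tau>"] by linarith
      also have "\<dots> \<le> C7 * \<delta> * (1 + KV) + KV * (C7 * \<delta>)"
        using t v\<tau> KV(1) const_pos \<delta>(1) by (intro add_mono mult_mono) auto
      also have "\<dots> = C7 * \<delta> * (2 * KV + 1)" by (simp add: algebra_simps)
      finally show ?thesis using \<delta>(5) by simp
    qed
    with pos' v tan show ?thesis by blast
  qed
  obtain u where u: "mo.sol u" "om (u 0) (mo.w 0) = 0"
    "\<And>t. 0 \<le> t \<Longrightarrow> t \<le> \<tau> \<Longrightarrow> fa2 (u t) (mo.w t) * cos (\<psi> t) + fb2 (u t) (mo.w t) * sin (\<psi> t) > 0"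
    "\<bar>om (u 0) (u \<tau>) - om (Vs kk 0) (Vs kk \<tau>)\<bar> < com" using key[of kk] by auto
  obtain v where v: "mo.sol v" "om (v 0) (mo.w 0) = 0"
    "\<And>t. 0 \<le> t \<Longrightarrow> t \<le> \<tau> \<Longrightarrow> fa2 (v t) (mo.w t) * cos (\<psi> t) + fb2 (v t) (mo.w t) * sin (\<psi> t) > 0"
    "\<bar>om (v 0) (v \<tau>) - om (Vs 0 0) (Vs 0 \<tau>)\<bar> < com" using key[of 0] by auto
  have sign: "om (u 0) (u \<tau>) > 0" "om (v 0) (v \<tau>) < 0"
    using om_Vs_bounds[OF \<tau>12(1)] u(4) v(4) by linarith+
  show "cz_index F \<gamma> \<tau> = 2" "hyperbolic F \<gamma> \<tau>"
    using mo.index_two_hyperbolic[OF u(1,2) v(1,2) \<tau>(1,3) \<psi> u(3) v(3) sign] by blast+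
qed

end

section \<open>The regularized Hamiltonian\<close>

definition hA1 where "hA1 s = sin (2 * s) / (8::real)"
definition hA1' where "hA1' s = cos (2 * s) / (4::real)"
definition hA1'' where "hA1'' s = - sin (2 * s) / (2::real)"
definition hA2 where "hA2 s = sinh (2 * s) / (8::real)"
definition hA2' where "hA2' s = cosh (2 * s) / (4::real)"
definition hA2'' where "hA2'' s = sinh (2 * s) / (2::real)"

definition hV where "hV \<mu> E x = V_E E (fst x) (snd x) + (1 - 2 * \<mu>) * V_hat \<mu> (fst x) (snd x)"
definition hV1 :: "real \<Rightarrow> real \<Rightarrow> real \<times> real \<Rightarrow> real" where
  "hV1 \<mu> E x = - (E / 2) * cosh (fst x) * sinh (fst x) - sinh (fst x) / 2 - sinh (2 * fst x) * cosh (2 * fst x) / 32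
     - (1 - 2 * \<mu>) / 16 * (sinh (fst x) * cos (snd x) * ((cosh (fst x))\<^sup>2 - (cos (snd x))\<^sup>2)
       + (1 / 2 - \<mu> + cosh (fst x) * cos (snd x)) * (2 * cosh (fst x) * sinh (fst x)))"
definition hV2 :: "real \<Rightarrow> real \<Rightarrow> real \<times> real \<Rightarrow> real" where
  "hV2 \<mu> E x = - (E / 2) * cos (snd x) * sin (snd x) - sin (2 * snd x) * cos (2 * snd x) / 32
     + (1 - 2 * \<mu>) * (- sin (snd x) / 2 - 1 / 16 * (- cosh (fst x) * sin (snd x) * ((cosh (fst x))\<^sup>2 - (cos (snd x))\<^sup>2)
       + (1 / 2 - \<mu> + cosh (fst x) * cos (snd x)) * (2 * cos (snd x) * sin (snd x))))"
definition hV11 :: "real \<Rightarrow> real \<Rightarrow> real \<times> real \<Rightarrow> real" where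
  "hV11 \<mu> E x = - (E / 2) * ((cosh (fst x))\<^sup>2 + (sinh (fst x))\<^sup>2) - cosh (fst x) / 2
     - ((cosh (2 * fst x))\<^sup>2 + (sinh (2 * fst x))\<^sup>2) / 16
     - (1 - 2 * \<mu>) / 16 * (cosh (fst x) * cos (snd x) * ((cosh (fst x))\<^sup>2 - (cos (snd x))\<^sup>2)
       + 4 * (sinh (fst x))\<^sup>2 * cosh (fst x) * cos (snd x)
       + (1 / 2 - \<mu> + cosh (fst x) * cos (snd x)) * (2 * ((cosh (fst x))\<^sup>2 + (sinh (fst x))\<^sup>2)))"
definition hV12 :: "real \<Rightarrow> real \<Rightarrow> real \<times> real \<Rightarrow> real" where
  "hV12 \<mu> E x = - (1 - 2 * \<mu>) / 16 * (- sinh (fst x) * sin (snd x) * ((cosh (fst x))\<^sup>2 - (cos (snd x))\<^sup>2)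
       + sinh (fst x) * cos (snd x) * (2 * cos (snd x) * sin (snd x))
       - cosh (fst x) * sin (snd x) * (2 * cosh (fst x) * sinh (fst x)))"
definition hV22 :: "real \<Rightarrow> real \<Rightarrow> real \<times> real \<Rightarrow> real" where
  "hV22 \<mu> E x = - (E / 2) * ((cos (snd x))\<^sup>2 - (sin (snd x))\<^sup>2) - ((cos (2 * snd x))\<^sup>2 - (sin (2 * snd x))\<^sup>2) / 16
     + (1 - 2 * \<mu>) * (- cos (snd x) / 2 - 1 / 16 * (- cosh (fst x) * cos (snd x) * ((cosh (fst x))\<^sup>2 - (cos (snd x))\<^sup>2)
       - 4 * cosh (fst x) * (sin (snd x))\<^sup>2 * cos (snd x)
       + (1 / 2 - \<mu> + cosh (fst x) * cos (snd x)) * (2 * ((cos (snd x))\<^sup>2 - (sin (snd x))\<^sup>2))))"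

lemma hyperbolic_chain:
  fixes g :: "'a::real_normed_vector \<Rightarrow> real"
  assumes "(g has_derivative g') (at z)"
  shows "((\<lambda>z. cosh (g z)) has_derivative (\<lambda>h. sinh (g z) * g' h)) (at z)"
    "((\<lambda>z. sinh (g z)) has_derivative (\<lambda>h. cosh (g z) * g' h)) (at z)"
    "((\<lambda>z. cos (g z)) has_derivative (\<lambda>h. - sin (g z) * g' h)) (at z)"
    "((\<lambda>z. sin (g z)) has_derivative (\<lambda>h. cos (g z) * g' h)) (at z)"
proof -
  have c: "((\<lambda>z. f (g z)) has_derivative (\<lambda>h. f' * g' h)) (at z)" if "(f has_real_derivative f') (at (g z))" for f f'
    using has_derivative_compose[OF assms that[unfolded has_field_derivative_def]] by simp
  show "((\<lambda>z. cosh (g z)) has_derivative (\<lambda>h. sinh (g z) * g' h)) (at z)"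
    "((\<lambda>z. sinh (g z)) has_derivative (\<lambda>h. cosh (g z) * g' h)) (at z)"
    "((\<lambda>z. cos (g z)) has_derivative (\<lambda>h. - sin (g z) * g' h)) (at z)"
    "((\<lambda>z. sin (g z)) has_derivative (\<lambda>h. cos (g z) * g' h)) (at z)"
    by (rule c; auto intro!: derivative_eq_intros)+
qed

lemma hV_derivative: "(hV \<mu> E has_derivative (\<lambda>h. hV1 \<mu> E x * fst h + hV2 \<mu> E x * snd h)) (at x)"
  unfolding hV_def[abs_def] V_E_def V_hat_def
  by (rule derivative_eq_intros hyperbolic_chain refl | simp)+
    (simp add: hV1_def hV2_def fun_eq_iff field_simps power2_eq_square)

lemma hV1_derivative: "(hV1 \<mu> E has_derivative (\<lambda>h. hV11 \<mu> E x * fst h + hV12 \<mu> E x * snd h)) (at x)"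
  unfolding hV1_def[abs_def]
  by (rule derivative_eq_intros hyperbolic_chain refl | simp)+
    (simp add: hV11_def hV12_def fun_eq_iff field_simps power2_eq_square)

lemma hV2_derivative: "(hV2 \<mu> E has_derivative (\<lambda>h. hV12 \<mu> E x * fst h + hV22 \<mu> E x * snd h)) (at x)"
  unfolding hV2_def[abs_def]
  by (rule derivative_eq_intros hyperbolic_chain refl | simp)+
    (simp add: hV12_def hV22_def fun_eq_iff field_simps power2_eq_square)

interpretation ham: magnetic hA1 hA1' hA1'' hA2 hA2' hA2'' "hV \<mu> E" "hV1 \<mu> E" "hV2 \<mu> E" "hV11 \<mu> E" "hV12 \<mu> E" "hV22 \<mu> E"
  for \<mu> E
proof
  show "(hA1 has_real_derivative hA1' s) (at s)" "(hA1' has_real_derivative hA1'' s) (at s)"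
    "(hA2 has_real_derivative hA2' s) (at s)" "(hA2' has_real_derivative hA2'' s) (at s)" for s
    unfolding hA1_def[abs_def] hA1'_def hA1''_def hA2_def[abs_def] hA2'_def hA2''_def hA1'_def[abs_def] hA2'_def[abs_def]
    by (auto intro!: derivative_eq_intros)
  show "continuous_on UNIV hA1''" "continuous_on UNIV hA2''"
    unfolding hA1''_def[abs_def] hA2''_def[abs_def] by (intro continuous_intros; simp)+
  show "continuous_on UNIV (hV11 \<mu> E)" "continuous_on UNIV (hV12 \<mu> E)" "continuous_on UNIV (hV22 \<mu> E)"
    unfolding hV11_def[abs_def] hV12_def[abs_def] hV22_def[abs_def] by (intro continuous_intros; simp)+
qed (rule hV_derivative hV1_derivative hV2_derivative)+

lemma H_hat_F: "H_hat \<mu> E = ham.F \<mu> E"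
  by (rule ext) (simp add: H_hat_def ham.F_def ham.P1_def ham.P2_def hA1_def hA2_def hV_def comp_defs split: prod.split)

section \<open>The first Lagrange point\<close>

text \<open>\<open>pot\<close> is \<open>H_mu\<close> on the real axis with p + i q = 0, in the
  coordinate r = 1 - \<mu> - q, and \<open>crit\<close> is its derivative with respect to q.\<close>

definition crit :: "real \<Rightarrow> real \<Rightarrow> real" where
  "crit \<mu> r = (1 - \<mu>) / (1 - r)\<^sup>2 - \<mu> / r\<^sup>2 - (1 - \<mu> - r)"
definition pot :: "real \<Rightarrow> real \<Rightarrow> real" where
  "pot \<mu> r = - (\<mu> / r + (1 - \<mu>) / (1 - r) + (1 - \<mu> - r)\<^sup>2 / 2)"

lemma crit_strict_mono:
  assumes "0 < \<mu>" "\<mu> < 1" "0 < r" "r < s" "s < 1"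
  shows "crit \<mu> r < crit \<mu> s"
proof -
  have "(1 - s)\<^sup>2 < (1 - r)\<^sup>2" "r\<^sup>2 < s\<^sup>2" using assms by (intro power_strict_mono; simp)+
  hence "(1 - \<mu>) / (1 - r)\<^sup>2 < (1 - \<mu>) / (1 - s)\<^sup>2" "\<mu> / s\<^sup>2 < \<mu> / r\<^sup>2"
    using assms by (intro divide_strict_left_mono mult_pos_pos; simp)+
  thus ?thesis unfolding crit_def using assms by linarith
qed

lemma crit_root_exists:
  assumes "0 < \<mu>" "\<mu> < 1"
  shows "\<exists>r. 0 < r \<and> r < 1 \<and> crit \<mu> r = 0"
proof -
  \<comment> \<open>Clearing denominators gives a function that is continuous on all of [0, 1], with
    the values - \<mu> and 1 - \<mu> at the ends.\<close>
  define g where "g r = (1 - \<mu>) * r\<^sup>2 - \<mu> * (1 - r)\<^sup>2 - (1 - \<mu> - r) * r\<^sup>2 * (1 - r)\<^sup>2" for r :: real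
  have "\<exists>r\<ge>0. r \<le> 1 \<and> g r = 0"
    by (rule IVT') (use assms in \<open>auto simp: g_def intro!: continuous_intros\<close>)
  then obtain r where r: "0 \<le> r" "r \<le> 1" "g r = 0" by auto
  have "r \<noteq> 0" "r \<noteq> 1" using r(3) assms by (auto simp: g_def)
  with r have r': "0 < r" "r < 1" by auto
  hence nz: "r\<^sup>2 \<noteq> 0" "(1 - r)\<^sup>2 \<noteq> 0" by auto
  have "crit \<mu> r * (r\<^sup>2 * (1 - r)\<^sup>2) = g r"
    unfolding crit_def g_def using nz by (simp add: field_simps)
  hence "crit \<mu> r = 0" using r(3) nz by simp
  thus ?thesis using r' by blast
qed

definition rt :: "real \<Rightarrow> real" where "rt \<mu> = (SOME r. 0 < r \<and> r < 1 \<and> crit \<mu> r = 0)"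

lemma rt: "0 < \<mu> \<Longrightarrow> \<mu> < 1 \<Longrightarrow> 0 < rt \<mu>" "0 < \<mu> \<Longrightarrow> \<mu> < 1 \<Longrightarrow> rt \<mu> < 1"
  "0 < \<mu> \<Longrightarrow> \<mu> < 1 \<Longrightarrow> crit \<mu> (rt \<mu>) = 0"
  using someI_ex[OF crit_root_exists, of \<mu>] unfolding rt_def by blast+

lemma rt_unique:
  assumes "0 < \<mu>" "\<mu> < 1" "0 < r" "r < 1" "crit \<mu> r = 0"
  shows "r = rt \<mu>"
  using crit_strict_mono[OF assms(1,2), of r "rt \<mu>"] crit_strict_mono[OF assms(1,2), of "rt \<mu>" r] rt[of \<mu>] assms
  by (cases r "rt \<mu>" rule: linorder_cases) auto

lemma H_mu_derivative:
  assumes "q \<noteq> of_real (1 - \<mu>)" "q \<noteq> of_real (- \<mu>)"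
  shows "(H_mu \<mu> has_derivative (\<lambda>h. (fst h + \<i> * snd h) \<bullet> (p + \<i> * q)
     + \<mu> / (cmod (q - of_real (1 - \<mu>)))\<^sup>2 * (snd h \<bullet> sgn (q - of_real (1 - \<mu>)))
     + (1 - \<mu>) / (cmod (q + of_real \<mu>))\<^sup>2 * (snd h \<bullet> sgn (q + of_real \<mu>))
     - snd h \<bullet> q)) (at (p, q))"
proof -
  have nz: "q - of_real (1 - \<mu>) \<noteq> 0" "q + of_real \<mu> \<noteq> 0"
    using assms by (auto simp: add_eq_0_iff)
  have n: "((\<lambda>z. cmod (snd z + c)) has_derivative (\<lambda>h. snd h \<bullet> sgn (q + c))) (at (p, q))" if "q + c \<noteq> 0" for c
  proof -
    have "((\<lambda>z. snd z + c) has_derivative (\<lambda>h. snd h)) (at (p, q))" by (auto intro!: derivative_eq_intros)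
    from has_derivative_compose[OF this, of norm "\<lambda>h. h \<bullet> sgn (q + c)"] has_derivative_norm[OF that] show ?thesis by simp
  qed
  have sq: "((\<lambda>z. (cmod (f z))\<^sup>2 / 2) has_derivative (\<lambda>h. f' h \<bullet> f (p, q))) (at (p, q))"
    if "(f has_derivative f') (at (p, q))" for f f' :: "complex \<times> complex \<Rightarrow> complex"
    unfolding power2_norm_eq_inner
    by (rule derivative_eq_intros has_derivative_inner that refl)+ (auto simp: inner_commute)
  have inv: "((\<lambda>z. c / g z) has_derivative (\<lambda>h. - c / (g (p, q))\<^sup>2 * g' h)) (at (p, q))"
    if "(g has_derivative g') (at (p, q))" "g (p, q) \<noteq> 0" for c and g :: "complex \<times> complex \<Rightarrow> real" and g'
    using that by (auto intro!: derivative_eq_intros simp: fun_eq_iff field_simps power2_eq_square)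
  have H: "H_mu \<mu> = (\<lambda>z. (cmod (fst z + \<i> * snd z))\<^sup>2 / 2 - \<mu> / cmod (snd z + (- of_real (1 - \<mu>)))
     - (1 - \<mu>) / cmod (snd z + of_real \<mu>) - (cmod (snd z))\<^sup>2 / 2)"
    unfolding H_mu_def by (auto simp: fun_eq_iff algebra_simps)
  have d1: "((\<lambda>z. (cmod (fst z + \<i> * snd z))\<^sup>2 / 2) has_derivative (\<lambda>h. (fst h + \<i> * snd h) \<bullet> (p + \<i> * q))) (at (p, q))"
  proof -
    have "((\<lambda>z. fst z + \<i> * snd z) has_derivative (\<lambda>h. fst h + \<i> * snd h)) (at (p, q))"
      by (auto intro!: derivative_eq_intros)
    from sq[OF this] show ?thesis by simp
  qed
  have d4: "((\<lambda>z. (cmod (snd z))\<^sup>2 / 2) has_derivative (\<lambda>h. snd h \<bullet> q)) (at (p, q))"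
    using sq[OF has_derivative_snd[OF has_derivative_ident]] by simp
  have d2: "((\<lambda>z. \<mu> / cmod (snd z + (- of_real (1 - \<mu>)))) has_derivative
     (\<lambda>h. - \<mu> / (cmod (q + (- of_real (1 - \<mu>))))\<^sup>2 * (snd h \<bullet> sgn (q + (- of_real (1 - \<mu>)))))) (at (p, q))"
  proof -
    have nz': "q + (- of_real (1 - \<mu>)) \<noteq> 0" using nz(1) unfolding add_uminus_conv_diff .
    hence "cmod (q + (- of_real (1 - \<mu>))) \<noteq> 0" unfolding norm_eq_zero .
    from inv[OF n[OF nz'], unfolded snd_conv, OF this] show ?thesis .
  qed
  have d3: "((\<lambda>z. (1 - \<mu>) / cmod (snd z + of_real \<mu>)) has_derivative
     (\<lambda>h. - (1 - \<mu>) / (cmod (q + of_real \<mu>))\<^sup>2 * (snd h \<bullet> sgn (q + of_real \<mu>)))) (at (p, q))"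
  proof -
    have "cmod (q + of_real \<mu>) \<noteq> 0" using nz(2) unfolding norm_eq_zero .
    from inv[OF n[OF nz(2)], unfolded snd_conv, OF this] show ?thesis .
  qed
  show ?thesis unfolding H
    by (rule has_derivative_eq_rhs[OF has_derivative_diff[OF has_derivative_diff[OF has_derivative_diff[OF d1 d2] d3] d4]])
      (intro ext, simp only: add_uminus_conv_diff minus_divide_left[symmetric] mult_minus_left diff_minus_eq_add)
qed

lemma H_mu_derivative_axis:
  assumes "0 < r" "r < 1"
  shows "(H_mu \<mu> has_derivative (\<lambda>h. (fst h + \<i> * snd h) \<bullet> (p + \<i> * of_real (1 - \<mu> - r)) + crit \<mu> r * Re (snd h)))
    (at (p, of_real (1 - \<mu> - r)))"
proof -
  define q :: complex where "q = of_real (1 - \<mu> - r)"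
  have a: "q - of_real (1 - \<mu>) = of_real (- r)" "q + of_real \<mu> = of_real (1 - r)" by (simp_all add: q_def)
  have "q \<noteq> of_real (1 - \<mu>)" "q \<noteq> of_real (- \<mu>)" using assms unfolding q_def of_real_eq_iff by auto
  note d = H_mu_derivative[OF this, of p]
  have sg: "sgn (of_real (- r)) = (- 1 :: complex)" "sgn (of_real (1 - r)) = (1 :: complex)"
    unfolding sgn_of_real using assms by simp_all
  show ?thesis unfolding q_def[symmetric]
    by (rule has_derivative_eq_rhs[OF d], unfold a norm_of_real sg)
      (use assms in \<open>simp add: fun_eq_iff crit_def inner_complex_def q_def algebra_simps\<close>)
qed

text \<open>The p-part of the gradient forces p + i q = 0; then the derivative along the axis is
  \<open>crit\<close>, whose only zero in (0, 1) is \<open>rt\<close>. This settles the definite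
  description in \<open>l1\<close>.\<close>

lemma l1_eq:
  assumes "0 < \<mu>" "\<mu> < 1"
  shows "l1 \<mu> = (- (\<i> * of_real (1 - \<mu> - rt \<mu>)), of_real (1 - \<mu> - rt \<mu>))"
  unfolding l1_def
proof (rule the_equality)
  note r = rt[OF assms]
  define q :: complex where "q = of_real (1 - \<mu> - rt \<mu>)"
  have seg: "of_real x \<in> open_segment (of_real (- \<mu>)) (of_real (1 - \<mu>) :: complex) \<longleftrightarrow> - \<mu> < x \<and> x < 1 - \<mu>" for x
  proof -
    have "open_segment (of_real (- \<mu>)) (of_real (1 - \<mu>) :: complex) = of_real ` open_segment (- \<mu>) (1 - \<mu>)"
      by (rule open_segment_of_real)
    also have "open_segment (- \<mu>) (1 - \<mu>) = {- \<mu><..<1 - \<mu>}" by (simp add: open_segment_eq_real_ivl)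
    finally show ?thesis by auto
  qed
  have segE: "\<exists>x. z = of_real x \<and> - \<mu> < x \<and> x < 1 - \<mu>"
    if "z \<in> open_segment (of_real (- \<mu>)) (of_real (1 - \<mu>) :: complex)" for z
  proof -
    have "open_segment (of_real (- \<mu>)) (of_real (1 - \<mu>) :: complex) = of_real ` open_segment (- \<mu>) (1 - \<mu>)"
      by (rule open_segment_of_real)
    thus ?thesis using that by (auto simp: open_segment_eq_real_ivl)
  qed
  have "GDERIV (H_mu \<mu>) (- (\<i> * q), q) :> 0"
    unfolding gderiv_def using H_mu_derivative_axis[OF r(1,2), of \<mu> "- (\<i> * q)"] r(3) by (simp add: q_def)
  moreover have "q \<in> open_segment (of_real (- \<mu>)) (of_real (1 - \<mu>))" unfolding q_def seg using r by simp
  ultimately show "snd (- (\<i> * of_real (1 - \<mu> - rt \<mu>)), complex_of_real (1 - \<mu> - rt \<mu>)) \<in> open_segment (of_real (- \<mu>)) (of_real (1 - \<mu>)) \<and>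
    GDERIV (H_mu \<mu>) (- (\<i> * of_real (1 - \<mu> - rt \<mu>)), of_real (1 - \<mu> - rt \<mu>)) :> 0" by (simp add: q_def)
  fix z :: "complex \<times> complex"
  assume z: "snd z \<in> open_segment (of_real (- \<mu>)) (of_real (1 - \<mu>)) \<and> GDERIV (H_mu \<mu>) z :> 0"
  then obtain x where x: "snd z = of_real x" "- \<mu> < x" "x < 1 - \<mu>" using segE by blast
  define s where "s = 1 - \<mu> - x"
  have s: "0 < s" "s < 1" "x = 1 - \<mu> - s" using x by (auto simp: s_def)
  define p where "p = fst z"
  have zp: "z = (p, of_real (1 - \<mu> - s))" using x(1) s(3) by (simp add: p_def prod_eq_iff)
  have "(H_mu \<mu> has_derivative (\<lambda>h. h \<bullet> 0)) (at (p, of_real (1 - \<mu> - s)))" using z unfolding gderiv_def zp by blast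
  from has_derivative_unique[OF H_mu_derivative_axis[OF s(1,2)] this]
  have fz: "(fst h + \<i> * snd h) \<bullet> (p + \<i> * of_real (1 - \<mu> - s)) + crit \<mu> s * Re (snd h) = 0" for h
    by (metis inner_zero_right)
  have "p + \<i> * of_real (1 - \<mu> - s) = 0" using fz[of "(p + \<i> * of_real (1 - \<mu> - s), 0)"] by simp
  moreover from this have "crit \<mu> s = 0" using fz[of "(0, 1)"] by simp
  hence "s = rt \<mu>" using rt_unique assms s by blast
  ultimately show "z = (- (\<i> * of_real (1 - \<mu> - rt \<mu>)), of_real (1 - \<mu> - rt \<mu>))"
    unfolding zp by (simp add: eq_neg_iff_add_eq_0)
qed

lemma r1_eq: "0 < \<mu> \<Longrightarrow> \<mu> < 1 \<Longrightarrow> r1 \<mu> = rt \<mu>"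
  unfolding r1_def by (simp add: l1_eq)

lemma L1_eq: "0 < \<mu> \<Longrightarrow> \<mu> < 1 \<Longrightarrow> L1 \<mu> = pot \<mu> (rt \<mu>)"
proof -
  assume \<mu>: "0 < \<mu>" "\<mu> < 1"
  define r where "r = rt \<mu>"
  have r: "0 < r" "r < 1" using rt[OF \<mu>] by (auto simp: r_def)
  have a: "complex_of_real (1 - \<mu> - r) - of_real (1 - \<mu>) = of_real (- r)" "complex_of_real (1 - \<mu> - r) + of_real \<mu> = of_real (1 - r)"
    by simp_all
  show ?thesis unfolding L1_def l1_eq[OF \<mu>] H_mu_def r_def[symmetric] prod.case a norm_of_real
    using r by (simp add: pot_def)
qed

text \<open>\<open>crit\<close> is increasing in r. Its signs at r0 - d and r0 + d persist for
  nearby \<mu> and enclose the root.\<close>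

lemma rt_continuous:
  assumes \<mu>0: "0 < \<mu>0" "\<mu>0 < 1" and "e > 0"
  shows "\<forall>\<^sub>F \<mu> in nhds \<mu>0. 0 < \<mu> \<and> \<mu> < 1 \<and> \<bar>rt \<mu> - rt \<mu>0\<bar> < e"
proof -
  define r0 where "r0 = rt \<mu>0"
  note r0 = rt[OF \<mu>0, folded r0_def]
  define d where "d = min (e / 2) (min (r0 / 2) ((1 - r0) / 2))"
  have d: "0 < d" "d < e" "d < r0" "d < 1 - r0" proof -
    have "0 < d" "d \<le> e / 2" "d \<le> r0 / 2" "d \<le> (1 - r0) / 2"
      unfolding d_def using r0 \<open>e > 0\<close>
      by (simp, intro min.cobounded1, intro min.coboundedI2[OF min.cobounded1], intro min.coboundedI2[OF min.cobounded2])
    moreover have "(1 - r0) / 2 < 1 - r0" "r0 / 2 < r0" "e / 2 < e" using r0 \<open>e > 0\<close> by auto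
    ultimately show "0 < d" "d < e" "d < r0" "d < 1 - r0" by linarith+
  qed
  have c: "isCont (\<lambda>\<mu>. crit \<mu> r) \<mu>0" if "0 < r" "r < 1" for r
    unfolding crit_def using that by (intro continuous_intros) auto
  have "crit \<mu>0 (r0 - d) < 0" "crit \<mu>0 (r0 + d) > 0"
    using crit_strict_mono[OF \<mu>0, of "r0 - d" r0] crit_strict_mono[OF \<mu>0, of r0 "r0 + d"] d r0 by auto
  hence "\<forall>\<^sub>F \<mu> in nhds \<mu>0. crit \<mu> (r0 - d) < 0" "\<forall>\<^sub>F \<mu> in nhds \<mu>0. crit \<mu> (r0 + d) > 0"
    using order_tendstoD(2)[OF iffD1[OF tendsto_at_iff_tendsto_nhds[of "\<lambda>\<mu>. crit \<mu> (r0 - d)"] c[of "r0 - d", unfolded isCont_def]]]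
      order_tendstoD(1)[OF iffD1[OF tendsto_at_iff_tendsto_nhds[of "\<lambda>\<mu>. crit \<mu> (r0 + d)"] c[of "r0 + d", unfolded isCont_def]]] d r0
    by auto
  moreover have "\<forall>\<^sub>F \<mu> in nhds \<mu>0. \<mu> \<in> {0<..<1}" using \<mu>0 by (intro eventually_nhds_in_open) auto
  ultimately show ?thesis
  proof eventually_elim
    case (elim \<mu>)
    hence \<mu>: "0 < \<mu>" "\<mu> < 1" by auto
    note r = rt[OF \<mu>]
    have "r0 - d < rt \<mu>"
    proof (rule ccontr)
      assume "\<not> r0 - d < rt \<mu>"
      hence "crit \<mu> (rt \<mu>) \<le> crit \<mu> (r0 - d)"
        using crit_strict_mono[OF \<mu> r(1), of "r0 - d"] d r0 by (cases "rt \<mu> = r0 - d") auto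
      thus False using elim r by simp
    qed
    moreover have "rt \<mu> < r0 + d"
    proof (rule ccontr)
      assume "\<not> rt \<mu> < r0 + d"
      hence "crit \<mu> (r0 + d) \<le> crit \<mu> (rt \<mu>)"
        using crit_strict_mono[OF \<mu> _ _ r(2), of "r0 + d"] d r0 by (cases "rt \<mu> = r0 + d") auto
      thus False using elim r by simp
    qed
    ultimately show ?case using \<mu> d by (auto simp: r0_def abs_less_iff)
  qed
qed

text \<open>On x1 = 0 with cos y = 1 - 2 r the coordinate change gives q1 = 1 - \<mu> - r, and the
  factor in front of H_mu - E becomes r (1 - r). The derivatives are arranged so that the terms with
  pot - E and \<open>crit\<close> drop out at the Lagrange point with E = L1 \<mu>, where the signs
  of \<open>hV11\<close> and \<open>hV22\<close> become visible.\<close>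

lemma hV_axis:
  assumes "cos y = 1 - 2 * r" "0 < r" "r < 1"
  shows "hV \<mu> E (0, y) = r * (1 - r) * (pot \<mu> r - E)"
    "hV2 \<mu> E (0, y) = sin y / 2 * ((1 - 2 * r) * (pot \<mu> r - E) - r * (1 - r) * crit \<mu> r)"
    "hV11 \<mu> E (0, y) = (pot \<mu> r - E) / 2 + r * (1 - r) * (crit \<mu> r * (1 - 2 * r) / 2 + r * (1 - r) * (\<mu> / r ^ 3 + (1 - \<mu>) / (1 - r) ^ 3 - 1))"
    "hV22 \<mu> E (0, y) = (1 - 2 * r) / 2 * ((1 - 2 * r) * (pot \<mu> r - E) - r * (1 - r) * crit \<mu> r)
       + r * (1 - r) * (- 2 * (pot \<mu> r - E) - 2 * (1 - 2 * r) * crit \<mu> r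
          - r * (1 - r) * (2 * \<mu> / r ^ 3 + 2 * (1 - \<mu>) / (1 - r) ^ 3 + 1))"
    "hV1 \<mu> E (0, y) = 0" "hV12 \<mu> E (0, y) = 0"
proof -
  have S2: "(sin y)\<^sup>2 = 4 * r * (1 - r)" using sin_cos_squared_add[of y] unfolding assms(1)
    by (simp add: power2_eq_square algebra_simps)
  have c2: "cos (2 * y) = 1 - 8 * r * (1 - r)" unfolding cos_double_cos assms(1) by (simp add: power2_eq_square algebra_simps)
  have s2: "sin (2 * y) = 2 * sin y * (1 - 2 * r)" unfolding sin_double assms(1) ..
  have s22: "(sin (2 * y))\<^sup>2 = 16 * r * (1 - r) * (1 - 2 * r)\<^sup>2" unfolding s2 power_mult_distrib S2 by simp
  have nz: "r \<noteq> 0" "1 - r \<noteq> 0" using assms by auto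
  have p: "r * (1 - r) * pot \<mu> r = - (\<mu> * (1 - r) + (1 - \<mu>) * r + r * (1 - r) * (1 - \<mu> - r)\<^sup>2 / 2)"
    unfolding pot_def using nz by (simp add: field_simps)
  have pc: "(1 - 2 * r) * pot \<mu> r - r * (1 - r) * crit \<mu> r = 2 * \<mu> - 1 - (1 - 2 * r) * (1 - \<mu> - r)\<^sup>2 / 2 + r * (1 - r) * (1 - \<mu> - r)"
    unfolding pot_def crit_def using nz by (simp add: field_simps) algebra
  have p11: "pot \<mu> r / 2 + r * (1 - r) * (crit \<mu> r * (1 - 2 * r) / 2 + r * (1 - r) * (\<mu> / r ^ 3 + (1 - \<mu>) / (1 - r) ^ 3 - 1))
     = - 1 / 2 * \<mu> - (1 - \<mu>) / 2 - (1 - \<mu> - r)\<^sup>2 / 4 - r * (1 - r) * (1 - 2 * r) * (1 - \<mu> - r) / 2 - (r * (1 - r))\<^sup>2 "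
    unfolding pot_def crit_def using nz by (simp add: field_simps) algebra
  show "hV \<mu> E (0, y) = r * (1 - r) * (pot \<mu> r - E)"
    unfolding right_diff_distrib[of "r * (1 - r)" "pot \<mu> r" E] p unfolding hV_def V_E_def V_hat_def fst_conv snd_conv s22 assms(1)
    by (simp add: field_simps power2_eq_square)
  show "hV1 \<mu> E (0, y) = 0" "hV12 \<mu> E (0, y) = 0" by (simp_all add: hV1_def hV12_def)
  have "(1 - 2 * r) * (pot \<mu> r - E) - r * (1 - r) * crit \<mu> r = (1 - 2 * r) * pot \<mu> r - r * (1 - r) * crit \<mu> r - (1 - 2 * r) * E"
    by (simp add: algebra_simps)
  note W = this[unfolded pc]
  show "hV2 \<mu> E (0, y) = sin y / 2 * ((1 - 2 * r) * (pot \<mu> r - E) - r * (1 - r) * crit \<mu> r)"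
    unfolding W unfolding hV2_def fst_conv snd_conv s2 c2 assms(1)
    by (simp add: field_simps power2_eq_square)
  have "(pot \<mu> r - E) / 2 + r * (1 - r) * (crit \<mu> r * (1 - 2 * r) / 2 + r * (1 - r) * (\<mu> / r ^ 3 + (1 - \<mu>) / (1 - r) ^ 3 - 1))
    = pot \<mu> r / 2 + r * (1 - r) * (crit \<mu> r * (1 - 2 * r) / 2 + r * (1 - r) * (\<mu> / r ^ 3 + (1 - \<mu>) / (1 - r) ^ 3 - 1)) - E / 2"
    by simp
  note W11 = this[unfolded p11]
  show "hV11 \<mu> E (0, y) = (pot \<mu> r - E) / 2 + r * (1 - r) * (crit \<mu> r * (1 - 2 * r) / 2 + r * (1 - r) * (\<mu> / r ^ 3 + (1 - \<mu>) / (1 - r) ^ 3 - 1))"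
    unfolding W11 unfolding hV11_def fst_conv snd_conv assms(1)
    by (simp add: field_simps power2_eq_square)
  have p22: "- 2 * pot \<mu> r - 2 * (1 - 2 * r) * crit \<mu> r - r * (1 - r) * (2 * \<mu> / r ^ 3 + 2 * (1 - \<mu>) / (1 - r) ^ 3 + 1)
    = (1 - \<mu> - r)\<^sup>2 + 2 * (1 - 2 * r) * (1 - \<mu> - r) - r * (1 - r)"
    unfolding pot_def crit_def using nz by (simp add: field_simps) algebra
  have "- 2 * (pot \<mu> r - E) - 2 * (1 - 2 * r) * crit \<mu> r - r * (1 - r) * (2 * \<mu> / r ^ 3 + 2 * (1 - \<mu>) / (1 - r) ^ 3 + 1)
    = - 2 * pot \<mu> r - 2 * (1 - 2 * r) * crit \<mu> r - r * (1 - r) * (2 * \<mu> / r ^ 3 + 2 * (1 - \<mu>) / (1 - r) ^ 3 + 1) + 2 * E"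
    by simp
  note W22 = this[unfolded p22]
  show "hV22 \<mu> E (0, y) = (1 - 2 * r) / 2 * ((1 - 2 * r) * (pot \<mu> r - E) - r * (1 - r) * crit \<mu> r)
       + r * (1 - r) * (- 2 * (pot \<mu> r - E) - 2 * (1 - 2 * r) * crit \<mu> r
          - r * (1 - r) * (2 * \<mu> / r ^ 3 + 2 * (1 - \<mu>) / (1 - r) ^ 3 + 1))"
    unfolding W W22 unfolding hV22_def fst_conv snd_conv c2 s22 S2 assms(1)
    by (simp add: field_simps power2_eq_square)
qed

section \<open>The saddle-centers of the regularized Hamiltonian\<close>

text \<open>Here \<alpha> and - \<beta> are the second derivatives of the potential in x1 and x2.
  Eliminating k2 leaves the quadratic g for k1; it is negative at b and positive at X, so it has a
  root beyond b.\<close>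

lemma saddle_center_roots:
  fixes \<alpha> \<beta> b :: real
  assumes "\<alpha> > 0" "\<beta> > 0" "b > 0"
  shows "\<exists>k1 k2. 0 < k2 \<and> k2 < b \<and> b < k1 \<and> k2 * (k1 - b) = \<alpha> \<and> k1 * (b - k2) = \<beta>"
proof -
  define g where "g x = b * x * x - (b * b + \<alpha> + \<beta>) * x + \<beta> * b" for x
  define X where "X = b + (\<alpha> + \<beta>) / b + 1"
  have bX: "b * X - (b * b + \<alpha> + \<beta>) = b" using assms by (simp add: X_def field_simps)
  have X: "X \<ge> b" using assms by (simp add: X_def)
  have "g b = - (\<alpha> * b)" by (simp add: g_def algebra_simps)
  hence gb: "g b < 0" using assms by simp
  have "g X = (b * X - (b * b + \<alpha> + \<beta>)) * X + \<beta> * b" by (simp add: g_def algebra_simps)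
  hence gX: "g X > 0" unfolding bX using assms X by (simp add: add_pos_pos)
  have "\<exists>x\<ge>b. x \<le> X \<and> g x = 0"
    by (rule IVT') (use gb gX X in \<open>auto simp: g_def intro!: continuous_intros\<close>)
  then obtain k1 where k1: "k1 \<ge> b" "g k1 = 0" by auto
  with gb have k1b: "k1 > b" by (cases "k1 = b") auto
  define k2 where "k2 = \<alpha> / (k1 - b)"
  have k2: "k2 > 0" "k2 * (k1 - b) = \<alpha>" using assms k1b by (auto simp: k2_def)
  have "k1 * (b - k2) * (k1 - b) = k1 * b * (k1 - b) - k1 * (k2 * (k1 - b))" by (simp add: algebra_simps)
  also have "\<dots> = \<beta> * (k1 - b)" using k1(2) unfolding k2 g_def by (simp add: algebra_simps)
  finally have "k1 * (b - k2) = \<beta>" using k1b by simp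
  moreover from this have "0 < k1 * (b - k2)" using assms by simp
  hence "k2 < b" using k1b assms by (simp add: zero_less_mult_iff)
  ultimately show ?thesis using k2 k1b by blast
qed

context saddle_center
begin

text \<open>The order of the choices is \<delta> for the index, then \<eta>, and last \<epsilon>,
  which depends on \<eta> through \<open>cone_prop_exists\<close>.\<close>

lemma smallness_exists:
  "\<exists>\<epsilon>>0. \<exists>\<eta> \<delta>. cone_prop \<epsilon> \<eta> \<and> 0 \<le> \<eta> \<and> \<eta> \<le> 1 \<and> (1 + 2 * k1 + 2 * k2) * \<eta> + 4 * C\<^sup>2 * \<epsilon> < m * k2 \<and>
     2 * \<eta> + 4 * C * \<epsilon> \<le> k2 / 2 \<and> index_small \<delta> \<and> \<epsilon> \<le> \<delta> \<and> \<eta> \<le> \<delta>"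
proof -
  obtain \<delta> where \<delta>: "\<delta> > 0" "index_small \<delta>" using index_small_exists by blast
  define A where "A = 1 + 2 * k1 + 2 * k2"
  have A: "A > 0" using pos by (simp add: A_def)
  define \<eta> where "\<eta> = min \<delta> (min 1 (min (k2 / 8) (m * k2 / (4 * A))))"
  have mk: "m * k2 > 0" using pos by simp
  have \<eta>: "\<eta> > 0" "\<eta> \<le> \<delta>" "\<eta> \<le> 1" "\<eta> \<le> k2 / 8" "\<eta> \<le> m * k2 / (4 * A)"
    unfolding \<eta>_def using \<delta> pos mk A by auto
  obtain \<epsilon>0 where \<epsilon>0: "\<epsilon>0 > 0" "\<And>\<epsilon>. 0 \<le> \<epsilon> \<Longrightarrow> \<epsilon> \<le> \<epsilon>0 \<Longrightarrow> cone_prop \<epsilon> \<eta>"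
    using cone_prop_exists[OF \<eta>(1)] by blast
  have C0: "C > 0" using C(1) by simp
  define \<epsilon> where "\<epsilon> = min \<epsilon>0 (min \<delta> (min (k2 / (16 * C)) (m * k2 / (16 * C\<^sup>2))))"
  have \<epsilon>: "\<epsilon> > 0" "\<epsilon> \<le> \<epsilon>0" "\<epsilon> \<le> \<delta>" "\<epsilon> \<le> k2 / (16 * C)" "\<epsilon> \<le> m * k2 / (16 * C\<^sup>2)"
    unfolding \<epsilon>_def using \<delta> pos mk C0 \<epsilon>0 by auto
  have "A * \<eta> \<le> m * k2 / 4" using \<eta>(5) A by (simp add: pos_le_divide_eq mult.commute mult.left_commute)
  moreover have "4 * C\<^sup>2 * \<epsilon> \<le> m * k2 / 4" using \<epsilon>(5) C0 by (simp add: pos_le_divide_eq mult.commute mult.left_commute)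
  ultimately have "A * \<eta> + 4 * C\<^sup>2 * \<epsilon> < m * k2" using mk by linarith
  moreover have "4 * C * \<epsilon> \<le> k2 / 4" using \<epsilon>(4) C0 by (simp add: pos_le_divide_eq mult.commute mult.left_commute)
  hence "2 * \<eta> + 4 * C * \<epsilon> \<le> k2 / 2" using \<eta>(4) by linarith
  ultimately show ?thesis using \<epsilon> \<eta> \<epsilon>0(2)[of \<epsilon>] \<delta>(2) unfolding A_def
    by (intro exI[of _ \<epsilon>] conjI exI[of _ \<eta>] exI[of _ \<delta>]) auto
qed

end

section \<open>Joint continuity in the parameters and the phase point\<close>

lemma param_near:
  fixes g :: "real \<times> real \<times> phase \<Rightarrow> real"
  assumes "continuous_on UNIV g" "e > 0"
  shows "\<exists>\<rho>>0. \<forall>\<mu> E z. \<bar>\<mu> - \<mu>0\<bar> < \<rho> \<and> \<bar>E - E0\<bar> < \<rho> \<and> dist z z0 < \<rho> \<longrightarrow> \<bar>g (\<mu>, E, z) - g (\<mu>0, E0, z0)\<bar> < e"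
proof -
  obtain d where d: "d > 0" "\<And>q. dist q (\<mu>0, E0, z0) < d \<Longrightarrow> dist (g q) (g (\<mu>0, E0, z0)) < e"
    using assms unfolding continuous_on_iff by (metis UNIV_I)
  have "\<bar>g (\<mu>, E, z) - g (\<mu>0, E0, z0)\<bar> < e"
    if "\<bar>\<mu> - \<mu>0\<bar> < d / 3" "\<bar>E - E0\<bar> < d / 3" "dist z z0 < d / 3" for \<mu> E z
  proof -
    have "dist (\<mu>, E, z) (\<mu>0, E0, z0) \<le> dist \<mu> \<mu>0 + dist (E, z) (E0, z0)"
      unfolding dist_Pair_Pair[of \<mu>] by (rule sqrt_sum_squares_le_sum) auto
    also have "dist (E, z) (E0, z0) \<le> dist E E0 + dist z z0"
      unfolding dist_Pair_Pair[of E] by (rule sqrt_sum_squares_le_sum) auto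
    finally have "dist (\<mu>, E, z) (\<mu>0, E0, z0) < d" using that by (simp add: dist_real_def)
    from d(2)[OF this] show ?thesis by (simp add: dist_real_def)
  qed
  thus ?thesis using d(1) by (intro exI[of _ "d / 3"]) auto
qed

lemma ham_continuous:
  "continuous_on UNIV (\<lambda>q::real \<times> real \<times> phase. ham.H11 (fst q) (fst (snd q)) (snd (snd q)))"
  "continuous_on UNIV (\<lambda>q::real \<times> real \<times> phase. ham.H12 (fst q) (fst (snd q)) (snd (snd q)))"
  "continuous_on UNIV (\<lambda>q::real \<times> real \<times> phase. ham.H22 (fst q) (fst (snd q)) (snd (snd q)))"
  "continuous_on UNIV (\<lambda>q::real \<times> real \<times> phase. hA1' (cx2 (snd (snd q))))"
  "continuous_on UNIV (\<lambda>q::real \<times> real \<times> phase. hA2' (cx1 (snd (snd q))))"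
  "continuous_on UNIV (\<lambda>q::real \<times> real \<times> phase. ham.P2 (snd (snd q)) * hA2'' (cx1 (snd (snd q)))
     + hV11 (fst q) (fst (snd q)) (cx1 (snd (snd q)), cx2 (snd (snd q))))"
  "continuous_on UNIV (\<lambda>q::real \<times> real \<times> phase. hV22 (fst q) (fst (snd q)) (0, cx2 (snd (snd q))))"
  "continuous_on UNIV (\<lambda>q::real \<times> real \<times> phase. hV2 (fst q) (fst (snd q)) (0, cx2 (snd (snd q))))"
  "continuous_on UNIV (\<lambda>q::real \<times> real \<times> phase. norm (ham.XF (fst q) (fst (snd q)) (snd (snd q))))"
  unfolding ham.H11_def ham.H12_def ham.H22_def ham.XF_def ham.G1_def ham.G2_def ham.P1_def ham.P2_def
    hA1_def hA2_def hA1'_def hA1''_def hA2'_def hA2''_def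
    hV1_def hV2_def hV11_def hV12_def hV22_def comp_defs fst_conv snd_conv
  by (intro continuous_intros; simp)+

lemma DX_difference:
  "norm (ham.DX \<mu> E z v - ham.DX \<mu>' E' z' v) \<le>
    (\<bar>ham.H11 \<mu> E z - ham.H11 \<mu>' E' z'\<bar> + 2 * \<bar>ham.H12 \<mu> E z - ham.H12 \<mu>' E' z'\<bar> + \<bar>ham.H22 \<mu> E z - ham.H22 \<mu>' E' z'\<bar>
     + 2 * \<bar>hA1' (cx2 z) - hA1' (cx2 z')\<bar> + 2 * \<bar>hA2' (cx1 z) - hA2' (cx1 z')\<bar>) * norm v"
proof -
  define a where "a = ham.H11 \<mu> E z - ham.H11 \<mu>' E' z'"
  define b where "b = ham.H12 \<mu> E z - ham.H12 \<mu>' E' z'"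
  define c where "c = ham.H22 \<mu> E z - ham.H22 \<mu>' E' z'"
  define p where "p = hA1' (cx2 z) - hA1' (cx2 z')"
  define q where "q = hA2' (cx1 z) - hA2' (cx1 z')"
  define n where "n = norm v"
  define d where "d = ham.DX \<mu> E z v - ham.DX \<mu>' E' z' v"
  have eq: "cy1 d = - (a * cx1 v + b * cx2 v + q * cy2 v)" "cy2 d = - (b * cx1 v + c * cx2 v + p * cy1 v)"
    "cx1 d = p * cx2 v" "cx2 d = q * cx1 v"
    unfolding d_def ham.DX_def a_def b_def c_def p_def q_def by (simp_all add: algebra_simps)
  have m: "\<bar>x * y\<bar> \<le> \<bar>x\<bar> * n" if "\<bar>y\<bar> \<le> n" for x y :: real unfolding abs_mult using that by (intro mult_left_mono) auto
  note v = norm_comp_le[of v, folded n_def]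
  have t3: "\<bar>- (x + y + w)\<bar> \<le> X + Y + W" if "\<bar>x\<bar> \<le> X" "\<bar>y\<bar> \<le> Y" "\<bar>w\<bar> \<le> W" for x y w X Y W :: real
    using that by linarith
  have "\<bar>cy1 d\<bar> \<le> \<bar>a\<bar> * n + \<bar>b\<bar> * n + \<bar>q\<bar> * n" "\<bar>cy2 d\<bar> \<le> \<bar>b\<bar> * n + \<bar>c\<bar> * n + \<bar>p\<bar> * n"
    "\<bar>cx1 d\<bar> \<le> \<bar>p\<bar> * n" "\<bar>cx2 d\<bar> \<le> \<bar>q\<bar> * n"
    unfolding eq by (intro t3 m v)+
  hence "norm d \<le> (\<bar>a\<bar> * n + \<bar>b\<bar> * n + \<bar>q\<bar> * n) + (\<bar>b\<bar> * n + \<bar>c\<bar> * n + \<bar>p\<bar> * n) + \<bar>p\<bar> * n + \<bar>q\<bar> * n"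
    using norm_le_comp[of d] by linarith
  thus ?thesis unfolding d_def[symmetric] a_def[symmetric] b_def[symmetric] c_def[symmetric] p_def[symmetric] q_def[symmetric] n_def[symmetric]
    by (simp add: algebra_simps)
qed

lemma DX_near:
  assumes "e > 0"
  shows "\<exists>\<rho>>0. \<forall>\<mu> E z. \<bar>\<mu> - \<mu>0\<bar> < \<rho> \<and> \<bar>E - E0\<bar> < \<rho> \<and> dist z z0 < \<rho> \<longrightarrow>
    (\<forall>v. norm (ham.DX \<mu> E z v - ham.DX \<mu>0 E0 z0 v) \<le> e * norm v)"
proof -
  have e8: "e / 8 > 0" using assms by simp
  obtain r1 where r1: "r1 > 0" "\<forall>\<mu> E z. \<bar>\<mu> - \<mu>0\<bar> < r1 \<and> \<bar>E - E0\<bar> < r1 \<and> dist z z0 < r1 \<longrightarrow> \<bar>ham.H11 \<mu> E z - ham.H11 \<mu>0 E0 z0\<bar> < e / 8"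
    using param_near[OF ham_continuous(1) e8] unfolding fst_conv snd_conv by blast
  obtain r2 where r2: "r2 > 0" "\<forall>\<mu> E z. \<bar>\<mu> - \<mu>0\<bar> < r2 \<and> \<bar>E - E0\<bar> < r2 \<and> dist z z0 < r2 \<longrightarrow> \<bar>ham.H12 \<mu> E z - ham.H12 \<mu>0 E0 z0\<bar> < e / 8"
    using param_near[OF ham_continuous(2) e8] unfolding fst_conv snd_conv by blast
  obtain r3 where r3: "r3 > 0" "\<forall>\<mu> E z. \<bar>\<mu> - \<mu>0\<bar> < r3 \<and> \<bar>E - E0\<bar> < r3 \<and> dist z z0 < r3 \<longrightarrow> \<bar>ham.H22 \<mu> E z - ham.H22 \<mu>0 E0 z0\<bar> < e / 8"
    using param_near[OF ham_continuous(3) e8] unfolding fst_conv snd_conv by blast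
  obtain r4 where r4: "r4 > 0" "\<forall>\<mu> E z. \<bar>\<mu> - \<mu>0\<bar> < r4 \<and> \<bar>E - E0\<bar> < r4 \<and> dist z z0 < r4 \<longrightarrow> \<bar>hA1' (cx2 z) - hA1' (cx2 z0)\<bar> < e / 8"
    using param_near[OF ham_continuous(4) e8, of \<mu>0 E0 z0] unfolding fst_conv snd_conv by blast
  obtain r5 where r5: "r5 > 0" "\<forall>\<mu> E z. \<bar>\<mu> - \<mu>0\<bar> < r5 \<and> \<bar>E - E0\<bar> < r5 \<and> dist z z0 < r5 \<longrightarrow> \<bar>hA2' (cx1 z) - hA2' (cx1 z0)\<bar> < e / 8"
    using param_near[OF ham_continuous(5) e8, of \<mu>0 E0 z0] unfolding fst_conv snd_conv by blast
  define \<rho> where "\<rho> = Min {r1, r2, r3, r4, r5}"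
  have \<rho>: "\<rho> > 0" "\<rho> \<le> r1" "\<rho> \<le> r2" "\<rho> \<le> r3" "\<rho> \<le> r4" "\<rho> \<le> r5"
    unfolding \<rho>_def using r1 r2 r3 r4 r5 by simp_all
  have "norm (ham.DX \<mu> E z v - ham.DX \<mu>0 E0 z0 v) \<le> e * norm v"
    if d: "\<bar>\<mu> - \<mu>0\<bar> < \<rho>" "\<bar>E - E0\<bar> < \<rho>" "dist z z0 < \<rho>" for \<mu> E z v
  proof -
    have "\<bar>ham.H11 \<mu> E z - ham.H11 \<mu>0 E0 z0\<bar> < e / 8" "\<bar>ham.H12 \<mu> E z - ham.H12 \<mu>0 E0 z0\<bar> < e / 8"
      "\<bar>ham.H22 \<mu> E z - ham.H22 \<mu>0 E0 z0\<bar> < e / 8" "\<bar>hA1' (cx2 z) - hA1' (cx2 z0)\<bar> < e / 8" "\<bar>hA2' (cx1 z) - hA2' (cx1 z0)\<bar> < e / 8"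
      using r1(2) r2(2) r3(2) r4(2) r5(2) d \<rho> by (meson less_le_trans)+
    hence "\<bar>ham.H11 \<mu> E z - ham.H11 \<mu>0 E0 z0\<bar> + 2 * \<bar>ham.H12 \<mu> E z - ham.H12 \<mu>0 E0 z0\<bar> + \<bar>ham.H22 \<mu> E z - ham.H22 \<mu>0 E0 z0\<bar>
     + 2 * \<bar>hA1' (cx2 z) - hA1' (cx2 z0)\<bar> + 2 * \<bar>hA2' (cx1 z) - hA2' (cx1 z0)\<bar> \<le> e" by linarith
    from order_trans[OF DX_difference mult_right_mono[OF this norm_ge_zero]] show ?thesis .
  qed
  thus ?thesis using \<rho>(1) by blast
qed

text \<open>For \<open>\<sigma> = 1\<close> or \<open>\<sigma> = - 1\<close> these are the deck transformations of the universal cover over the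
  quotient of the cylinder by the antipodal map.\<close>

definition deck :: "real \<Rightarrow> int \<Rightarrow> phase \<Rightarrow> phase" where
  "deck \<sigma> k z = \<sigma> *\<^sub>R z + (0, 0, 0, 2 * pi * of_int k)"

lemma deck_comp [simp]: "cy1 (deck \<sigma> k z) = \<sigma> * cy1 z" "cy2 (deck \<sigma> k z) = \<sigma> * cy2 z"
  "cx1 (deck \<sigma> k z) = \<sigma> * cx1 z" "cx2 (deck \<sigma> k z) = \<sigma> * cx2 z + 2 * pi * of_int k"
  by (simp_all add: deck_def)

lemma trig_shift: "sin (x + 2 * pi * of_int k) = sin x" "cos (x + 2 * pi * of_int k) = cos x"
  "sin (2 * (x + 2 * pi * of_int k)) = sin (2 * x)" "cos (2 * (x + 2 * pi * of_int k)) = cos (2 * x)"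
proof -
  have s: "sin (x + 2 * pi * of_int j) = sin x" and c: "cos (x + 2 * pi * of_int j) = cos x" for x :: real and j :: int
    unfolding sin_add cos_add by simp_all
  have "2 * (x + 2 * pi * of_int k) = 2 * x + 2 * pi * of_int (2 * k)" by (simp add: algebra_simps)
  thus "sin (2 * (x + 2 * pi * of_int k)) = sin (2 * x)" "cos (2 * (x + 2 * pi * of_int k)) = cos (2 * x)"
    using s[of "2 * x" "2 * k"] c[of "2 * x" "2 * k"] by metis+
qed (simp_all add: sin_add cos_add)

lemma sign_simps:
  fixes x :: real
  assumes "\<sigma> = 1 \<or> \<sigma> = - 1"
  shows "sin (\<sigma> * x) = \<sigma> * sin x" "cos (\<sigma> * x) = cos x" "sinh (\<sigma> * x) = \<sigma> * sinh x" "cosh (\<sigma> * x) = cosh x"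
    "sin (2 * (\<sigma> * x)) = \<sigma> * sin (2 * x)" "cos (2 * (\<sigma> * x)) = cos (2 * x)"
    "sinh (2 * (\<sigma> * x)) = \<sigma> * sinh (2 * x)" "cosh (2 * (\<sigma> * x)) = cosh (2 * x)" "\<sigma> * (\<sigma> * x) = x" "(\<sigma> * x)\<^sup>2 = x\<^sup>2"
  using assms by auto

context
  fixes \<sigma> :: real and k :: int
  assumes \<sigma>: "\<sigma> = 1 \<or> \<sigma> = - 1"
begin

lemma A_deck: "hA1 (\<sigma> * x + 2 * pi * of_int k) = \<sigma> * hA1 x" "hA1' (\<sigma> * x + 2 * pi * of_int k) = hA1' x"
  "hA1'' (\<sigma> * x + 2 * pi * of_int k) = \<sigma> * hA1'' x"
  "hA2 (\<sigma> * x) = \<sigma> * hA2 x" "hA2' (\<sigma> * x) = hA2' x" "hA2'' (\<sigma> * x) = \<sigma> * hA2'' x"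
  unfolding hA1_def hA2_def hA1'_def hA1''_def hA2'_def hA2''_def trig_shift sign_simps[OF \<sigma>] by simp_all

lemma V_deck: "hV \<mu> E (\<sigma> * x, \<sigma> * y + 2 * pi * of_int k) = hV \<mu> E (x, y)"
  "hV1 \<mu> E (\<sigma> * x, \<sigma> * y + 2 * pi * of_int k) = \<sigma> * hV1 \<mu> E (x, y)"
  "hV2 \<mu> E (\<sigma> * x, \<sigma> * y + 2 * pi * of_int k) = \<sigma> * hV2 \<mu> E (x, y)"
  "hV11 \<mu> E (\<sigma> * x, \<sigma> * y + 2 * pi * of_int k) = hV11 \<mu> E (x, y)"
  "hV12 \<mu> E (\<sigma> * x, \<sigma> * y + 2 * pi * of_int k) = hV12 \<mu> E (x, y)"
  "hV22 \<mu> E (\<sigma> * x, \<sigma> * y + 2 * pi * of_int k) = hV22 \<mu> E (x, y)"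
  using \<sigma> unfolding hV_def V_E_def V_hat_def hV1_def hV2_def hV11_def hV12_def hV22_def fst_conv snd_conv trig_shift
  by (auto simp: field_simps)

lemma ham_deck: "ham.P1 (deck \<sigma> k z) = \<sigma> * ham.P1 z" "ham.P2 (deck \<sigma> k z) = \<sigma> * ham.P2 z"
  "ham.XF \<mu> E (deck \<sigma> k z) = \<sigma> *\<^sub>R ham.XF \<mu> E z" "ham.DX \<mu> E (deck \<sigma> k z) = ham.DX \<mu> E z"
  "ham.F \<mu> E (deck \<sigma> k z) = ham.F \<mu> E z"
proof -
  show P: "ham.P1 (deck \<sigma> k z) = \<sigma> * ham.P1 z" "ham.P2 (deck \<sigma> k z) = \<sigma> * ham.P2 z"
    unfolding ham.P1_def ham.P2_def deck_comp A_deck by (simp_all add: distrib_left)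
  have s: "(\<sigma> * a) * (\<sigma> * b) = a * b" for a b using \<sigma> by auto
  show "ham.XF \<mu> E (deck \<sigma> k z) = \<sigma> *\<^sub>R ham.XF \<mu> E z"
    unfolding ham.XF_def ham.G1_def ham.G2_def P deck_comp A_deck V_deck
    by (simp add: algebra_simps)
  show "ham.DX \<mu> E (deck \<sigma> k z) = ham.DX \<mu> E z"
    unfolding ham.DX_def[abs_def] ham.H11_def ham.H12_def ham.H22_def P deck_comp A_deck V_deck s ..
  show "ham.F \<mu> E (deck \<sigma> k z) = ham.F \<mu> E z"
    unfolding ham.F_def P deck_comp V_deck sign_simps[OF \<sigma>] ..
qed

lemma dist_deck: "dist (deck \<sigma> k z) (deck \<sigma> k w) = dist z w"
  unfolding deck_def dist_norm using \<sigma> by (auto simp: norm_minus_commute)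

lemma deck_inverse: "deck \<sigma> k (\<sigma> *\<^sub>R (z - (0, 0, 0, 2 * pi * of_int k))) = z"
  using \<sigma> by (auto simp: deck_def)

end

text \<open>A deck transformation multiplies the frame by \<sigma> and hence, by linearity, the
  solutions. In the inner products \<sigma> occurs twice and cancels, so index and hyperbolicity may
  be computed on any lift.\<close>

lemma transverse_flow_deck:
  assumes \<sigma>: "\<sigma> = 1 \<or> \<sigma> = - 1"
    and mo: "magnetic_orbit hA1 hA1' hA1'' hA2 hA2' hA2'' (hV \<mu> E) (hV1 \<mu> E) (hV2 \<mu> E) (hV11 \<mu> E) (hV12 \<mu> E) (hV22 \<mu> E) \<gamma>"
  shows "transverse_flow (ham.F \<mu> E) (\<lambda>t. deck \<sigma> k (\<gamma> t)) = transverse_flow (ham.F \<mu> E) \<gamma>"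
proof -
  interpret mo: magnetic_orbit hA1 hA1' hA1'' hA2 hA2' hA2'' "hV \<mu> E" "hV1 \<mu> E" "hV2 \<mu> E" "hV11 \<mu> E" "hV12 \<mu> E" "hV22 \<mu> E" \<gamma>
    by (rule mo)
  have grad: "grad (ham.F \<mu> E) (deck \<sigma> k z) = \<sigma> *\<^sub>R grad (ham.F \<mu> E) z" for z
  proof -
    have "ham.XF \<mu> E (deck \<sigma> k z) = \<sigma> *\<^sub>R ham.XF \<mu> E z" by (rule ham_deck[OF \<sigma>])
    thus ?thesis unfolding ham.grad_F ham.gradF_def ham.XF_def by auto
  qed
  have n\<sigma>: "\<bar>\<sigma>\<bar> = 1" "\<sigma> * \<sigma> = 1" using \<sigma> by auto
  have fr: "frame1 (ham.F \<mu> E) (deck \<sigma> k z) = \<sigma> *\<^sub>R frame1 (ham.F \<mu> E) z"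
    "frame2 (ham.F \<mu> E) (deck \<sigma> k z) = \<sigma> *\<^sub>R frame2 (ham.F \<mu> E) z" for z
    unfolding frame1_def frame2_def grad norm_scaleR n\<sigma> by (auto split: prod.splits simp: algebra_simps)
  have lin: "lin_flow (ham.F \<mu> E) (\<lambda>t. deck \<sigma> k (\<gamma> t)) v0 = lin_flow (ham.F \<mu> E) \<gamma> v0" for v0
    unfolding lin_flow_def ham.frechet_XF ham_deck[OF \<sigma>] ..
  have sc: "lin_flow (ham.F \<mu> E) \<gamma> (\<sigma> *\<^sub>R v0) t = \<sigma> *\<^sub>R lin_flow (ham.F \<mu> E) \<gamma> v0 t" for v0 t
  proof -
    obtain v where v: "v 0 = v0" "mo.sol v" using mo.sol_exists by blast
    have s: "mo.sol (\<lambda>t. \<sigma> *\<^sub>R v t)" using mo.sol_linear[OF v(2,2), of \<sigma> 0] by simp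
    show ?thesis using mo.lin_flow_eq[OF v(2,1)] mo.lin_flow_eq[OF s, of "\<sigma> *\<^sub>R v0"] v(1) by simp
  qed
  have "lin_flow (ham.F \<mu> E) \<gamma> (a *\<^sub>R (\<sigma> *\<^sub>R u) + b *\<^sub>R (\<sigma> *\<^sub>R v)) t = \<sigma> *\<^sub>R lin_flow (ham.F \<mu> E) \<gamma> (a *\<^sub>R u + b *\<^sub>R v) t" for a b u v t
    using sc[of "a *\<^sub>R u + b *\<^sub>R v" t] by (simp add: algebra_simps)
  thus ?thesis unfolding transverse_flow_def[abs_def] lin fr Let_def
    by (simp add: fun_eq_iff n\<sigma> flip: mult.assoc)
qed

text \<open>The union of all deck images of a ball: it is saturated for the projection to the
  cylinder and invariant under the antipodal map, so one center accounts for both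
  saddle-centers.\<close>

definition nbhd :: "phase \<Rightarrow> real \<Rightarrow> phase set" where
  "nbhd z0 R = {z. \<exists>\<sigma> k. (\<sigma> = 1 \<or> \<sigma> = - 1) \<and> dist z (deck \<sigma> k z0) < R}"

lemma cyl_open_nbhd: "cyl_open (nbhd z0 R)"
  unfolding cyl_open_def
proof (intro conjI allI impI)
  have "z \<in> nbhd z0 R \<longleftrightarrow> z \<in> (\<Union>\<sigma>\<in>{1, - 1}. \<Union>k. ball (deck \<sigma> k z0) R)" for z
    unfolding nbhd_def UN_iff mem_ball mem_Collect_eq by (simp only: dist_commute) blast
  hence "nbhd z0 R = (\<Union>\<sigma>\<in>{1, - 1}. \<Union>k. ball (deck \<sigma> k z0) R)" by blast
  thus "open (nbhd z0 R)" by auto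
next
  fix z z' assume "z \<in> nbhd z0 R \<and> cyl_eq z z'"
  then obtain \<sigma> k j where \<sigma>: "\<sigma> = 1 \<or> \<sigma> = - 1" and d: "dist z (deck \<sigma> k z0) < R"
    and z': "z' = z + (0, 0, 0, 2 * pi * of_int j)"
    unfolding nbhd_def cyl_eq_def by blast
  have "z' - deck \<sigma> (k + j) z0 = z - deck \<sigma> k z0"
    unfolding z' deck_def by (simp add: algebra_simps prod_eq_iff)
  hence "dist z' (deck \<sigma> (k + j) z0) < R" using d by (simp add: dist_norm)
  thus "z' \<in> nbhd z0 R" using \<sigma> unfolding nbhd_def by blast
qed

lemma nbhd_cyl: "z \<in> nbhd z0 R \<Longrightarrow> cyl_eq z z' \<Longrightarrow> z' \<in> nbhd z0 R"
  using cyl_open_nbhd[of z0 R] unfolding cyl_open_def by blast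

lemma cyl_eq_deck: "cyl_eq z z' \<longleftrightarrow> (\<exists>k. z' = deck 1 k z)"
  by (simp add: cyl_eq_def deck_def)

lemma cyl_eq_trans: "cyl_eq a b \<Longrightarrow> cyl_eq b c \<Longrightarrow> cyl_eq a c"
proof -
  assume "cyl_eq a b" "cyl_eq b c"
  then obtain j k :: int where "b = a + (0, 0, 0, 2 * pi * of_int j)" "c = b + (0, 0, 0, 2 * pi * of_int k)"
    unfolding cyl_eq_def by blast
  hence "c = a + (0, 0, 0, 2 * pi * of_int (j + k))" by (simp add: algebra_simps prod_eq_iff)
  thus ?thesis unfolding cyl_eq_def by blast
qed

lemma cyl_eq_sym: "cyl_eq a b \<Longrightarrow> cyl_eq b a"
proof -
  assume "cyl_eq a b"
  then obtain j :: int where "b = a + (0, 0, 0, 2 * pi * of_int j)" unfolding cyl_eq_def by blast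
  hence "a = b + (0, 0, 0, 2 * pi * of_int (- j))" by (simp add: prod_eq_iff)
  thus ?thesis unfolding cyl_eq_def by blast
qed

section \<open>Periodic orbits on the cylinder and their lifts\<close>

lemma periodic_multiples:
  fixes \<gamma> :: "real \<Rightarrow> phase"
  assumes "\<And>t. cyl_eq (\<gamma> t) (\<gamma> (t + T))"
  shows "cyl_eq (\<gamma> t) (\<gamma> (t + of_int n * T))"
proof -
  have nat: "cyl_eq (\<gamma> t) (\<gamma> (t + of_nat m * T))" for m :: nat and t
  proof (induction m)
    case 0 show ?case by (auto simp: cyl_eq_def zero_prod_def[symmetric] intro!: exI[of _ 0])
  next
    case (Suc m)
    have "t + of_nat m * T + T = t + of_nat (Suc m) * T" by (simp add: algebra_simps)
    with assms[of "t + of_nat m * T"] Suc show ?case using cyl_eq_trans by metis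
  qed
  show ?thesis
  proof (cases "n \<ge> 0")
    case True
    then obtain m :: nat where "n = int m" using nonneg_int_cases by blast
    thus ?thesis using nat[of t m] by simp
  next
    case False
    define m where "m = nat (- n)"
    have "real_of_int n = - real m" using False by (simp add: m_def)
    hence "t + of_int n * T + of_nat m * T = t" by simp
    thus ?thesis using cyl_eq_sym[OF nat[of "t + of_int n * T" m]] by metis
  qed
qed

lemma reduce_to_interval:
  fixes T a t :: real
  assumes "T > 0"
  shows "\<exists>n::int. a \<le> t + of_int n * T \<and> t + of_int n * T < a + T"
proof -
  define x where "x = (t - a) / T"
  have t: "t = a + x * T" using assms by (simp add: x_def)
  have "0 \<le> (x - of_int \<lfloor>x\<rfloor>) * T" "(x - of_int \<lfloor>x\<rfloor>) * T < 1 * T"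
    using assms by (intro mult_nonneg_nonneg mult_strict_right_mono; linarith)+
  hence "a \<le> t + of_int (- \<lfloor>x\<rfloor>) * T \<and> t + of_int (- \<lfloor>x\<rfloor>) * T < a + T"
    unfolding t by (simp add: algebra_simps)
  thus ?thesis by blast
qed

lemma K_deck:
  assumes \<sigma>: "\<sigma> = 1 \<or> \<sigma> = - 1"
  shows "ham.P2 (deck \<sigma> k z) * hA2'' (cx1 (deck \<sigma> k z)) + hV11 \<mu> E (cx1 (deck \<sigma> k z), cx2 (deck \<sigma> k z))
    = ham.P2 z * hA2'' (cx1 z) + hV11 \<mu> E (cx1 z, cx2 z)"
proof -
  have "(\<sigma> * a) * (\<sigma> * b) = a * b" for a b using \<sigma> by auto
  thus ?thesis unfolding ham_deck[OF \<sigma>] deck_comp A_deck[OF \<sigma>] V_deck[OF \<sigma>] by simp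
qed

lemma gderiv_gradF: "GDERIV (ham.F \<mu> E) z :> D \<Longrightarrow> ham.gradF \<mu> E z = D"
proof -
  assume "GDERIV (ham.F \<mu> E) z :> D"
  from has_derivative_unique[OF this[unfolded gderiv_def] ham.F_has_derivative]
  have "h \<bullet> D = h \<bullet> ham.gradF \<mu> E z" for h by metis
  thus ?thesis by (metis inner_commute vector_eq_ldot)
qed

text \<open>A closed orbit may wind around the cylinder, so its lift can be unbounded.
  \<open>DX\<close> is bounded along it nevertheless, being invariant under deck transformations and
  continuous on one period.\<close>

lemma periodic_magnetic_orbit:
  assumes per: "periodic_orbit (H_hat \<mu> E) \<gamma> T"
  shows "magnetic_orbit hA1 hA1' hA1'' hA2 hA2' hA2'' (hV \<mu> E) (hV1 \<mu> E) (hV2 \<mu> E) (hV11 \<mu> E) (hV12 \<mu> E) (hV22 \<mu> E) \<gamma>"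
proof
  have der: "(\<gamma> has_vector_derivative ham.XF \<mu> E (\<gamma> t)) (at t)" for t
    using per unfolding periodic_orbit_def H_hat_F ham.ham_vf_F by blast
  thus "(\<gamma> has_vector_derivative ham.XF \<mu> E (\<gamma> t)) (at t)" for t .
  show "\<exists>t. \<gamma> t \<noteq> \<gamma> 0" using per unfolding periodic_orbit_def by blast
  have cont: "continuous_on S \<gamma>" for S
    using der by (auto intro!: continuous_at_imp_continuous_on dest: has_vector_derivative_continuous)
  have T: "T > 0" and cyl: "\<And>t. cyl_eq (\<gamma> t) (\<gamma> (t + T))" using per unfolding periodic_orbit_def by auto
  define h where "h p = ham.DX \<mu> E (\<gamma> (fst p)) (snd p)" for p
  have "compact (h ` ({0..T} \<times> cball 0 1))"
    unfolding h_def
    by (intro compact_continuous_image ham.DX_continuous continuous_intros compact_Times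
        continuous_on_compose2[OF cont[of UNIV]]) auto
  from compact_imp_bounded[OF this] obtain L where L0: "\<forall>x\<in>h ` ({0..T} \<times> cball 0 1). norm x \<le> L"
    unfolding bounded_iff by (rule exE)
  have L: "norm (ham.DX \<mu> E (\<gamma> t) v) \<le> L" if "t \<in> {0..T}" "norm v \<le> 1" for t v
  proof -
    have "(t, v) \<in> {0..T} \<times> cball 0 1" using that by (simp add: mem_Times_iff)
    from bspec[OF L0 imageI[OF this]] show ?thesis unfolding h_def fst_conv snd_conv .
  qed
  have "norm (ham.DX \<mu> E (\<gamma> t) v) \<le> \<bar>L\<bar> * norm v" for t v
  proof (cases "v = 0")
    case True
    thus ?thesis using linear_0[OF has_derivative_linear[OF ham.XF_has_derivative]] by simp
  next
    case False
    obtain n where n: "0 \<le> t + of_int n * T \<and> t + of_int n * T < 0 + T" using reduce_to_interval[OF T] by blast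
    obtain k where "\<gamma> (t + of_int n * T) = deck 1 k (\<gamma> t)"
      using periodic_multiples[of \<gamma> T t n, OF cyl] unfolding cyl_eq_deck by blast
    hence eq: "ham.DX \<mu> E (\<gamma> t) = ham.DX \<mu> E (\<gamma> (t + of_int n * T))" by (simp add: ham_deck)
    have "norm (ham.DX \<mu> E (\<gamma> t) ((1 / norm v) *\<^sub>R v)) \<le> L"
      unfolding eq using n False by (intro L) auto
    hence "norm (ham.DX \<mu> E (\<gamma> t) v) / norm v \<le> L"
      unfolding linear_cmul[OF has_derivative_linear[OF ham.XF_has_derivative]] by simp
    hence "norm (ham.DX \<mu> E (\<gamma> t) v) \<le> L * norm v" using False by (simp add: divide_le_eq)
    also have "\<dots> \<le> \<bar>L\<bar> * norm v" by (intro mult_right_mono) auto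
    finally show ?thesis .
  qed
  thus "\<exists>L\<ge>0. \<forall>t v. norm (ham.DX \<mu> E (\<gamma> t) v) \<le> L * norm v" by (intro exI[of _ "\<bar>L\<bar>"]) auto
qed

lemma first_exit:
  fixes h :: "real \<Rightarrow> real"
  assumes "continuous_on {0..t1} h" "0 \<le> t1" "h 0 < c" "c \<le> h t1"
  shows "\<exists>t2. 0 \<le> t2 \<and> t2 \<le> t1 \<and> h t2 = c \<and> (\<forall>t. 0 \<le> t \<and> t \<le> t2 \<longrightarrow> h t \<le> c)"
proof -
  define A where "A = {t\<in>{0..t1}. h t = c}"
  have "\<exists>x\<ge>0. x \<le> t1 \<and> h x = c" by (rule IVT') (use assms in auto)
  hence "A \<noteq> {}" unfolding A_def by auto
  moreover have "closed A" unfolding A_def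
    by (rule continuous_closed_preimage_constant[OF assms(1)]) auto
  moreover have "A \<subseteq> {0..t1}" unfolding A_def by auto
  ultimately have "compact A" by (metis bounded_closed_interval bounded_subset compact_eq_bounded_closed)
  then obtain t2 where t2: "t2 \<in> A" "\<And>t. t \<in> A \<Longrightarrow> t2 \<le> t"
    using compact_attains_inf[OF _ \<open>A \<noteq> {}\<close>] by blast
  have "h t \<le> c" if "0 \<le> t" "t \<le> t2" for t
  proof (rule ccontr)
    assume "\<not> h t \<le> c"
    hence "\<exists>x\<ge>0. x \<le> t \<and> h x = c" using t2(1) that
      by (intro IVT') (use assms in \<open>auto simp: A_def elim: continuous_on_subset\<close>)
    then obtain x where x: "0 \<le> x" "x \<le> t" "h x = c" by auto
    hence "x \<in> A" using that t2(1) by (auto simp: A_def)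
    from t2(2)[OF this] have "x = t" using x that by auto
    thus False using x \<open>\<not> h t \<le> c\<close> by simp
  qed
  thus ?thesis using t2(1) by (intro exI[of _ t2]) (auto simp: A_def)
qed

section \<open>Critical points on the axis x1 = 0\<close>

lemma hV_axis_DERIV:
  "((\<lambda>y. hV \<mu> E (0, y)) has_real_derivative hV2 \<mu> E (0, x)) (at x)"
  "((\<lambda>y. hV2 \<mu> E (0, y)) has_real_derivative hV22 \<mu> E (0, x)) (at x)"
proof -
  have c: "((\<lambda>y::real. (0::real, y)) has_derivative (\<lambda>h. (0, h))) (at x)"
    by (intro has_derivative_Pair has_derivative_const has_derivative_ident)
  show "((\<lambda>y. hV \<mu> E (0, y)) has_real_derivative hV2 \<mu> E (0, x)) (at x)"
    "((\<lambda>y. hV2 \<mu> E (0, y)) has_real_derivative hV22 \<mu> E (0, x)) (at x)"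
    using has_derivative_compose[OF c hV_derivative] has_derivative_compose[OF c hV2_derivative]
    by (simp_all add: has_field_derivative_def)
qed

lemma critical_max:
  fixes f :: "real \<Rightarrow> real"
  assumes f: "\<And>x. \<bar>x - c\<bar> < R \<Longrightarrow> (f has_real_derivative f' x) (at x)"
    and f': "\<And>x. \<bar>x - c\<bar> < R \<Longrightarrow> (f' has_real_derivative f'' x) (at x)"
    and neg: "\<And>x. \<bar>x - c\<bar> < R \<Longrightarrow> f'' x < 0"
    and y: "f' y = 0" "\<bar>y - c\<bar> < R" and z: "\<bar>z - c\<bar> < R"
  shows "f z \<le> f y"
proof -
  have dec: "f' v < f' u" if uv: "u < v" "\<bar>u - c\<bar> < R" "\<bar>v - c\<bar> < R" for u v
  proof (rule DERIV_neg_imp_decreasing[OF uv(1)])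
    fix x assume "u \<le> x" "x \<le> v"
    hence "\<bar>x - c\<bar> < R" using uv by linarith
    thus "\<exists>d. (f' has_real_derivative d) (at x) \<and> d < 0" using f' neg by blast
  qed
  consider "z < y" | "z = y" | "y < z" by linarith
  thus ?thesis
  proof cases
    case 1
    have "\<exists>x>z. x < y \<and> f y - f z = (y - z) * f' x"
      by (rule MVT2[OF 1]) (use f y z in force)
    then obtain x where x: "z < x" "x < y" "f y - f z = (y - z) * f' x" by blast
    have "f' y < f' x" by (rule dec) (use x y z in linarith)+
    hence "(y - z) * f' x > 0" using 1 y(1) by simp
    thus ?thesis using x(3) by linarith
  next
    case 3
    have "\<exists>x>y. x < z \<and> f z - f y = (z - y) * f' x"
      by (rule MVT2[OF 3]) (use f y z in force)
    then obtain x where x: "y < x" "x < z" "f z - f y = (z - y) * f' x" by blast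
    have "f' x < f' y" by (rule dec) (use x y z in linarith)+
    hence "(z - y) * f' x < 0" using 3 y(1) by (simp add: mult_pos_neg)
    thus ?thesis using x(3) by linarith
  qed simp
qed

text \<open>The point over (0, y) at which the kinetic momenta \<open>P1\<close> and
  \<open>P2\<close> vanish, so that only the potential decides whether it is an equilibrium.\<close>

definition axis_point :: "real \<Rightarrow> phase" where "axis_point y = (- hA1 y, 0, 0, y)"

lemma axis_point_values:
  "ham.XF \<mu> E (axis_point y) = 0 \<longleftrightarrow> hV2 \<mu> E (0, y) = 0" "ham.F \<mu> E (axis_point y) = hV \<mu> E (0, y)"
  by (simp_all add: ham.XF_def ham.F_def ham.G1_def ham.G2_def ham.P1_def ham.P2_def axis_point_def hA2_def hV1_def zero_prod_def)

text \<open>One radius \<rho> serves for parameters and points. The bounds \<rho> < xs and \<rho> <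
  pi - xs keep the deck images of the ball disjoint, and 1 / 4 is the value of hA2' at 0.\<close>

locale lagrange_neighbourhood = saddle_center "hA1' xs" "1 / 4" k1 k2 for xs k1 k2 +
  fixes \<mu>0 \<kappa> \<epsilon> \<eta> \<delta> \<rho> :: real
  assumes \<mu>0: "0 < \<mu>0" "\<mu>0 < 1" and xs: "0 < xs" "xs < pi" "cos xs = 1 - 2 * rt \<mu>0"
    and \<epsilon>: "0 < \<epsilon>" and cone: "cone_prop \<epsilon> \<eta>" and \<eta>: "0 \<le> \<eta>" "\<eta> \<le> 1"
    and small1: "(1 + 2 * k1 + 2 * k2) * \<eta> + 4 * C\<^sup>2 * \<epsilon> < m * k2"
    and small2: "2 * \<eta> + 4 * C * \<epsilon> \<le> k2 / 2"
    and small3: "index_small \<delta>" "\<epsilon> \<le> \<delta>" "\<eta> \<le> \<delta>"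
    and \<rho>: "0 < \<rho>" "\<rho> < xs" "\<rho> < pi - xs"
    and near: "\<And>\<mu> E z v. \<bar>\<mu> - \<mu>0\<bar> < \<rho> \<Longrightarrow> \<bar>E - L1 \<mu>0\<bar> < \<rho> \<Longrightarrow> dist z (axis_point xs) < \<rho> \<Longrightarrow>
      norm (ham.DX \<mu> E z v - A0 v) \<le> \<epsilon> * norm v"
    and \<kappa>: "0 < \<kappa>" "\<And>\<mu> E z. \<bar>\<mu> - \<mu>0\<bar> < \<rho> \<Longrightarrow> \<bar>E - L1 \<mu>0\<bar> < \<rho> \<Longrightarrow> dist z (axis_point xs) < \<rho> \<Longrightarrow>
      \<kappa> \<le> ham.P2 z * hA2'' (cx1 z) + hV11 \<mu> E (cx1 z, cx2 z)"
    and concave: "\<And>\<mu> E y. \<bar>\<mu> - \<mu>0\<bar> < \<rho> \<Longrightarrow> \<bar>E - L1 \<mu>0\<bar> < \<rho> \<Longrightarrow> \<bar>y - xs\<bar> < \<rho> \<Longrightarrow> hV22 \<mu> E (0, y) < 0"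
begin

definition S0 :: phase where "S0 = axis_point xs"

lemma S0_comp [simp]: "cy1 S0 = - hA1 xs" "cy2 S0 = 0" "cx1 S0 = 0" "cx2 S0 = xs"
  by (simp_all add: S0_def axis_point_def)

text \<open>The x2-coordinates of the centers are \<plusminus> xs modulo 2 pi; distinct ones are at
  least 2 xs or 2 (pi - xs) apart.\<close>

lemma deck_disjoint:
  assumes \<sigma>: "\<sigma> = 1 \<or> \<sigma> = - 1" "\<sigma>' = 1 \<or> \<sigma>' = - 1"
    and d: "dist z (deck \<sigma> k S0) < \<rho>" "dist z (deck \<sigma>' k' S0) < \<rho>"
  shows "\<sigma>' = \<sigma> \<and> k' = k"
proof -
  have "\<bar>cx2 z - cx2 (deck \<sigma> k S0)\<bar> < \<rho>" "\<bar>cx2 z - cx2 (deck \<sigma>' k' S0)\<bar> < \<rho>"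
    using d norm_comp_le(4)[of "z - deck \<sigma> k S0"] norm_comp_le(4)[of "z - deck \<sigma>' k' S0"]
    unfolding dist_norm comp_linear by linarith+
  hence e: "\<bar>\<sigma>' * xs - \<sigma> * xs + 2 * pi * of_int (k' - k)\<bar> < 2 * \<rho>" by (simp add: algebra_simps)
  have j: "k' - k = 0 \<or> pi \<le> pi * of_int (k' - k) \<or> pi * of_int (k' - k) \<le> - pi"
  proof -
    consider "k' - k = 0" | "k' - k \<ge> 1" | "k' - k \<le> - 1" by linarith
    thus ?thesis
    proof cases
      case 2
      hence "pi * 1 \<le> pi * of_int (k' - k)" by (intro mult_left_mono) auto
      thus ?thesis by simp
    next
      case 3
      hence "real_of_int (k' - k) \<le> - 1" by linarith
      hence "pi * of_int (k' - k) \<le> pi * (- 1)" by (intro mult_left_mono) auto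
      thus ?thesis by simp
    qed simp
  qed
  define w where "w = pi * of_int (k' - k)"
  have e': "\<bar>\<sigma>' * xs - \<sigma> * xs + 2 * w\<bar> < 2 * \<rho>" using e by (simp add: w_def mult.assoc)
  have j': "k' - k = 0 \<and> w = 0 \<or> pi \<le> w \<or> w \<le> - pi" using j by (auto simp: w_def)
  show ?thesis using \<sigma> e' j' \<rho> xs by (elim disjE) (simp; linarith)+
qed

lemma deck_same:
  assumes "\<sigma> = 1 \<or> \<sigma> = - 1" "dist z S0 < \<rho>" "dist z' S0 < \<rho>" "cyl_eq (deck \<sigma> k z) (deck \<sigma> k z')"
  shows "z' = z"
proof -
  obtain j :: int where "deck \<sigma> k z' = deck \<sigma> k z + (0, 0, 0, 2 * pi * of_int j)"
    using assms(4) unfolding cyl_eq_def by blast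
  hence eq: "deck \<sigma> k z' = deck \<sigma> (k + j) z" by (simp add: deck_def algebra_simps prod_eq_iff)
  have "dist (deck \<sigma> k z') (deck \<sigma> k S0) < \<rho>" unfolding dist_deck[OF assms(1)] by (rule assms)
  moreover have "dist (deck \<sigma> k z') (deck \<sigma> (k + j) S0) < \<rho>" unfolding eq dist_deck[OF assms(1)] by (rule assms)
  ultimately have "j = 0" using deck_disjoint[OF assms(1,1)] by fastforce
  hence "deck \<sigma> k z' = deck \<sigma> k z" using eq by simp
  hence "dist z' z = 0" using dist_deck[OF assms(1), of k z' z] by simp
  thus ?thesis by simp
qed

lemma saddle_centers_nbhd:
  assumes "R > 0"
  shows "saddle_centers \<mu>0 \<subseteq> nbhd S0 R"
proof
  fix z assume "z \<in> saddle_centers \<mu>0"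
  then obtain y1 y2 where grad: "ham.gradF \<mu>0 (L1 \<mu>0) z = 0"
    and "cyl_eq (y1, y2, 0, arccos (1 - 2 * r1 \<mu>0)) z \<or> cyl_eq (y1, y2, 0, - arccos (1 - 2 * r1 \<mu>0)) z"
    unfolding saddle_centers_def H_hat_F using gderiv_gradF by blast
  moreover have "arccos (1 - 2 * r1 \<mu>0) = xs"
    unfolding r1_eq[OF \<mu>0] xs(3)[symmetric] using xs(1,2) by (simp add: arccos_cos)
  ultimately have "\<exists>\<sigma>. (\<sigma> = 1 \<or> \<sigma> = - 1) \<and> cyl_eq (y1, y2, 0, \<sigma> * xs) z" by (metis mult_1 mult_minus1)
  then obtain \<sigma> k where \<sigma>: "\<sigma> = 1 \<or> \<sigma> = - 1" and z: "z = (y1, y2, 0, \<sigma> * xs) + (0, 0, 0, 2 * pi * of_int k)"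
    unfolding cyl_eq_def by blast
  have "ham.P1 z = 0" "ham.P2 z = 0" using grad by (auto simp: ham.gradF_def zero_prod_def)
  moreover have cx: "cx1 z = 0" "cx2 z = \<sigma> * xs + 2 * pi * of_int k" by (simp_all add: z)
  ultimately have cy: "cy1 z = \<sigma> * - hA1 xs" "cy2 z = 0"
    unfolding ham.P1_def ham.P2_def cx A_deck[OF \<sigma>] by (simp_all add: hA2_def)
  have "z = deck \<sigma> k S0"
    by (rule phase_eqI) (simp_all add: cx cy)
  hence "dist z (deck \<sigma> k S0) < R" using assms by simp
  thus "z \<in> nbhd S0 R" using \<sigma> unfolding nbhd_def by blast
qed

text \<open>For other parameters than (\<mu>0, L1 \<mu>0) the point \<open>S0\<close> is in general
  no equilibrium; the last condition provides one near it on the axis. The condition on arccos keeps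
  the Lagrange position of \<mu> inside the interval on which \<open>hV\<close> is concave.\<close>

definition good :: "real \<Rightarrow> real \<Rightarrow> bool" where
  "good \<mu> E \<longleftrightarrow> 0 < \<mu> \<and> \<mu> < 1 \<and> \<bar>\<mu> - \<mu>0\<bar> < \<rho> \<and> \<bar>E - L1 \<mu>0\<bar> < \<rho> \<and> \<bar>arccos (1 - 2 * rt \<mu>) - xs\<bar> < \<rho> \<and>
    (\<exists>y. dist (axis_point y) S0 < \<rho> \<and> hV2 \<mu> E (0, y) = 0)"

lemma local_magnetic_good:
  assumes "good \<mu> E"
  obtains y where "hV2 \<mu> E (0, y) = 0" "\<bar>y - xs\<bar> < \<rho>"
    "local_magnetic (hA1' xs) (1 / 4) k1 k2 hA1 hA1' hA1'' hA2 hA2' hA2'' (hV \<mu> E) (hV1 \<mu> E) (hV2 \<mu> E) (hV11 \<mu> E)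
      (hV12 \<mu> E) (hV22 \<mu> E) (ball S0 \<rho>) (axis_point y) \<epsilon> \<eta>"
proof -
  from assms obtain y where y: "dist (axis_point y) S0 < \<rho>" "hV2 \<mu> E (0, y) = 0"
    and p: "\<bar>\<mu> - \<mu>0\<bar> < \<rho>" "\<bar>E - L1 \<mu>0\<bar> < \<rho>" unfolding good_def by blast
  have "\<bar>y - xs\<bar> < \<rho>"
    using y(1) norm_comp_le(4)[of "axis_point y - S0"] by (simp add: dist_norm axis_point_def)
  moreover have "local_magnetic (hA1' xs) (1 / 4) k1 k2 hA1 hA1' hA1'' hA2 hA2' hA2'' (hV \<mu> E) (hV1 \<mu> E) (hV2 \<mu> E) (hV11 \<mu> E)
      (hV12 \<mu> E) (hV22 \<mu> E) (ball S0 \<rho>) (axis_point y) \<epsilon> \<eta>"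
  proof
    show "norm (ham.DX \<mu> E z v - A0 v) \<le> \<epsilon> * norm v" if "z \<in> ball S0 \<rho>" for z v
      using near[OF p] that by (simp add: S0_def dist_commute)
  qed (use y \<epsilon> cone \<eta> small1 small2 in \<open>auto simp: axis_point_values dist_commute\<close>)
  ultimately show ?thesis using that y(2) by blast
qed

text \<open>If E \<le> L1 \<mu>, then \<open>hV\<close> is nonnegative at the Lagrange position xl,
  hence also at the equilibrium y, where the concave function on the axis is maximal. But
  \<open>equilibrium_energy\<close> puts the equilibrium strictly below the level 0 of the
  orbit.\<close>

lemma energy_above:
  assumes g: "good \<mu> E" and der: "\<And>t. (\<gamma> has_vector_derivative ham.XF \<mu> E (\<gamma> t)) (at t)"
    and "\<And>t. \<gamma> t \<in> ball S0 \<rho>" "\<And>t. ham.F \<mu> E (\<gamma> t) = 0" and nc: "\<exists>t. \<gamma> t \<noteq> \<gamma> 0"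
  shows "L1 \<mu> < E"
proof (rule ccontr)
  assume "\<not> L1 \<mu> < E"
  hence E: "E \<le> L1 \<mu>" by simp
  obtain y where y: "hV2 \<mu> E (0, y) = 0" "\<bar>y - xs\<bar> < \<rho>" and
    "local_magnetic (hA1' xs) (1 / 4) k1 k2 hA1 hA1' hA1'' hA2 hA2' hA2'' (hV \<mu> E) (hV1 \<mu> E) (hV2 \<mu> E) (hV11 \<mu> E)
      (hV12 \<mu> E) (hV22 \<mu> E) (ball S0 \<rho>) (axis_point y) \<epsilon> \<eta>"
    using local_magnetic_good[OF g] by blast
  then interpret L: local_magnetic "hA1' xs" "1 / 4" k1 k2 hA1 hA1' hA1'' hA2 hA2' hA2'' "hV \<mu> E" "hV1 \<mu> E" "hV2 \<mu> E" "hV11 \<mu> E"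
      "hV12 \<mu> E" "hV22 \<mu> E" "ball S0 \<rho>" "axis_point y" \<epsilon> \<eta> by blast
  have fl: "L.flows \<gamma>" unfolding L.flows_def using der assms(3) by blast
  have neg: "hV \<mu> E (0, y) < 0"
    using L.equilibrium_energy[OF fl L.flows_ne_Se[OF fl nc]] assms(4) by (simp add: axis_point_values)
  define r where "r = rt \<mu>"
  define xl where "xl = arccos (1 - 2 * r)"
  have \<mu>: "0 < \<mu>" "\<mu> < 1" and p: "\<bar>\<mu> - \<mu>0\<bar> < \<rho>" "\<bar>E - L1 \<mu>0\<bar> < \<rho>" and xl: "\<bar>xl - xs\<bar> < \<rho>"
    using g unfolding good_def xl_def r_def by blast+
  have r: "0 < r" "r < 1" unfolding r_def using rt[OF \<mu>] by auto
  hence "cos xl = 1 - 2 * r" unfolding xl_def by (simp add: cos_arccos)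
  from hV_axis(1)[OF this r] have "hV \<mu> E (0, xl) \<ge> 0"
    using E r unfolding L1_eq[OF \<mu>] r_def by simp
  moreover note d = hV_axis_DERIV[of \<mu> E]
  have "hV \<mu> E (0, xl) \<le> hV \<mu> E (0, y)"
    by (rule critical_max[where f = "\<lambda>y. hV \<mu> E (0, y)" and f' = "\<lambda>y. hV2 \<mu> E (0, y)" and f'' = "\<lambda>y. hV22 \<mu> E (0, y)", OF d])
      (use concave[OF p] y xl in auto)
  ultimately show False using neg by linarith
qed

text \<open>The orbit is connected and the deck images of the ball are open and disjoint, so it
  stays in one of them, and undoing that transformation brings it to \<open>S0\<close>.\<close>

lemma unfold_orbit:
  assumes per: "periodic_orbit (H_hat \<mu> E) \<gamma> T" and W: "\<And>t. \<gamma> t \<in> nbhd S0 \<rho>"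
  obtains \<sigma> k g where "\<sigma> = 1 \<or> \<sigma> = - 1" "\<And>t. \<gamma> t = deck \<sigma> k (g t)" "\<And>t. dist (g t) S0 < \<rho>"
    "\<And>t. (g has_vector_derivative ham.XF \<mu> E (g t)) (at t)" "\<And>t. ham.F \<mu> E (g t) = 0" "\<exists>t. g t \<noteq> g 0"
proof -
  have der: "(\<gamma> has_vector_derivative ham.XF \<mu> E (\<gamma> t)) (at t)" and F0: "ham.F \<mu> E (\<gamma> t) = 0" for t
    using per unfolding periodic_orbit_def H_hat_F ham.ham_vf_F by blast+
  have cont: "continuous_on UNIV \<gamma>"
    using der by (auto intro!: continuous_at_imp_continuous_on dest: has_vector_derivative_continuous)
  define G where "G \<sigma> k = {t. dist (\<gamma> t) (deck \<sigma> k S0) < \<rho>}" for \<sigma> k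
  have opn: "open (G \<sigma> k)" for \<sigma> k
    unfolding G_def by (intro open_Collect_less continuous_intros cont)
  have "\<gamma> 0 \<in> nbhd S0 \<rho>" by (rule W)
  then obtain \<sigma> k where \<sigma>: "\<sigma> = 1 \<or> \<sigma> = - 1" and 0: "0 \<in> G \<sigma> k" unfolding nbhd_def G_def by blast
  define O' where "O' = (\<Union>p\<in>{p. (fst p = 1 \<or> fst p = - 1) \<and> p \<noteq> (\<sigma>, k)}. G (fst p) (snd p))"
  have oO: "open O'" unfolding O'_def by (intro open_UN ballI opn)
  have cov: "UNIV \<subseteq> G \<sigma> k \<union> O'"
  proof
    fix t
    obtain \<sigma>' k' where "\<sigma>' = 1 \<or> \<sigma>' = - 1" "t \<in> G \<sigma>' k'" using W[of t] unfolding nbhd_def G_def by blast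
    thus "t \<in> G \<sigma> k \<union> O'" unfolding O'_def by (cases "(\<sigma>', k') = (\<sigma>, k)") (auto intro!: bexI[of _ "(\<sigma>', k')"])
  qed
  have dis: "G \<sigma> k \<inter> O' \<inter> UNIV = {}"
  proof (rule equals0I)
    fix t assume "t \<in> G \<sigma> k \<inter> O' \<inter> UNIV"
    then obtain p where p: "fst p = 1 \<or> fst p = - 1" "p \<noteq> (\<sigma>, k)" "t \<in> G (fst p) (snd p)" "t \<in> G \<sigma> k"
      unfolding O'_def by blast
    from deck_disjoint[OF \<sigma> p(1), of "\<gamma> t" k "snd p"] p(3,4) have "fst p = \<sigma> \<and> snd p = k" unfolding G_def by blast
    thus False using p(2) by (auto simp: prod_eq_iff)
  qed
  from connectedD[OF connected_UNIV opn oO dis cov] 0 have "O' = {}" by blast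
  hence B: "dist (\<gamma> t) (deck \<sigma> k S0) < \<rho>" for t using cov unfolding G_def by blast
  define g where "g t = \<sigma> *\<^sub>R (\<gamma> t - (0, 0, 0, 2 * pi * of_int k))" for t
  have dg: "\<gamma> t = deck \<sigma> k (g t)" for t unfolding g_def by (rule deck_inverse[OF \<sigma>, symmetric])
  show ?thesis
  proof (rule that[OF \<sigma> dg])
    show "dist (g t) S0 < \<rho>" for t using B[of t] unfolding dg dist_deck[OF \<sigma>] .
    show "ham.F \<mu> E (g t) = 0" for t using F0[of t] unfolding dg ham_deck[OF \<sigma>] .
    show "\<exists>t. g t \<noteq> g 0" using per dg unfolding periodic_orbit_def by metis
    show "(g has_vector_derivative ham.XF \<mu> E (g t)) (at t)" for t
    proof -
      have "(g has_vector_derivative \<sigma> *\<^sub>R (ham.XF \<mu> E (\<gamma> t) - 0)) (at t)"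
        unfolding g_def[abs_def]
        by (intro bounded_linear.has_vector_derivative[OF bounded_linear_scaleR_right] has_vector_derivative_diff der
            has_vector_derivative_const)
      moreover have "\<sigma> *\<^sub>R (ham.XF \<mu> E (\<gamma> t) - 0) = ham.XF \<mu> E (g t)"
        unfolding dg[of t] ham_deck[OF \<sigma>] using \<sigma> by auto
      ultimately show ?thesis by simp
    qed
  qed
qed

text \<open>The lift h closes up exactly and not only modulo 2 pi, because it stays in one ball. A
  competitor in the neighbourhood lifts to the same orbit up to a time shift; the sign of its deck
  transformation decides whether it is a shift of \<gamma>0 or of its antipodal image.\<close>

lemma orbit_inside_is_lyapunov:
  assumes g: "good \<mu> E" and per0: "periodic_orbit (H_hat \<mu> E) \<gamma>0 T0" and W0: "\<And>t. \<gamma>0 t \<in> nbhd S0 \<rho>"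
  shows "\<exists>\<tau>. lyapunov_orbit (nbhd S0 \<rho>) \<mu> E \<gamma>0 \<tau> \<and> covers \<gamma>0 T0 \<gamma>0 \<tau>"
proof -
  obtain y where
    "local_magnetic (hA1' xs) (1 / 4) k1 k2 hA1 hA1' hA1'' hA2 hA2' hA2'' (hV \<mu> E) (hV1 \<mu> E) (hV2 \<mu> E) (hV11 \<mu> E)
      (hV12 \<mu> E) (hV22 \<mu> E) (ball S0 \<rho>) (axis_point y) \<epsilon> \<eta>"
    using local_magnetic_good[OF g] by blast
  then interpret L: local_magnetic "hA1' xs" "1 / 4" k1 k2 hA1 hA1' hA1'' hA2 hA2' hA2'' "hV \<mu> E" "hV1 \<mu> E" "hV2 \<mu> E" "hV11 \<mu> E"
      "hV12 \<mu> E" "hV22 \<mu> E" "ball S0 \<rho>" "axis_point y" \<epsilon> \<eta> by blast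
  define lift where "lift \<gamma> \<sigma> k h \<longleftrightarrow> (\<sigma> = 1 \<or> \<sigma> = - 1) \<and> (\<forall>t. \<gamma> t = deck \<sigma> k (h t)) \<and> L.flows h \<and>
    (\<forall>t. ham.F \<mu> E (h t) = 0) \<and> (\<exists>t. h t \<noteq> h 0)" for \<gamma> \<sigma> k h
  have lift_exists: "\<exists>\<sigma> k h. lift \<gamma> \<sigma> k h"
    if per: "periodic_orbit (H_hat \<mu> E) \<gamma> T" and W: "range \<gamma> \<subseteq> nbhd S0 \<rho>" for \<gamma> T
  proof -
    have W': "\<gamma> t \<in> nbhd S0 \<rho>" for t using W by blast
    obtain \<sigma> k h where h: "\<sigma> = 1 \<or> \<sigma> = - 1" "\<And>t. \<gamma> t = deck \<sigma> k (h t)" "\<And>t. dist (h t) S0 < \<rho>"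
      "\<And>t. (h has_vector_derivative ham.XF \<mu> E (h t)) (at t)" "\<And>t. ham.F \<mu> E (h t) = 0" "\<exists>t. h t \<noteq> h 0"
      using unfold_orbit[OF per W'] by blast
    have "L.flows h" unfolding L.flows_def using h(3,4) by (auto simp: dist_commute)
    thus ?thesis unfolding lift_def using h by blast
  qed
  obtain \<sigma> k h where "lift \<gamma>0 \<sigma> k h" using lift_exists[OF per0] W0 by blast
  hence \<sigma>: "\<sigma> = 1 \<or> \<sigma> = - 1" and dg: "\<And>t. \<gamma>0 t = deck \<sigma> k (h t)" and fl: "L.flows h"
    and F0: "\<And>t. ham.F \<mu> E (h t) = 0" and nc: "\<exists>t. h t \<noteq> h 0" unfolding lift_def by blast+
  have B: "dist (h t) S0 < \<rho>" for t using fl unfolding L.flows_def by (auto simp: dist_commute)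
  have der: "(h has_vector_derivative ham.XF \<mu> E (h t)) (at t)" for t using fl unfolding L.flows_def by blast
  have ret: "h (t + s) = h t" if "cyl_eq (\<gamma>0 t) (\<gamma>0 (t + s))" for t s
    using deck_same[OF \<sigma> B B] that unfolding dg by blast
  obtain \<phi> where \<phi>: "L.angular h \<phi>" using L.angular_exists[OF fl nc] by blast
  obtain \<tau> where \<tau>: "\<tau> > 0" "\<phi> \<tau> = \<phi> 0 + 2 * pi" "\<And>t. h (t + \<tau>) = h t" "om1 * \<tau> \<le> 2 * pi" "2 * pi \<le> om2 * \<tau>"
    "\<And>T. T > 0 \<Longrightarrow> h T = h 0 \<Longrightarrow> \<exists>k::nat. k \<ge> 1 \<and> T = of_nat k * \<tau>"
    using L.period[OF fl F0 \<phi>] by blast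
  have refl: "cyl_eq z z" for z by (auto simp: cyl_eq_def zero_prod_def[symmetric] intro!: exI[of _ 0])
  have per1: "periodic_orbit (H_hat \<mu> E) \<gamma>0 \<tau>"
    using per0 \<tau>(1,3) refl unfolding periodic_orbit_def dg by metis
  have "simple_orbit (H_hat \<mu> E) \<gamma>0 \<tau>"
    unfolding simple_orbit_def
  proof (intro conjI per1 allI impI notI)
    fix T' assume T': "0 < T' \<and> T' < \<tau>" and c: "\<forall>t. cyl_eq (\<gamma>0 t) (\<gamma>0 (t + T'))"
    have "h T' = h 0" using ret[of 0 T'] c[THEN spec, of 0] by simp
    then obtain j :: nat where j: "j \<ge> 1" "T' = of_nat j * \<tau>" using \<tau>(6) T' by blast
    have "1 * \<tau> \<le> of_nat j * \<tau>" using j(1) \<tau>(1) by (intro mult_right_mono) auto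
    thus False using j T' by linarith
  qed
  moreover have "transverse_flow (H_hat \<mu> E) \<gamma>0 = transverse_flow (H_hat \<mu> E) h"
    using transverse_flow_deck[OF \<sigma> L.flows_magnetic_orbit[OF fl nc], of k]
    unfolding H_hat_F by (simp add: dg[abs_def, symmetric] fun_eq_iff flip: dg)
  hence "cz_index (H_hat \<mu> E) \<gamma>0 \<tau> = cz_index (H_hat \<mu> E) h \<tau>" "hyperbolic (H_hat \<mu> E) \<gamma>0 \<tau> = hyperbolic (H_hat \<mu> E) h \<tau>"
    unfolding cz_index_def hyperbolic_def by simp_all
  moreover have "h \<tau> = h 0" using \<tau>(3)[of 0] by simp
  note L.local_index_two[OF small3 fl nc \<phi> \<tau>(1,2) this \<tau>(4,5), folded H_hat_F]
  ultimately have hyp: "hyp_index2_in (nbhd S0 \<rho>) \<mu> E \<gamma>0 \<tau>"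
    unfolding hyp_index2_in_def using W0 by auto
  have uniq: "\<exists>s. (\<forall>t. cyl_eq (\<gamma>' t) (\<gamma>0 (t + s))) \<or> (\<forall>t. cyl_eq (\<gamma>' t) (- \<gamma>0 (t + s)))"
    if "hyp_index2_in (nbhd S0 \<rho>) \<mu> E \<gamma>' \<tau>'" for \<gamma>' \<tau>'
  proof -
    have "periodic_orbit (H_hat \<mu> E) \<gamma>' \<tau>'" "range \<gamma>' \<subseteq> nbhd S0 \<rho>"
      using that unfolding hyp_index2_in_def simple_orbit_def by blast+
    from lift_exists[OF this] obtain \<sigma>' k' h' where "lift \<gamma>' \<sigma>' k' h'" by blast
    hence \<sigma>': "\<sigma>' = 1 \<or> \<sigma>' = - 1" and dg': "\<And>t. \<gamma>' t = deck \<sigma>' k' (h' t)" and fl': "L.flows h'"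
      and F0': "\<And>t. ham.F \<mu> E (h' t) = 0" and nc': "\<exists>t. h' t \<noteq> h' 0" unfolding lift_def by blast+
    obtain s where s: "\<And>t. h' t = h (t + s)" using L.flows_same_orbit[OF fl nc F0 fl' nc' F0'] by blast
    show ?thesis
    proof (cases "\<sigma>' = \<sigma>")
      case True
      have "cyl_eq (\<gamma>' t) (\<gamma>0 (t + s))" for t
        unfolding cyl_eq_def dg dg' s True
        by (rule exI[of _ "k - k'"]) (simp add: deck_def algebra_simps prod_eq_iff)
      thus ?thesis by blast
    next
      case False
      hence \<sigma>'': "\<sigma>' = - \<sigma>" using \<sigma> \<sigma>' by auto
      have "cyl_eq (\<gamma>' t) (- \<gamma>0 (t + s))" for t
        unfolding cyl_eq_def dg dg' s \<sigma>''
        by (rule exI[of _ "- k - k'"]) (simp add: deck_def algebra_simps prod_eq_iff)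
      thus ?thesis by blast
    qed
  qed
  have "L1 \<mu> < E"
    by (rule energy_above[OF g der _ F0 nc]) (use B in \<open>auto simp: dist_commute\<close>)
  hence "lyapunov_orbit (nbhd S0 \<rho>) \<mu> E \<gamma>0 \<tau>"
    unfolding lyapunov_orbit_def using hyp uniq by blast
  moreover have "covers \<gamma>0 T0 \<gamma>0 \<tau>"
  proof -
    have T0: "T0 > 0" and c: "cyl_eq (\<gamma>0 0) (\<gamma>0 (0 + T0))" using per0 unfolding periodic_orbit_def by blast+
    have "h T0 = h 0" using ret[OF c] by simp
    from \<tau>(6)[OF T0 this] obtain j :: nat where "j \<ge> 1" "T0 = of_nat j * \<tau>" by blast
    thus ?thesis unfolding covers_def using refl by (intro exI[of _ j] exI[of _ 0]) simp
  qed
  ultimately show ?thesis by blast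
qed

text \<open>As \<open>S0\<close> need not be an equilibrium for (\<mu>, E), the size of its velocity
  enters Gronwall's inequality as the inhomogeneity M. The sign \<tau> covers both time
  directions.\<close>

lemma escape_slow:
  assumes g: "good \<mu> E" and der: "\<And>t. (g has_vector_derivative \<tau> *\<^sub>R ham.XF \<mu> E (g t)) (at t)" and "\<bar>\<tau>\<bar> = 1"
    and M: "norm (ham.XF \<mu> E S0) \<le> M" and R: "dist (g 0) S0 \<le> R" "R < \<rho> / 2"
    and small: "(R\<^sup>2 + M\<^sup>2) * exp ((2 * (C + \<epsilon>) + 1) * T) < (\<rho> / 2)\<^sup>2" and t: "0 \<le> t" "t \<le> T"
  shows "dist (g t) S0 < \<rho>"
proof (rule ccontr)
  assume out: "\<not> dist (g t) S0 < \<rho>"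
  obtain y where
    "local_magnetic (hA1' xs) (1 / 4) k1 k2 hA1 hA1' hA1'' hA2 hA2' hA2'' (hV \<mu> E) (hV1 \<mu> E) (hV2 \<mu> E) (hV11 \<mu> E)
      (hV12 \<mu> E) (hV22 \<mu> E) (ball S0 \<rho>) (axis_point y) \<epsilon> \<eta>"
    using local_magnetic_good[OF g] by blast
  then interpret L: local_magnetic "hA1' xs" "1 / 4" k1 k2 hA1 hA1' hA1'' hA2 hA2' hA2'' "hV \<mu> E" "hV1 \<mu> E" "hV2 \<mu> E" "hV11 \<mu> E"
      "hV12 \<mu> E" "hV22 \<mu> E" "ball S0 \<rho>" "axis_point y" \<epsilon> \<eta> by blast
  have cont: "continuous_on S g" for S
    using der by (auto intro!: continuous_at_imp_continuous_on dest: has_vector_derivative_continuous)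
  \<comment> \<open>Stopping at distance \<rho> / 2 keeps the path inside the ball on which the
    Lipschitz bound holds.\<close>
  have "\<exists>t2. 0 \<le> t2 \<and> t2 \<le> t \<and> dist (g t2) S0 = \<rho> / 2 \<and> (\<forall>s. 0 \<le> s \<and> s \<le> t2 \<longrightarrow> dist (g s) S0 \<le> \<rho> / 2)"
    by (rule first_exit) (use t R out \<rho> in \<open>auto intro!: continuous_intros cont\<close>)
  then obtain t2 where t2: "0 \<le> t2" "t2 \<le> t" "dist (g t2) S0 = \<rho> / 2" "\<And>s. 0 \<le> s \<Longrightarrow> s \<le> t2 \<Longrightarrow> dist (g s) S0 \<le> \<rho> / 2"
    by blast
  have C0: "C + \<epsilon> \<ge> 0" using C(1) \<epsilon> by simp
  have "(norm (g t2 - S0))\<^sup>2 + M\<^sup>2 \<le> ((norm (g 0 - S0))\<^sup>2 + M\<^sup>2) * exp ((2 * (C + \<epsilon>) + 1) * t2)"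
  proof (rule gronwall[OF t2(1) C0])
    show "((\<lambda>t. g t - S0) has_vector_derivative \<tau> *\<^sub>R ham.XF \<mu> E (g s)) (at s)" for s
      using has_vector_derivative_diff[OF der has_vector_derivative_const] by simp
    fix s assume s: "0 \<le> s" "s \<le> t2"
    have "g s \<in> ball S0 \<rho>" "S0 \<in> ball S0 \<rho>" using t2(4)[OF s] \<rho> by (auto simp: dist_commute)
    from L.XF_lipschitz[OF this(2,1)] have "norm (ham.XF \<mu> E (g s) - ham.XF \<mu> E S0) \<le> (C + \<epsilon>) * norm (g s - S0)" .
    hence "norm (ham.XF \<mu> E (g s)) \<le> (C + \<epsilon>) * norm (g s - S0) + M"
      using M norm_triangle_sub[of "ham.XF \<mu> E (g s)" "ham.XF \<mu> E S0"] by linarith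
    thus "norm (\<tau> *\<^sub>R ham.XF \<mu> E (g s)) \<le> (C + \<epsilon>) * norm (g s - S0) + M" using \<open>\<bar>\<tau>\<bar> = 1\<close> by simp
  qed
  also have "\<dots> \<le> (R\<^sup>2 + M\<^sup>2) * exp ((2 * (C + \<epsilon>) + 1) * T)"
    using R t t2 C0 order_trans[OF norm_ge_zero M] by (intro mult_mono add_mono power_mono) (auto simp: dist_norm intro!: mult_left_mono)
  also have "\<dots> < (\<rho> / 2)\<^sup>2" by (rule small)
  finally have "(norm (g t2 - S0))\<^sup>2 + M\<^sup>2 < (\<rho> / 2)\<^sup>2" .
  moreover have "norm (g t2 - S0) = \<rho> / 2" using t2(3) by (simp only: dist_norm)
  ultimately show False using zero_le_power2[of M] by simp
qed

lemma escape_slow_nbhd: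
  assumes g: "good \<mu> E" and per: "periodic_orbit (H_hat \<mu> E) \<gamma> T"
    and M: "norm (ham.XF \<mu> E S0) \<le> M" and R: "\<gamma> s \<in> nbhd S0 R" "R < \<rho> / 2"
    and small: "(R\<^sup>2 + M\<^sup>2) * exp ((2 * (C + \<epsilon>) + 1) * T0) < (\<rho> / 2)\<^sup>2" and t: "\<bar>t - s\<bar> \<le> T0"
  shows "\<gamma> t \<in> nbhd S0 \<rho>"
proof -
  have der: "(\<gamma> has_vector_derivative ham.XF \<mu> E (\<gamma> t)) (at t)" for t
    using per unfolding periodic_orbit_def H_hat_F ham.ham_vf_F by blast
  obtain \<sigma> k where \<sigma>: "\<sigma> = 1 \<or> \<sigma> = - 1" and B: "dist (\<gamma> s) (deck \<sigma> k S0) < R"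
    using R(1) unfolding nbhd_def by blast
  define g where "g t = \<sigma> *\<^sub>R (\<gamma> t - (0, 0, 0, 2 * pi * of_int k))" for t
  have dg: "\<gamma> t = deck \<sigma> k (g t)" for t unfolding g_def by (rule deck_inverse[OF \<sigma>, symmetric])
  have gd: "(g has_vector_derivative ham.XF \<mu> E (g t)) (at t)" for t
  proof -
    have "(g has_vector_derivative \<sigma> *\<^sub>R (ham.XF \<mu> E (\<gamma> t) - 0)) (at t)"
      unfolding g_def[abs_def]
      by (intro bounded_linear.has_vector_derivative[OF bounded_linear_scaleR_right] has_vector_derivative_diff der
          has_vector_derivative_const)
    moreover have "\<sigma> *\<^sub>R (ham.XF \<mu> E (\<gamma> t) - 0) = ham.XF \<mu> E (g t)"
      unfolding dg[of t] ham_deck[OF \<sigma>] using \<sigma> by auto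
    ultimately show ?thesis by simp
  qed
  have gs: "dist (g s) S0 \<le> R" using B unfolding dg dist_deck[OF \<sigma>] by simp
  have "dist (g t) S0 < \<rho>"
  proof (cases "s \<le> t")
    case True
    have "dist (g ((t - s) + s)) S0 < \<rho>"
      by (rule escape_slow[where g = "\<lambda>t. g (t + s)" and \<tau> = 1, OF g _ _ M _ R(2) small])
        (use True t gs in \<open>auto intro!: has_vector_derivative_shift gd\<close>)
    thus ?thesis by simp
  next
    case False
    have "((\<lambda>t. g (s - t)) has_vector_derivative - ham.XF \<mu> E (g (s - t))) (at t)" for t
      by (rule has_vector_derivative_reflect) (rule gd)
    hence "dist (g (s - (s - t))) S0 < \<rho>"
      by (intro escape_slow[where g = "\<lambda>t. g (s - t)" and \<tau> = "- 1", OF g _ _ M _ R(2) small])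
        (use False t gs in auto)
    thus ?thesis by simp
  qed
  hence "dist (\<gamma> t) (deck \<sigma> k S0) < \<rho>" unfolding dg dist_deck[OF \<sigma>] .
  thus ?thesis using \<sigma> unfolding nbhd_def by blast
qed

text \<open>The index is taken over [0, T], so a stretch of length T0 near \<open>S0\<close> must
  fit into this interval. As the orbit leaves the neighbourhood, T > 2 * T0, and the stretch either
  after or before the visit fits.\<close>

lemma index_large_near:
  fixes n :: nat
  assumes g: "good \<mu> E" and per: "periodic_orbit (H_hat \<mu> E) \<gamma> T"
    and M: "norm (ham.XF \<mu> E S0) \<le> M" and R: "\<gamma> s \<in> nbhd S0 R" "R < \<rho> / 2"
    and T0: "T0 = 3 * (pi / sqrt \<kappa>) * (2 * real n + 8)"
    and small: "(R\<^sup>2 + M\<^sup>2) * exp ((2 * (C + \<epsilon>) + 1) * T0) < (\<rho> / 2)\<^sup>2"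
    and out: "\<not> range \<gamma> \<subseteq> nbhd S0 \<rho>"
  shows "int n < cz_index (H_hat \<mu> E) \<gamma> T"
proof -
  interpret mo: magnetic_orbit hA1 hA1' hA1'' hA2 hA2' hA2'' "hV \<mu> E" "hV1 \<mu> E" "hV2 \<mu> E" "hV11 \<mu> E" "hV12 \<mu> E" "hV22 \<mu> E" \<gamma>
    by (rule periodic_magnetic_orbit[OF per])
  have T: "T > 0" and cyl: "\<And>t. cyl_eq (\<gamma> t) (\<gamma> (t + T))" using per unfolding periodic_orbit_def by blast+
  have stay: "\<gamma> t \<in> nbhd S0 \<rho>" if "\<gamma> s \<in> nbhd S0 R" "\<bar>t - s\<bar> \<le> T0" for s t
    by (rule escape_slow_nbhd[OF g per M that(1) R(2) small that(2)])
  have T2: "T > 2 * T0"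
  proof (rule ccontr)
    assume "\<not> T > 2 * T0"
    \<comment> \<open>Otherwise the times within T0 of s would cover a whole period.\<close>
    have "\<gamma> t \<in> nbhd S0 \<rho>" for t
    proof -
      obtain j :: int where j: "s - T0 \<le> t + of_int j * T" "t + of_int j * T < s - T0 + T"
        using reduce_to_interval[OF T] by blast
      have "\<bar>t + of_int j * T - s\<bar> \<le> T0" using j \<open>\<not> T > 2 * T0\<close> by linarith
      from nbhd_cyl[OF stay[OF R(1) this] cyl_eq_sym[OF periodic_multiples[of \<gamma> T, OF cyl]]] show ?thesis .
    qed
    thus False using out by blast
  qed
  obtain j :: int where j: "0 \<le> s + of_int j * T" "s + of_int j * T < 0 + T"
    using reduce_to_interval[OF T] by blast
  define s' where "s' = s + of_int j * T"
  have s': "0 \<le> s'" "s' < T" and s'R: "\<gamma> s' \<in> nbhd S0 R"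
    using j nbhd_cyl[OF R(1) periodic_multiples[of \<gamma> T, OF cyl]] by (auto simp: s'_def)
  define t0 where "t0 = (if s' + T0 \<le> T then s' else s' - T0)"
  have t0: "0 \<le> t0" "t0 + T0 \<le> T" using s' T2 by (auto simp: t0_def)
  have T0_nonneg: "T0 \<ge> 0" unfolding T0 using \<kappa>(1) by simp
  have K: "mo.K t \<ge> \<kappa>" if t: "t0 \<le> t" "t \<le> t0 + T0" for t
  proof -
    have "\<bar>t - s'\<bar> \<le> T0" using t T0_nonneg by (auto simp: t0_def split: if_splits)
    from stay[OF s'R this] obtain \<sigma> k where \<sigma>: "\<sigma> = 1 \<or> \<sigma> = - 1" and B: "dist (\<gamma> t) (deck \<sigma> k S0) < \<rho>"
      unfolding nbhd_def by blast
    define z where "z = \<sigma> *\<^sub>R (\<gamma> t - (0, 0, 0, 2 * pi * of_int k))"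
    have dz: "\<gamma> t = deck \<sigma> k z" unfolding z_def by (rule deck_inverse[OF \<sigma>, symmetric])
    have "dist z (axis_point xs) < \<rho>" using B unfolding dz dist_deck[OF \<sigma>] S0_def .
    moreover have "\<bar>\<mu> - \<mu>0\<bar> < \<rho>" "\<bar>E - L1 \<mu>0\<bar> < \<rho>" using g unfolding good_def by blast+
    ultimately show ?thesis using \<kappa>(2)[of \<mu> E z] unfolding mo.K_def dz K_deck[OF \<sigma>] by blast
  qed
  show ?thesis unfolding H_hat_F
    by (rule mo.cz_index_large[OF \<kappa>(1) t0(1)]) (use t0 K in \<open>auto simp: T0\<close>)
qed

end

lemma lagrange_neighbourhood_exists:
  assumes \<mu>0: "0 < \<mu>0" "\<mu>0 < 1"
  shows "\<exists>xs k1 k2 \<kappa> \<epsilon> \<eta> \<delta> \<rho>. lagrange_neighbourhood xs k1 k2 \<mu>0 \<kappa> \<epsilon> \<eta> \<delta> \<rho>"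
proof -
  define r where "r = rt \<mu>0"
  have r: "0 < r" "r < 1" "crit \<mu>0 r = 0" unfolding r_def using rt[OF \<mu>0] by auto
  define xs where "xs = arccos (1 - 2 * r)"
  have xs: "0 < xs" "xs < pi" using arccos_lt_bounded[of "1 - 2 * r"] r unfolding xs_def by auto
  have cx: "cos xs = 1 - 2 * r" unfolding xs_def using r by (simp add: cos_arccos)
  have pot0: "pot \<mu>0 r - L1 \<mu>0 = 0" unfolding L1_eq[OF \<mu>0] r_def by simp
  note ax = hV_axis[OF cx r(1,2), of \<mu>0 "L1 \<mu>0", unfolded pot0 r(3)]
  have rr: "r * (1 - r) > 0" using r by simp
  \<comment> \<open>As r and 1 - r are less than 1, the two quotients by cubes add up to more than
    1, which decides the sign of \<alpha>.\<close>
  have cub: "\<mu>0 < \<mu>0 / r ^ 3" "1 - \<mu>0 < (1 - \<mu>0) / (1 - r) ^ 3"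
    using \<mu>0 r by (simp_all add: pos_less_divide_eq power_less_one_iff)
  define \<alpha> where "\<alpha> = hV11 \<mu>0 (L1 \<mu>0) (0, xs)"
  define \<beta> where "\<beta> = - hV22 \<mu>0 (L1 \<mu>0) (0, xs)"
  have "\<alpha> = r * (1 - r) * (r * (1 - r) * (\<mu>0 / r ^ 3 + (1 - \<mu>0) / (1 - r) ^ 3 - 1))" unfolding \<alpha>_def ax by simp
  moreover have "\<mu>0 / r ^ 3 + (1 - \<mu>0) / (1 - r) ^ 3 - 1 > 0" using cub by linarith
  ultimately have \<alpha>: "\<alpha> > 0" using rr by simp
  have "\<beta> = r * (1 - r) * (r * (1 - r) * (2 * (\<mu>0 / r ^ 3) + 2 * ((1 - \<mu>0) / (1 - r) ^ 3) + 1))"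
    unfolding \<beta>_def ax by simp
  moreover have "2 * (\<mu>0 / r ^ 3) + 2 * ((1 - \<mu>0) / (1 - r) ^ 3) + 1 > 0" using cub \<mu>0 by linarith
  ultimately have \<beta>: "\<beta> > 0" using rr by simp
  have "hA1' xs = (2 * (1 - 2 * r)\<^sup>2 - 1) / 4" unfolding hA1'_def cos_double_cos cx ..
  hence "1 / 4 - hA1' xs = 2 * (r * (1 - r))" by (simp add: power2_eq_square field_simps)
  hence b: "1 / 4 - hA1' xs > 0" using rr by simp
  obtain k1 k2 where k: "0 < k2" "k2 < 1 / 4 - hA1' xs" "1 / 4 - hA1' xs < k1"
    "k2 * (k1 - (1 / 4 - hA1' xs)) = \<alpha>" "k1 * (1 / 4 - hA1' xs - k2) = \<beta>"
    using saddle_center_roots[OF \<alpha> \<beta> b] by blast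
  interpret saddle_center "hA1' xs" "1 / 4" k1 k2 by unfold_locales (use k in auto)
  obtain \<epsilon> \<eta> \<delta> where sm: "\<epsilon> > 0" "cone_prop \<epsilon> \<eta>" "0 \<le> \<eta>" "\<eta> \<le> 1" "(1 + 2 * k1 + 2 * k2) * \<eta> + 4 * C\<^sup>2 * \<epsilon> < m * k2"
    "2 * \<eta> + 4 * C * \<epsilon> \<le> k2 / 2" "index_small \<delta>" "\<epsilon> \<le> \<delta>" "\<eta> \<le> \<delta>"
    using smallness_exists by blast
  define z0 where "z0 = axis_point xs"
  have cz: "cx1 z0 = 0" "cx2 z0 = xs" "ham.P1 z0 = 0" "ham.P2 z0 = 0"
    by (simp_all add: z0_def axis_point_def ham.P1_def ham.P2_def hA2_def)
  have lin: "ham.DX \<mu>0 (L1 \<mu>0) z0 v = A0 v" for v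
  proof -
    have h: "ham.H11 \<mu>0 (L1 \<mu>0) z0 = (1 / 4)\<^sup>2 + k2 * P" "ham.H12 \<mu>0 (L1 \<mu>0) z0 = 0"
      "ham.H22 \<mu>0 (L1 \<mu>0) z0 = (hA1' xs)\<^sup>2 - k1 * Q" "hA2' 0 = 1 / 4"
      unfolding ham.H11_def ham.H12_def ham.H22_def cz P_def Q_def b_def k \<alpha>_def \<beta>_def ax(6) by (simp_all add: hA2'_def)
    show ?thesis unfolding ham.DX_def A0_def cz h by simp
  qed
  obtain \<rho>1 where \<rho>1: "\<rho>1 > 0" "\<forall>\<mu> E z. \<bar>\<mu> - \<mu>0\<bar> < \<rho>1 \<and> \<bar>E - L1 \<mu>0\<bar> < \<rho>1 \<and> dist z z0 < \<rho>1 \<longrightarrow>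
      (\<forall>v. norm (ham.DX \<mu> E z v - A0 v) \<le> \<epsilon> * norm v)"
    using DX_near[OF sm(1), of \<mu>0 "L1 \<mu>0" z0] unfolding lin by blast
  have "\<alpha> / 2 > 0" using \<alpha> by simp
  from param_near[OF ham_continuous(6) this, of \<mu>0 "L1 \<mu>0" z0] obtain \<rho>2 where \<rho>2: "\<rho>2 > 0"
    "\<forall>\<mu> E z. \<bar>\<mu> - \<mu>0\<bar> < \<rho>2 \<and> \<bar>E - L1 \<mu>0\<bar> < \<rho>2 \<and> dist z z0 < \<rho>2 \<longrightarrow>
      \<bar>ham.P2 z * hA2'' (cx1 z) + hV11 \<mu> E (cx1 z, cx2 z) - \<alpha>\<bar> < \<alpha> / 2"
    unfolding fst_conv snd_conv cz mult_zero_left add_0 \<alpha>_def[symmetric] by blast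
  from param_near[OF ham_continuous(7) \<beta>, of \<mu>0 "L1 \<mu>0" "(0, 0, 0, xs)"] obtain \<rho>3 where \<rho>3: "\<rho>3 > 0"
    "\<forall>\<mu> E z. \<bar>\<mu> - \<mu>0\<bar> < \<rho>3 \<and> \<bar>E - L1 \<mu>0\<bar> < \<rho>3 \<and> dist z (0, 0, 0, xs) < \<rho>3 \<longrightarrow>
      \<bar>hV22 \<mu> E (0, cx2 z) - hV22 \<mu>0 (L1 \<mu>0) (0, xs)\<bar> < \<beta>"
    unfolding fst_conv snd_conv comp_simps by blast
  define \<rho> where "\<rho> = Min {\<rho>1, \<rho>2, \<rho>3, xs / 2, (pi - xs) / 2}"
  have \<rho>: "\<rho> > 0" "\<rho> \<le> \<rho>1" "\<rho> \<le> \<rho>2" "\<rho> \<le> \<rho>3" "\<rho> \<le> xs / 2" "\<rho> \<le> (pi - xs) / 2"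
    unfolding \<rho>_def using \<rho>1(1) \<rho>2(1) \<rho>3(1) xs by simp (intro Min_le; simp)+
  have "(pi - xs) / 2 < pi - xs" "xs / 2 < xs" using xs by simp_all
  hence \<rho>': "\<rho> < xs" "\<rho> < pi - xs" using \<rho>(5,6) by (simp_all only: le_less_trans)
  have \<alpha>': "0 < \<alpha> / 2" using \<alpha> by simp
  have "lagrange_neighbourhood xs k1 k2 \<mu>0 (\<alpha> / 2) \<epsilon> \<eta> \<delta> \<rho>"
  proof
    fix \<mu> E :: real assume p: "\<bar>\<mu> - \<mu>0\<bar> < \<rho>" "\<bar>E - L1 \<mu>0\<bar> < \<rho>"
    show "norm (ham.DX \<mu> E z v - A0 v) \<le> \<epsilon> * norm v" if "dist z (axis_point xs) < \<rho>" for z v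
    proof -
      have "\<bar>\<mu> - \<mu>0\<bar> < \<rho>1 \<and> \<bar>E - L1 \<mu>0\<bar> < \<rho>1 \<and> dist z z0 < \<rho>1"
        using p that \<rho>(2) unfolding z0_def by linarith
      thus ?thesis using \<rho>1(2) by blast
    qed
    show "\<alpha> / 2 \<le> ham.P2 z * hA2'' (cx1 z) + hV11 \<mu> E (cx1 z, cx2 z)" if "dist z (axis_point xs) < \<rho>" for z
    proof -
      have "\<bar>\<mu> - \<mu>0\<bar> < \<rho>2 \<and> \<bar>E - L1 \<mu>0\<bar> < \<rho>2 \<and> dist z z0 < \<rho>2"
        using p that \<rho>(3) unfolding z0_def by linarith
      hence "\<bar>ham.P2 z * hA2'' (cx1 z) + hV11 \<mu> E (cx1 z, cx2 z) - \<alpha>\<bar> < \<alpha> / 2" using \<rho>2(2) by blast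
      thus ?thesis by linarith
    qed
    show "hV22 \<mu> E (0, y) < 0" if "\<bar>y - xs\<bar> < \<rho>" for y
    proof -
      have "dist (0, 0, 0, y) (0::real, 0::real, 0::real, xs) = \<bar>y - xs\<bar>" by (simp add: dist_Pair_Pair dist_real_def)
      hence "\<bar>\<mu> - \<mu>0\<bar> < \<rho>3 \<and> \<bar>E - L1 \<mu>0\<bar> < \<rho>3 \<and> dist (0, 0, 0, y) (0::real, 0::real, 0::real, xs) < \<rho>3"
        using p that \<rho>(4) by linarith
      from \<rho>3(2)[THEN spec, THEN spec, THEN spec, THEN mp, OF this]
      have "\<bar>hV22 \<mu> E (0, cx2 (0, 0, 0, y)) - hV22 \<mu>0 (L1 \<mu>0) (0, xs)\<bar> < \<beta>" .
      thus ?thesis unfolding comp_simps \<beta>_def by linarith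
    qed
  qed (fact \<mu>0 xs cx[unfolded r_def] \<rho>(1) \<rho>' \<alpha>' sm)+
  thus ?thesis by blast
qed

context lagrange_neighbourhood
begin

lemma critical_at_S0: "hV2 \<mu>0 (L1 \<mu>0) (0, xs) = 0"
  using hV_axis(2)[OF xs(3) rt(1,2)[OF \<mu>0], of \<mu>0 "L1 \<mu>0"] rt(3)[OF \<mu>0] by (simp add: L1_eq[OF \<mu>0])

text \<open>On the axis \<open>hV\<close> is strictly concave near xs, so \<open>hV2\<close> changes
  sign at xs. The signs at xs - t and xs + t persist for nearby parameters, and the intermediate
  value theorem yields the critical point.\<close>

lemma good_near: "\<exists>d>0. \<forall>\<mu> E. \<bar>\<mu> - \<mu>0\<bar> < d \<and> \<bar>E - L1 \<mu>0\<bar> < d \<longrightarrow> good \<mu> E"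
proof -
  have "1 - 2 * rt \<mu>0 > - 1" "1 - 2 * rt \<mu>0 < 1" using rt[OF \<mu>0] by auto
  hence "isCont arccos (1 - 2 * rt \<mu>0)" by (rule isCont_arccos)
  moreover have "arccos (1 - 2 * rt \<mu>0) = xs" unfolding xs(3)[symmetric] using xs(1,2) by (simp add: arccos_cos)
  ultimately obtain d0 where d0: "d0 > 0" "\<And>u. dist u (1 - 2 * rt \<mu>0) < d0 \<Longrightarrow> dist (arccos u) xs < \<rho>"
    unfolding continuous_at_eps_delta using \<rho>(1) by metis
  have "d0 / 2 > 0" using d0(1) by simp
  from rt_continuous[OF \<mu>0 this] obtain d1 where d1: "d1 > 0"
    "\<And>\<mu>. dist \<mu> \<mu>0 < d1 \<Longrightarrow> 0 < \<mu> \<and> \<mu> < 1 \<and> \<bar>rt \<mu> - rt \<mu>0\<bar> < d0 / 2"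
    unfolding eventually_nhds_metric by blast
  have "continuous_on UNIV axis_point"
    unfolding axis_point_def hA1_def by (intro continuous_intros) simp
  then obtain t' where t': "t' > 0" "\<And>y. dist y xs < t' \<Longrightarrow> dist (axis_point y) S0 < \<rho>"
    unfolding continuous_on_iff S0_def using \<rho>(1) by (metis UNIV_I)
  define t where "t = min (t' / 2) (\<rho> / 2)"
  have t: "0 < t" "t < t'" "t < \<rho>" unfolding t_def using t'(1) \<rho>(1) by auto
  have dec: "hV2 \<mu>0 (L1 \<mu>0) (0, v) < hV2 \<mu>0 (L1 \<mu>0) (0, u)" if "u < v" "\<bar>u - xs\<bar> \<le> t" "\<bar>v - xs\<bar> \<le> t" for u v
  proof (rule DERIV_neg_imp_decreasing[OF that(1), where f = "\<lambda>y. hV2 \<mu>0 (L1 \<mu>0) (0, y)"])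
    fix x assume "u \<le> x" "x \<le> v"
    hence "\<bar>x - xs\<bar> < \<rho>" using that(2,3) t(3) by linarith
    hence "hV22 \<mu>0 (L1 \<mu>0) (0, x) < 0" by (intro concave) (use \<rho>(1) in auto)
    thus "\<exists>d. ((\<lambda>y. hV2 \<mu>0 (L1 \<mu>0) (0, y)) has_real_derivative d) (at x) \<and> d < 0" using hV_axis_DERIV(2) by blast
  qed
  have sg: "hV2 \<mu>0 (L1 \<mu>0) (0, xs - t) > 0" "- hV2 \<mu>0 (L1 \<mu>0) (0, xs + t) > 0"
    using dec[of "xs - t" xs] dec[of xs "xs + t"] t(1) by (auto simp: critical_at_S0)
  from param_near[OF ham_continuous(8) sg(1), of \<mu>0 "L1 \<mu>0" "(0, 0, 0, xs - t)"] obtain d2 where d2: "d2 > 0"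
    "\<forall>\<mu> E z. \<bar>\<mu> - \<mu>0\<bar> < d2 \<and> \<bar>E - L1 \<mu>0\<bar> < d2 \<and> dist z (0, 0, 0, xs - t) < d2 \<longrightarrow>
      \<bar>hV2 \<mu> E (0, cx2 z) - hV2 \<mu>0 (L1 \<mu>0) (0, xs - t)\<bar> < hV2 \<mu>0 (L1 \<mu>0) (0, xs - t)"
    unfolding fst_conv snd_conv comp_simps by blast
  from param_near[OF ham_continuous(8) sg(2), of \<mu>0 "L1 \<mu>0" "(0, 0, 0, xs + t)"] obtain d3 where d3: "d3 > 0"
    "\<forall>\<mu> E z. \<bar>\<mu> - \<mu>0\<bar> < d3 \<and> \<bar>E - L1 \<mu>0\<bar> < d3 \<and> dist z (0, 0, 0, xs + t) < d3 \<longrightarrow>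
      \<bar>hV2 \<mu> E (0, cx2 z) - hV2 \<mu>0 (L1 \<mu>0) (0, xs + t)\<bar> < - hV2 \<mu>0 (L1 \<mu>0) (0, xs + t)"
    unfolding fst_conv snd_conv comp_simps by blast
  define d where "d = Min {\<rho>, d1, d2, d3}"
  have d: "d > 0" "d \<le> \<rho>" "d \<le> d1" "d \<le> d2" "d \<le> d3" unfolding d_def using \<rho>(1) d1(1) d2(1) d3(1) by simp_all
  have "good \<mu> E" if p: "\<bar>\<mu> - \<mu>0\<bar> < d" "\<bar>E - L1 \<mu>0\<bar> < d" for \<mu> E
  proof -
    have \<mu>: "0 < \<mu> \<and> \<mu> < 1 \<and> \<bar>rt \<mu> - rt \<mu>0\<bar> < d0 / 2" using d1(2)[of \<mu>] p d by (simp add: dist_real_def)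
    hence "dist (1 - 2 * rt \<mu>) (1 - 2 * rt \<mu>0) < d0" unfolding dist_real_def by linarith
    from d0(2)[OF this] have "\<bar>arccos (1 - 2 * rt \<mu>) - xs\<bar> < \<rho>" unfolding dist_real_def .
    moreover have "\<exists>y. dist (axis_point y) S0 < \<rho> \<and> hV2 \<mu> E (0, y) = 0"
    proof -
      have p': "\<bar>\<mu> - \<mu>0\<bar> < d2" "\<bar>E - L1 \<mu>0\<bar> < d2" "\<bar>\<mu> - \<mu>0\<bar> < d3" "\<bar>E - L1 \<mu>0\<bar> < d3" using p d by linarith+
      have "\<bar>hV2 \<mu> E (0, xs - t) - hV2 \<mu>0 (L1 \<mu>0) (0, xs - t)\<bar> < hV2 \<mu>0 (L1 \<mu>0) (0, xs - t)"
        using d2(2)[THEN spec, of \<mu>, THEN spec, of E, THEN spec, of "(0, 0, 0, xs - t)"] p' d2(1) by simp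
      moreover have "\<bar>hV2 \<mu> E (0, xs + t) - hV2 \<mu>0 (L1 \<mu>0) (0, xs + t)\<bar> < - hV2 \<mu>0 (L1 \<mu>0) (0, xs + t)"
        using d3(2)[THEN spec, of \<mu>, THEN spec, of E, THEN spec, of "(0, 0, 0, xs + t)"] p' d3(1) by simp
      ultimately have s: "hV2 \<mu> E (0, xs + t) \<le> 0" "0 \<le> hV2 \<mu> E (0, xs - t)" by linarith+
      have "continuous_on {xs - t..xs + t} (\<lambda>y. hV2 \<mu> E (0, y))"
        by (intro continuous_at_imp_continuous_on ballI DERIV_isCont[OF hV_axis_DERIV(2)])
      from IVT2'[where f = "\<lambda>y. hV2 \<mu> E (0, y)", OF s _ this] t(1)
      obtain y where "xs - t \<le> y" "y \<le> xs + t" "hV2 \<mu> E (0, y) = 0" by auto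
      moreover from this have "dist (axis_point y) S0 < \<rho>" using t by (intro t') (auto simp: dist_real_def)
      ultimately show ?thesis by blast
    qed
    moreover have "\<bar>\<mu> - \<mu>0\<bar> < \<rho>" "\<bar>E - L1 \<mu>0\<bar> < \<rho>" using p d by linarith+
    ultimately show ?thesis using \<mu> unfolding good_def by blast
  qed
  thus ?thesis using d(1) by blast
qed

lemma vector_field_small_near:
  assumes "M > 0"
  shows "\<exists>d>0. \<forall>\<mu> E. \<bar>\<mu> - \<mu>0\<bar> < d \<and> \<bar>E - L1 \<mu>0\<bar> < d \<longrightarrow> norm (ham.XF \<mu> E S0) \<le> M"
proof -
  have 0: "norm (ham.XF \<mu>0 (L1 \<mu>0) S0) = 0" using critical_at_S0 by (simp add: S0_def axis_point_values)
  obtain d where d: "d > 0" "\<forall>\<mu> E z. \<bar>\<mu> - \<mu>0\<bar> < d \<and> \<bar>E - L1 \<mu>0\<bar> < d \<and> dist z S0 < d \<longrightarrow> \<bar>norm (ham.XF \<mu> E z) - 0\<bar> < M"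
    using param_near[OF ham_continuous(9) assms, of \<mu>0 "L1 \<mu>0" S0] unfolding fst_conv snd_conv 0 by blast
  have "norm (ham.XF \<mu> E S0) \<le> M" if "\<bar>\<mu> - \<mu>0\<bar> < d" "\<bar>E - L1 \<mu>0\<bar> < d" for \<mu> E
    using d(2)[THEN spec, of \<mu>, THEN spec, of E, THEN spec, of S0] that d(1) by simp
  thus ?thesis using d(1) by blast
qed

lemma index_large:
  fixes n :: nat
  shows "\<exists>R>0. \<forall>\<^sub>F (\<mu>, E) in nhds (\<mu>0, L1 \<mu>0). \<forall>\<gamma> T. periodic_orbit (H_hat \<mu> E) \<gamma> T \<and> (\<exists>t. \<gamma> t \<in> nbhd S0 R) \<and>
      \<not> (\<exists>\<delta> \<tau>. lyapunov_orbit (nbhd S0 \<rho>) \<mu> E \<delta> \<tau> \<and> covers \<gamma> T \<delta> \<tau>) \<longrightarrow> int n < cz_index (H_hat \<mu> E) \<gamma> T"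
proof -
  define T0 where "T0 = 3 * (pi / sqrt \<kappa>) * (2 * real n + 8)"
  define G where "G = exp ((2 * (C + \<epsilon>) + 1) * T0)"
  have "T0 \<ge> 0" unfolding T0_def using \<kappa>(1) by simp
  hence G: "G \<ge> 1" unfolding G_def using C(1) \<epsilon> by simp
  \<comment> \<open>With M = R the Gronwall bound becomes 2 R^2 G = \<rho>^2 / 8, which is less than
    (\<rho> / 2)^2.\<close>
  define R where "R = \<rho> / (4 * sqrt G)"
  have R: "R > 0" "R < \<rho> / 2" "(R\<^sup>2 + R\<^sup>2) * G < (\<rho> / 2)\<^sup>2"
  proof -
    have sG: "sqrt G \<ge> 1" using G by simp
    show "R > 0" unfolding R_def using \<rho>(1) sG by simp
    have "2 < 4 * sqrt G" using sG by linarith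
    from mult_strict_left_mono[OF this \<rho>(1)] have "\<rho> * 2 < \<rho> * (4 * sqrt G)" .
    thus "R < \<rho> / 2" unfolding R_def using sG by (simp add: field_simps)
    have "R\<^sup>2 * G = (\<rho> / 4)\<^sup>2" unfolding R_def using G by (simp add: power_divide power_mult_distrib)
    hence "(R\<^sup>2 + R\<^sup>2) * G = 2 * (\<rho> / 4)\<^sup>2" by (simp add: distrib_right)
    also have "\<dots> < (\<rho> / 2)\<^sup>2" using \<rho>(1) by (simp add: power2_eq_square)
    finally show "(R\<^sup>2 + R\<^sup>2) * G < (\<rho> / 2)\<^sup>2" .
  qed
  obtain d1 where d1: "d1 > 0" "\<And>\<mu> E. \<bar>\<mu> - \<mu>0\<bar> < d1 \<Longrightarrow> \<bar>E - L1 \<mu>0\<bar> < d1 \<Longrightarrow> good \<mu> E" using good_near by blast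
  obtain d2 where d2: "d2 > 0" "\<And>\<mu> E. \<bar>\<mu> - \<mu>0\<bar> < d2 \<Longrightarrow> \<bar>E - L1 \<mu>0\<bar> < d2 \<Longrightarrow> norm (ham.XF \<mu> E S0) \<le> R"
    using vector_field_small_near[OF R(1)] by blast
  have "int n < cz_index (H_hat \<mu> E) \<gamma> T"
    if p: "dist (\<mu>, E) (\<mu>0, L1 \<mu>0) < min d1 d2" and per: "periodic_orbit (H_hat \<mu> E) \<gamma> T" and s: "\<gamma> s \<in> nbhd S0 R"
      and nl: "\<not> (\<exists>\<delta> \<tau>. lyapunov_orbit (nbhd S0 \<rho>) \<mu> E \<delta> \<tau> \<and> covers \<gamma> T \<delta> \<tau>)" for \<mu> E \<gamma> T s
  proof -
    have "\<bar>\<mu> - \<mu>0\<bar> < min d1 d2" "\<bar>E - L1 \<mu>0\<bar> < min d1 d2"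
      using p dist_fst_le[of "(\<mu>, E)" "(\<mu>0, L1 \<mu>0)"] dist_snd_le[of "(\<mu>, E)" "(\<mu>0, L1 \<mu>0)"]
      unfolding fst_conv snd_conv dist_real_def by linarith+
    hence g: "good \<mu> E" and M: "norm (ham.XF \<mu> E S0) \<le> R" using d1(2) d2(2) by simp_all
    have "\<not> range \<gamma> \<subseteq> nbhd S0 \<rho>"
    proof
      assume "range \<gamma> \<subseteq> nbhd S0 \<rho>"
      hence "\<gamma> t \<in> nbhd S0 \<rho>" for t by blast
      from orbit_inside_is_lyapunov[OF g per this] nl show False by blast
    qed
    from index_large_near[OF g per M s R(2) T0_def R(3)[unfolded G_def] this] show ?thesis .
  qed
  hence "\<forall>\<^sub>F (\<mu>, E) in nhds (\<mu>0, L1 \<mu>0). \<forall>\<gamma> T. periodic_orbit (H_hat \<mu> E) \<gamma> T \<and> (\<exists>t. \<gamma> t \<in> nbhd S0 R) \<and>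
      \<not> (\<exists>\<delta> \<tau>. lyapunov_orbit (nbhd S0 \<rho>) \<mu> E \<delta> \<tau> \<and> covers \<gamma> T \<delta> \<tau>) \<longrightarrow> int n < cz_index (H_hat \<mu> E) \<gamma> T"
    unfolding eventually_nhds_metric using d1(1) d2(1) by (intro exI[of _ "min d1 d2"]) auto
  thus ?thesis using R(1) by blast
qed

end

theorem theorem1p8:
  fixes \<mu>0 :: real
  assumes "0 < \<mu>0" and "\<mu>0 < 1"
  shows "\<exists>W. cyl_open W \<and> saddle_centers \<mu>0 \<subseteq> W \<and>
    (\<forall>N::nat. \<exists>U. cyl_open U \<and> saddle_centers \<mu>0 \<subseteq> U \<and>
      (\<forall>\<^sub>F (\<mu>, E) in nhds (\<mu>0, L1 \<mu>0).
        \<forall>\<gamma> T. periodic_orbit (H_hat \<mu> E) \<gamma> T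
          \<and> (\<exists>t. \<gamma> t \<in> U)
          \<and> \<not> (\<exists>\<delta> \<tau>. lyapunov_orbit W \<mu> E \<delta> \<tau> \<and> covers \<gamma> T \<delta> \<tau>)
          \<longrightarrow> int N < cz_index (H_hat \<mu> E) \<gamma> T))"
proof -
  obtain xs k1 k2 \<kappa> \<epsilon> \<eta> \<delta> \<rho> where "lagrange_neighbourhood xs k1 k2 \<mu>0 \<kappa> \<epsilon> \<eta> \<delta> \<rho>"
    using lagrange_neighbourhood_exists[OF assms] by blast
  then interpret lagrange_neighbourhood xs k1 k2 \<mu>0 \<kappa> \<epsilon> \<eta> \<delta> \<rho> .
  show ?thesis
  \<comment> \<open>The radius \<rho> of \<open>W\<close> was obtained from \<mu>0 alone; n enters
    only through the radius R of the inner neighbourhood and the range of parameters.\<close>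
  proof (rule exI[of _ "nbhd S0 \<rho>"], intro conjI allI cyl_open_nbhd saddle_centers_nbhd \<rho>)
    fix n :: nat
    obtain R where "R > 0" "\<forall>\<^sub>F (\<mu>, E) in nhds (\<mu>0, L1 \<mu>0). \<forall>\<gamma> T. periodic_orbit (H_hat \<mu> E) \<gamma> T \<and> (\<exists>t. \<gamma> t \<in> nbhd S0 R) \<and>
      \<not> (\<exists>\<delta> \<tau>. lyapunov_orbit (nbhd S0 \<rho>) \<mu> E \<delta> \<tau> \<and> covers \<gamma> T \<delta> \<tau>) \<longrightarrow> int n < cz_index (H_hat \<mu> E) \<gamma> T"
      using index_large by blast
    thus "\<exists>U. cyl_open U \<and> saddle_centers \<mu>0 \<subseteq> U \<and>
      (\<forall>\<^sub>F (\<mu>, E) in nhds (\<mu>0, L1 \<mu>0). \<forall>\<gamma> T. periodic_orbit (H_hat \<mu> E) \<gamma> T \<and> (\<exists>t. \<gamma> t \<in> U) \<and>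
        \<not> (\<exists>\<delta> \<tau>. lyapunov_orbit (nbhd S0 \<rho>) \<mu> E \<delta> \<tau> \<and> covers \<gamma> T \<delta> \<tau>) \<longrightarrow> int n < cz_index (H_hat \<mu> E) \<gamma> T)"
      using cyl_open_nbhd saddle_centers_nbhd by blast
  qed
qed

end
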